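(* Let $Z>0$, $R>0$, $k>0$ with $k\neq m\pi/Z$ for all integers $m\ge1$; let $k_m=\sqrt{k^2-m^2\pi^2/Z^2}$ if $k>m\pi/Z$ and $k_m=\mathrm{i}\sqrt{m^2\pi^2/Z^2-k^2}$ otherwise, and $\kappa=\min_{m\ge1}|k_m|$. Let $\rho\ge2R$, $d=\rho-R$, $\chi_0>0$ with $\kappa\chi_0R\ge1$, $\chi(r)=0$ for $r\le R$ and $\chi(r)=\chi_0(r-R)^2$ for $r>R$, $\alpha(r)=1+(1+\mathrm{i})\chi'(r)$, $\beta(r)=1+(1+\mathrm{i})\chi(r)/r$. Let $\Omega_{\mathrm{pml}}=(R,\rho)\times(0,Z)$, $\Gamma_R=\{(R,z):0<z<Z\}$, and $$a_{\mathrm{pml}}(w,v)=\int_{\Omega_{\mathrm{pml}}}\frac1{r\beta}\Big(\frac1\alpha\partial_rw\,\partial_r\bar v+\alpha\,\partial_zw\,\partial_z\bar v-\alpha k^2w\bar v\Big)\mathrm{d}r\,\mathrm{d}z.$$ Let $H^{1/2}_0(\Gamma_R)$ be the space of $\eta=\sum_{m\ge1}\eta_m\sin(m\pi z/Z)$ with $\|\eta\|_{H^{1/2}(\Gamma_R)}^2=\sum_m m|\eta_m|^2<\infty$. Then for every $\eta\in H^{1/2}_0(\Gamma_R)$ there is a unique $w\in H^1(\Omega_{\mathrm{pml}})$ with $w=\eta$ on $\Gamma_R$, $w=0$ on $\partial\Omega_{\mathrm{pml}}\setminus\Gamma_R$, and $a_{\mathrm{pml}}(w,v)=0$ for all $v\in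 H^1_0(\Omega_{\mathrm{pml}})$ (the weak form of $\frac{r\beta}{\alpha}\partial_r\big(\frac1{r\alpha\beta}\partial_rw\big)+\partial_z^2w+k^2w=0$ in $\Omega_{\mathrm{pml}}$). Moreover, there is a constant $C>0$ independent of $\chi_0$ and $\rho$ such that $$\|w\|_{H^1(\Omega_{\mathrm{pml}})}\le Cd^6|\alpha(\rho)|^4|\beta(\rho)|^2\|\eta\|_{H^{1/2}(\Gamma_R)}.$$ *)

theory Defs
  imports "HOL-Analysis.Analysis"
begin

type_synonym pt = "real \<times> real"  (* points (r,z) *)

definition pd :: "pt \<Rightarrow> (pt \<Rightarrow> complex) \<Rightarrow> pt \<Rightarrow> complex" where
  "pd d f x = frechet_derivative f (at x) d"

fun iter_pd :: "pt list \<Rightarrow> (pt \<Rightarrow> complex) \<Rightarrow> pt \<Rightarrow> complex" where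
  "iter_pd [] f = f"
| "iter_pd (d # ds) f = pd d (iter_pd ds f)"

definition smooth :: "(pt \<Rightarrow> complex) \<Rightarrow> bool" where
  "smooth f \<longleftrightarrow> (\<forall>ds. iter_pd ds f differentiable_on UNIV)"

definition tsupport :: "(pt \<Rightarrow> complex) \<Rightarrow> pt set" where
  "tsupport f = closure {x. f x \<noteq> 0}"

definition test_fun :: "pt set \<Rightarrow> (pt \<Rightarrow> complex) \<Rightarrow> bool" where
  "test_fun \<Omega> \<phi> \<longleftrightarrow> smooth \<phi> \<and> compact (tsupport \<phi>) \<and> tsupport \<phi> \<subseteq> \<Omega>"

definition L2 :: "'a::euclidean_space set \<Rightarrow> ('a \<Rightarrow> complex) \<Rightarrow> bool" where
  "L2 S f \<longleftrightarrow> set_borel_measurable lborel S f \<and> set_integrable lborel S (\<lambda>x. (cmod (f x))\<^sup>2)"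

definition weak_deriv :: "pt set \<Rightarrow> pt \<Rightarrow> (pt \<Rightarrow> complex) \<Rightarrow> (pt \<Rightarrow> complex) \<Rightarrow> bool" where
  "weak_deriv \<Omega> d w g \<longleftrightarrow>
     (\<forall>\<phi>. test_fun \<Omega> \<phi> \<longrightarrow>
        (LINT x:\<Omega>|lborel. w x * pd d \<phi> x) = - (LINT x:\<Omega>|lborel. g x * \<phi> x))"

(* the (a.e. unique) weak partial derivative in direction d *)
definition wpd :: "pt set \<Rightarrow> pt \<Rightarrow> (pt \<Rightarrow> complex) \<Rightarrow> pt \<Rightarrow> complex" where
  "wpd \<Omega> d w = (SOME g. L2 \<Omega> g \<and> weak_deriv \<Omega> d w g)"

definition H1 :: "pt set \<Rightarrow> (pt \<Rightarrow> complex) \<Rightarrow> bool" where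
  "H1 \<Omega> w \<longleftrightarrow> L2 \<Omega> w \<and>
     (\<exists>g. L2 \<Omega> g \<and> weak_deriv \<Omega> (1,0) w g) \<and> (\<exists>g. L2 \<Omega> g \<and> weak_deriv \<Omega> (0,1) w g)"

definition H1_norm :: "pt set \<Rightarrow> (pt \<Rightarrow> complex) \<Rightarrow> real" where
  "H1_norm \<Omega> w = sqrt (LINT x:\<Omega>|lborel.
      (cmod (w x))\<^sup>2 + (cmod (wpd \<Omega> (1,0) w x))\<^sup>2 + (cmod (wpd \<Omega> (0,1) w x))\<^sup>2)"

definition H1_0 :: "pt set \<Rightarrow> (pt \<Rightarrow> complex) \<Rightarrow> bool" where
  "H1_0 \<Omega> v \<longleftrightarrow> H1 \<Omega> v \<and>
     (\<exists>\<phi>. (\<forall>n. test_fun \<Omega> (\<phi> n)) \<and> (\<lambda>n. H1_norm \<Omega> (\<lambda>x. v x - \<phi> n x)) \<longlonglongrightarrow> 0)"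

definition Omega_pml :: "real \<Rightarrow> real \<Rightarrow> real \<Rightarrow> pt set" where
  "Omega_pml R \<rho> Z = {R<..<\<rho>} \<times> {0<..<Z}"

(* Boundary values in the trace sense (trace = continuous extension of restriction
   from C^\<infinity>(closure \<Omega>), which is dense in H^1 of the rectangle):
   w = \<eta> on \<Gamma>_R = {R} \<times> (0,Z) and w = 0 on the rest of the boundary of
   (R,\<rho>) \<times> (0,Z). *)
definition trace_bc :: "real \<Rightarrow> real \<Rightarrow> real \<Rightarrow> (pt \<Rightarrow> complex) \<Rightarrow> (real \<Rightarrow> complex) \<Rightarrow> bool" where
  "trace_bc R \<rho> Z w \<eta> \<longleftrightarrow>
     (\<exists>u :: nat \<Rightarrow> pt \<Rightarrow> complex. (\<forall>n. smooth (u n)) \<and>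
        (\<lambda>n. H1_norm (Omega_pml R \<rho> Z) (\<lambda>x. w x - u n x)) \<longlonglongrightarrow> 0 \<and>
        (\<lambda>n. LINT z:{0<..<Z}|lborel. (cmod (u n (R, z) - \<eta> z))\<^sup>2) \<longlonglongrightarrow> 0 \<and>
        (\<lambda>n. LINT z:{0<..<Z}|lborel. (cmod (u n (\<rho>, z)))\<^sup>2) \<longlonglongrightarrow> 0 \<and>
        (\<lambda>n. LINT r:{R<..<\<rho>}|lborel. (cmod (u n (r, 0)))\<^sup>2) \<longlonglongrightarrow> 0 \<and>
        (\<lambda>n. LINT r:{R<..<\<rho>}|lborel. (cmod (u n (r, Z)))\<^sup>2) \<longlonglongrightarrow> 0)"

definition chi :: "real \<Rightarrow> real \<Rightarrow> real \<Rightarrow> real" where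
  "chi \<chi>0 R r = (if r \<le> R then 0 else \<chi>0 * (r - R)\<^sup>2)"

definition alpha :: "real \<Rightarrow> real \<Rightarrow> real \<Rightarrow> complex" where
  "alpha \<chi>0 R r = 1 + (1 + \<i>) * complex_of_real (deriv (chi \<chi>0 R) r)"

definition beta :: "real \<Rightarrow> real \<Rightarrow> real \<Rightarrow> complex" where
  "beta \<chi>0 R r = 1 + (1 + \<i>) * complex_of_real (chi \<chi>0 R r / r)"

definition a_pml :: "real \<Rightarrow> real \<Rightarrow> real \<Rightarrow> real \<Rightarrow> real \<Rightarrow>
    (pt \<Rightarrow> complex) \<Rightarrow> (pt \<Rightarrow> complex) \<Rightarrow> complex" where
  "a_pml k Z R \<rho> \<chi>0 w v =
     (let \<Omega> = Omega_pml R \<rho> Z in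
      LINT x:\<Omega>|lborel.
        (1 / (complex_of_real (fst x) * beta \<chi>0 R (fst x))) *
        ((1 / alpha \<chi>0 R (fst x)) * wpd \<Omega> (1,0) w x * cnj (wpd \<Omega> (1,0) v x)
         + alpha \<chi>0 R (fst x) * wpd \<Omega> (0,1) w x * cnj (wpd \<Omega> (0,1) v x)
         - alpha \<chi>0 R (fst x) * complex_of_real (k\<^sup>2) * w x * cnj (v x)))"

definition km :: "real \<Rightarrow> real \<Rightarrow> nat \<Rightarrow> complex" where
  "km Z k m = (if k > real m * pi / Z
               then complex_of_real (sqrt (k\<^sup>2 - (real m)\<^sup>2 * pi\<^sup>2 / Z\<^sup>2))
               else \<i> * complex_of_real (sqrt ((real m)\<^sup>2 * pi\<^sup>2 / Z\<^sup>2 - k\<^sup>2)))"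

definition kappa :: "real \<Rightarrow> real \<Rightarrow> real" where
  "kappa Z k = (INF m\<in>{1::nat..}. cmod (km Z k m))"

(* sine coefficients: \<eta> = \<Sum>_{m\<ge>1} \<eta>_m sin(m\<pi>z/Z) in L^2(0,Z) *)
definition sine_coeff :: "real \<Rightarrow> (real \<Rightarrow> complex) \<Rightarrow> nat \<Rightarrow> complex" where
  "sine_coeff Z \<eta> m = complex_of_real (2 / Z) *
     (LINT z:{0<..<Z}|lborel. \<eta> z * complex_of_real (sin (real m * pi * z / Z)))"

definition H12_0 :: "real \<Rightarrow> (real \<Rightarrow> complex) \<Rightarrow> bool" where
  "H12_0 Z \<eta> \<longleftrightarrow> L2 {0<..<Z} \<eta> \<and>
     summable (\<lambda>m. real m * (cmod (sine_coeff Z \<eta> m))\<^sup>2)"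

definition H12_norm :: "real \<Rightarrow> (real \<Rightarrow> complex) \<Rightarrow> real" where
  "H12_norm Z \<eta> = sqrt (\<Sum>m. real m * (cmod (sine_coeff Z \<eta> m))\<^sup>2)"

definition pml_solution :: "real \<Rightarrow> real \<Rightarrow> real \<Rightarrow> real \<Rightarrow> real \<Rightarrow>
    (real \<Rightarrow> complex) \<Rightarrow> (pt \<Rightarrow> complex) \<Rightarrow> bool" where
  "pml_solution k Z R \<rho> \<chi>0 \<eta> w \<longleftrightarrow>
     H1 (Omega_pml R \<rho> Z) w \<and> trace_bc R \<rho> Z w \<eta> \<and>
     (\<forall>v. H1_0 (Omega_pml R \<rho> Z) v \<longrightarrow> a_pml k Z R \<rho> \<chi>0 w v = 0)"

end

theory Submission
  imports Defs
begin

text \<open>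
  The sine modes of \<open>w\<close> decouple into two-point boundary value problems for
  \<open>(w' / (r \<alpha> \<beta>))' = - k\<^sub>m\<^sup>2 (\<alpha> / (r \<beta>)) w\<close> on \<open>(R, \<rho>)\<close> with \<open>w(R) = \<eta>\<^sub>m\<close>, \<open>w(\<rho>) = 0\<close>. The energy identity bounds each mode:
  for evanescent modes its real part is coercive, while for propagating modes its imaginary part controls \<open>w\<close> and \<open>w'\<close>
  with weights vanishing at \<open>R\<close>, and an integration by parts removes the weights. Comparison with the lift
  \<open>exp (- m (r - R)) (\<rho> - r) / (\<rho> - R)\<close> of the boundary value, whose squared energy is of order \<open>m\<close>, produces the \<open>H\<^sup>1\<^sup>/\<^sup>2\<close> norm
  of \<open>\<eta>\<close>. The modal series converges in \<open>H\<^sup>1\<close> to a solution. Uniqueness follows by duality: testing the weak form with the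
  solutions of the inhomogeneous mode equations shows that the difference of two solutions is orthogonal to all
  functions \<open>f(r) sin(m\<pi>z/Z)\<close>.
\<close>

section \<open>Square-integrable functions\<close>

text \<open>For a propagating mode neither part of the energy is coercive: the real part is
  indefinite, and the imaginary part degenerates at the interface \<open>R\<close>, where the
  absorption vanishes and the data sit. This loss fixes the exponents. Uniformity in \<chi>0 and
  \<rho> comes from measuring everything by \<open>X = (\<kappa> + 4) * \<chi>0 * d\<close>. As
  \<open>\<kappa> * \<chi>0 * R \<ge> 1\<close> and \<open>d \<ge> R\<close>, constants are absorbed
  into \<open>\<kappa> * \<chi>0 * d\<close>, so |\<alpha>| and |\<beta>| are at most
  \<open>X\<close> throughout the layer, while \<open>x = \<chi>0 * d\<close> is at most
  \<open>|\<alpha>(\<rho>)| / 2\<close> and \<open>2 * |\<beta>(\<rho>)|\<close>. All bounds become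
  monomials in \<open>d\<close> and \<open>x\<close> of degree at most 6 in each; missing powers are
  supplied by \<open>d / R \<ge> 1\<close> and \<open>\<kappa> * x \<ge> 1\<close>. Duality in the
  uniqueness proof means that only explicit products have to be shown to lie in \<open>H1_0\<close>,
  not a difference of solutions with zero traces. Weak derivatives are fixed only up to null sets,
  so \<open>a_pml\<close> and \<open>H1_norm\<close> are always rewritten with concrete
  representatives first.\<close>

definition sqn :: "'a::euclidean_space set \<Rightarrow> ('a \<Rightarrow> complex) \<Rightarrow> real" where
  "sqn S f = (LINT x:S|lborel. (cmod (f x))\<^sup>2)"

definition l2n :: "'a::euclidean_space set \<Rightarrow> ('a \<Rightarrow> complex) \<Rightarrow> real" where
  "l2n S f = sqrt (sqn S f)"

lemma sqn_nonneg: "0 \<le> sqn S f"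
  unfolding sqn_def set_lebesgue_integral_def by (intro integral_nonneg_AE) auto

lemma l2n_nonneg: "0 \<le> l2n S f"
  by (simp add: l2n_def sqn_nonneg)

lemma l2n_sq: "(l2n S f)\<^sup>2 = sqn S f"
  by (simp add: l2n_def sqn_nonneg)

lemma L2_measurable: "L2 S f \<Longrightarrow> (\<lambda>x. indicator S x *\<^sub>R f x) \<in> borel_measurable lborel"
  by (simp add: L2_def set_borel_measurable_def)

lemma L2_sq_integrable: "L2 S f \<Longrightarrow> set_integrable lborel S (\<lambda>x. (cmod (f x))\<^sup>2)"
  by (simp add: L2_def)

lemma L2I:
  assumes "set_borel_measurable lborel S f" "set_integrable lborel S h"
    and "\<And>x. x \<in> S \<Longrightarrow> (cmod (f x))\<^sup>2 \<le> h x"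
  shows "L2 S f"
  unfolding L2_def
proof
  show "set_borel_measurable lborel S f" by fact
  have m: "(\<lambda>x. (cmod (indicator S x *\<^sub>R f x))\<^sup>2) \<in> borel_measurable lborel"
    using assms(1) unfolding set_borel_measurable_def by measurable
  have "(\<lambda>x. (cmod (indicator S x *\<^sub>R f x))\<^sup>2) = (\<lambda>x. indicator S x *\<^sub>R (cmod (f x))\<^sup>2)"
    by (auto simp: indicator_def)
  with m have "set_borel_measurable lborel S (\<lambda>x. (cmod (f x))\<^sup>2)"
    by (simp add: set_borel_measurable_def)
  then show "set_integrable lborel S (\<lambda>x. (cmod (f x))\<^sup>2)"
    by (rule set_integrable_bound[OF assms(2)]) (use assms(3) in force)
qed

lemma set_borel_measurable_add:
  fixes f g :: "'a::euclidean_space \<Rightarrow> complex"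
  assumes "set_borel_measurable lborel S f" "set_borel_measurable lborel S g"
  shows "set_borel_measurable lborel S (\<lambda>x. f x + g x)"
  using borel_measurable_add[OF assms[unfolded set_borel_measurable_def]]
  by (simp add: set_borel_measurable_def scaleR_add_right)

lemma set_borel_measurable_mult:
  fixes f g :: "'a::euclidean_space \<Rightarrow> complex"
  assumes "set_borel_measurable lborel S f" "set_borel_measurable lborel S g"
  shows "set_borel_measurable lborel S (\<lambda>x. f x * g x)"
proof -
  have "(\<lambda>x. (indicator S x *\<^sub>R f x) * (indicator S x *\<^sub>R g x)) = (\<lambda>x. indicator S x *\<^sub>R (f x * g x))"
    by (auto simp: indicator_def)
  then show ?thesis
    using borel_measurable_times[OF assms[unfolded set_borel_measurable_def]]
    by (simp add: set_borel_measurable_def)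
qed

lemma set_borel_measurable_cnj:
  fixes f :: "'a::euclidean_space \<Rightarrow> complex"
  assumes "set_borel_measurable lborel S f"
  shows "set_borel_measurable lborel S (\<lambda>x. cnj (f x))"
proof -
  have "cnj \<in> borel_measurable borel"
    by (intro borel_measurable_continuous_onI continuous_intros)
  from measurable_compose[OF assms[unfolded set_borel_measurable_def] this]
  show ?thesis by (simp add: set_borel_measurable_def)
qed

lemma L2_cnj: "L2 S f \<Longrightarrow> L2 S (\<lambda>x. cnj (f x))"
  by (simp add: L2_def set_borel_measurable_cnj)

lemma set_borel_measurable_cmult:
  fixes f :: "'a::euclidean_space \<Rightarrow> complex"
  assumes "set_borel_measurable lborel S f"
  shows "set_borel_measurable lborel S (\<lambda>x. c * f x)"
proof -
  have "(\<lambda>x. c * (indicator S x *\<^sub>R f x)) \<in> borel_measurable lborel"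
    using assms unfolding set_borel_measurable_def by measurable
  then show ?thesis by (simp add: set_borel_measurable_def)
qed

lemma L2_mult_bounded:
  assumes "L2 S f" "set_borel_measurable lborel S h" "\<And>x. x \<in> S \<Longrightarrow> cmod (h x) \<le> M"
  shows "L2 S (\<lambda>x. h x * f x)"
proof (rule L2I)
  show "set_borel_measurable lborel S (\<lambda>x. h x * f x)"
    using assms by (intro set_borel_measurable_mult) (auto simp: L2_def)
  show "set_integrable lborel S (\<lambda>x. M\<^sup>2 * (cmod (f x))\<^sup>2)"
    using L2_sq_integrable[OF assms(1)] by auto
  fix x assume "x \<in> S"
  then show "(cmod (h x * f x))\<^sup>2 \<le> M\<^sup>2 * (cmod (f x))\<^sup>2"
    using assms(3)[of x] by (simp add: norm_mult power_mult_distrib mult_right_mono power_mono)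
qed

lemma L2_cmult: "L2 S f \<Longrightarrow> L2 S (\<lambda>x. c * f x)"
  by (rule L2I[where h="\<lambda>x. (cmod c)\<^sup>2 * (cmod (f x))\<^sup>2"])
     (auto simp: L2_def norm_mult power_mult_distrib intro: set_borel_measurable_cmult)

lemma L2_add:
  assumes "L2 S f" "L2 S g" shows "L2 S (\<lambda>x. f x + g x)"
proof (rule L2I)
  show "set_borel_measurable lborel S (\<lambda>x. f x + g x)"
    using assms by (intro set_borel_measurable_add) (auto simp: L2_def)
  show "set_integrable lborel S (\<lambda>x. 2 * (cmod (f x))\<^sup>2 + 2 * (cmod (g x))\<^sup>2)"
    using assms[THEN L2_sq_integrable] by auto
  fix x
  have "(cmod (f x + g x))\<^sup>2 \<le> (cmod (f x) + cmod (g x))\<^sup>2"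
    by (intro power_mono norm_triangle_ineq) auto
  also have "\<dots> \<le> 2 * (cmod (f x))\<^sup>2 + 2 * (cmod (g x))\<^sup>2"
    by (smt (verit, ccfv_SIG) power2_sum sum_squares_bound)
  finally show "(cmod (f x + g x))\<^sup>2 \<le> 2 * (cmod (f x))\<^sup>2 + 2 * (cmod (g x))\<^sup>2" .
qed

lemma L2_diff: "L2 S f \<Longrightarrow> L2 S g \<Longrightarrow> L2 S (\<lambda>x. f x - g x)"
  using L2_add[of S f "\<lambda>x. (-1) * g x"] L2_cmult[of S g "-1"] by simp

lemma L2_zero: "L2 S (\<lambda>x. 0)"
  by (simp add: L2_def set_borel_measurable_def set_integrable_def)

lemma L2_sum:
  assumes "\<And>i. i \<in> I \<Longrightarrow> L2 S (f i)" shows "L2 S (\<lambda>x. \<Sum>i\<in>I. f i x)"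
proof (cases "finite I")
  case True
  then show ?thesis using assms by (induction I rule: finite_induct) (auto simp: L2_zero L2_add)
qed (simp add: L2_zero)

lemma L2_mult_integrable:
  assumes "L2 S f" "L2 S g" shows "set_integrable lborel S (\<lambda>x. f x * g x)"
proof (rule set_integrable_bound)
  show "set_integrable lborel S (\<lambda>x. (cmod (f x))\<^sup>2 + (cmod (g x))\<^sup>2)"
    using assms[THEN L2_sq_integrable] by auto
  show "set_borel_measurable lborel S (\<lambda>x. f x * g x)"
    using assms by (intro set_borel_measurable_mult) (auto simp: L2_def)
  have "a * b \<le> a\<^sup>2 + b\<^sup>2" for a b :: real
  proof -
    have "0 \<le> (a - b)\<^sup>2 + a\<^sup>2 + b\<^sup>2" by simp
    then show ?thesis by (simp add: power2_diff)
  qed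
  then show "AE x\<in>S in lborel. norm (f x * g x) \<le> norm ((cmod (f x))\<^sup>2 + (cmod (g x))\<^sup>2)"
    by (simp add: norm_mult)
qed

lemma L2_integrable:
  assumes "L2 S f" "S \<in> sets borel" "emeasure lborel S < \<infinity>" shows "set_integrable lborel S f"
proof -
  have "L2 S (\<lambda>x. 1)"
    using assms by (simp add: L2_def set_borel_measurable_def set_integrable_def)
  from L2_mult_integrable[OF assms(1) this] show ?thesis by simp
qed

lemma L2_continuous:
  assumes "compact K" "continuous_on K f" "S \<subseteq> K" "S \<in> sets borel"
  shows "L2 S f"
proof (rule L2I)
  have K: "K \<in> sets borel" using assms(1) by (simp add: borel_compact)
  have "integrable lborel (\<lambda>x. indicator K x *\<^sub>R f x)"
    using assms by (intro borel_integrable_compact) auto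
  then have "set_integrable lborel K f" by (simp add: set_integrable_def)
  then have "set_integrable lborel S f" using assms by (auto intro: set_integrable_subset[of lborel K])
  then show "set_borel_measurable lborel S f"
    by (simp add: set_borel_measurable_def set_integrable_def)
  have "continuous_on K (\<lambda>x. (cmod (f x))\<^sup>2)" by (intro continuous_intros assms)
  then have "set_integrable lborel K (\<lambda>x. (cmod (f x))\<^sup>2)"
    unfolding set_integrable_def using assms by (intro borel_integrable_compact) auto
  then show "set_integrable lborel S (\<lambda>x. (cmod (f x))\<^sup>2)"
    using assms by (auto intro: set_integrable_subset[of lborel K])
qed auto

lemma set_integral_AE_cong:
  fixes f g :: "'a::euclidean_space \<Rightarrow> 'b::{banach,second_countable_topology}"
  assumes "set_borel_measurable lborel S f" "set_borel_measurable lborel S g"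
    "AE x in lborel. x \<in> S \<longrightarrow> f x = g x"
  shows "(LINT x:S|lborel. f x) = (LINT x:S|lborel. g x)"
  unfolding set_lebesgue_integral_def
proof (rule integral_cong_AE)
  show "AE x in lborel. indicator S x *\<^sub>R f x = indicator S x *\<^sub>R g x"
    using assms(3) by eventually_elim (auto simp: indicator_def)
qed (use assms in \<open>auto simp: set_borel_measurable_def\<close>)

lemma set_integral_norm_le:
  fixes f :: "'a::euclidean_space \<Rightarrow> complex"
  assumes "set_integrable lborel S f" "set_integrable lborel S h"
    "\<And>x. x \<in> S \<Longrightarrow> cmod (f x) \<le> h x"
  shows "cmod (LINT x:S|lborel. f x) \<le> (LINT x:S|lborel. h x)"
  unfolding set_lebesgue_integral_def
proof (rule Bochner_Integration.integral_norm_bound_integral)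
  show "cmod (indicator S x *\<^sub>R f x) \<le> indicator S x *\<^sub>R h x" for x
    using assms(3) by (auto simp: indicator_def)
qed (use assms in \<open>auto simp: set_integrable_def\<close>)

text \<open>The optimal parameter is \<open>sqrt (B / A)\<close>; shifting both numbers by
  \<open>e > 0\<close> keeps this choice meaningful when one of them is zero, and \<open>e\<close>
  tends to 0 at the end. It turns weighted AM-GM into Cauchy-Schwarz.\<close>

lemma le_sqrt_mult_of_AMGM:
  fixes x A B :: real
  assumes "A \<ge> 0" "B \<ge> 0" and le: "\<And>t. t > 0 \<Longrightarrow> 2 * x \<le> t * A + B / t"
  shows "x \<le> sqrt A * sqrt B"
proof -
  have "x \<le> sqrt (A + e) * sqrt (B + e)" if "e > 0" for e
  proof -
    have pos: "A + e > 0" "B + e > 0" using assms that by auto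
    define t where "t = sqrt (B + e) / sqrt (A + e)"
    have t: "t > 0" using pos by (simp add: t_def)
    have "2 * x \<le> t * A + B / t" using le t by simp
    also have "\<dots> \<le> t * (A + e) + (B + e) / t"
      using t that by (intro add_mono mult_left_mono divide_right_mono) auto
    also have "t * (A + e) = sqrt (B + e) * ((A + e) / sqrt (A + e))"
      by (simp add: t_def)
    also have "(B + e) / t = sqrt (A + e) * ((B + e) / sqrt (B + e))"
      by (simp add: t_def)
    also have "(A + e) / sqrt (A + e) = sqrt (A + e)" using pos by (simp add: real_div_sqrt)
    also have "(B + e) / sqrt (B + e) = sqrt (B + e)" using pos by (simp add: real_div_sqrt)
    finally show ?thesis by simp
  qed
  then have ev: "eventually (\<lambda>e. x \<le> sqrt (A + e) * sqrt (B + e)) (at_right 0)"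
    by (auto simp: eventually_at_right_field intro: exI[of _ 1])
  have "((\<lambda>e. sqrt (A + e) * sqrt (B + e)) \<longlongrightarrow> sqrt (A + 0) * sqrt (B + 0)) (at_right 0)"
    by (intro tendsto_intros)
  from tendsto_lowerbound[OF this ev] show ?thesis by simp
qed

text \<open>Integrate \<open>2 * |f g| \<le> t * |f|\<^sup>2 + |g|\<^sup>2 / t\<close> and optimise
  over \<open>t\<close>. The modulus stays inside the integral, as the triangle inequality and the
  passage from L2 to L1 in \<open>Riesz_Fischer_L2\<close> require.\<close>

lemma L2_norm_integral_le:
  assumes "L2 S f" "L2 S g"
  shows "(LINT x:S|lborel. cmod (f x * g x)) \<le> l2n S f * l2n S g"
  unfolding l2n_def
proof (rule le_sqrt_mult_of_AMGM)
  fix t :: real assume t: "t > 0"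
  have i1: "set_integrable lborel S (\<lambda>x. cmod (f x * g x))"
    using L2_mult_integrable[OF assms] by (rule set_integrable_norm)
  have "2 * (LINT x:S|lborel. cmod (f x * g x)) = (LINT x:S|lborel. 2 * cmod (f x * g x))" by simp
  also have "\<dots> \<le> (LINT x:S|lborel. t * (cmod (f x))\<^sup>2 + (cmod (g x))\<^sup>2 / t)"
  proof (rule set_integral_mono)
    fix x
    have "0 \<le> (sqrt t * cmod (f x) - cmod (g x) / sqrt t)\<^sup>2" by simp
    also have "\<dots> = t * (cmod (f x))\<^sup>2 + (cmod (g x))\<^sup>2 / t - 2 * (cmod (f x) * cmod (g x))"
      using t by (simp add: power2_diff power_mult_distrib power_divide)
    finally show "2 * cmod (f x * g x) \<le> t * (cmod (f x))\<^sup>2 + (cmod (g x))\<^sup>2 / t"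
      by (simp add: norm_mult)
  qed (use i1 assms[THEN L2_sq_integrable] in auto)
  also have "\<dots> = t * sqn S f + sqn S g / t"
    unfolding sqn_def using assms[THEN L2_sq_integrable] by (subst set_integral_add) auto
  finally show "2 * (LINT x:S|lborel. cmod (f x * g x)) \<le> t * sqn S f + sqn S g / t" .
qed (auto simp: sqn_nonneg)

lemma Cauchy_Schwarz_L2:
  assumes "L2 S f" "L2 S g"
  shows "cmod (LINT x:S|lborel. f x * g x) \<le> l2n S f * l2n S g"
proof -
  have "cmod (LINT x:S|lborel. f x * g x) \<le> (LINT x:S|lborel. cmod (f x * g x))"
    using L2_mult_integrable[OF assms]
    by (intro set_integral_norm_le set_integrable_norm) auto
  with L2_norm_integral_le[OF assms] show ?thesis by simp
qed

lemma sqn_add_le: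
  assumes "L2 S f" "L2 S g"
  shows "sqn S (\<lambda>x. f x + g x) \<le> 2 * sqn S f + 2 * sqn S g"
proof -
  have "sqn S (\<lambda>x. f x + g x) \<le> (LINT x:S|lborel. 2 * (cmod (f x))\<^sup>2 + 2 * (cmod (g x))\<^sup>2)"
    unfolding sqn_def
  proof (rule set_integral_mono)
    fix x
    have "(cmod (f x + g x))\<^sup>2 \<le> (cmod (f x) + cmod (g x))\<^sup>2"
      by (intro power_mono norm_triangle_ineq) auto
    also have "\<dots> \<le> 2 * (cmod (f x))\<^sup>2 + 2 * (cmod (g x))\<^sup>2"
      by (smt (verit, ccfv_SIG) power2_sum sum_squares_bound)
    finally show "(cmod (f x + g x))\<^sup>2 \<le> 2 * (cmod (f x))\<^sup>2 + 2 * (cmod (g x))\<^sup>2" .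
  qed (use assms[THEN L2_sq_integrable] L2_sq_integrable[OF L2_add[OF assms]] in auto)
  also have "\<dots> = 2 * sqn S f + 2 * sqn S g"
    unfolding sqn_def using assms[THEN L2_sq_integrable] by (subst set_integral_add) auto
  finally show ?thesis .
qed

lemma sqn_cmult: "sqn S (\<lambda>x. c * f x) = (cmod c)\<^sup>2 * sqn S f"
  by (simp add: sqn_def norm_mult power_mult_distrib)

lemma l2n_triangle:
  assumes "L2 S f" "L2 S g"
  shows "l2n S (\<lambda>x. f x + g x) \<le> l2n S f + l2n S g"
proof -
  have i: "set_integrable lborel S (\<lambda>x. cmod (f x * g x))"
    using L2_mult_integrable[OF assms] by (rule set_integrable_norm)
  have "sqn S (\<lambda>x. f x + g x) \<le> (LINT x:S|lborel. (cmod (f x))\<^sup>2 + (cmod (g x))\<^sup>2 + 2 * cmod (f x * g x))"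
    unfolding sqn_def
  proof (rule set_integral_mono)
    fix x
    have "(cmod (f x + g x))\<^sup>2 \<le> (cmod (f x) + cmod (g x))\<^sup>2"
      by (intro power_mono norm_triangle_ineq) auto
    then show "(cmod (f x + g x))\<^sup>2 \<le> (cmod (f x))\<^sup>2 + (cmod (g x))\<^sup>2 + 2 * cmod (f x * g x)"
      by (simp add: power2_sum norm_mult)
  qed (use i assms[THEN L2_sq_integrable] L2_sq_integrable[OF L2_add[OF assms]] in auto)
  also have "\<dots> = sqn S f + sqn S g + 2 * (LINT x:S|lborel. cmod (f x * g x))"
    unfolding sqn_def using assms[THEN L2_sq_integrable] i by (simp add: set_integral_add)
  also have "\<dots> \<le> (l2n S f + l2n S g)\<^sup>2"
    using L2_norm_integral_le[OF assms] by (simp add: power2_sum l2n_sq)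
  finally show ?thesis
    unfolding l2n_def[of S "\<lambda>x. f x + g x"] by (intro real_le_lsqrt) (auto simp: l2n_nonneg sqn_nonneg)
qed

lemma sqn_AE_cong:
  assumes "L2 S f" "L2 S g" "AE x in lborel. x \<in> S \<longrightarrow> f x = g x"
  shows "sqn S f = sqn S g"
  unfolding sqn_def
proof (rule set_integral_AE_cong)
  show "AE x in lborel. x \<in> S \<longrightarrow> (cmod (f x))\<^sup>2 = (cmod (g x))\<^sup>2"
    using assms(3) by eventually_elim auto
qed (use assms[unfolded L2_def set_integrable_def] in \<open>auto simp: set_borel_measurable_def\<close>)

lemma L2_tendsto_integral:
  assumes "L2 S f" "\<And>n. L2 S (F n)" "L2 S g" "(\<lambda>n. sqn S (\<lambda>x. f x - F n x)) \<longlonglongrightarrow> 0"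
  shows "(\<lambda>n. LINT x:S|lborel. F n x * g x) \<longlonglongrightarrow> (LINT x:S|lborel. f x * g x)"
proof (rule LIM_zero_cancel, rule Lim_null_comparison)
  have "(\<lambda>n. l2n S (\<lambda>x. f x - F n x) * l2n S g) \<longlonglongrightarrow> sqrt 0 * l2n S g"
    unfolding l2n_def[of S "\<lambda>x. f x - F n x" for n] by (intro tendsto_intros assms)
  then show "(\<lambda>n. l2n S (\<lambda>x. f x - F n x) * l2n S g) \<longlonglongrightarrow> 0" by simp
  have "norm ((LINT x:S|lborel. F n x * g x) - (LINT x:S|lborel. f x * g x)) \<le> l2n S (\<lambda>x. f x - F n x) * l2n S g" for n
  proof -
    have "(LINT x:S|lborel. f x * g x) - (LINT x:S|lborel. F n x * g x) = (LINT x:S|lborel. (f x - F n x) * g x)"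
      using assms by (simp add: left_diff_distrib set_integral_diff L2_mult_integrable)
    with Cauchy_Schwarz_L2[OF L2_diff[OF assms(1,2)] assms(3), of n]
    show ?thesis by (metis norm_minus_commute)
  qed
  then show "\<forall>\<^sub>F n in sequentially. norm ((LINT x:S|lborel. F n x * g x) - (LINT x:S|lborel. f x * g x)) \<le> l2n S (\<lambda>x. f x - F n x) * l2n S g"
    by simp
qed

text \<open>On a set of finite measure an L2 Cauchy sequence is Cauchy in L1, so a subsequence
  converges almost everywhere; Fatou's lemma then shows that this pointwise limit is the L2 limit of
  the whole sequence. The solution and its two derivatives are obtained from here.\<close>

lemma Riesz_Fischer_L2:
  fixes f :: "nat \<Rightarrow> 'a::euclidean_space \<Rightarrow> complex"
  assumes f: "\<And>n. L2 S (f n)" and S: "S \<in> sets borel" "emeasure lborel S < \<infinity>"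
    and C: "\<And>e. e > 0 \<Longrightarrow> \<exists>N. \<forall>i\<ge>N. \<forall>j\<ge>N. sqn S (\<lambda>x. f i x - f j x) < e"
  obtains g where "L2 S g" "(\<lambda>n. sqn S (\<lambda>x. g x - f n x)) \<longlonglongrightarrow> 0"
proof -
  define s where "s = (\<lambda>n x. indicator S x *\<^sub>R f n x)"
  have si: "integrable lborel (s n)" for n
    using L2_integrable[OF f S, of n] by (simp add: set_integrable_def s_def)
  have sm [measurable]: "s n \<in> borel_measurable lborel" for n
    using si by auto
  have one: "L2 S (\<lambda>x. 1)"
    using S by (simp add: L2_def set_borel_measurable_def set_integrable_def)
  have C1: "\<exists>N. \<forall>i\<ge>N. \<forall>j\<ge>N. LINT x|lborel. norm (s i x - s j x) < e" if e: "e > 0" for e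
  proof -
    \<comment> \<open>The added 1 keeps \<open>K\<close> positive even if \<open>S\<close> is a null
      set.\<close>
    define K where "K = l2n S (\<lambda>x. 1) + 1"
    have K: "K > 0" using l2n_nonneg[of S "\<lambda>x. 1"] by (simp add: K_def)
    obtain N where N: "\<forall>i\<ge>N. \<forall>j\<ge>N. sqn S (\<lambda>x. f i x - f j x) < (e / K)\<^sup>2"
      using C[of "(e/K)\<^sup>2"] e K by auto
    have "LINT x|lborel. norm (s i x - s j x) < e" if "i \<ge> N" "j \<ge> N" for i j
    proof -
      have "l2n S (\<lambda>x. f i x - f j x) < sqrt ((e / K)\<^sup>2)"
        unfolding l2n_def using N that by (intro real_sqrt_less_mono) auto
      then have lt: "l2n S (\<lambda>x. f i x - f j x) < e / K" using e K by simp
      have "(LINT x|lborel. norm (s i x - s j x)) = (LINT x:S|lborel. cmod ((f i x - f j x) * 1))"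
        unfolding set_lebesgue_integral_def s_def
        by (intro Bochner_Integration.integral_cong) (auto simp: indicator_def)
      also have "\<dots> \<le> l2n S (\<lambda>x. f i x - f j x) * l2n S (\<lambda>x. 1)"
        by (intro L2_norm_integral_le L2_diff f one)
      also have "\<dots> \<le> l2n S (\<lambda>x. f i x - f j x) * K"
        by (intro mult_left_mono l2n_nonneg) (simp add: K_def)
      also have "\<dots> < e" using lt K by (simp add: pos_less_divide_eq)
      finally show ?thesis .
    qed
    then show ?thesis by auto
  qed
  obtain r where r: "strict_mono r" "AE x in lborel. Cauchy (\<lambda>i. s (r i) x)"
    using cauchy_L1_AE_cauchy_subseq[OF si C1] by blast
  define g where "g x = lim (\<lambda>i. s (r i) x)" for x
  have gm [measurable]: "g \<in> borel_measurable lborel"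
    unfolding g_def by measurable
  have g0: "g x = 0" if "x \<notin> S" for x
    using that by (simp add: g_def s_def)
  have gS: "indicator S x *\<^sub>R g x = g x" for x using g0[of x] by (auto simp: indicator_def)
  have lim: "AE x in lborel. (\<lambda>i. s (r i) x) \<longlonglongrightarrow> g x"
    using r(2) by eventually_elim (simp add: g_def Cauchy_convergent_iff convergent_LIMSEQ_iff)
  have sq: "ennreal (sqn S (\<lambda>x. f i x - f j x)) = (\<integral>\<^sup>+x. ennreal ((cmod (s i x - s j x))\<^sup>2) \<partial>lborel)" for i j
  proof -
    have "integrable lborel (\<lambda>x. indicator S x *\<^sub>R (cmod (f i x - f j x))\<^sup>2)"
      using L2_sq_integrable[OF L2_diff[OF f f]] by (simp add: set_integrable_def)
    then have "ennreal (sqn S (\<lambda>x. f i x - f j x)) = (\<integral>\<^sup>+x. ennreal (indicator S x *\<^sub>R (cmod (f i x - f j x))\<^sup>2) \<partial>lborel)"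
      unfolding sqn_def set_lebesgue_integral_def by (subst nn_integral_eq_integral) auto
    also have "\<dots> = (\<integral>\<^sup>+x. ennreal ((cmod (s i x - s j x))\<^sup>2) \<partial>lborel)"
      by (intro nn_integral_cong) (auto simp: indicator_def s_def)
    finally show ?thesis .
  qed
  have key: "\<exists>N. \<forall>n\<ge>N. (\<integral>\<^sup>+x. ennreal ((cmod (g x - s n x))\<^sup>2) \<partial>lborel) \<le> ennreal e" if e: "e > 0" for e
  proof -
    obtain N where N: "\<forall>i\<ge>N. \<forall>j\<ge>N. sqn S (\<lambda>x. f i x - f j x) < e"
      using C[OF e] by auto
    have "(\<integral>\<^sup>+x. ennreal ((cmod (g x - s n x))\<^sup>2) \<partial>lborel) \<le> ennreal e" if n: "n \<ge> N" for n
    proof -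
      have "(\<integral>\<^sup>+x. ennreal ((cmod (g x - s n x))\<^sup>2) \<partial>lborel)
          = (\<integral>\<^sup>+x. liminf (\<lambda>i. ennreal ((cmod (s (r i) x - s n x))\<^sup>2)) \<partial>lborel)"
      proof (rule nn_integral_cong_AE)
        show "AE x in lborel. ennreal ((cmod (g x - s n x))\<^sup>2) = liminf (\<lambda>i. ennreal ((cmod (s (r i) x - s n x))\<^sup>2))"
          using lim
        proof eventually_elim
          case (elim x)
          have "(\<lambda>i. ennreal ((cmod (s (r i) x - s n x))\<^sup>2)) \<longlonglongrightarrow> ennreal ((cmod (g x - s n x))\<^sup>2)"
            by (intro tendsto_intros tendsto_ennrealI elim)
          then show ?case by (rule lim_imp_Liminf[OF trivial_limit_sequentially, symmetric])
        qed
      qed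
      also have "\<dots> \<le> liminf (\<lambda>i. \<integral>\<^sup>+x. ennreal ((cmod (s (r i) x - s n x))\<^sup>2) \<partial>lborel)"
        by (rule nn_integral_liminf) measurable
      also have "\<dots> \<le> ennreal e"
      proof (rule Liminf_le)
        have "(\<integral>\<^sup>+x. ennreal ((cmod (s (r i) x - s n x))\<^sup>2) \<partial>lborel) \<le> ennreal e" if "i \<ge> N" for i
        proof -
          have "r i \<ge> N" using seq_suble[OF r(1), of i] that by simp
          with N n have "sqn S (\<lambda>x. f (r i) x - f n x) \<le> e" by (auto intro: less_imp_le)
          then show ?thesis unfolding sq[symmetric] by (rule ennreal_leI)
        qed
        then show "\<forall>\<^sub>F i in sequentially. (\<integral>\<^sup>+x. ennreal ((cmod (s (r i) x - s n x))\<^sup>2) \<partial>lborel) \<le> ennreal e"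
          by (auto simp: eventually_sequentially)
      qed simp
      finally show ?thesis .
    qed
    then show ?thesis by auto
  qed
  \<comment> \<open>A finite bound on the extended integral gives integrability, so membership in
    \<open>L2\<close> and the real estimate come out together.\<close>
  have gd: "L2 S (\<lambda>x. g x - f n x) \<and> sqn S (\<lambda>x. g x - f n x) \<le> e"
    if le: "(\<integral>\<^sup>+x. ennreal ((cmod (g x - s n x))\<^sup>2) \<partial>lborel) \<le> ennreal e" and e: "e > 0" for n e
  proof -
    have eq: "(cmod (g x - s n x))\<^sup>2 = indicator S x *\<^sub>R (cmod (g x - f n x))\<^sup>2" for x
      using g0[of x] by (auto simp: indicator_def s_def)
    have int: "integrable lborel (\<lambda>x. (cmod (g x - s n x))\<^sup>2)"
    proof (rule integrableI_bounded)
      show "(\<integral>\<^sup>+x. ennreal (norm ((cmod (g x - s n x))\<^sup>2)) \<partial>lborel) < \<infinity>"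
        using le by (simp add: le_less_trans)
    qed measurable
    have "(\<lambda>x. g x - s n x) = (\<lambda>x. indicator S x *\<^sub>R (g x - f n x))"
      using g0 by (auto simp: indicator_def s_def)
    moreover have "(\<lambda>x. g x - s n x) \<in> borel_measurable lborel" by measurable
    ultimately have m: "set_borel_measurable lborel S (\<lambda>x. g x - f n x)"
      by (simp add: set_borel_measurable_def)
    have L: "L2 S (\<lambda>x. g x - f n x)"
      using m int by (simp add: L2_def set_integrable_def eq)
    have "ennreal (sqn S (\<lambda>x. g x - f n x)) = (\<integral>\<^sup>+x. ennreal ((cmod (g x - s n x))\<^sup>2) \<partial>lborel)"
      unfolding sqn_def set_lebesgue_integral_def eq[symmetric]
      by (rule nn_integral_eq_integral[OF int, symmetric]) auto
    with le have "ennreal (sqn S (\<lambda>x. g x - f n x)) \<le> ennreal e" by simp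
    then have "sqn S (\<lambda>x. g x - f n x) \<le> e" using e by (simp add: ennreal_le_iff)
    with L show ?thesis by simp
  qed
  show ?thesis
  proof
    obtain N where "(\<integral>\<^sup>+x. ennreal ((cmod (g x - s N x))\<^sup>2) \<partial>lborel) \<le> ennreal 1"
      using key[of 1] by auto
    from gd[OF this] have "L2 S (\<lambda>x. g x - f N x)" by simp
    from L2_add[OF this f[of N]] show "L2 S g" by simp
    show "(\<lambda>n. sqn S (\<lambda>x. g x - f n x)) \<longlonglongrightarrow> 0"
    proof (rule LIMSEQ_I)
      fix e :: real assume "e > 0"
      then have e2: "e / 2 > 0" by simp
      obtain N where "\<forall>n\<ge>N. (\<integral>\<^sup>+x. ennreal ((cmod (g x - s n x))\<^sup>2) \<partial>lborel) \<le> ennreal (e / 2)"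
        using key[OF e2] by auto
      then have "\<forall>n\<ge>N. sqn S (\<lambda>x. g x - f n x) \<le> e / 2" using gd e2 by blast
      then show "\<exists>N. \<forall>n\<ge>N. norm (sqn S (\<lambda>x. g x - f n x) - 0) < e"
        using \<open>e > 0\<close> by (intro exI[of _ N]) (auto simp: sqn_nonneg intro: le_less_trans)
    qed
  qed
qed

section \<open>Fubini and the fundamental theorem of calculus on rectangles\<close>

lemma set_integral_Times:
  fixes f :: "real \<times> real \<Rightarrow> complex"
  assumes "set_integrable lborel (A \<times> B) f"
  shows "(LINT x:A\<times>B|lborel. f x) = (LINT r:A|lborel. LINT z:B|lborel. f (r, z))" (is ?th1)
    and "(LINT x:A\<times>B|lborel. f x) = (LINT z:B|lborel. LINT r:A|lborel. f (r, z))" (is ?th2)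
proof -
  have int: "integrable (lborel \<Otimes>\<^sub>M lborel) (\<lambda>x. indicator (A \<times> B) x *\<^sub>R f x)"
    using assms by (simp add: set_integrable_def lborel_prod)
  have eq: "indicator (A \<times> B) (r, z) *\<^sub>R f (r, z) = indicat_real A r *\<^sub>R (indicat_real B z *\<^sub>R f (r, z))" for r z
    by (auto simp: indicator_def)
  have eq2: "indicator (A \<times> B) (r, z) *\<^sub>R f (r, z) = indicat_real B z *\<^sub>R (indicat_real A r *\<^sub>R f (r, z))" for r z
    by (auto simp: indicator_def)
  have "(LINT x:A\<times>B|lborel. f x) = (\<integral>r. (\<integral>z. indicator (A \<times> B) (r, z) *\<^sub>R f (r, z) \<partial>lborel) \<partial>lborel)"
    unfolding set_lebesgue_integral_def
    using lborel_pair.integral_fst'[OF int] by (simp add: lborel_prod)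
  then show ?th1 by (simp add: eq set_lebesgue_integral_def del: scaleR_scaleR)
  have int2: "integrable (lborel \<Otimes>\<^sub>M lborel) (case_prod (\<lambda>r z. indicator (A \<times> B) (r, z) *\<^sub>R f (r, z)))"
    using int by (simp add: case_prod_beta')
  have "(LINT x:A\<times>B|lborel. f x) = (\<integral>z. (\<integral>r. indicator (A \<times> B) (r, z) *\<^sub>R f (r, z) \<partial>lborel) \<partial>lborel)"
    unfolding set_lebesgue_integral_def
    using lborel_pair.integral_snd[OF int2] by (simp add: lborel_prod case_prod_beta')
  then show ?th2 by (simp add: eq2 set_lebesgue_integral_def del: scaleR_scaleR)
qed

lemma set_integral_Ioo_Icc:
  fixes f :: "real \<Rightarrow> 'a::{banach,second_countable_topology}"
  shows "(LINT x:{a<..<b}|lborel. f x) = (LINT x:{a..b}|lborel. f x)"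
  by (rule set_integral_discrete_difference[where X="{a,b}"]) auto

lemma set_integral_FTC:
  fixes f :: "real \<Rightarrow> 'a::euclidean_space"
  assumes "a \<le> b" "\<And>x. a \<le> x \<Longrightarrow> x \<le> b \<Longrightarrow> (F has_vector_derivative f x) (at x within {a..b})"
    "continuous_on {a..b} f"
  shows "(LINT x:{a<..<b}|lborel. f x) = F b - F a"
  by (subst set_integral_Ioo_Icc, unfold set_lebesgue_integral_def, rule integral_FTC_Icc[OF assms])

lemma set_integrable_continuous:
  fixes f :: "'a::euclidean_space \<Rightarrow> 'b::{banach,second_countable_topology}"
  assumes "compact K" "continuous_on K f" "S \<subseteq> K" "S \<in> sets borel"
  shows "set_integrable lborel S f"
proof (rule set_integrable_subset)
  show "set_integrable lborel K f"
    unfolding set_integrable_def using assms by (intro borel_integrable_compact) auto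
qed (use assms in auto)

lemma sets_rect [simp]: "{a<..<b} \<times> {c<..<d} \<in> sets (borel :: (real \<times> real) measure)"
  by (intro borel_open open_Times) auto

lemma rect_subset: "{a<..<b} \<times> {c<..<d} \<subseteq> {a..b} \<times> {c..(d::real)}" for a b :: real
  by auto

lemma compact_rect [simp]: "compact ({a..b} \<times> {c..(d::real)})" for a b :: real
  by (intro compact_Times) auto

lemma emeasure_rect_finite [simp]: "emeasure lborel ({a<..<b} \<times> {c<..<(d::real)}) < \<infinity>" for a b :: real
  by (rule emeasure_bounded_finite) (rule bounded_subset[OF compact_imp_bounded[OF compact_rect] rect_subset])

lemma set_integrable_rect:
  fixes f :: "real \<times> real \<Rightarrow> complex"
  assumes "continuous_on ({a..b} \<times> {c..d}) f"
  shows "set_integrable lborel ({a<..<b} \<times> {c<..<d}) f"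
  by (rule set_integrable_continuous[OF compact_rect assms rect_subset]) simp

lemma L2_rect:
  fixes f :: "real \<times> real \<Rightarrow> complex"
  assumes "continuous_on ({a..b} \<times> {c..d}) f"
  shows "L2 ({a<..<b} \<times> {c<..<d}) f"
  by (rule L2_continuous[OF compact_rect assms rect_subset]) simp

lemma continuous_on_slice1:
  assumes "continuous_on (A \<times> B) f" "z \<in> B" shows "continuous_on A (\<lambda>r. f (r, z))"
  by (rule continuous_on_compose2[OF assms(1)]) (use assms in \<open>auto intro!: continuous_intros\<close>)

lemma continuous_on_slice2:
  assumes "continuous_on (A \<times> B) f" "r \<in> A" shows "continuous_on B (\<lambda>z. f (r, z))"
  by (rule continuous_on_compose2[OF assms(1)]) (use assms in \<open>auto intro!: continuous_intros\<close>)

lemma integral_rect_deriv_fst: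
  fixes F G :: "real \<times> real \<Rightarrow> complex"
  assumes "a \<le> b"
    and "\<And>r z. r \<in> {a..b} \<Longrightarrow> z \<in> {c..d} \<Longrightarrow> ((\<lambda>r. F (r, z)) has_vector_derivative G (r, z)) (at r within {a..b})"
    and G: "continuous_on ({a..b} \<times> {c..d}) G"
  shows "(LINT x:{a<..<b}\<times>{c<..<d}|lborel. G x) = (LINT z:{c<..<d}|lborel. F (b, z) - F (a, z))"
proof -
  have "(LINT x:{a<..<b}\<times>{c<..<d}|lborel. G x) = (LINT z:{c<..<d}|lborel. LINT r:{a<..<b}|lborel. G (r, z))"
    by (rule set_integral_Times(2)[OF set_integrable_rect[OF G]])
  also have "\<dots> = (LINT z:{c<..<d}|lborel. F (b, z) - F (a, z))"
  proof (rule set_lebesgue_integral_cong)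
    show "\<forall>z. z \<in> {c<..<d} \<longrightarrow> (LINT r:{a<..<b}|lborel. G (r, z)) = F (b, z) - F (a, z)"
      using assms by (auto intro!: set_integral_FTC continuous_on_slice1[OF G])
  qed auto
  finally show ?thesis .
qed

lemma integral_rect_deriv_snd:
  fixes F G :: "real \<times> real \<Rightarrow> complex"
  assumes "c \<le> d"
    and "\<And>r z. r \<in> {a..b} \<Longrightarrow> z \<in> {c..d} \<Longrightarrow> ((\<lambda>z. F (r, z)) has_vector_derivative G (r, z)) (at z within {c..d})"
    and G: "continuous_on ({a..b} \<times> {c..d}) G"
  shows "(LINT x:{a<..<b}\<times>{c<..<d}|lborel. G x) = (LINT r:{a<..<b}|lborel. F (r, d) - F (r, c))"
proof -
  have "(LINT x:{a<..<b}\<times>{c<..<d}|lborel. G x) = (LINT r:{a<..<b}|lborel. LINT z:{c<..<d}|lborel. G (r, z))"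
    by (rule set_integral_Times(1)[OF set_integrable_rect[OF G]])
  also have "\<dots> = (LINT r:{a<..<b}|lborel. F (r, d) - F (r, c))"
  proof (rule set_lebesgue_integral_cong)
    show "\<forall>r. r \<in> {a<..<b} \<longrightarrow> (LINT z:{c<..<d}|lborel. G (r, z)) = F (r, d) - F (r, c)"
      using assms by (auto intro!: set_integral_FTC continuous_on_slice2[OF G])
  qed auto
  finally show ?thesis .
qed

section \<open>Smooth functions and cut-offs\<close>

text \<open>Induction on the list of directions keeps every iterated derivative inside the invariant
  set \<open>S\<close>, so no formula for iterated derivatives is ever written down.\<close>

lemma smoothI:
  assumes "f \<in> S" "\<And>g. g \<in> S \<Longrightarrow> g differentiable_on UNIV" "\<And>g d. g \<in> S \<Longrightarrow> pd d g \<in> S"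
  shows "smooth f"
proof -
  have "iter_pd ds f \<in> S" for ds
    by (induction ds) (auto intro: assms)
  then show ?thesis using assms(2) by (auto simp: smooth_def)
qed

lemma smooth_pd: assumes "smooth f" shows "smooth (pd d f)"
proof -
  have "iter_pd ds (pd d f) = iter_pd (ds @ [d]) f" for ds
    by (induction ds) auto
  then show ?thesis using assms by (simp add: smooth_def)
qed

lemma smooth_differentiable: assumes "smooth f" shows "f differentiable (at x)"
proof -
  have "iter_pd [] f differentiable_on UNIV" using assms unfolding smooth_def by blast
  then show ?thesis by (cases x) (simp add: differentiable_on_def)
qed

lemma smooth_continuous_on: "smooth f \<Longrightarrow> continuous_on A f"
  by (intro continuous_at_imp_continuous_on ballI differentiable_imp_continuous_within smooth_differentiable)

lemma pd_add:
  assumes "f differentiable (at x)" "g differentiable (at x)"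
  shows "pd d (\<lambda>x. f x + g x) x = pd d f x + pd d g x"
  unfolding pd_def
  by (subst frechet_derivative_at[symmetric])
     (auto intro!: derivative_eq_intros simp: frechet_derivative_works[symmetric] assms)

lemma pd_mult:
  assumes "f differentiable (at x)" "g differentiable (at x)"
  shows "pd d (\<lambda>x. f x * g x) x = f x * pd d g x + pd d f x * g x"
  unfolding pd_def
  by (subst frechet_derivative_at[symmetric])
     (rule has_derivative_mult, auto simp: frechet_derivative_works[symmetric] assms)

lemma pd_const_fun: "pd d (\<lambda>x. c) = (\<lambda>x. 0)"
  by (simp add: pd_def frechet_derivative_const fun_eq_iff)

text \<open>An invariant set for \<open>smoothI\<close>: the product rule stays inside sums of
  products. It serves to prove that smooth functions are closed under sums and products without a
  Leibniz formula.\<close>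

inductive_set smooth_alg :: "(pt \<Rightarrow> complex) set" where
  base: "smooth f \<Longrightarrow> f \<in> smooth_alg"
| add: "f \<in> smooth_alg \<Longrightarrow> g \<in> smooth_alg \<Longrightarrow> (\<lambda>x. f x + g x) \<in> smooth_alg"
| mult: "f \<in> smooth_alg \<Longrightarrow> g \<in> smooth_alg \<Longrightarrow> (\<lambda>x. f x * g x) \<in> smooth_alg"

lemma smooth_alg_smooth: assumes "f \<in> smooth_alg" shows "smooth f"
proof (rule smoothI[OF assms])
  have diff: "g differentiable (at x)" if "g \<in> smooth_alg" for g x
    using that
  proof induction
    case (base f)
    then show ?case by (rule smooth_differentiable)
  next
    case (mult f g)
    then show ?case by (intro differentiable_mult)
  qed auto
  then show "g differentiable_on UNIV" if "g \<in> smooth_alg" for g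
    using that by (simp add: differentiable_on_def)
  show "pd d g \<in> smooth_alg" if "g \<in> smooth_alg" for g d
    using that
  proof induction
    case (base f)
    then show ?case by (intro smooth_alg.base smooth_pd)
  next
    case (add f g)
    have "pd d (\<lambda>x. f x + g x) = (\<lambda>x. pd d f x + pd d g x)"
      by (intro ext pd_add diff add)
    then show ?case using add by (auto intro: smooth_alg.add)
  next
    case (mult f g)
    have "pd d (\<lambda>x. f x * g x) = (\<lambda>x. f x * pd d g x + pd d f x * g x)"
      by (intro ext pd_mult diff mult)
    then show ?case using mult by (auto intro!: smooth_alg.add smooth_alg.mult)
  qed
qed

lemma smooth_add: "smooth f \<Longrightarrow> smooth g \<Longrightarrow> smooth (\<lambda>x. f x + g x)"
  and smooth_mult: "smooth f \<Longrightarrow> smooth g \<Longrightarrow> smooth (\<lambda>x. f x * g x)"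
  by (blast intro: smooth_alg_smooth smooth_alg.intros)+

lemma smooth_const: "smooth (\<lambda>x. c)"
  by (rule smoothI[where S="range (\<lambda>c x. c)"]) (auto simp: pd_const_fun)

lemma smooth_sum: "finite I \<Longrightarrow> (\<And>i. i \<in> I \<Longrightarrow> smooth (f i)) \<Longrightarrow> smooth (\<lambda>x. \<Sum>i\<in>I. f i x)"
  by (induction I rule: finite_induct) (auto intro: smooth_const smooth_add)

section \<open>Smooth functions of one variable and their lift to the plane\<close>

text \<open>The greatest fixed point of "has a derivative of the same kind", that is, C-infinity on
  the line. Coinduction replaces induction over the order of the derivative.\<close>

coinductive sm :: "(real \<Rightarrow> complex) \<Rightarrow> bool" where
  smI: "(\<And>x. (f has_vector_derivative f' x) (at x)) \<Longrightarrow> sm f' \<Longrightarrow> sm f"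

lemma smE:
  assumes "sm f" obtains f' where "sm f'" "\<And>x. (f has_vector_derivative f' x) (at x)"
  using assms by cases auto

inductive_set sm_alg :: "(real \<Rightarrow> complex) set" where
  base: "sm f \<Longrightarrow> f \<in> sm_alg"
| add: "f \<in> sm_alg \<Longrightarrow> g \<in> sm_alg \<Longrightarrow> (\<lambda>x. f x + g x) \<in> sm_alg"
| mult: "f \<in> sm_alg \<Longrightarrow> g \<in> sm_alg \<Longrightarrow> (\<lambda>x. f x * g x) \<in> sm_alg"

lemma sm_alg_deriv: "f \<in> sm_alg \<Longrightarrow> \<exists>f'\<in>sm_alg. \<forall>x. (f has_vector_derivative f' x) (at x)"
proof (induction rule: sm_alg.induct)
  case (base f)
  then show ?case by (meson smE sm_alg.base)
next
  case (add f g)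
  then obtain f' g' where "f' \<in> sm_alg" "g' \<in> sm_alg" "\<forall>x. (f has_vector_derivative f' x) (at x)"
    "\<forall>x. (g has_vector_derivative g' x) (at x)" by blast
  then show ?case
    by (intro bexI[of _ "\<lambda>x. f' x + g' x"]) (auto intro: sm_alg.add derivative_intros)
next
  case (mult f g)
  then obtain f' g' where *: "f' \<in> sm_alg" "g' \<in> sm_alg" "\<forall>x. (f has_vector_derivative f' x) (at x)"
    "\<forall>x. (g has_vector_derivative g' x) (at x)" by blast
  show ?case
  proof (intro bexI allI)
    show "((\<lambda>x. f x * g x) has_vector_derivative f x * g' x + f' x * g x) (at x)" for x
      using * by (intro has_vector_derivative_mult) auto
    show "(\<lambda>x. f x * g' x + f' x * g x) \<in> sm_alg"
      using * mult by (intro sm_alg.add sm_alg.mult)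
  qed
qed

lemma sm_alg_sm: "f \<in> sm_alg \<Longrightarrow> sm f"
proof (coinduction arbitrary: f)
  case sm
  from sm_alg_deriv[OF this] show ?case by auto
qed

lemma sm_add: "sm f \<Longrightarrow> sm g \<Longrightarrow> sm (\<lambda>x. f x + g x)"
  and sm_mult: "sm f \<Longrightarrow> sm g \<Longrightarrow> sm (\<lambda>x. f x * g x)"
  by (blast intro: sm_alg_sm sm_alg.intros)+

lemma sm_polynomial:
  fixes f :: "real \<Rightarrow> complex"
  shows "polynomial_function f \<Longrightarrow> sm f"
proof (coinduction arbitrary: f)
  case sm
  from has_vector_derivative_polynomial_function[OF this] show ?case by metis
qed

lemma sm_const: "sm (\<lambda>x. c)"
  by (intro sm_polynomial polynomial_function_const)

text \<open>All combinations \<open>a * sin + b * cos\<close> of one frequency are treated at once,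
  because this family is closed under differentiation and the sine alone is not.\<close>

lemma sm_sin: "sm (\<lambda>x. of_real (sin (w * x)))"
proof -
  have "sm (\<lambda>x. of_real (a * sin (w * x) + b * cos (w * x)))" for a b
  proof (coinduction arbitrary: a b)
    case sm
    show ?case
    proof (intro exI conjI allI)
      fix x
      have "((\<lambda>x. a * sin (w * x) + b * cos (w * x)) has_real_derivative (- b * w) * sin (w * x) + (a * w) * cos (w * x)) (at x)"
        by (auto intro!: derivative_eq_intros simp: algebra_simps)
      then show "((\<lambda>x. complex_of_real (a * sin (w * x) + b * cos (w * x))) has_vector_derivative
          of_real ((- b * w) * sin (w * x) + (a * w) * cos (w * x))) (at x)"
        by (intro has_vector_derivative_of_real) (simp add: has_real_derivative_iff_has_vector_derivative)
    qed (rule refl, rule disjI1, rule exI[of _ "- b * w"], rule exI[of _ "a * w"], rule refl)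
  qed
  from this[of 1 0] show ?thesis by simp
qed

text \<open>Turns uniform approximation of a derivative into approximation of the function, with a
  prescribed initial value.\<close>

lemma sm_antiderivative:
  assumes "sm q"
  obtains p where "sm p" "p a = c" "\<And>x. (p has_vector_derivative q x) (at x)"
proof -
  have cont: "continuous_on A q" for A
    by (rule smE[OF assms]) (auto intro!: continuous_at_imp_continuous_on has_vector_derivative_continuous)
  define p where "p = (\<lambda>u. c + (LBINT y=a..u. q y))"
  have d: "(p has_vector_derivative q x) (at x)" for x
  proof -
    \<comment> \<open>An interval with both \<open>a\<close> and \<open>x\<close> in its interior:
      the fundamental theorem yields a derivative within a closed interval, which is a full
      derivative only at interior points.\<close>
    define l u where "l = min a x - 1" and "u = max a x + 1"
    have "((\<lambda>u. LBINT y=a..u. q y) has_vector_derivative q x) (at x within {l..u})"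
      by (rule interval_integral_FTC2) (auto simp: l_def u_def intro: cont)
    then have "((\<lambda>u. LBINT y=a..u. q y) has_vector_derivative q x) (at x within {l<..<u})"
      by (rule has_vector_derivative_within_subset) auto
    then have "((\<lambda>u. LBINT y=a..u. q y) has_vector_derivative q x) (at x)"
      by (subst (asm) has_vector_derivative_within_open) (auto simp: l_def u_def)
    then show ?thesis unfolding p_def by (auto intro!: derivative_eq_intros)
  qed
  show ?thesis
  proof
    show "sm p" using d assms by (rule smI)
    show "p a = c" by (simp add: p_def)
  qed (rule d)
qed

lemma vector_derivative_fst_chain:
  fixes f :: "real \<Rightarrow> complex"
  assumes "(f has_vector_derivative f') (at (fst x))"
  shows "((\<lambda>x::pt. c * f (fst x)) has_derivative (\<lambda>h. c * (fst h *\<^sub>R f'))) (at x)"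
proof -
  have "(fst has_derivative fst) (at x)" by (intro bounded_linear_imp_has_derivative bounded_linear_fst)
  from diff_chain_at[OF this, of f] assms
  have "(f \<circ> fst has_derivative (\<lambda>h. fst h *\<^sub>R f')) (at x)"
    by (simp add: has_vector_derivative_def o_def)
  then show ?thesis unfolding o_def by (rule has_derivative_mult_right)
qed

lemma vector_derivative_snd_chain:
  fixes f :: "real \<Rightarrow> complex"
  assumes "(f has_vector_derivative f') (at (snd x))"
  shows "((\<lambda>x::pt. c * f (snd x)) has_derivative (\<lambda>h. c * (snd h *\<^sub>R f'))) (at x)"
proof -
  have "(snd has_derivative snd) (at x)" by (intro bounded_linear_imp_has_derivative bounded_linear_snd)
  from diff_chain_at[OF this, of f] assms
  have "(f \<circ> snd has_derivative (\<lambda>h. snd h *\<^sub>R f')) (at x)"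
    by (simp add: has_vector_derivative_def o_def)
  then show ?thesis unfolding o_def by (rule has_derivative_mult_right)
qed

lemma smooth_fst: assumes "sm f" shows "smooth (\<lambda>x. f (fst x))"
proof (rule smoothI[where S="{\<lambda>x. c * f (fst x) | c f. sm f}"])
  show "(\<lambda>x. f (fst x)) \<in> {\<lambda>x. c * f (fst x) | c f. sm f}"
    using assms by (auto intro!: exI[of _ 1] exI[of _ f])
  show "g differentiable_on UNIV" if "g \<in> {\<lambda>x. c * f (fst x) | c f. sm f}" for g :: "pt \<Rightarrow> complex"
  proof -
    from that obtain c f where g: "g = (\<lambda>x. c * f (fst x))" and f: "sm f" by blast
    from f obtain f' where d: "sm f'" "\<And>x. (f has_vector_derivative f' x) (at x)" by (rule smE) blast
    show ?thesis
      unfolding g differentiable_on_def differentiable_def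
      by (intro ballI exI, rule vector_derivative_fst_chain, rule d(2))
  qed
  show "pd d g \<in> {\<lambda>x. c * f (fst x) | c f. sm f}" if "g \<in> {\<lambda>x. c * f (fst x) | c f. sm f}" for g :: "pt \<Rightarrow> complex" and d
  proof -
    from that obtain c f where g: "g = (\<lambda>x. c * f (fst x))" and f: "sm f" by blast
    from f obtain f' where f': "sm f'" "\<And>x. (f has_vector_derivative f' x) (at x)" by (rule smE) blast
    have "pd d g x = (c * of_real (fst d)) * f' (fst x)" for x
      unfolding g pd_def frechet_derivative_at[OF vector_derivative_fst_chain[OF f'(2)], symmetric]
      by (simp add: scaleR_conv_of_real)
    then have "pd d g = (\<lambda>x. (c * of_real (fst d)) * f' (fst x))" by (rule ext)
    with f' show ?thesis by blast
  qed
qed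

lemma smooth_snd: assumes "sm f" shows "smooth (\<lambda>x. f (snd x))"
proof (rule smoothI[where S="{\<lambda>x. c * f (snd x) | c f. sm f}"])
  show "(\<lambda>x. f (snd x)) \<in> {\<lambda>x. c * f (snd x) | c f. sm f}"
    using assms by (auto intro!: exI[of _ 1] exI[of _ f])
  show "g differentiable_on UNIV" if "g \<in> {\<lambda>x. c * f (snd x) | c f. sm f}" for g :: "pt \<Rightarrow> complex"
  proof -
    from that obtain c f where g: "g = (\<lambda>x. c * f (snd x))" and f: "sm f" by blast
    from f obtain f' where d: "sm f'" "\<And>x. (f has_vector_derivative f' x) (at x)" by (rule smE) blast
    show ?thesis
      unfolding g differentiable_on_def differentiable_def
      by (intro ballI exI, rule vector_derivative_snd_chain, rule d(2))
  qed
  show "pd d g \<in> {\<lambda>x. c * f (snd x) | c f. sm f}" if "g \<in> {\<lambda>x. c * f (snd x) | c f. sm f}" for g :: "pt \<Rightarrow> complex" and d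
  proof -
    from that obtain c f where g: "g = (\<lambda>x. c * f (snd x))" and f: "sm f" by blast
    from f obtain f' where f': "sm f'" "\<And>x. (f has_vector_derivative f' x) (at x)" by (rule smE) blast
    have "pd d g x = (c * of_real (snd d)) * f' (snd x)" for x
      unfolding g pd_def frechet_derivative_at[OF vector_derivative_snd_chain[OF f'(2)], symmetric]
      by (simp add: scaleR_conv_of_real)
    then have "pd d g = (\<lambda>x. (c * of_real (snd d)) * f' (snd x))" by (rule ext)
    with f' show ?thesis by blast
  qed
qed

lemma smooth_has_derivative:
  assumes "smooth f" shows "(f has_derivative (\<lambda>d. pd d f x)) (at x)"
  using smooth_differentiable[OF assms, of x] by (simp add: pd_def frechet_derivative_works)

lemma smooth_deriv_fst:
  assumes "smooth f" shows "((\<lambda>r. f (r, z)) has_vector_derivative pd (1,0) f (r, z)) (at r within A)"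
proof -
  have "((\<lambda>r. (r, z)) has_derivative (\<lambda>h. (h, 0))) (at r)"
    by (auto intro!: derivative_eq_intros)
  from diff_chain_at[OF this smooth_has_derivative[OF assms, of "(r, z)"]]
  have "((\<lambda>r. f (r, z)) has_derivative (\<lambda>h. pd (h, 0) f (r, z))) (at r)" by (simp add: o_def)
  moreover have "pd (h, 0) f (r, z) = h *\<^sub>R pd (1, 0) f (r, z)" for h
    using linear_scale[OF has_derivative_linear[OF smooth_has_derivative[OF assms, of "(r, z)"]], of h "(1,0)"] by simp
  then have "(\<lambda>h. pd (h, 0) f (r, z)) = (\<lambda>h. h *\<^sub>R pd (1, 0) f (r, z))" by (rule ext)
  ultimately show ?thesis
    unfolding has_vector_derivative_def by (metis has_derivative_at_withinI)
qed

lemma smooth_deriv_snd: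
  assumes "smooth f" shows "((\<lambda>z. f (r, z)) has_vector_derivative pd (0,1) f (r, z)) (at z within A)"
proof -
  have "((\<lambda>z. (r, z)) has_derivative (\<lambda>h. (0, h))) (at z)"
    by (auto intro!: derivative_eq_intros)
  from diff_chain_at[OF this smooth_has_derivative[OF assms, of "(r, z)"]]
  have "((\<lambda>z. f (r, z)) has_derivative (\<lambda>h. pd (0, h) f (r, z))) (at z)" by (simp add: o_def)
  moreover have "pd (0, h) f (r, z) = h *\<^sub>R pd (0, 1) f (r, z)" for h
    using linear_scale[OF has_derivative_linear[OF smooth_has_derivative[OF assms, of "(r, z)"]], of h "(0,1)"] by simp
  then have "(\<lambda>h. pd (0, h) f (r, z)) = (\<lambda>h. h *\<^sub>R pd (0, 1) f (r, z))" by (rule ext)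
  ultimately show ?thesis
    unfolding has_vector_derivative_def by (metis has_derivative_at_withinI)
qed

section \<open>Flat functions and cut-offs\<close>

text \<open>The classical germ \<open>exp (- (1 / t))\<close> with a factor evaluated at
  \<open>1 / t\<close>. For polynomial \<open>g\<close> the family is closed under differentiation,
  which is the reason for the parameter.\<close>

definition flat :: "(real \<Rightarrow> real) \<Rightarrow> real \<Rightarrow> real" where
  "flat g t = (if t > 0 then g (1 / t) * exp (- (1 / t)) else 0)"

lemma poly_times_exp_tendsto_0:
  assumes "real_polynomial_function g" shows "((\<lambda>y. y * g y * exp (- y)) \<longlongrightarrow> 0) at_top"
proof -
  obtain a n where g: "g = (\<lambda>x. \<Sum>i\<le>n. a i * x^i)"
    using assms real_polynomial_function_iff_sum by blast
  have "((\<lambda>y. \<Sum>i\<le>n. a i * (y ^ Suc i / exp y)) \<longlongrightarrow> (\<Sum>i\<le>n. a i * 0)) at_top"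
    by (intro tendsto_intros tendsto_power_div_exp_0)
  then show ?thesis
    by (simp add: g sum_distrib_left sum_distrib_right exp_minus field_simps)
qed

text \<open>The only delicate point is \<open>t = 0\<close>. There the difference quotient from the
  right is \<open>y * g y * exp (- y)\<close> at \<open>y = 1 / t\<close>, which the exponential
  sends to 0; from the left it vanishes.\<close>

lemma flat_deriv:
  assumes "real_polynomial_function g" and "\<And>x. (g has_real_derivative g' x) (at x)"
  shows "(flat g has_real_derivative flat (\<lambda>y. (g y - g' y) * y\<^sup>2) t) (at t)"
proof -
  consider "t > 0" | "t < 0" | "t = 0" by linarith
  then show ?thesis
  proof cases
    case 1
    have "((\<lambda>t. g (1 / t) * exp (- (1 / t))) has_real_derivative
        g' (1 / t) * (- 1 / t\<^sup>2) * exp (- (1 / t)) + exp (- (1 / t)) * (1 / t\<^sup>2) * g (1 / t)) (at t)"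
    proof (rule DERIV_mult)
      have "((\<lambda>t. 1 / t) has_real_derivative - 1 / t\<^sup>2) (at t)"
        using 1 by (auto intro!: derivative_eq_intros simp: power2_eq_square)
      from DERIV_chain2[OF assms(2) this]
      show "((\<lambda>t. g (1 / t)) has_real_derivative g' (1 / t) * (- 1 / t\<^sup>2)) (at t)" .
      show "((\<lambda>t. exp (- (1 / t))) has_real_derivative exp (- (1 / t)) * (1 / t\<^sup>2)) (at t)"
        using 1 by (auto intro!: derivative_eq_intros simp: power2_eq_square)
    qed
    then have "((\<lambda>t. g (1 / t) * exp (- (1 / t))) has_real_derivative flat (\<lambda>y. (g y - g' y) * y\<^sup>2) t) (at t)"
      using 1 by (simp add: flat_def field_simps)
    then show ?thesis
      by (rule has_field_derivative_transform_within_open[of _ _ _ "{0<..}"]) (use 1 in \<open>auto simp: flat_def\<close>)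
  next
    case 2
    have "((\<lambda>t. 0) has_real_derivative flat (\<lambda>y. (g y - g' y) * y\<^sup>2) t) (at t)"
      using 2 by (simp add: flat_def)
    then show ?thesis
      by (rule has_field_derivative_transform_within_open[of _ _ _ "{..<0}"]) (use 2 in \<open>auto simp: flat_def\<close>)
  next
    case 3
    have "((\<lambda>s. flat g s / s) \<longlongrightarrow> 0) (at_right 0)"
    proof -
      have "((\<lambda>s. (1 / s) * g (1 / s) * exp (- (1 / s))) \<longlongrightarrow> 0) (at_right (0::real))"
        by (rule filterlim_compose[OF poly_times_exp_tendsto_0[OF assms(1)]])
           (use filterlim_inverse_at_top_right in \<open>simp add: inverse_eq_divide\<close>)
      then show ?thesis
        by (rule Lim_transform_eventually) (auto simp: eventually_at_filter flat_def)
    qed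
    moreover have "((\<lambda>s. flat g s / s) \<longlongrightarrow> 0) (at_left 0)"
      by (rule Lim_transform_eventually[OF tendsto_const]) (auto simp: eventually_at_filter flat_def)
    ultimately have "((\<lambda>s. flat g s / s) \<longlongrightarrow> 0) (at 0)"
      by (rule filterlim_split_at_real[rotated])
    then show ?thesis using 3 by (simp add: has_field_derivative_iff flat_def)
  qed
qed

text \<open>Coinduction over all polynomials \<open>g\<close> and all constants \<open>c\<close>: a
  derivative changes the polynomial as in \<open>flat_deriv\<close> and multiplies \<open>c\<close>
  by the slope \<open>p\<close>.\<close>

lemma sm_flat:
  assumes "real_polynomial_function g" shows "sm (\<lambda>x. of_real (flat g (p * x + q)))"
proof -
  have "sm (\<lambda>x. of_real (c * flat g (p * x + q)))" for c
    using assms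
  proof (coinduction arbitrary: c g)
    case sm
    obtain g' where g': "real_polynomial_function g'" "\<And>x. (g has_real_derivative g' x) (at x)"
      using has_real_derivative_polynomial_function[OF sm] by blast
    define h where "h = (\<lambda>y. (g y - g' y) * y\<^sup>2)"
    have h: "real_polynomial_function h"
      unfolding h_def using sm g'(1)
      by (intro real_polynomial_function.intros(4) real_polynomial_function_diff real_polynomial_function_power)
         (auto intro: real_polynomial_function.intros(1) bounded_linear_ident)
    have "((\<lambda>x. c * flat g (p * x + q)) has_real_derivative (c * p) * flat h (p * x + q)) (at x)" for x
    proof -
      have "((\<lambda>x. p * x + q) has_real_derivative p) (at x)" by (auto intro!: derivative_eq_intros)
      from DERIV_cmult[OF DERIV_chain2[OF flat_deriv[OF sm g'(2)] this], of c] show ?thesis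
        by (simp add: h_def mult_ac)
    qed
    then have "((\<lambda>x. complex_of_real (c * flat g (p * x + q))) has_vector_derivative of_real ((c * p) * flat h (p * x + q))) (at x)" for x
      by (intro has_vector_derivative_of_real) (simp add: has_real_derivative_iff_has_vector_derivative)
    note d = this
    show ?case
      by (rule exI, rule exI[of _ "\<lambda>x. complex_of_real ((c * p) * flat h (p * x + q))"], intro conjI allI,
          rule refl, rule d, rule disjI1, rule exI[of _ "c * p"], rule exI[of _ h], intro conjI refl h)
  qed
  from this[of 1] show ?thesis by simp
qed

text \<open>The shift by 1 keeps the support at distance \<open>1 / (n + 1)\<close> from both ends,
  hence compact in the open interval. There is no plateau: the values stay below 1 and only tend to
  1 pointwise, which suits dominated convergence.\<close>

definition cut :: "real \<Rightarrow> real \<Rightarrow> nat \<Rightarrow> real \<Rightarrow> real" where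
  "cut a b n x = flat (\<lambda>_. 1) (real (Suc n) * (x - a) - 1) * flat (\<lambda>_. 1) (real (Suc n) * (b - x) - 1)"

lemma flat1_bounds: "0 \<le> flat (\<lambda>_. 1) t" "flat (\<lambda>_. 1) t \<le> 1"
  by (auto simp: flat_def)

lemma cut_bounds: "0 \<le> cut a b n x" "cut a b n x \<le> 1"
  unfolding cut_def by (intro mult_nonneg_nonneg mult_le_one flat1_bounds)+

lemma cut_support:
  assumes "cut a b n x \<noteq> 0" shows "x \<in> {a + 1 / real (Suc n)..b - 1 / real (Suc n)}"
proof -
  have "real (Suc n) * (x - a) > 1" "real (Suc n) * (b - x) > 1"
    using assms by (auto simp: cut_def flat_def split: if_splits)
  then show ?thesis by (simp add: field_simps)
qed

lemma flat1_tendsto: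
  assumes "y > 0" shows "(\<lambda>n. flat (\<lambda>_. 1) (real (Suc n) * y - 1)) \<longlonglongrightarrow> 1"
proof -
  have top: "filterlim (\<lambda>n. real (Suc n) * y - 1) at_top sequentially"
  proof -
    have "filterlim (\<lambda>n. - 1 + y * real (Suc n)) at_top sequentially"
      by (intro filterlim_tendsto_add_at_top[OF tendsto_const] filterlim_tendsto_pos_mult_at_top[OF tendsto_const assms]
          filterlim_compose[OF filterlim_real_sequentially filterlim_Suc])
    then show ?thesis by (simp add: mult.commute)
  qed
  have "((\<lambda>t::real. exp (- inverse t)) \<longlongrightarrow> exp (- 0)) at_top"
    by (intro tendsto_intros tendsto_inverse_0_at_top filterlim_ident)
  then have "((\<lambda>t::real. exp (- (1 / t))) \<longlongrightarrow> 1) at_top" by (simp add: inverse_eq_divide)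
  then have "((\<lambda>t. flat (\<lambda>_. 1) t) \<longlongrightarrow> 1) at_top"
    by (rule Lim_transform_eventually)
       (use eventually_gt_at_top[of "0::real"] in eventually_elim, simp add: flat_def)
  from filterlim_compose[OF this top] show ?thesis .
qed

lemma cut_tendsto:
  assumes "x \<in> {a<..<b}" shows "(\<lambda>n. cut a b n x) \<longlonglongrightarrow> 1"
  unfolding cut_def using tendsto_mult[OF flat1_tendsto[of "x - a"] flat1_tendsto[of "b - x"]] assms by simp

lemma sm_cut: "sm (\<lambda>x. of_real (cut a b n x))"
proof -
  have "sm (\<lambda>x. of_real (flat (\<lambda>_. 1) (real (Suc n) * x + (- real (Suc n) * a - 1))) *
     of_real (flat (\<lambda>_. 1) ((- real (Suc n)) * x + (real (Suc n) * b - 1))))"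
    by (intro sm_mult sm_flat real_polynomial_function.intros(2))
  then show ?thesis by (simp add: cut_def algebra_simps)
qed

section \<open>Weak derivatives\<close>

lemma test_funI:
  assumes "smooth \<phi>" "{x. \<phi> x \<noteq> 0} \<subseteq> K" "compact K" "K \<subseteq> \<Omega>"
  shows "test_fun \<Omega> \<phi>"
proof -
  have "tsupport \<phi> \<subseteq> K"
    unfolding tsupport_def using assms by (intro closure_minimal compact_imp_closed)
  moreover have "compact (tsupport \<phi>)"
    using calculation assms(3) unfolding tsupport_def
    by (metis closed_closure closed_Int_compact inf.absorb_iff1)
  ultimately show ?thesis using assms by (auto simp: test_fun_def)
qed

lemma test_fun_smooth: "test_fun \<Omega> \<phi> \<Longrightarrow> smooth \<phi>"
  by (simp add: test_fun_def)

lemma test_fun_outside: "test_fun \<Omega> \<phi> \<Longrightarrow> x \<notin> \<Omega> \<Longrightarrow> \<phi> x = 0"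
  unfolding test_fun_def tsupport_def using closure_subset[of "{x. \<phi> x \<noteq> 0}"] by auto

lemma test_fun_L2: "test_fun \<Omega> \<phi> \<Longrightarrow> L2 ({a<..<b} \<times> {c<..<d}) \<phi>"
  by (rule L2_rect, rule smooth_continuous_on, erule test_fun_smooth)

lemma test_fun_pd_L2: "test_fun \<Omega> \<phi> \<Longrightarrow> L2 ({a<..<b} \<times> {c<..<d}) (pd e \<phi>)"
  by (rule L2_rect, rule smooth_continuous_on, rule smooth_pd, erule test_fun_smooth)

lemma test_fun_cut:
  assumes "sm u" "sm v"
  shows "test_fun ({a<..<b} \<times> {c<..<d}) (\<lambda>x. (u (fst x) * of_real (cut a b n (fst x))) * (v (snd x) * of_real (cut c d m (snd x))))"
proof (rule test_funI)
  let ?K = "{a + 1 / real (Suc n)..b - 1 / real (Suc n)} \<times> {c + 1 / real (Suc m)..d - 1 / real (Suc m)}"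
  show "smooth (\<lambda>x. (u (fst x) * of_real (cut a b n (fst x))) * (v (snd x) * of_real (cut c d m (snd x))))"
    by (intro smooth_mult smooth_fst smooth_snd assms sm_cut)
  show "{x. (u (fst x) * of_real (cut a b n (fst x))) * (v (snd x) * of_real (cut c d m (snd x))) \<noteq> 0} \<subseteq> ?K"
  proof (rule subsetI, clarify)
    fix r z assume "(u (fst (r,z)) * of_real (cut a b n (fst (r,z)))) * (v (snd (r,z)) * of_real (cut c d m (snd (r,z)))) \<noteq> 0"
    then show "r \<in> {a + 1 / real (Suc n)..b - 1 / real (Suc n)} \<and> z \<in> {c + 1 / real (Suc m)..d - 1 / real (Suc m)}"
      by (intro conjI cut_support) auto
  qed
  have "{p + e..q - e} \<subseteq> {p<..<q}" if "e > 0" for p q e :: real using that by auto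
  then show "?K \<subseteq> {a<..<b} \<times> {c<..<d}"
    by (intro Sigma_mono) simp_all
qed (intro compact_Times compact_Icc)

text \<open>The cut-offs tend pointwise to the indicator function of a box, so orthogonality to test functions
  passes to boxes, and from there to all Borel sets.\<close>

lemma L2_orthogonal_test_funs_AE_0:
  assumes g: "L2 ({a<..<b} \<times> {c<..<d}) g"
    and orth: "\<And>\<phi>. test_fun ({a<..<b} \<times> {c<..<d}) \<phi> \<Longrightarrow> (LINT x:{a<..<b} \<times> {c<..<d}|lborel. g x * \<phi> x) = 0"
  shows "AE x in lborel. x \<in> {a<..<b} \<times> {c<..<d} \<longrightarrow> g x = 0"
proof -
  define \<Omega> where "\<Omega> = {a<..<b} \<times> {c<..<d}"
  define h where "h = (\<lambda>x. indicator \<Omega> x *\<^sub>R g x)"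
  have hi: "integrable lborel h"
    using L2_integrable[OF g sets_rect emeasure_rect_finite] by (simp add: h_def \<Omega>_def set_integrable_def)
  then have hm [measurable]: "h \<in> borel_measurable lborel" by simp
  have box: "(LINT x:{p<..<q} \<times> {s<..<t}|lborel. h x) = 0"
    if sub: "a \<le> p" "q \<le> b" "c \<le> s" "t \<le> d" for p q s t
  proof -
    define \<phi> where "\<phi> = (\<lambda>n x. complex_of_real (cut p q n (fst x)) * of_real (cut s t n (snd x)))"
    have test0: "test_fun ({p<..<q} \<times> {s<..<t}) (\<phi> n)" for n
      using test_fun_cut[OF sm_const[of 1] sm_const[of 1], of p q s t n n] by (simp add: \<phi>_def)
    have test: "test_fun \<Omega> (\<phi> n)" for n
      using test0[of n] sub unfolding test_fun_def \<Omega>_def by force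
    have sub2: "{p<..<q} \<times> {s<..<t} \<subseteq> \<Omega>" using sub by (auto simp: \<Omega>_def)
    have "(\<lambda>n. LINT x|lborel. h x * \<phi> n x) \<longlonglongrightarrow> (LINT x|lborel. h x * indicator ({p<..<q} \<times> {s<..<t}) x)"
    proof (rule integral_dominated_convergence[where w="\<lambda>x. norm (h x)"])
      show "AE x in lborel. (\<lambda>n. h x * \<phi> n x) \<longlonglongrightarrow> h x * indicator ({p<..<q} \<times> {s<..<t}) x"
      proof (intro AE_I2 tendsto_intros)
        fix x :: pt
        show "(\<lambda>n. \<phi> n x) \<longlonglongrightarrow> indicator ({p<..<q} \<times> {s<..<t}) x"
        proof (cases "x \<in> {p<..<q} \<times> {s<..<t}")
          case True
          then have "(\<lambda>n. cut p q n (fst x)) \<longlonglongrightarrow> 1" "(\<lambda>n. cut s t n (snd x)) \<longlonglongrightarrow> 1"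
            by (auto intro: cut_tendsto)
          then have "(\<lambda>n. complex_of_real (cut p q n (fst x)) * of_real (cut s t n (snd x))) \<longlonglongrightarrow> of_real 1 * of_real 1"
            by (intro tendsto_intros)
          then show ?thesis using True by (simp add: \<phi>_def)
        next
          case False
          then show ?thesis using test_fun_outside[OF test0] by simp
        qed
      qed
      have "cmod (\<phi> n x) \<le> 1" for n x
        unfolding \<phi>_def norm_mult norm_of_real using cut_bounds by (intro mult_le_one) auto
      then show "AE x in lborel. norm (h x * \<phi> n x) \<le> norm (h x)" for n
        by (intro AE_I2) (auto simp: norm_mult intro: mult_right_le_one_le)
      have "\<phi> n \<in> borel_measurable borel" for n
        by (intro borel_measurable_continuous_onI smooth_continuous_on test_fun_smooth[OF test])
      then show "(\<lambda>x. h x * \<phi> n x) \<in> borel_measurable lborel" for n by simp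
      have [measurable]: "{p<..<q} \<times> {s<..<t} \<in> sets lborel" by simp
      show "(\<lambda>x. h x * indicator ({p<..<q} \<times> {s<..<t}) x) \<in> borel_measurable lborel" by measurable
    qed (use hi in auto)
    moreover have "(LINT x|lborel. h x * \<phi> n x) = 0" for n
      using orth[OF test[unfolded \<Omega>_def], of n] unfolding set_lebesgue_integral_def h_def \<Omega>_def by simp
    ultimately have "(LINT x|lborel. h x * indicator ({p<..<q} \<times> {s<..<t}) x) = 0"
      by (simp add: LIMSEQ_const_iff)
    moreover have "h x * indicator ({p<..<q} \<times> {s<..<t}) x = indicator ({p<..<q} \<times> {s<..<t}) x *\<^sub>R h x" for x
      by (auto simp: indicator_def)
    ultimately show ?thesis by (simp add: set_lebesgue_integral_def)
  qed
  have "(LINT x:A|lborel. h x) = 0" if "A \<in> sets lborel" for A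
  proof -
    let ?E = "range (\<lambda>(p, q). box p q :: pt set)"
    have si: "set_integrable lborel B h" if "B \<in> sets lborel" for B
      using hi that unfolding set_integrable_def by (rule integrable_mult_indicator[rotated])
    have univ: "(LINT x:UNIV|lborel. h x) = 0"
    proof -
      have "(LINT x:UNIV|lborel. h x) = (LINT x:{a<..<b} \<times> {c<..<d}|lborel. h x)"
        unfolding set_lebesgue_integral_def
        by (intro Bochner_Integration.integral_cong) (auto simp: h_def \<Omega>_def indicator_def)
      with box[of a b c d] show ?thesis by simp
    qed
    have Int: "Int_stable ?E" by (auto simp: Int_stable_def box_Int_box)
    have "?E \<subseteq> Pow UNIV" "A \<in> sigma_sets UNIV ?E" using that by (simp_all add: borel_eq_box)
    with Int show ?thesis
    proof (induction rule: sigma_sets_induct_disjoint)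
      case (basic B)
      then obtain p q where B: "B = box p q" by auto
      have Beq: "B = {fst p<..<fst q} \<times> {snd p<..<snd q}"
        unfolding B by (cases p; cases q) (auto simp: box_def Basis_prod_def)
      \<comment> \<open>\<open>h\<close> vanishes outside the rectangle, so an arbitrary box can be
        clipped to it before \<open>box\<close> is applied.\<close>
      have "(LINT x:B|lborel. h x) = (LINT x:{max a (fst p)<..<min b (fst q)} \<times> {max c (snd p)<..<min d (snd q)}|lborel. h x)"
        unfolding set_lebesgue_integral_def
        by (intro Bochner_Integration.integral_cong) (auto simp: h_def \<Omega>_def indicator_def Beq)
      also have "\<dots> = 0" by (rule box) auto
      finally show ?case .
    next
      case (compl B)
      have B: "B \<in> sets lborel" using compl by (simp add: borel_eq_box)
      have "(LINT x:UNIV|lborel. h x) = (LINT x:B \<union> (UNIV - B)|lborel. h x)" by simp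
      also have "\<dots> = (LINT x:B|lborel. h x) + (LINT x:(UNIV - B)|lborel. h x)"
        using B by (intro set_integral_Un si) auto
      finally show ?case using univ compl by simp
    next
      case (union B)
      have B: "B i \<in> sets lborel" for i using union by (auto simp: borel_eq_box)
      have "(LINT x:(\<Union>i. B i)|lborel. h x) = (\<Sum>i. (LINT x:(B i)|lborel. h x))"
      proof (rule lebesgue_integral_countable_add)
        show "set_integrable lborel (\<Union>i. B i) h" using B by (intro si) auto
        show "\<And>i j. i \<noteq> j \<Longrightarrow> B i \<inter> B j = {}" using union(1) by (auto simp: disjoint_family_on_def)
      qed (rule B)
      with union show ?case by simp
    qed (simp add: set_lebesgue_integral_def)
  qed
  from sigma_finite_measure.density_zero[OF lborel.sigma_finite_measure_axioms hi this] have "AE x in lborel. h x = 0" .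
  then show ?thesis by eventually_elim (auto simp: h_def \<Omega>_def)
qed

lemma weak_deriv_unique:
  fixes a b c d :: real
  defines "\<Omega> \<equiv> {a<..<b} \<times> {c<..<d}"
  assumes "L2 \<Omega> g" "weak_deriv \<Omega> e w g" "L2 \<Omega> h" "weak_deriv \<Omega> e w h"
  shows "AE x in lborel. x \<in> \<Omega> \<longrightarrow> g x = h x"
proof -
  have "AE x in lborel. x \<in> {a<..<b} \<times> {c<..<d} \<longrightarrow> g x - h x = 0"
  proof (rule L2_orthogonal_test_funs_AE_0)
    show "L2 ({a<..<b} \<times> {c<..<d}) (\<lambda>x. g x - h x)" using assms by (auto intro: L2_diff)
    fix \<phi> assume \<phi>: "test_fun ({a<..<b} \<times> {c<..<d}) \<phi>"
    then have "(LINT x:\<Omega>|lborel. g x * \<phi> x) = (LINT x:\<Omega>|lborel. h x * \<phi> x)"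
      using assms unfolding weak_deriv_def by (metis minus_equation_iff)
    moreover have "(LINT x:\<Omega>|lborel. (g x - h x) * \<phi> x) = (LINT x:\<Omega>|lborel. g x * \<phi> x) - (LINT x:\<Omega>|lborel. h x * \<phi> x)"
      using assms \<phi> by (simp add: left_diff_distrib set_integral_diff L2_mult_integrable test_fun_L2)
    ultimately show "(LINT x:{a<..<b} \<times> {c<..<d}|lborel. (g x - h x) * \<phi> x) = 0"
      by (simp add: \<Omega>_def)
  qed
  then show ?thesis unfolding \<Omega>_def by eventually_elim simp
qed

lemma wpd_works:
  assumes "L2 \<Omega> g" "weak_deriv \<Omega> e w g"
  shows "L2 \<Omega> (wpd \<Omega> e w)" "weak_deriv \<Omega> e w (wpd \<Omega> e w)"
  using someI[of "\<lambda>g. L2 \<Omega> g \<and> weak_deriv \<Omega> e w g" g] assms unfolding wpd_def by auto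

text \<open>\<open>wpd\<close> is an unspecified choice among the weak derivatives; this connects it
  with any concrete one, and all later computations with concrete derivatives pass through
  it.\<close>

lemma wpd_AE_eq:
  fixes a b c d :: real
  defines "\<Omega> \<equiv> {a<..<b} \<times> {c<..<d}"
  assumes "L2 \<Omega> g" "weak_deriv \<Omega> e w g"
  shows "AE x in lborel. x \<in> \<Omega> \<longrightarrow> wpd \<Omega> e w x = g x"
  using weak_deriv_unique[of a b c d "wpd \<Omega> e w" e w g] wpd_works[OF assms(2,3)] assms by simp

lemma H1D:
  assumes "H1 \<Omega> w"
  shows "L2 \<Omega> w" "L2 \<Omega> (wpd \<Omega> (1,0) w)" "weak_deriv \<Omega> (1,0) w (wpd \<Omega> (1,0) w)"
    "L2 \<Omega> (wpd \<Omega> (0,1) w)" "weak_deriv \<Omega> (0,1) w (wpd \<Omega> (0,1) w)"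
  using assms wpd_works unfolding H1_def by blast+

lemma H1_norm_sq:
  assumes "H1 \<Omega> w"
  shows "(H1_norm \<Omega> w)\<^sup>2 = sqn \<Omega> w + sqn \<Omega> (wpd \<Omega> (1,0) w) + sqn \<Omega> (wpd \<Omega> (0,1) w)"
proof -
  note L = H1D(1,2,4)[OF assms, THEN L2_sq_integrable]
  have "(LINT x:\<Omega>|lborel. (cmod (w x))\<^sup>2 + (cmod (wpd \<Omega> (1,0) w x))\<^sup>2 + (cmod (wpd \<Omega> (0,1) w x))\<^sup>2)
     = sqn \<Omega> w + sqn \<Omega> (wpd \<Omega> (1,0) w) + sqn \<Omega> (wpd \<Omega> (0,1) w)"
    unfolding sqn_def using L by (simp add: set_integral_add)
  then show ?thesis unfolding H1_norm_def by (simp add: sqn_nonneg)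
qed

lemma H1I:
  assumes "L2 \<Omega> w" "L2 \<Omega> g" "weak_deriv \<Omega> (1,0) w g" "L2 \<Omega> h" "weak_deriv \<Omega> (0,1) w h"
  shows "H1 \<Omega> w"
  using assms by (auto simp: H1_def)

lemma H1_norm_sq_eq:
  fixes a b c d :: real
  defines "\<Omega> \<equiv> {a<..<b} \<times> {c<..<d}"
  assumes "L2 \<Omega> w" "L2 \<Omega> g" "weak_deriv \<Omega> (1,0) w g" "L2 \<Omega> h" "weak_deriv \<Omega> (0,1) w h"
  shows "(H1_norm \<Omega> w)\<^sup>2 = sqn \<Omega> w + sqn \<Omega> g + sqn \<Omega> h"
proof -
  have "sqn \<Omega> (wpd \<Omega> (1,0) w) = sqn \<Omega> g"
    by (intro sqn_AE_cong wpd_works(1)[OF assms(3,4)] assms(3) wpd_AE_eq[OF assms(3,4)[unfolded \<Omega>_def], folded \<Omega>_def])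
  moreover have "sqn \<Omega> (wpd \<Omega> (0,1) w) = sqn \<Omega> h"
    by (intro sqn_AE_cong wpd_works(1)[OF assms(5,6)] assms(5) wpd_AE_eq[OF assms(5,6)[unfolded \<Omega>_def], folded \<Omega>_def])
  ultimately show ?thesis using H1_norm_sq[OF H1I[OF assms(2-6)]] by simp
qed

lemma weak_deriv_add:
  fixes a b c d :: real
  defines "\<Omega> \<equiv> {a<..<b} \<times> {c<..<d}"
  assumes "L2 \<Omega> w" "L2 \<Omega> g" "weak_deriv \<Omega> e w g" "L2 \<Omega> w'" "L2 \<Omega> g'" "weak_deriv \<Omega> e w' g'"
  shows "weak_deriv \<Omega> e (\<lambda>x. w x + w' x) (\<lambda>x. g x + g' x)"
  unfolding weak_deriv_def
proof (intro allI impI)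
  fix \<phi> assume \<phi>: "test_fun \<Omega> \<phi>"
  note L = test_fun_L2[OF \<phi>, of a b c d, folded \<Omega>_def] test_fun_pd_L2[OF \<phi>, of a b c d, folded \<Omega>_def]
  show "(LINT x:\<Omega>|lborel. (w x + w' x) * pd e \<phi> x) = - (LINT x:\<Omega>|lborel. (g x + g' x) * \<phi> x)"
    using assms(4,7) \<phi> L assms(2,3,5,6)
    by (simp add: distrib_right set_integral_add L2_mult_integrable weak_deriv_def)
qed

lemma weak_deriv_cmult:
  assumes "weak_deriv \<Omega> e w g"
  shows "weak_deriv \<Omega> e (\<lambda>x. k * w x) (\<lambda>x. k * g x)"
  using assms by (simp add: weak_deriv_def mult.assoc)

lemma weak_deriv_diff:
  fixes a b c d :: real
  defines "\<Omega> \<equiv> {a<..<b} \<times> {c<..<d}"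
  assumes "L2 \<Omega> w" "L2 \<Omega> g" "weak_deriv \<Omega> e w g" "L2 \<Omega> w'" "L2 \<Omega> g'" "weak_deriv \<Omega> e w' g'"
  shows "weak_deriv \<Omega> e (\<lambda>x. w x - w' x) (\<lambda>x. g x - g' x)"
  using weak_deriv_add[OF assms(2-4)[unfolded \<Omega>_def] L2_cmult[OF assms(5), of "-1", unfolded \<Omega>_def] L2_cmult[OF assms(6), of "-1", unfolded \<Omega>_def]
      weak_deriv_cmult[OF assms(7), of "-1", unfolded \<Omega>_def]] by (simp add: \<Omega>_def)

text \<open>Both sides of the defining identity are continuous in L2 against a fixed test function.
  This closedness makes the L2 limits of the modal sums and of their derivatives fit
  together.\<close>

lemma weak_deriv_limit:
  fixes a b c d :: real
  defines "\<Omega> \<equiv> {a<..<b} \<times> {c<..<d}"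
  assumes "\<And>n. L2 \<Omega> (W n)" "\<And>n. L2 \<Omega> (G n)" "\<And>n. weak_deriv \<Omega> e (W n) (G n)" "L2 \<Omega> w" "L2 \<Omega> g"
    "(\<lambda>n. sqn \<Omega> (\<lambda>x. w x - W n x)) \<longlonglongrightarrow> 0" "(\<lambda>n. sqn \<Omega> (\<lambda>x. g x - G n x)) \<longlonglongrightarrow> 0"
  shows "weak_deriv \<Omega> e w g"
  unfolding weak_deriv_def
proof (intro allI impI)
  fix \<phi> assume \<phi>: "test_fun \<Omega> \<phi>"
  note L = test_fun_L2[OF \<phi>, of a b c d, folded \<Omega>_def] test_fun_pd_L2[OF \<phi>, of a b c d, folded \<Omega>_def]
  have "(\<lambda>n. LINT x:\<Omega>|lborel. W n x * pd e \<phi> x) \<longlonglongrightarrow> (LINT x:\<Omega>|lborel. w x * pd e \<phi> x)"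
    by (intro L2_tendsto_integral assms L)
  moreover have "(\<lambda>n. - (LINT x:\<Omega>|lborel. G n x * \<phi> x)) \<longlonglongrightarrow> - (LINT x:\<Omega>|lborel. g x * \<phi> x)"
    by (intro tendsto_intros L2_tendsto_integral assms L)
  moreover have "(LINT x:\<Omega>|lborel. W n x * pd e \<phi> x) = - (LINT x:\<Omega>|lborel. G n x * \<phi> x)" for n
    using assms(4) \<phi> by (simp add: weak_deriv_def)
  ultimately show "(LINT x:\<Omega>|lborel. w x * pd e \<phi> x) = - (LINT x:\<Omega>|lborel. g x * \<phi> x)"
    by (metis (no_types, lifting) LIMSEQ_unique tendsto_cong_limit ext)
qed

text \<open>Integration by parts in \<open>r\<close> alone, where the test function kills the
  boundary terms. Asking only for one continuous partial derivative on the closed rectangle admits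
  mode functions that are merely C^1.\<close>

lemma weak_deriv_fst_classical:
  fixes F G :: "pt \<Rightarrow> complex"
  assumes F: "continuous_on ({a..b} \<times> {c..d}) F" and G: "continuous_on ({a..b} \<times> {c..d}) G" and "a \<le> b"
    and D: "\<And>r z. r \<in> {a..b} \<Longrightarrow> z \<in> {c..d} \<Longrightarrow> ((\<lambda>r. F (r, z)) has_vector_derivative G (r, z)) (at r within {a..b})"
  shows "weak_deriv ({a<..<b} \<times> {c<..<d}) (1,0) F G"
  unfolding weak_deriv_def
proof (intro allI impI)
  fix \<phi> assume \<phi>: "test_fun ({a<..<b} \<times> {c<..<d}) \<phi>"
  note s = test_fun_smooth[OF \<phi>]
  have C: "continuous_on A \<phi>" "continuous_on A (pd e \<phi>)" for A e
    by (intro smooth_continuous_on smooth_pd s)+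
  have "(LINT x:{a<..<b} \<times> {c<..<d}|lborel. F x * pd (1,0) \<phi> x + G x * \<phi> x)
     = (LINT z:{c<..<d}|lborel. F (b, z) * \<phi> (b, z) - F (a, z) * \<phi> (a, z))"
  proof (rule integral_rect_deriv_fst[OF \<open>a \<le> b\<close>])
    show "continuous_on ({a..b} \<times> {c..d}) (\<lambda>x. F x * pd (1, 0) \<phi> x + G x * \<phi> x)"
      by (intro continuous_intros F G C)
    show "((\<lambda>r. F (r, z) * \<phi> (r, z)) has_vector_derivative F (r, z) * pd (1, 0) \<phi> (r, z) + G (r, z) * \<phi> (r, z)) (at r within {a..b})"
      if "r \<in> {a..b}" "z \<in> {c..d}" for r z
      by (intro has_vector_derivative_mult D that smooth_deriv_fst s)
  qed
  also have "\<dots> = 0" by (simp add: test_fun_outside[OF \<phi>])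
  finally have "(LINT x:{a<..<b} \<times> {c<..<d}|lborel. F x * pd (1,0) \<phi> x) + (LINT x:{a<..<b} \<times> {c<..<d}|lborel. G x * \<phi> x) = 0"
    by (subst (asm) set_integral_add) (intro set_integrable_rect continuous_intros F G C)+
  then show "(LINT x:{a<..<b} \<times> {c<..<d}|lborel. F x * pd (1,0) \<phi> x) = - (LINT x:{a<..<b} \<times> {c<..<d}|lborel. G x * \<phi> x)"
    by (simp add: add_eq_0_iff)
qed

lemma weak_deriv_snd_classical:
  fixes F G :: "pt \<Rightarrow> complex"
  assumes F: "continuous_on ({a..b} \<times> {c..d}) F" and G: "continuous_on ({a..b} \<times> {c..d}) G" and "c \<le> d"
    and D: "\<And>r z. r \<in> {a..b} \<Longrightarrow> z \<in> {c..d} \<Longrightarrow> ((\<lambda>z. F (r, z)) has_vector_derivative G (r, z)) (at z within {c..d})"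
  shows "weak_deriv ({a<..<b} \<times> {c<..<d}) (0,1) F G"
  unfolding weak_deriv_def
proof (intro allI impI)
  fix \<phi> assume \<phi>: "test_fun ({a<..<b} \<times> {c<..<d}) \<phi>"
  note s = test_fun_smooth[OF \<phi>]
  have C: "continuous_on A \<phi>" "continuous_on A (pd e \<phi>)" for A e
    by (intro smooth_continuous_on smooth_pd s)+
  have "(LINT x:{a<..<b} \<times> {c<..<d}|lborel. F x * pd (0,1) \<phi> x + G x * \<phi> x)
     = (LINT r:{a<..<b}|lborel. F (r, d) * \<phi> (r, d) - F (r, c) * \<phi> (r, c))"
  proof (rule integral_rect_deriv_snd[OF \<open>c \<le> d\<close>])
    show "continuous_on ({a..b} \<times> {c..d}) (\<lambda>x. F x * pd (0,1) \<phi> x + G x * \<phi> x)"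
      by (intro continuous_intros F G C)
    show "((\<lambda>z. F (r, z) * \<phi> (r, z)) has_vector_derivative F (r, z) * pd (0,1) \<phi> (r, z) + G (r, z) * \<phi> (r, z)) (at z within {c..d})"
      if "r \<in> {a..b}" "z \<in> {c..d}" for r z
      by (intro has_vector_derivative_mult D that smooth_deriv_snd s)
  qed
  also have "\<dots> = 0" by (simp add: test_fun_outside[OF \<phi>])
  finally have "(LINT x:{a<..<b} \<times> {c<..<d}|lborel. F x * pd (0,1) \<phi> x) + (LINT x:{a<..<b} \<times> {c<..<d}|lborel. G x * \<phi> x) = 0"
    by (subst (asm) set_integral_add) (intro set_integrable_rect continuous_intros F G C)+
  then show "(LINT x:{a<..<b} \<times> {c<..<d}|lborel. F x * pd (0,1) \<phi> x) = - (LINT x:{a<..<b} \<times> {c<..<d}|lborel. G x * \<phi> x)"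
    by (simp add: add_eq_0_iff)
qed

section \<open>Products of one-variable functions and their approximation by test functions\<close>

lemma emeasure_Ioo_finite [simp]: "emeasure lborel {a<..<b::real} < top"
  using emeasure_bounded_finite[of "{a<..<b}"] bounded_subset[OF bounded_closed_interval[of a b], of "{a<..<b}"]
  by (auto simp: subset_eq)

lemma sqn_dominated_tendsto_0:
  fixes F :: "nat \<Rightarrow> 'a::euclidean_space \<Rightarrow> complex"
  assumes S: "S \<in> sets borel" "emeasure lborel S < \<infinity>" and F: "\<And>n. L2 S (F n)"
    and B: "\<And>n x. x \<in> S \<Longrightarrow> cmod (F n x) \<le> B" and lim: "\<And>x. x \<in> S \<Longrightarrow> (\<lambda>n. F n x) \<longlonglongrightarrow> 0"
  shows "(\<lambda>n. sqn S (F n)) \<longlonglongrightarrow> 0"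
proof -
  have "(\<lambda>n. LINT x|lborel. indicator S x *\<^sub>R (cmod (F n x))\<^sup>2) \<longlonglongrightarrow> (LINT x::'a|lborel. (0::real))"
  proof (rule integral_dominated_convergence[where w="\<lambda>x. indicator S x *\<^sub>R B\<^sup>2"])
    show "integrable lborel (\<lambda>x. indicator S x *\<^sub>R B\<^sup>2)"
      using S by (intro integrable_scaleR_left) (auto simp: integrable_indicator_iff)
    show "AE x in lborel. (\<lambda>n. indicator S x *\<^sub>R (cmod (F n x))\<^sup>2) \<longlonglongrightarrow> 0"
    proof (intro AE_I2)
      fix x
      have "(\<lambda>n. (cmod (F n x))\<^sup>2) \<longlonglongrightarrow> (cmod 0)\<^sup>2" if "x \<in> S"
        using lim[OF that] by (intro tendsto_intros)
      then show "(\<lambda>n. indicator S x *\<^sub>R (cmod (F n x))\<^sup>2) \<longlonglongrightarrow> 0"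
        by (cases "x \<in> S") auto
    qed
    show "AE x in lborel. norm (indicator S x *\<^sub>R (cmod (F n x))\<^sup>2) \<le> indicator S x *\<^sub>R B\<^sup>2" for n
      using B by (intro AE_I2) (auto simp: indicator_def intro!: power_mono)
    show "(\<lambda>x. indicator S x *\<^sub>R (cmod (F n x))\<^sup>2) \<in> borel_measurable lborel" for n
      using L2_sq_integrable[OF F[of n]] by (auto simp: set_integrable_def)
  qed simp
  then show ?thesis by (simp add: sqn_def set_lebesgue_integral_def)
qed

lemma L2_product:
  fixes f g :: "real \<Rightarrow> complex"
  assumes f: "L2 A f" and g: "L2 B g"
  shows "L2 (A \<times> B) (\<lambda>x. f (fst x) * g (snd x))"
    and "sqn (A \<times> B) (\<lambda>x. f (fst x) * g (snd x)) = sqn A f * sqn B g"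
proof -
  define F where "F = (\<lambda>r. indicator A r *\<^sub>R f r)"
  define G where "G = (\<lambda>z. indicator B z *\<^sub>R g z)"
  have [measurable]: "F \<in> borel_measurable borel" "G \<in> borel_measurable borel"
    using f g by (auto simp: F_def G_def L2_def set_borel_measurable_def)
  have eq: "indicator (A \<times> B) x *\<^sub>R (f (fst x) * g (snd x)) = F (fst x) * G (snd x)" for x
    by (cases x) (auto simp: F_def G_def indicator_def)
  have m: "(\<lambda>x. F (fst x) * G (snd x)) \<in> borel_measurable (lborel \<Otimes>\<^sub>M lborel)" by measurable
  then have m': "set_borel_measurable lborel (A \<times> B) (\<lambda>x. f (fst x) * g (snd x))"
    unfolding set_borel_measurable_def eq by (simp add: lborel_prod)
  have F2: "(cmod (F r))\<^sup>2 = indicator A r *\<^sub>R (cmod (f r))\<^sup>2" for r by (auto simp: F_def indicator_def)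
  have G2: "(cmod (G r))\<^sup>2 = indicator B r *\<^sub>R (cmod (g r))\<^sup>2" for r by (auto simp: G_def indicator_def)
  have Fi: "integrable lborel (\<lambda>r. (cmod (F r))\<^sup>2)" and Gi: "integrable lborel (\<lambda>r. (cmod (G r))\<^sup>2)"
    using f g by (auto simp: F2 G2 L2_def set_integrable_def)
  have int: "integrable (lborel \<Otimes>\<^sub>M lborel) (\<lambda>x. (cmod (F (fst x)))\<^sup>2 * (cmod (G (snd x)))\<^sup>2)"
  proof (rule lborel_pair.Fubini_integrable)
    show "(\<lambda>x. (cmod (F (fst x)))\<^sup>2 * (cmod (G (snd x)))\<^sup>2) \<in> borel_measurable (lborel \<Otimes>\<^sub>M lborel)" by measurable
    show "integrable lborel (\<lambda>x. LINT y|lborel. norm ((cmod (F (fst (x, y))))\<^sup>2 * (cmod (G (snd (x, y))))\<^sup>2))"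
      using Fi by simp
  qed (use Gi in auto)
  have eq2: "indicator (A \<times> B) x *\<^sub>R (cmod (f (fst x) * g (snd x)))\<^sup>2 = (cmod (F (fst x)))\<^sup>2 * (cmod (G (snd x)))\<^sup>2" for x
    by (cases x) (auto simp: F_def G_def indicator_def norm_mult power_mult_distrib)
  show "L2 (A \<times> B) (\<lambda>x. f (fst x) * g (snd x))"
    unfolding L2_def set_integrable_def eq2 using m' int by (simp add: lborel_prod)
  have "sqn (A \<times> B) (\<lambda>x. f (fst x) * g (snd x)) = (LINT x|(lborel \<Otimes>\<^sub>M lborel). (cmod (F (fst x)))\<^sup>2 * (cmod (G (snd x)))\<^sup>2)"
    unfolding sqn_def set_lebesgue_integral_def eq2 by (simp add: lborel_prod)
  also have "\<dots> = (LINT r|lborel. LINT z|lborel. (cmod (F r))\<^sup>2 * (cmod (G z))\<^sup>2)"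
    using lborel_pair.integral_fst'[OF int] by simp
  also have "\<dots> = sqn A f * sqn B g"
    by (simp add: sqn_def set_lebesgue_integral_def F2 G2)
  finally show "sqn (A \<times> B) (\<lambda>x. f (fst x) * g (snd x)) = sqn A f * sqn B g" .
qed

lemma l2n_product:
  fixes f g :: "real \<Rightarrow> complex"
  assumes "L2 A f" "L2 B g"
  shows "l2n (A \<times> B) (\<lambda>x. f (fst x) * g (snd x)) = l2n A f * l2n B g"
  by (simp add: l2n_def L2_product(2)[OF assms] real_sqrt_mult)

lemma sqn_tendsto_iff: "(\<lambda>n. sqn S (F n)) \<longlonglongrightarrow> 0 \<longleftrightarrow> (\<lambda>n. l2n S (F n)) \<longlonglongrightarrow> 0"
proof
  assume "(\<lambda>n. sqn S (F n)) \<longlonglongrightarrow> 0"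
  then have "(\<lambda>n. sqrt (sqn S (F n))) \<longlonglongrightarrow> sqrt 0" by (rule tendsto_real_sqrt)
  then show "(\<lambda>n. l2n S (F n)) \<longlonglongrightarrow> 0" by (simp add: l2n_def)
next
  assume "(\<lambda>n. l2n S (F n)) \<longlonglongrightarrow> 0"
  then have "(\<lambda>n. (l2n S (F n))\<^sup>2) \<longlonglongrightarrow> 0\<^sup>2" by (intro tendsto_intros)
  then show "(\<lambda>n. sqn S (F n)) \<longlonglongrightarrow> 0" by (simp add: l2n_sq)
qed

text \<open>Split the difference as \<open>(f - F) * g + F * (g - G)\<close>; the norm of a product
  factorises, and the norm of \<open>F n\<close> is at most that of \<open>f\<close> plus the
  error.\<close>

lemma L2_product_tendsto:
  fixes f g :: "real \<Rightarrow> complex"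
  assumes f: "L2 A f" "\<And>n. L2 A (F n)" "(\<lambda>n. sqn A (\<lambda>x. f x - F n x)) \<longlonglongrightarrow> 0"
    and g: "L2 B g" "\<And>n. L2 B (G n)" "(\<lambda>n. sqn B (\<lambda>x. g x - G n x)) \<longlonglongrightarrow> 0"
  shows "(\<lambda>n. sqn (A \<times> B) (\<lambda>x. f (fst x) * g (snd x) - F n (fst x) * G n (snd x))) \<longlonglongrightarrow> 0"
  unfolding sqn_tendsto_iff
proof (rule Lim_null_comparison)
  let ?a = "\<lambda>n. l2n A (\<lambda>x. f x - F n x)" and ?b = "\<lambda>n. l2n B (\<lambda>x. g x - G n x)"
  have "?a \<longlonglongrightarrow> 0" "?b \<longlonglongrightarrow> 0" using f(3) g(3) by (simp_all add: sqn_tendsto_iff)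
  then have "(\<lambda>n. ?a n * l2n B g + (l2n A f + ?a n) * ?b n) \<longlonglongrightarrow> 0 * l2n B g + (l2n A f + 0) * 0"
    by (intro tendsto_intros)
  then show "(\<lambda>n. ?a n * l2n B g + (l2n A f + ?a n) * ?b n) \<longlonglongrightarrow> 0" by simp
  have "l2n (A \<times> B) (\<lambda>x. f (fst x) * g (snd x) - F n (fst x) * G n (snd x)) \<le> ?a n * l2n B g + (l2n A f + ?a n) * ?b n" for n
  proof -
    have fF: "L2 A (\<lambda>x. f x - F n x)" and gG: "L2 B (\<lambda>x. g x - G n x)" using f g by (auto intro: L2_diff)
    have "(\<lambda>x. f (fst x) * g (snd x) - F n (fst x) * G n (snd x))
       = (\<lambda>x. (f (fst x) - F n (fst x)) * g (snd x) + F n (fst x) * (g (snd x) - G n (snd x)))"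
      by (auto simp: algebra_simps)
    then have "l2n (A \<times> B) (\<lambda>x. f (fst x) * g (snd x) - F n (fst x) * G n (snd x))
      \<le> l2n (A \<times> B) (\<lambda>x. (f (fst x) - F n (fst x)) * g (snd x)) + l2n (A \<times> B) (\<lambda>x. F n (fst x) * (g (snd x) - G n (snd x)))"
      using l2n_triangle[OF L2_product(1)[OF fF g(1)] L2_product(1)[OF f(2) gG]] by simp
    also have "\<dots> = ?a n * l2n B g + l2n A (F n) * ?b n"
      using l2n_product[OF fF g(1)] l2n_product[OF f(2) gG] by simp
    also have "l2n A (F n) \<le> l2n A f + ?a n"
    proof -
      have "l2n A (F n) \<le> l2n A f + l2n A (\<lambda>x. (-1) * (f x - F n x))"
        using l2n_triangle[OF f(1) L2_cmult[OF fF, of "-1"]] by simp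
      also have "l2n A (\<lambda>x. (-1) * (f x - F n x)) = ?a n" unfolding l2n_def sqn_cmult by simp
      finally show ?thesis .
    qed
    finally show ?thesis by (simp add: l2n_nonneg mult_right_mono)
  qed
  then show "\<forall>\<^sub>F n in sequentially. norm (l2n (A \<times> B) (\<lambda>x. f (fst x) * g (snd x) - F n (fst x) * G n (snd x))) \<le> ?a n * l2n B g + (l2n A f + ?a n) * ?b n"
    by (simp add: l2n_nonneg)
qed

lemma vector_derivative_bound:
  fixes f :: "real \<Rightarrow> complex"
  assumes "a \<le> x" "x \<le> b" "\<And>x. x \<in> {a..b} \<Longrightarrow> (f has_vector_derivative f' x) (at x within {a..b})"
    "\<And>x. x \<in> {a..b} \<Longrightarrow> cmod (f' x) \<le> B"
  shows "cmod (f x - f a) \<le> B * (x - a)"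
proof -
  have "(f' has_integral (f x - f a)) {a..x}"
  proof (intro fundamental_theorem_of_calculus)
    show "(f has_vector_derivative f' y) (at y within {a..x})" if "y \<in> {a..x}" for y
      by (rule has_vector_derivative_within_subset[OF assms(3)]) (use that assms in auto)
  qed (use assms in auto)
  moreover have "0 \<le> B"
    using order_trans[OF norm_ge_zero assms(4)[of a]] assms(1,2) by simp
  ultimately have "cmod (f x - f a) \<le> B * measure lborel {a..x}"
    by (intro has_integral_bound_real[where S="{}"]) (use assms in auto)
  then show ?thesis using assms by simp
qed

text \<open>Stone-Weierstrass is applied to the derivative and the polynomial is integrated, which
  controls both orders; a linear correction of slope \<open>k\<close> then restores the value at
  \<open>b\<close>. Exact end values are essential later: they make approximants vanish where
  cut-offs are steep, and they give exact traces.\<close>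

lemma sm_C1_approx:
  fixes v :: "real \<Rightarrow> complex"
  assumes ab: "a < b" and v: "\<And>x. x \<in> {a..b} \<Longrightarrow> (v has_vector_derivative v' x) (at x within {a..b})"
    and v': "continuous_on {a..b} v'" and e: "e > 0"
  obtains p p' where "sm p" "sm p'" "\<And>x. (p has_vector_derivative p' x) (at x)" "p a = v a" "p b = v b"
    "\<And>x. x \<in> {a..b} \<Longrightarrow> cmod (v x - p x) \<le> e" "\<And>x. x \<in> {a..b} \<Longrightarrow> cmod (v' x - p' x) \<le> e"
proof -
  \<comment> \<open>The derivative is off by \<open>\<delta>\<close> from the polynomial and by at
    most \<open>\<delta>\<close> from the slope \<open>k\<close>; the function is off by at most
    \<open>b - a\<close> times as much. Hence the factors 2 and \<open>b - a\<close>.\<close>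
  define \<delta> where "\<delta> = e / (2 + 2 * (b - a))"
  have \<delta>: "\<delta> > 0" "2 * \<delta> \<le> e" "2 * \<delta> * (b - a) \<le> e" using ab e by (simp_all add: \<delta>_def field_simps)
  obtain q where q: "polynomial_function q" "\<And>x. x \<in> {a..b} \<Longrightarrow> cmod (v' x - q x) < \<delta>"
    using Stone_Weierstrass_polynomial_function[OF compact_Icc v' \<delta>(1)] by blast
  have smq: "sm q" by (rule sm_polynomial[OF q(1)])
  obtain p0 where p0: "sm p0" "p0 a = v a" "\<And>x. (p0 has_vector_derivative q x) (at x)"
    using sm_antiderivative[OF smq, of a "v a"] by blast
  have d0: "cmod (v x - p0 x) \<le> \<delta> * (b - a)" if x: "x \<in> {a..b}" for x
  proof -
    have "cmod ((v x - p0 x) - (v a - p0 a)) \<le> \<delta> * (x - a)"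
    proof (rule vector_derivative_bound)
      show "((\<lambda>x. v x - p0 x) has_vector_derivative v' x - q x) (at x within {a..b})" if "x \<in> {a..b}" for x
        using v[OF that] p0(3)[of x] by (intro derivative_intros) (auto intro: has_vector_derivative_at_within)
      show "cmod (v' x - q x) \<le> \<delta>" if "x \<in> {a..b}" for x using q(2)[OF that] by simp
    qed (use x in auto)
    also have "\<dots> \<le> \<delta> * (b - a)" using x \<delta>(1) by (intro mult_left_mono) auto
    finally show ?thesis by (simp add: p0(2))
  qed
  define k where "k = (v b - p0 b) / of_real (b - a)"
  have k: "cmod k \<le> \<delta>"
    using d0[of b] ab by (simp add: k_def norm_divide pos_divide_le_eq flip: of_real_diff)
  define p where "p = (\<lambda>x. p0 x + k * (of_real x - of_real a))"
  show ?thesis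
  proof
    have "polynomial_function (\<lambda>x::real. complex_of_real x)"
      using polynomial_function_bounded_linear[OF bounded_linear_of_real] by blast
    then have "sm (\<lambda>x. k * (of_real x - of_real a))"
      by (intro sm_mult sm_const sm_polynomial polynomial_function_diff polynomial_function_const)
    then show "sm p" unfolding p_def by (intro sm_add p0)
    show "sm (\<lambda>x. q x + k)" by (intro sm_add smq sm_const)
    show "(p has_vector_derivative q x + k) (at x)" for x
    proof -
      have "((\<lambda>x. k * (complex_of_real x - of_real a)) has_vector_derivative k) (at x)"
        by (auto intro!: derivative_eq_intros has_vector_derivative_of_real)
      then show ?thesis unfolding p_def by (intro derivative_intros p0)
    qed
    show "p a = v a" by (simp add: p_def p0)
    show "p b = v b" using ab by (simp add: p_def k_def flip: of_real_diff)
    show "cmod (v x - p x) \<le> e" if x: "x \<in> {a..b}" for x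
    proof -
      have "cmod (v x - p x) \<le> cmod (v x - p0 x) + cmod (k * (of_real x - of_real a))"
        unfolding p_def using norm_triangle_ineq4[of "v x - p0 x" "k * (of_real x - of_real a)"] by (simp add: algebra_simps)
      also have "cmod (k * (of_real x - of_real a)) = cmod k * (x - a)"
        using x by (simp add: norm_mult flip: of_real_diff)
      also have "\<dots> \<le> \<delta> * (b - a)" using x k \<delta> by (intro mult_mono) auto
      finally show ?thesis using d0[OF x] \<delta>(3) by simp
    qed
    show "cmod (v' x - (q x + k)) \<le> e" if x: "x \<in> {a..b}" for x
    proof -
      have "cmod (v' x - (q x + k)) \<le> cmod (v' x - q x) + cmod k"
        using norm_triangle_ineq4[of "v' x - q x" k] by (simp add: algebra_simps)
      then show ?thesis using q(2)[OF x] k \<delta>(2) by simp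
    qed
  qed
qed

text \<open>\<open>flat (\<lambda>y. y\<^sup>2)\<close> is the derivative of
  \<open>flat (\<lambda>_. 1)\<close>. At \<open>t = N * y - 1\<close> the product with
  \<open>t + 1\<close> is the slope of a cut-off times the distance \<open>y\<close> to the end
  point: bounded independently of \<open>N\<close>, and tending to 0 as \<open>N\<close>
  grows.\<close>

lemma flat_sq_bound:
  "0 \<le> flat (\<lambda>y. y\<^sup>2) t" "(t + 1) * flat (\<lambda>y. y\<^sup>2) t \<le> 2"
  "t > 0 \<Longrightarrow> (t + 1) * flat (\<lambda>y. y\<^sup>2) t \<le> 1 / t + (1 / t)\<^sup>2"
proof -
  show nn: "0 \<le> flat (\<lambda>y. y\<^sup>2) t" by (simp add: flat_def)
  have *: "(t + 1) * flat (\<lambda>y. y\<^sup>2) t = (1 / t + (1 / t)\<^sup>2) * exp (- (1 / t))" if "t > 0"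
    using that by (simp add: flat_def field_simps power2_eq_square)
  show "(t + 1) * flat (\<lambda>y. y\<^sup>2) t \<le> 1 / t + (1 / t)\<^sup>2" if "t > 0"
    unfolding *[OF that] using that by (intro mult_right_le_one_le) auto
  show "(t + 1) * flat (\<lambda>y. y\<^sup>2) t \<le> 2"
  proof (cases "t > 0")
    case True
    define y where "y = 1 / t"
    have y: "y > 0" using True by (simp add: y_def)
    have "y + y\<^sup>2 \<le> 2 * exp y" using exp_lower_Taylor_quadratic[of y] y by simp
    then have "(y + y\<^sup>2) * exp (- y) \<le> 2" by (simp add: exp_minus field_simps)
    then show ?thesis using *[OF True] by (simp add: y_def)
  qed (simp add: flat_def)
qed

lemma cut_deriv:
  "((\<lambda>x. complex_of_real (cut a b n x)) has_vector_derivative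
     of_real (real (Suc n) * flat (\<lambda>y. y\<^sup>2) (real (Suc n) * (x - a) - 1) * flat (\<lambda>_. 1) (real (Suc n) * (b - x) - 1)
     - real (Suc n) * flat (\<lambda>_. 1) (real (Suc n) * (x - a) - 1) * flat (\<lambda>y. y\<^sup>2) (real (Suc n) * (b - x) - 1))) (at x)"
proof -
  have fd: "(flat (\<lambda>_. 1) has_real_derivative flat (\<lambda>y. y\<^sup>2) t) (at t)" for t
    using flat_deriv[of "\<lambda>_. 1" "\<lambda>_. 0" t] by (simp add: real_polynomial_function.intros)
  have "((\<lambda>x. real (Suc n) * (x - a) - 1) has_real_derivative real (Suc n)) (at x)"
       "((\<lambda>x. real (Suc n) * (b - x) - 1) has_real_derivative - real (Suc n)) (at x)"
    by (auto intro!: derivative_eq_intros)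
  from DERIV_mult[OF DERIV_chain2[OF fd this(1)] DERIV_chain2[OF fd this(2)]]
  have "(cut a b n has_real_derivative real (Suc n) * flat (\<lambda>y. y\<^sup>2) (real (Suc n) * (x - a) - 1) * flat (\<lambda>_. 1) (real (Suc n) * (b - x) - 1)
     - real (Suc n) * flat (\<lambda>_. 1) (real (Suc n) * (x - a) - 1) * flat (\<lambda>y. y\<^sup>2) (real (Suc n) * (b - x) - 1)) (at x)"
    by (simp add: cut_def[abs_def] algebra_simps)
  then show ?thesis
    by (intro has_vector_derivative_of_real) (simp add: has_real_derivative_iff_has_vector_derivative)
qed

lemma flat_sq_scaled_tendsto:
  assumes "y > 0" shows "(\<lambda>n. real (Suc n) * y * flat (\<lambda>y. y\<^sup>2) (real (Suc n) * y - 1)) \<longlonglongrightarrow> 0"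
proof -
  have top: "filterlim (\<lambda>n. real (Suc n) * y - 1) at_top sequentially"
  proof -
    have "filterlim (\<lambda>n. - 1 + y * real (Suc n)) at_top sequentially"
      by (intro filterlim_tendsto_add_at_top[OF tendsto_const] filterlim_tendsto_pos_mult_at_top[OF tendsto_const assms]
          filterlim_compose[OF filterlim_real_sequentially filterlim_Suc])
    then show ?thesis by (simp add: mult.commute)
  qed
  have "((\<lambda>t. (t + 1) * flat (\<lambda>y. y\<^sup>2) t) \<longlongrightarrow> 0) at_top"
  proof (rule Lim_null_comparison)
    have "((\<lambda>t::real. inverse t + (inverse t)\<^sup>2) \<longlongrightarrow> 0 + 0\<^sup>2) at_top"
      by (intro tendsto_intros tendsto_inverse_0_at_top filterlim_ident)
    then show "((\<lambda>t::real. inverse t + (inverse t)\<^sup>2) \<longlongrightarrow> 0) at_top" by simp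
    show "\<forall>\<^sub>F t in at_top. norm ((t + 1) * flat (\<lambda>y. y\<^sup>2) t) \<le> inverse t + (inverse t)\<^sup>2"
      using eventually_gt_at_top[of "0::real"]
    proof eventually_elim
      case (elim t)
      then have "norm ((t + 1) * flat (\<lambda>y. y\<^sup>2) t) = (t + 1) * flat (\<lambda>y. y\<^sup>2) t"
        using flat_sq_bound(1)[of t] by simp
      with flat_sq_bound(3)[OF elim] show ?case by (simp only: inverse_eq_divide)
    qed
  qed
  from filterlim_compose[OF this top] show ?thesis by simp
qed

text \<open>The slope of the cut-off grows like \<open>n\<close> near the ends, but an approximant
  that vanishes there is at most \<open>M\<close> times the distance to the end. So their product
  stays bounded and tends to 0 pointwise, and dominated convergence applies.\<close>

lemma C1_vanishing_test_approx:
  fixes v :: "real \<Rightarrow> complex"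
  assumes ab: "a < b" and v: "\<And>x. x \<in> {a..b} \<Longrightarrow> (v has_vector_derivative v' x) (at x within {a..b})"
    and v': "continuous_on {a..b} v'" and e: "e > 0" and v0: "v a = 0" "v b = 0"
  obtains p n f' where "sm p" "continuous_on {a..b} f'"
    "\<And>x. ((\<lambda>x. p x * of_real (cut a b n x)) has_vector_derivative f' x) (at x)"
    "sqn {a<..<b} (\<lambda>x. v x - p x * of_real (cut a b n x)) < e" "sqn {a<..<b} (\<lambda>x. v' x - f' x) < e"
proof -
  define S where "S = {a<..<b}"
  have S: "S \<in> sets borel" "emeasure lborel S < \<infinity>"
    by (simp_all add: S_def)
  have LC: "L2 S f" if "continuous_on {a..b} f" for f
    using that by (intro L2_continuous[of "{a..b}"]) (auto simp: S_def)
  have vc: "continuous_on {a..b} v"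
    using v by (intro continuous_on_vector_derivative) auto
  \<comment> \<open>The estimate \<open>sqn_add_le\<close> doubles both errors: the polynomial error
    then takes less than \<open>e / 2\<close>, and the cut-off error below \<open>e / 4\<close>
    takes the other half.\<close>
  define \<delta> where "\<delta> = sqrt (e / (4 * (1 + (b - a))))"
  have \<delta>: "\<delta> > 0" using ab e by (simp add: \<delta>_def)
  have \<delta>2: "2 * (\<delta>\<^sup>2 * (b - a)) < e / 2"
    using ab e by (simp add: \<delta>_def field_simps)
  obtain p p' where p: "sm p" "sm p'" "\<And>x. (p has_vector_derivative p' x) (at x)" "p a = 0" "p b = 0"
    "\<And>x. x \<in> {a..b} \<Longrightarrow> cmod (v x - p x) \<le> \<delta>" "\<And>x. x \<in> {a..b} \<Longrightarrow> cmod (v' x - p' x) \<le> \<delta>"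
    using sm_C1_approx[OF ab v v' \<delta>] v0 by metis
  have smc: "continuous_on X g" if "sm g" for X g
    by (rule smE[OF that]) (auto intro!: continuous_at_imp_continuous_on has_vector_derivative_continuous)
  have small: "sqn S f \<le> \<delta>\<^sup>2 * (b - a)" if "continuous_on {a..b} f" "\<And>x. x \<in> {a..b} \<Longrightarrow> cmod (f x) \<le> \<delta>" for f
  proof -
    have "sqn S f \<le> (LINT x:S|lborel. \<delta>\<^sup>2)"
      unfolding sqn_def
    proof (rule set_integral_mono)
      show "set_integrable lborel S (\<lambda>x. \<delta>\<^sup>2)" by (simp add: set_integrable_def S_def)
      show "(cmod (f x))\<^sup>2 \<le> \<delta>\<^sup>2" if "x \<in> S" for x
        using that \<open>\<And>x. x \<in> {a..b} \<Longrightarrow> cmod (f x) \<le> \<delta>\<close>[of x] by (intro power_mono) (auto simp: S_def)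
    qed (use L2_sq_integrable[OF LC[OF that(1)]] in auto)
    also have "\<dots> = \<delta>\<^sup>2 * (b - a)"
      using ab by (simp add: set_lebesgue_integral_def S_def)
    finally show ?thesis .
  qed
  obtain M where M: "\<And>x. x \<in> {a..b} \<Longrightarrow> cmod (p' x) \<le> M"
    using compact_imp_bounded[OF compact_continuous_image[OF smc[OF p(2)] compact_Icc[of a b]]]
    unfolding bounded_iff by fastforce
  have M0: "M \<ge> 0" using order_trans[OF norm_ge_zero M[of a]] ab by simp
  have pa: "cmod (p x) \<le> M * (x - a)" if "x \<in> {a..b}" for x
    using vector_derivative_bound[of a x b p p' M] that M p(3,4) by (auto intro: has_vector_derivative_at_within)
  have pb: "cmod (p x) \<le> M * (b - x)" if "x \<in> {a..b}" for x
  proof -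
    have "cmod (p b - p x) \<le> M * (b - x)"
      by (rule vector_derivative_bound[of x b b p p' M]) (use that M p(3) in \<open>auto intro: has_vector_derivative_at_within\<close>)
    then show ?thesis using p(5) by simp
  qed
  define E where "E = flat (\<lambda>_. 1)"
  define E' where "E' = flat (\<lambda>y. y\<^sup>2)"
  define c' where "c' = (\<lambda>n x. real (Suc n) * E' (real (Suc n) * (x - a) - 1) * E (real (Suc n) * (b - x) - 1)
     - real (Suc n) * E (real (Suc n) * (x - a) - 1) * E' (real (Suc n) * (b - x) - 1))"
  have cd: "((\<lambda>x. complex_of_real (cut a b n x)) has_vector_derivative of_real (c' n x)) (at x)" for n x
    unfolding c'_def E_def E'_def by (rule cut_deriv)
  have cc: "continuous_on X (\<lambda>x. complex_of_real (cut a b n x))" for X n by (rule smc[OF sm_cut])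
  have c'c: "continuous_on X (\<lambda>x. complex_of_real (c' n x))" for X n
  proof -
    have "continuous_on X (\<lambda>x. complex_of_real (flat g (real (Suc n) * (x - a) - 1)))"
         "continuous_on X (\<lambda>x. complex_of_real (flat g (real (Suc n) * (b - x) - 1)))" if "real_polynomial_function g" for g
      using smc[OF sm_flat[OF that, of "real (Suc n)" "- real (Suc n) * a - 1"]] smc[OF sm_flat[OF that, of "- real (Suc n)" "real (Suc n) * b - 1"]]
      by (simp_all add: algebra_simps)
    moreover have "real_polynomial_function (\<lambda>_::real. 1::real)" "real_polynomial_function (\<lambda>y::real. y\<^sup>2)"
      by (auto intro!: real_polynomial_function.intros(1,2) real_polynomial_function_power bounded_linear_ident)
    ultimately show ?thesis
      unfolding c'_def of_real_diff of_real_mult E_def E'_def by (intro continuous_intros) auto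
  qed
  define f' where "f' = (\<lambda>n x. p x * of_real (c' n x) + p' x * of_real (cut a b n x))"
  have f'd: "((\<lambda>x. p x * of_real (cut a b n x)) has_vector_derivative f' n x) (at x)" for n x
    unfolding f'_def by (intro has_vector_derivative_mult p cd)
  have f'c: "continuous_on X (f' n)" for X n
    unfolding f'_def by (intro continuous_intros c'c cc smc p)
  have t: "(\<lambda>n. complex_of_real (cut a b n x)) \<longlonglongrightarrow> of_real 1" if "x \<in> S" for x
    using cut_tendsto[of x a b] that unfolding S_def by (intro tendsto_intros)
  have c1: "(\<lambda>n. sqn S (\<lambda>x. p x - p x * of_real (cut a b n x))) \<longlonglongrightarrow> 0"
  proof (rule sqn_dominated_tendsto_0[OF S, where B="M * (b - a)"])
    show "L2 S (\<lambda>x. p x - p x * complex_of_real (cut a b n x))" for n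
      by (intro LC continuous_intros smc p cc)
    show "cmod (p x - p x * complex_of_real (cut a b n x)) \<le> M * (b - a)" if x: "x \<in> S" for n x
    proof -
      have "p x - p x * complex_of_real (cut a b n x) = p x * of_real (1 - cut a b n x)"
        by (simp add: algebra_simps)
      also have "cmod \<dots> \<le> cmod (p x) * 1" unfolding norm_mult norm_of_real
        using cut_bounds[of a b n x] by (intro mult_left_mono) auto
      also have "\<dots> \<le> M * (x - a)" using pa[of x] x by (simp add: S_def)
      also have "\<dots> \<le> M * (b - a)" using M0 x by (intro mult_left_mono) (auto simp: S_def)
      finally show ?thesis .
    qed
    show "(\<lambda>n. p x - p x * complex_of_real (cut a b n x)) \<longlonglongrightarrow> 0" if "x \<in> S" for x
      using tendsto_diff[OF tendsto_const tendsto_mult[OF tendsto_const t[OF that]], of "p x" "p x"] by simp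
  qed
  \<comment> \<open>Each of the two slopes is paired with the distance to its own end:
    \<open>pa\<close> compensates the one at \<open>a\<close>, \<open>pb\<close> the one at
    \<open>b\<close>.\<close>
  have pc': "cmod (p x * of_real (c' n x)) \<le> M * (real (Suc n) * (x - a) * E' (real (Suc n) * (x - a) - 1)
      + real (Suc n) * (b - x) * E' (real (Suc n) * (b - x) - 1))" if x: "x \<in> S" for n x
  proof -
    define N where "N = real (Suc n)"
    have N: "N > 0" by (simp add: N_def)
    have E1: "0 \<le> E t" "E t \<le> 1" for t unfolding E_def by (rule flat1_bounds)+
    have E2: "0 \<le> E' t" for t unfolding E'_def by (rule flat_sq_bound)
    have nnab: "0 \<le> N * E' (N * (x - a) - 1)" "0 \<le> N * E' (N * (b - x) - 1)" using N E2 by auto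
    have "\<bar>c' n x\<bar> \<le> \<bar>N * E' (N * (x - a) - 1) * E (N * (b - x) - 1)\<bar> + \<bar>N * E (N * (x - a) - 1) * E' (N * (b - x) - 1)\<bar>"
      unfolding c'_def N_def by (rule abs_triangle_ineq4)
    also have "\<bar>N * E' (N * (x - a) - 1) * E (N * (b - x) - 1)\<bar> \<le> N * E' (N * (x - a) - 1)"
      using mult_left_le[OF E1(2) nnab(1), of "N * (b - x) - 1"] E1 E2 N by (simp add: abs_mult)
    also have "\<bar>N * E (N * (x - a) - 1) * E' (N * (b - x) - 1)\<bar> \<le> N * E' (N * (b - x) - 1)"
      using mult_left_le[OF E1(2) nnab(2), of "N * (x - a) - 1"] E1 E2 N by (simp add: abs_mult mult_ac)
    finally have "\<bar>c' n x\<bar> \<le> N * E' (N * (x - a) - 1) + N * E' (N * (b - x) - 1)" by simp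
    then have "cmod (p x * of_real (c' n x)) \<le> cmod (p x) * (N * E' (N * (x - a) - 1)) + cmod (p x) * (N * E' (N * (b - x) - 1))"
      unfolding norm_mult norm_of_real by (metis mult_left_mono norm_ge_zero distrib_left)
    also have "\<dots> \<le> (M * (x - a)) * (N * E' (N * (x - a) - 1)) + (M * (b - x)) * (N * E' (N * (b - x) - 1))"
      using x pa[of x] pb[of x] nnab by (intro add_mono mult_right_mono) (auto simp: S_def)
    finally show ?thesis by (simp add: N_def algebra_simps)
  qed
  have c2: "(\<lambda>n. sqn S (\<lambda>x. p' x - f' n x)) \<longlonglongrightarrow> 0"
  proof (rule sqn_dominated_tendsto_0[OF S, where B="M + M * (2 + 2)"])
    show "L2 S (\<lambda>x. p' x - f' n x)" for n
      by (intro LC continuous_intros smc p f'c)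
    have eq: "p' x - f' n x = p' x * of_real (1 - cut a b n x) - p x * of_real (c' n x)" for n x
      by (simp add: f'_def algebra_simps)
    show "cmod (p' x - f' n x) \<le> M + M * (2 + 2)" if x: "x \<in> S" for n x
    proof -
      have "cmod (p' x - f' n x) \<le> cmod (p' x * of_real (1 - cut a b n x)) + cmod (p x * of_real (c' n x))"
        unfolding eq by (rule norm_triangle_ineq4)
      also have "cmod (p' x * of_real (1 - cut a b n x)) \<le> cmod (p' x) * 1" unfolding norm_mult norm_of_real
        using cut_bounds[of a b n x] by (intro mult_left_mono) auto
      also have "\<dots> \<le> M" using M[of x] x by (simp add: S_def)
      also have "cmod (p x * of_real (c' n x)) \<le> M * (2 + 2)"
      proof -
        have "N * y * E' (N * y - 1) \<le> 2" for N y using flat_sq_bound(2)[of "N * y - 1"] by (simp add: E'_def)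
        then have "M * (real (Suc n) * (x - a) * E' (real (Suc n) * (x - a) - 1)
            + real (Suc n) * (b - x) * E' (real (Suc n) * (b - x) - 1)) \<le> M * (2 + 2)"
          using M0 by (intro mult_left_mono add_mono) auto
        with pc'[OF x, of n] show ?thesis by linarith
      qed
      finally show ?thesis by simp
    qed
    show "(\<lambda>n. p' x - f' n x) \<longlonglongrightarrow> 0" if x: "x \<in> S" for x
    proof -
      have "(\<lambda>n. M * (real (Suc n) * (x - a) * E' (real (Suc n) * (x - a) - 1)
            + real (Suc n) * (b - x) * E' (real (Suc n) * (b - x) - 1))) \<longlonglongrightarrow> M * (0 + 0)"
      proof -
        have "0 < x - a" "0 < b - x" using x by (auto simp: S_def)
        note flat_sq_scaled_tendsto[OF this(1)] flat_sq_scaled_tendsto[OF this(2)]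
        from tendsto_mult[OF tendsto_const tendsto_add[OF this], of M] show ?thesis
          unfolding E'_def .
      qed
      then have "(\<lambda>n. p x * of_real (c' n x)) \<longlonglongrightarrow> 0"
        unfolding add_0_right mult_zero_right
        by (rule Lim_null_comparison[rotated]) (intro always_eventually allI pc'[OF x])
      moreover have "(\<lambda>n. p' x * of_real (1 - cut a b n x)) \<longlonglongrightarrow> p' x * of_real (1 - 1)"
        using cut_tendsto[of x a b] x unfolding S_def by (intro tendsto_intros)
      ultimately have "(\<lambda>n. p' x * of_real (1 - cut a b n x) - p x * of_real (c' n x)) \<longlonglongrightarrow> p' x * of_real (1 - 1) - 0"
        by (rule tendsto_diff[rotated])
      then show ?thesis by (simp add: eq)
    qed
  qed
  have e4: "e / 4 > 0" using e by simp
  have "\<forall>\<^sub>F n in sequentially. sqn S (\<lambda>x. p x - p x * of_real (cut a b n x)) < e / 4"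
    by (rule order_tendstoD(2)[OF c1 e4])
  moreover have "\<forall>\<^sub>F n in sequentially. sqn S (\<lambda>x. p' x - f' n x) < e / 4"
    by (rule order_tendstoD(2)[OF c2 e4])
  ultimately have "\<forall>\<^sub>F n in sequentially. sqn S (\<lambda>x. p x - p x * of_real (cut a b n x)) < e / 4 \<and> sqn S (\<lambda>x. p' x - f' n x) < e / 4"
    by eventually_elim simp
  then obtain n where n: "sqn S (\<lambda>x. p x - p x * of_real (cut a b n x)) < e / 4" "sqn S (\<lambda>x. p' x - f' n x) < e / 4"
    by (auto simp: eventually_sequentially)
  show ?thesis
  proof
    have "sqn S (\<lambda>x. v x - p x * of_real (cut a b n x)) \<le> 2 * sqn S (\<lambda>x. v x - p x) + 2 * sqn S (\<lambda>x. p x - p x * of_real (cut a b n x))"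
      using sqn_add_le[of S "\<lambda>x. v x - p x" "\<lambda>x. p x - p x * of_real (cut a b n x)",
          OF LC LC, OF continuous_on_diff[OF vc smc[OF p(1)]] continuous_on_diff[OF smc[OF p(1)] continuous_on_mult[OF smc[OF p(1)] cc]]]
      by simp
    moreover have "sqn S (\<lambda>x. v x - p x) \<le> \<delta>\<^sup>2 * (b - a)" by (intro small continuous_intros vc smc p)
    ultimately show "sqn {a<..<b} (\<lambda>x. v x - p x * of_real (cut a b n x)) < e" using n \<delta>2 by (simp add: S_def)
    have "sqn S (\<lambda>x. v' x - f' n x) \<le> 2 * sqn S (\<lambda>x. v' x - p' x) + 2 * sqn S (\<lambda>x. p' x - f' n x)"
      using sqn_add_le[of S "\<lambda>x. v' x - p' x" "\<lambda>x. p' x - f' n x",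
          OF LC LC, OF continuous_on_diff[OF v' smc[OF p(2)]] continuous_on_diff[OF smc[OF p(2)] f'c]]
      by simp
    moreover have "sqn S (\<lambda>x. v' x - p' x) \<le> \<delta>\<^sup>2 * (b - a)" by (intro small continuous_intros v' smc p)
    ultimately show "sqn {a<..<b} (\<lambda>x. v' x - f' n x) < e" using n \<delta>2 by (simp add: S_def)
  qed (use p f'd f'c in auto)
qed

lemma L2_Ioo:
  fixes f :: "real \<Rightarrow> complex"
  assumes "continuous_on {a..b} f" shows "L2 {a<..<b} f"
  using assms by (intro L2_continuous[of "{a..b}"]) auto

lemma continuous_on_fst_comp:
  assumes "continuous_on A f" shows "continuous_on (A \<times> B) (\<lambda>x. f (fst x))"
  by (rule continuous_on_compose2[OF assms continuous_on_fst]) auto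

lemma continuous_on_snd_comp:
  assumes "continuous_on B f" shows "continuous_on (A \<times> B) (\<lambda>x. f (snd x))"
  by (rule continuous_on_compose2[OF assms continuous_on_snd]) auto

lemma weak_deriv_product:
  fixes f g :: "real \<Rightarrow> complex"
  assumes "a \<le> b" "c \<le> d"
    and f: "\<And>x. x \<in> {a..b} \<Longrightarrow> (f has_vector_derivative f' x) (at x within {a..b})" and f': "continuous_on {a..b} f'"
    and g: "\<And>x. x \<in> {c..d} \<Longrightarrow> (g has_vector_derivative g' x) (at x within {c..d})" and g': "continuous_on {c..d} g'"
  shows "weak_deriv ({a<..<b} \<times> {c<..<d}) (1,0) (\<lambda>x. f (fst x) * g (snd x)) (\<lambda>x. f' (fst x) * g (snd x))"
    and "weak_deriv ({a<..<b} \<times> {c<..<d}) (0,1) (\<lambda>x. f (fst x) * g (snd x)) (\<lambda>x. f (fst x) * g' (snd x))"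
    and "L2 ({a<..<b} \<times> {c<..<d}) (\<lambda>x. f (fst x) * g (snd x))"
    and "L2 ({a<..<b} \<times> {c<..<d}) (\<lambda>x. f' (fst x) * g (snd x))"
    and "L2 ({a<..<b} \<times> {c<..<d}) (\<lambda>x. f (fst x) * g' (snd x))"
proof -
  have fc: "continuous_on {a..b} f" by (rule continuous_on_vector_derivative[OF f])
  have gc: "continuous_on {c..d} g" by (rule continuous_on_vector_derivative[OF g])
  note C = continuous_on_fst_comp[OF fc] continuous_on_fst_comp[OF f'] continuous_on_snd_comp[OF gc] continuous_on_snd_comp[OF g']
  show "weak_deriv ({a<..<b} \<times> {c<..<d}) (1,0) (\<lambda>x. f (fst x) * g (snd x)) (\<lambda>x. f' (fst x) * g (snd x))"
  proof (rule weak_deriv_fst_classical)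
    show "((\<lambda>r. f (fst (r, z)) * g (snd (r, z))) has_vector_derivative f' (fst (r, z)) * g (snd (r, z))) (at r within {a..b})"
      if "r \<in> {a..b}" "z \<in> {c..d}" for r z
      using f[OF that(1)] by (auto intro: has_vector_derivative_mult_left)
  qed (intro continuous_intros C assms)+
  show "weak_deriv ({a<..<b} \<times> {c<..<d}) (0,1) (\<lambda>x. f (fst x) * g (snd x)) (\<lambda>x. f (fst x) * g' (snd x))"
  proof (rule weak_deriv_snd_classical)
    show "((\<lambda>z. f (fst (r, z)) * g (snd (r, z))) has_vector_derivative f (fst (r, z)) * g' (snd (r, z))) (at z within {c..d})"
      if "r \<in> {a..b}" "z \<in> {c..d}" for r z
      using g[OF that(2)] by (auto intro: has_vector_derivative_mult_right)
  qed (intro continuous_intros C assms)+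
  show "L2 ({a<..<b} \<times> {c<..<d}) (\<lambda>x. f (fst x) * g (snd x))"
    "L2 ({a<..<b} \<times> {c<..<d}) (\<lambda>x. f' (fst x) * g (snd x))"
    "L2 ({a<..<b} \<times> {c<..<d}) (\<lambda>x. f (fst x) * g' (snd x))"
    by (intro L2_rect continuous_intros C)+
qed

lemma test_approx_sequence:
  fixes v :: "real \<Rightarrow> complex"
  assumes ab: "a < b" and v: "\<And>x. x \<in> {a..b} \<Longrightarrow> (v has_vector_derivative v' x) (at x within {a..b})"
    and v': "continuous_on {a..b} v'" and v0: "v a = 0" "v b = 0"
  obtains p k F' where "\<And>n. sm (p n)" "\<And>n. continuous_on {a..b} (F' n)"
    "\<And>n x. ((\<lambda>x. p n x * of_real (cut a b (k n) x)) has_vector_derivative F' n x) (at x)"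
    "(\<lambda>n::nat. sqn {a<..<b} (\<lambda>x. v x - p n x * of_real (cut a b (k n) x))) \<longlonglongrightarrow> 0"
    "(\<lambda>n. sqn {a<..<b} (\<lambda>x. v' x - F' n x)) \<longlonglongrightarrow> 0"
proof -
  define Q where "Q n p k f' \<longleftrightarrow> sm p \<and> continuous_on {a..b} f' \<and>
    (\<forall>x. ((\<lambda>x. p x * of_real (cut a b k x)) has_vector_derivative f' x) (at x)) \<and>
    sqn {a<..<b} (\<lambda>x. v x - p x * of_real (cut a b k x)) < inverse (real (Suc n)) \<and>
    sqn {a<..<b} (\<lambda>x. v' x - f' x) < inverse (real (Suc n))" for n p k f'
  have "\<exists>p k f'. Q n p k f'" for n
    unfolding Q_def
    by (rule C1_vanishing_test_approx[OF ab v v' _ v0, of "inverse (real (Suc n))"]) (assumption, simp, blast)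
  then obtain p k F' where *: "\<And>n. Q n (p n) (k n) (F' n)" by metis
  note * = *[unfolded Q_def, THEN conjunct1] *[unfolded Q_def, THEN conjunct2, THEN conjunct1]
    *[unfolded Q_def, THEN conjunct2, THEN conjunct2, THEN conjunct1, rule_format]
    *[unfolded Q_def, THEN conjunct2, THEN conjunct2, THEN conjunct2, THEN conjunct1]
    *[unfolded Q_def, THEN conjunct2, THEN conjunct2, THEN conjunct2, THEN conjunct2]
  have "(\<lambda>n. sqn {a<..<b} (\<lambda>x. v x - p n x * of_real (cut a b (k n) x))) \<longlonglongrightarrow> 0"
    by (rule Lim_null_comparison[OF _ LIMSEQ_inverse_real_of_nat]) (use *(4) in \<open>auto simp: sqn_nonneg less_imp_le\<close>)
  moreover have "(\<lambda>n. sqn {a<..<b} (\<lambda>x. v' x - F' n x)) \<longlonglongrightarrow> 0"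
    by (rule Lim_null_comparison[OF _ LIMSEQ_inverse_real_of_nat]) (use *(5) in \<open>auto simp: sqn_nonneg less_imp_le\<close>)
  ultimately show ?thesis using that *(1-3) by blast
qed

text \<open>Products of the one-variable approximants are test functions, and the three L2 norms of
  the \<open>H1\<close> error are differences of products. This supplies the test functions of the
  uniqueness proof.\<close>

lemma H1_0_product:
  fixes f g :: "real \<Rightarrow> complex"
  assumes ab: "a < b" and cd: "c < d"
    and f: "\<And>x. x \<in> {a..b} \<Longrightarrow> (f has_vector_derivative f' x) (at x within {a..b})" and f': "continuous_on {a..b} f'"
    and g: "\<And>x. x \<in> {c..d} \<Longrightarrow> (g has_vector_derivative g' x) (at x within {c..d})" and g': "continuous_on {c..d} g'"
    and f0: "f a = 0" "f b = 0" and g0: "g c = 0" "g d = 0"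
  shows "H1_0 ({a<..<b} \<times> {c<..<d}) (\<lambda>x. f (fst x) * g (snd x))"
proof -
  define \<Omega> where "\<Omega> = {a<..<b} \<times> {c<..<d}"
  obtain p k F' where p: "\<And>n. sm (p n)" "\<And>n. continuous_on {a..b} (F' n)"
    "\<And>n x. ((\<lambda>x. p n x * of_real (cut a b (k n) x)) has_vector_derivative F' n x) (at x)"
    "(\<lambda>n::nat. sqn {a<..<b} (\<lambda>x. f x - p n x * of_real (cut a b (k n) x))) \<longlonglongrightarrow> 0"
    "(\<lambda>n. sqn {a<..<b} (\<lambda>x. f' x - F' n x)) \<longlonglongrightarrow> 0"
    by (rule test_approx_sequence[OF ab f f' f0]) blast+
  obtain q l G' where q: "\<And>n. sm (q n)" "\<And>n. continuous_on {c..d} (G' n)"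
    "\<And>n x. ((\<lambda>x. q n x * of_real (cut c d (l n) x)) has_vector_derivative G' n x) (at x)"
    "(\<lambda>n::nat. sqn {c<..<d} (\<lambda>x. g x - q n x * of_real (cut c d (l n) x))) \<longlonglongrightarrow> 0"
    "(\<lambda>n. sqn {c<..<d} (\<lambda>x. g' x - G' n x)) \<longlonglongrightarrow> 0"
    by (rule test_approx_sequence[OF cd g g' g0]) blast+
  define F where "F = (\<lambda>n x. p n x * of_real (cut a b (k n) x))"
  define G where "G = (\<lambda>n x. q n x * of_real (cut c d (l n) x))"
  have F4: "(\<lambda>n. sqn {a<..<b} (\<lambda>x. f x - F n x)) \<longlonglongrightarrow> 0" using p(4) by (simp add: F_def)
  have G4: "(\<lambda>n. sqn {c<..<d} (\<lambda>x. g x - G n x)) \<longlonglongrightarrow> 0" using q(4) by (simp add: G_def)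
  have FG: "\<And>n x. (F n has_vector_derivative F' n x) (at x within {a..b})" "\<And>n x. (G n has_vector_derivative G' n x) (at x within {c..d})"
    using p(3) q(3) by (auto simp: F_def G_def intro: has_vector_derivative_at_within)
  have le: "a \<le> b" "c \<le> d" using ab cd by auto
  note W = weak_deriv_product[OF le f f' g g', folded \<Omega>_def]
  have V: "weak_deriv \<Omega> (1,0) (\<lambda>x. F n (fst x) * G n (snd x)) (\<lambda>x. F' n (fst x) * G n (snd x))"
    "weak_deriv \<Omega> (0,1) (\<lambda>x. F n (fst x) * G n (snd x)) (\<lambda>x. F n (fst x) * G' n (snd x))"
    "L2 \<Omega> (\<lambda>x. F n (fst x) * G n (snd x))" "L2 \<Omega> (\<lambda>x. F' n (fst x) * G n (snd x))" "L2 \<Omega> (\<lambda>x. F n (fst x) * G' n (snd x))" for n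
    unfolding \<Omega>_def by (rule weak_deriv_product[OF le FG(1) p(2) FG(2) q(2)])+
  have c: "continuous_on {a..b} f" "continuous_on {c..d} g" "\<And>n. continuous_on {a..b} (F n)" "\<And>n. continuous_on {c..d} (G n)"
    by (rule continuous_on_vector_derivative[OF f] continuous_on_vector_derivative[OF g]
        continuous_on_vector_derivative[OF FG(1)] continuous_on_vector_derivative[OF FG(2)]; assumption)+
  note L = L2_Ioo[OF c(1)] L2_Ioo[OF c(2)] L2_Ioo[OF c(3)] L2_Ioo[OF c(4)] L2_Ioo[OF f'] L2_Ioo[OF g'] L2_Ioo[OF p(2)] L2_Ioo[OF q(2)]
  show ?thesis
    unfolding H1_0_def \<Omega>_def[symmetric]
  proof (intro conjI exI allI)
    show "H1 \<Omega> (\<lambda>x. f (fst x) * g (snd x))" using W by (intro H1I)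
    show "test_fun \<Omega> (\<lambda>x. F n (fst x) * G n (snd x))" for n
      unfolding F_def G_def \<Omega>_def by (rule test_fun_cut[OF p(1) q(1)])
    let ?D = "\<lambda>n x. f (fst x) * g (snd x) - F n (fst x) * G n (snd x)"
    let ?D1 = "\<lambda>n x. f' (fst x) * g (snd x) - F' n (fst x) * G n (snd x)"
    let ?D2 = "\<lambda>n x. f (fst x) * g' (snd x) - F n (fst x) * G' n (snd x)"
    have "(H1_norm \<Omega> (?D n))\<^sup>2 = sqn \<Omega> (?D n) + sqn \<Omega> (?D1 n) + sqn \<Omega> (?D2 n)" for n
      unfolding \<Omega>_def
      by (rule H1_norm_sq_eq; unfold \<Omega>_def[symmetric]; intro L2_diff weak_deriv_diff[of a b c d, folded \<Omega>_def] W V)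
    moreover have "(\<lambda>n. sqn \<Omega> (?D n) + sqn \<Omega> (?D1 n) + sqn \<Omega> (?D2 n)) \<longlonglongrightarrow> 0 + 0 + 0"
      unfolding \<Omega>_def
      by (intro tendsto_add L2_product_tendsto L F4 p(5) G4 q(5))
    ultimately have "(\<lambda>n. sqrt ((H1_norm \<Omega> (?D n))\<^sup>2)) \<longlonglongrightarrow> sqrt 0"
      by (intro tendsto_real_sqrt) simp
    moreover have "0 \<le> H1_norm \<Omega> u" for u unfolding H1_norm_def set_lebesgue_integral_def
      by (intro real_sqrt_ge_zero integral_nonneg_AE) (auto intro!: AE_I2)
    ultimately show "(\<lambda>n. H1_norm \<Omega> (?D n)) \<longlonglongrightarrow> 0" by simp
  qed
qed

section \<open>Completeness of the sine system\<close>

text \<open>Polynomials in \<open>(r, cos \<theta>)\<close> are uniformly dense in the continuous functions on the rectangle, and multiplying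
  by \<open>r\<close> or \<open>cos \<theta>\<close> preserves the space of functions \<open>h\<close> with \<open>w h \<bottom> f(r) sin(m\<theta>)\<close> for all \<open>f\<close>, \<open>m\<close>.\<close>

lemma sine_products_complete:
  fixes a b Z :: real
  defines "\<Omega> \<equiv> {a<..<b} \<times> {0<..<Z}"
  assumes Z: "Z > 0" and w: "L2 \<Omega> w"
    and orth: "\<And>f m. continuous_on {a..b} f \<Longrightarrow> m \<ge> (1::nat) \<Longrightarrow>
      (LINT x:\<Omega>|lborel. w x * (f (fst x) * complex_of_real (sin (real m * pi * snd x / Z)))) = 0"
  shows "AE x in lborel. x \<in> \<Omega> \<longrightarrow> w x = 0"
proof -
  define \<theta> where "\<theta> = (\<lambda>x::pt. pi * snd x / Z)"
  define K where "K = {a..b} \<times> {0..Z}"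
  have \<theta>c: "continuous_on A \<theta>" for A unfolding \<theta>_def using Z by (intro continuous_intros) auto
  define V :: "(pt \<Rightarrow> complex) set" where "V = {h. continuous_on K h \<and> (\<forall>f m. continuous_on {a..b} f \<longrightarrow>
      (LINT x:\<Omega>|lborel. w x * (h x * (f (fst x) * complex_of_real (sin (real m * \<theta> x))))) = 0)}"
  have L2K: "L2 \<Omega> f" if "continuous_on K f" for f
    using that unfolding \<Omega>_def K_def by (rule L2_rect)
  have int: "set_integrable lborel \<Omega> (\<lambda>x. w x * f x)" if "continuous_on K f" for f
    using L2_mult_integrable[OF w L2K[OF that]] .
  have fs: "continuous_on K (\<lambda>x. f (fst x) * complex_of_real (sin (real m * \<theta> x)))" if "continuous_on {a..b} f" for f m
    unfolding K_def by (intro continuous_intros continuous_on_fst_comp that \<theta>c)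
  have V1: "(\<lambda>x. 1) \<in> V"
  proof -
    have "(LINT x:\<Omega>|lborel. w x * (f (fst x) * complex_of_real (sin (real m * \<theta> x)))) = 0" if "continuous_on {a..b} f" for f m
      using orth[OF that, of m] by (cases "m = 0") (simp_all add: \<theta>_def mult.assoc)
    then show ?thesis by (simp add: V_def)
  qed
  have Vadd: "(\<lambda>x. h x + g x) \<in> V" if "h \<in> V" "g \<in> V" for h g
  proof -
    have "(LINT x:\<Omega>|lborel. w x * ((h x + g x) * (f (fst x) * complex_of_real (sin (real m * \<theta> x))))) = 0"
      if f: "continuous_on {a..b} f" for f m
    proof -
      have "(LINT x:\<Omega>|lborel. w x * ((h x + g x) * (f (fst x) * complex_of_real (sin (real m * \<theta> x)))))
        = (LINT x:\<Omega>|lborel. w x * (h x * (f (fst x) * complex_of_real (sin (real m * \<theta> x)))) + w x * (g x * (f (fst x) * complex_of_real (sin (real m * \<theta> x)))))"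
        by (simp add: algebra_simps)
      also have "\<dots> = 0"
        using \<open>h \<in> V\<close> \<open>g \<in> V\<close> f by (subst set_integral_add) (auto simp: V_def intro!: int continuous_intros fs)
      finally show ?thesis .
    qed
    then show ?thesis using that by (auto simp: V_def intro!: continuous_intros)
  qed
  have Vscale: "(\<lambda>x. k * h x) \<in> V" if "h \<in> V" for h k
    using that by (auto simp: V_def mult.left_commute[of _ k] mult.assoc intro!: continuous_intros)
  have Vfst: "(\<lambda>x. of_real (fst x) * h x) \<in> V" if "h \<in> V" for h
  proof -
    have "(LINT x:\<Omega>|lborel. w x * (of_real (fst x) * h x * (f (fst x) * complex_of_real (sin (real m * \<theta> x))))) = 0"
      if f: "continuous_on {a..b} f" for f m
    proof -
      have "continuous_on {a..b} (\<lambda>r. of_real r * f r)" by (intro continuous_intros f)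
      then have "(LINT x:\<Omega>|lborel. w x * (h x * ((of_real (fst x) * f (fst x)) * complex_of_real (sin (real m * \<theta> x))))) = 0"
        using \<open>h \<in> V\<close> unfolding V_def mem_Collect_eq by blast
      then show ?thesis by (simp add: mult_ac)
    qed
    then show ?thesis using that by (auto simp: V_def intro!: continuous_intros)
  qed
  have Vcos: "(\<lambda>x. of_real (cos (\<theta> x)) * h x) \<in> V" if "h \<in> V" for h
  proof -
    have "(LINT x:\<Omega>|lborel. w x * (of_real (cos (\<theta> x)) * h x * (f (fst x) * complex_of_real (sin (real m * \<theta> x))))) = 0"
      if f: "continuous_on {a..b} f" for f m
    proof -
      define P where "P = (\<lambda>n. LINT x:\<Omega>|lborel. w x * (h x * (f (fst x) * complex_of_real (sin (real n * \<theta> x)))))"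
      have P0: "P n = 0" for n using \<open>h \<in> V\<close> f by (auto simp: V_def P_def)
      show ?thesis
      proof (cases m)
        case (Suc n)
        have eq: "w x * (of_real (cos (\<theta> x)) * h x * (f (fst x) * complex_of_real (sin (real m * \<theta> x))))
          = (1/2) * (w x * (h x * (f (fst x) * complex_of_real (sin (real (Suc m) * \<theta> x)))) + w x * (h x * (f (fst x) * complex_of_real (sin (real n * \<theta> x)))))" for x
        proof -
          \<comment> \<open>Multiplication by \<open>cos \<theta>\<close> moves the sine index by
            one in both directions and so stays in the family.\<close>
          have "cos (\<theta> x) * sin (real m * \<theta> x) = (1/2) * (sin (real (Suc m) * \<theta> x) + sin (real n * \<theta> x))"
            using sin_times_cos[of "real m * \<theta> x" "\<theta> x"] by (simp add: Suc algebra_simps)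
          from arg_cong[OF this, of complex_of_real]
          have "complex_of_real (cos (\<theta> x)) * complex_of_real (sin (real m * \<theta> x))
            = (1/2) * (complex_of_real (sin (real (Suc m) * \<theta> x)) + complex_of_real (sin (real n * \<theta> x)))"
            unfolding of_real_mult of_real_add by simp
          moreover have "W * (C * H * (G * S)) = (1/2) * (W * (H * (G * S1)) + W * (H * (G * S2)))"
            if "C * S = (1/2) * (S1 + S2)" for W C H G S S1 S2 :: complex
          proof -
            have "W * (C * H * (G * S)) = W * H * G * (C * S)" by (simp add: mult_ac)
            also have "\<dots> = (1/2) * (W * (H * (G * S1)) + W * (H * (G * S2)))"
              unfolding that by (simp add: algebra_simps)
            finally show ?thesis .
          qed
          ultimately show ?thesis by blast
        qed
        have "(LINT x:\<Omega>|lborel. w x * (of_real (cos (\<theta> x)) * h x * (f (fst x) * complex_of_real (sin (real m * \<theta> x))))) = (1/2) * (P (Suc m) + P n)"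
        proof -
          have hc: "continuous_on K h" using \<open>h \<in> V\<close> by (simp add: V_def)
          have "set_integrable lborel \<Omega> (\<lambda>x. w x * (h x * (f (fst x) * complex_of_real (sin (real n * \<theta> x)))))" for n
            by (rule int, rule continuous_on_mult[OF hc fs[OF f]])
          then show ?thesis
            unfolding eq set_integral_mult_right P_def by (simp only: set_integral_add(2))
        qed
        then show ?thesis by (simp add: P0)
      qed simp
    qed
    then show ?thesis using that \<theta>c by (auto simp: V_def intro!: continuous_intros)
  qed
  define e where "e = (\<lambda>x::pt. (fst x, cos (\<theta> x)))"
  have Vpoly: "(\<lambda>x. of_real (P (e x)) * h x) \<in> V" if "real_polynomial_function P" "h \<in> V" for P :: "pt \<Rightarrow> real" and h
    using that
  proof (induction arbitrary: h)
    case (linear P)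
    have "P (e x) = fst x * P (1, 0) + cos (\<theta> x) * P (0, 1)" for x
    proof -
      have "e x = fst x *\<^sub>R (1, 0) + cos (\<theta> x) *\<^sub>R (0, 1)" by (simp add: e_def)
      then show ?thesis using linear_add[OF bounded_linear.linear[OF linear(1)]] linear_scale[OF bounded_linear.linear[OF linear(1)]]
        by (simp del: scaleR_Pair)
    qed
    then have "(\<lambda>x. of_real (P (e x)) * h x) = (\<lambda>x. of_real (P (1, 0)) * (of_real (fst x) * h x) + of_real (P (0, 1)) * (of_real (cos (\<theta> x)) * h x))"
      by (simp add: algebra_simps)
    then show ?case using Vadd[OF Vscale[OF Vfst] Vscale[OF Vcos]] linear(2) by simp
  next
    case (const c)
    then show ?case by (rule Vscale)
  next
    case (add f g)
    then show ?case using Vadd[OF add(3) add(4)] by (simp add: algebra_simps)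
  next
    case (mult f g)
    then show ?case using mult(3)[OF mult(4)] by (simp add: algebra_simps)
  qed
  have sc: "continuous_on K (\<lambda>x. complex_of_real (sin (\<theta> x)))" by (intro continuous_intros \<theta>c)
  \<comment> \<open>Taking \<open>m = 1\<close> and constant \<open>f\<close> shows that
    \<open>w * sin \<theta>\<close> is orthogonal to all polynomials in
    \<open>(r, cos \<theta>)\<close>. The factor \<open>sin \<theta>\<close> is positive inside the
    rectangle and is divided out at the end.\<close>
  define u where "u = (\<lambda>x. w x * complex_of_real (sin (\<theta> x)))"
  have u: "L2 \<Omega> u"
    unfolding u_def mult.commute[of "w _"]
    by (rule L2_mult_bounded[OF w, where M=1]) (use L2K[OF sc] in \<open>auto simp: L2_def\<close>)
  have uP: "(LINT x:\<Omega>|lborel. u x * of_real (P (e x))) = 0" if "real_polynomial_function P" for P :: "pt \<Rightarrow> real"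
  proof -
    have "(LINT x:\<Omega>|lborel. w x * (of_real (P (e x)) * 1 * ((\<lambda>_. 1) (fst x) * complex_of_real (sin (real 1 * \<theta> x))))) = 0"
      using Vpoly[OF that V1] unfolding V_def mem_Collect_eq by (elim conjE allE[of _ "\<lambda>_. 1"] allE[of _ 1]) auto
    then show ?thesis by (simp add: u_def mult_ac)
  qed
  have ureal: "(LINT x:\<Omega>|lborel. u x * of_real (g x)) = 0" if g: "continuous_on K g" for g :: "pt \<Rightarrow> real"
  proof -
    define I where "I = (LINT x:\<Omega>|lborel. u x * of_real (g x))"
    define N where "N = (LINT x:\<Omega>|lborel. cmod (u x))"
    have ui: "set_integrable lborel \<Omega> (\<lambda>x. cmod (u x))"
      unfolding \<Omega>_def by (rule set_integrable_norm[OF L2_integrable[OF u[unfolded \<Omega>_def] sets_rect emeasure_rect_finite]])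
    have N: "N \<ge> 0" unfolding N_def set_lebesgue_integral_def by (intro integral_nonneg_AE) auto
    \<comment> \<open>The cosine maps \<open>[0, \<pi>]\<close> bijectively onto
      \<open>[-1, 1]\<close>, so a continuous function of \<open>(r, z)\<close> is a continuous
      function of \<open>(r, cos \<theta>)\<close> on a compact rectangle, where Stone-Weierstrass
      applies.\<close>
    define \<gamma> where "\<gamma> = (\<lambda>y::pt. g (fst y, Z * arccos (snd y) / pi))"
    have \<gamma>c: "continuous_on ({a..b} \<times> {-1..1}) \<gamma>"
      unfolding \<gamma>_def
    proof (rule continuous_on_compose2[OF g])
      show "continuous_on ({a..b} \<times> {- 1..1}) (\<lambda>y. (fst y, Z * arccos (snd y) / pi))"
        by (intro continuous_intros continuous_on_snd_comp[OF continuous_on_arccos']) auto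
      show "(\<lambda>y. (fst y, Z * arccos (snd y) / pi)) ` ({a..b} \<times> {- 1..1}) \<subseteq> K"
      proof clarify
        fix r c assume "r \<in> {a..b}" "c \<in> {-1..1::real}"
        then show "(fst (r, c), Z * arccos (snd (r, c)) / pi) \<in> K"
          using arccos_lbound[of c] arccos_ubound[of c] Z by (auto simp: K_def field_simps)
      qed
    qed
    have "cmod I \<le> \<epsilon>" if "\<epsilon> > 0" for \<epsilon>
    proof -
      have e1: "\<epsilon> / (N + 1) > 0" using that N by simp
      obtain P where P: "real_polynomial_function P" "\<And>y. y \<in> {a..b} \<times> {-1..1} \<Longrightarrow> \<bar>\<gamma> y - P y\<bar> < \<epsilon> / (N + 1)"
        using Stone_Weierstrass_real_polynomial_function[OF compact_rect \<gamma>c e1] by blast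
      have ge: "g x = \<gamma> (e x)" "e x \<in> {a..b} \<times> {-1..1}" if "x \<in> \<Omega>" for x
        using that Z by (auto simp: \<gamma>_def e_def \<theta>_def \<Omega>_def arccos_cos field_simps)
      have Pc: "continuous_on K (\<lambda>x. of_real (P (e x)) :: complex)"
      proof -
        have Pu: "continuous_on UNIV P"
          by (rule continuous_on_polymonial_function[OF P(1)[unfolded real_polynomial_function_eq]])
        have ec: "continuous_on K e"
          unfolding e_def by (intro continuous_on_Pair continuous_on_fst continuous_on_id continuous_on_cos \<theta>c)
        show ?thesis by (rule continuous_on_of_real[OF continuous_on_compose2[OF Pu ec subset_UNIV]])
      qed
      have gc: "continuous_on K (\<lambda>x. of_real (g x) :: complex)" by (intro continuous_intros g)
      have "I = (LINT x:\<Omega>|lborel. u x * of_real (g x)) - (LINT x:\<Omega>|lborel. u x * of_real (P (e x)))"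
        by (simp add: I_def uP[OF P(1)])
      also have "\<dots> = (LINT x:\<Omega>|lborel. u x * of_real (g x) - u x * of_real (P (e x)))"
        by (rule set_integral_diff(2)[symmetric]) (intro L2_mult_integrable u L2K gc Pc)+
      finally have I: "I = (LINT x:\<Omega>|lborel. u x * of_real (g x) - u x * of_real (P (e x)))" .
      have "cmod I \<le> (LINT x:\<Omega>|lborel. \<epsilon> / (N + 1) * cmod (u x))"
        unfolding I
      proof (rule set_integral_norm_le)
        show "set_integrable lborel \<Omega> (\<lambda>x. u x * of_real (g x) - u x * of_real (P (e x)))"
          by (intro set_integral_diff(1) L2_mult_integrable u L2K gc Pc)
        show "set_integrable lborel \<Omega> (\<lambda>x. \<epsilon> / (N + 1) * cmod (u x))" using ui by simp
        fix x assume x: "x \<in> \<Omega>"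
        have "u x * of_real (g x) - u x * of_real (P (e x)) = u x * of_real (g x - P (e x))" by (simp add: algebra_simps)
        moreover have "\<bar>g x - P (e x)\<bar> \<le> \<epsilon> / (N + 1)" using ge[OF x] P(2)[of "e x"] by simp
        ultimately show "cmod (u x * of_real (g x) - u x * of_real (P (e x))) \<le> \<epsilon> / (N + 1) * cmod (u x)"
          using mult_right_mono[of "\<bar>g x - P (e x)\<bar>" "\<epsilon> / (N + 1)" "cmod (u x)"]
          by (simp add: norm_mult mult.commute del: of_real_diff)
      qed
      also have "\<dots> = \<epsilon> / (N + 1) * N" by (simp add: N_def)
      also have "\<dots> \<le> \<epsilon>" using that N by (simp add: field_simps)
      finally show ?thesis .
    qed
    then have "cmod I \<le> 0" by (metis field_le_epsilon add_0)
    then show ?thesis by (simp add: I_def)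
  qed
  have "AE x in lborel. x \<in> {a<..<b} \<times> {0<..<Z} \<longrightarrow> u x = 0"
  proof (rule L2_orthogonal_test_funs_AE_0)
    show "L2 ({a<..<b} \<times> {0<..<Z}) u" using u by (simp add: \<Omega>_def)
    fix \<phi> assume "test_fun ({a<..<b} \<times> {0<..<Z}) \<phi>"
    then have c: "continuous_on K \<phi>" by (intro smooth_continuous_on test_fun_smooth)
    have c': "continuous_on K (\<lambda>x. complex_of_real (Re (\<phi> x)))" "continuous_on K (\<lambda>x. complex_of_real (Im (\<phi> x)))"
      by (intro continuous_intros c)+
    have "u x * \<phi> x = u x * of_real (Re (\<phi> x)) + \<i> * (u x * of_real (Im (\<phi> x)))" for x
      by (subst complex_eq[of "\<phi> x"]) (simp add: algebra_simps)
    then have "(LINT x:\<Omega>|lborel. u x * \<phi> x) = (LINT x:\<Omega>|lborel. u x * of_real (Re (\<phi> x)) + \<i> * (u x * of_real (Im (\<phi> x))))"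
      by simp
    also have "\<dots> = (LINT x:\<Omega>|lborel. u x * of_real (Re (\<phi> x))) + (LINT x:\<Omega>|lborel. \<i> * (u x * of_real (Im (\<phi> x))))"
      by (intro set_integral_add(2) set_integrable_mult_right impI L2_mult_integrable u L2K c')
    also have "\<dots> = 0"
      using ureal[of "\<lambda>x. Re (\<phi> x)"] ureal[of "\<lambda>x. Im (\<phi> x)"] c by (simp add: continuous_on_Re continuous_on_Im)
    finally show "(LINT x:{a<..<b} \<times> {0<..<Z}|lborel. u x * \<phi> x) = 0" by (simp add: \<Omega>_def)
  qed
  then show ?thesis
  proof eventually_elim
    case (elim x)
    show ?case
    proof
      assume x: "x \<in> \<Omega>"
      then have "sin (\<theta> x) > 0" unfolding \<theta>_def \<Omega>_def using Z by (intro sin_gt_zero) (auto simp: field_simps)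
      then show "w x = 0" using elim x by (auto simp: u_def \<Omega>_def)
    qed
  qed
qed

text \<open>Tensoring with the constant 1 on \<open>(0, 1)\<close> reduces the one-variable case to
  \<open>sine_products_complete\<close>.\<close>

lemma sine_complete:
  assumes Z: "Z > 0" and h: "L2 {0<..<Z} h"
    and orth: "\<And>m. m \<ge> (1::nat) \<Longrightarrow> (LINT z:{0<..<Z}|lborel. h z * complex_of_real (sin (real m * pi * z / Z))) = 0"
  shows "sqn {0<..<Z} h = 0"
proof -
  define w where "w = (\<lambda>x::pt. 1 * h (snd x))"
  have one: "L2 {0<..<1::real} (\<lambda>x. 1)" by (intro L2_Ioo continuous_intros)
  have w: "L2 ({0<..<1} \<times> {0<..<Z}) w" unfolding w_def by (rule L2_product(1)[OF one h])
  have "AE x in lborel. x \<in> {0<..<1} \<times> {0<..<Z} \<longrightarrow> w x = 0"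
  proof (rule sine_products_complete[OF Z w])
    fix f :: "real \<Rightarrow> complex" and m :: nat assume f: "continuous_on {0..1} f" and m: "1 \<le> m"
    have fs: "continuous_on ({0..1} \<times> {0..Z}) (\<lambda>x. f (fst x) * complex_of_real (sin (real m * pi * snd x / Z)))"
      using Z by (intro continuous_intros continuous_on_fst_comp f) auto
    have "(LINT x:{0<..<1} \<times> {0<..<Z}|lborel. w x * (f (fst x) * complex_of_real (sin (real m * pi * snd x / Z))))
      = (LINT r:{0<..<1}|lborel. LINT z:{0<..<Z}|lborel. f r * (h z * complex_of_real (sin (real m * pi * z / Z))))"
      by (subst set_integral_Times(1)[OF L2_mult_integrable[OF w L2_rect[OF fs]]]) (simp add: w_def mult_ac)
    also have "\<dots> = 0" using orth[OF m] by simp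
    finally show "(LINT x:{0<..<1} \<times> {0<..<Z}|lborel. w x * (f (fst x) * complex_of_real (sin (real m * pi * snd x / Z)))) = 0" .
  qed
  then have "sqn ({0<..<1} \<times> {0<..<Z}) w = sqn ({0<..<1} \<times> {0<..<Z}) (\<lambda>x::pt. 0)"
    by (intro sqn_AE_cong w L2_zero)
  then have "sqn {0<..<1::real} (\<lambda>x. 1) * sqn {0<..<Z} h = 0"
    unfolding w_def L2_product(2)[OF one h] by (simp add: sqn_def)
  moreover have "sqn {0<..<1::real} (\<lambda>x. 1) = 1"
    by (simp add: sqn_def set_lebesgue_integral_def)
  ultimately show ?thesis by simp
qed

section \<open>Linear first order systems\<close>

text \<open>In the sup norm weighted by \<open>exp (2 * L * (t - a))\<close> the integral operator
  contracts by 1/2 on the whole interval, since integrating \<open>L\<close> times the weight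
  returns at most half of it. So no continuation over short intervals arises.\<close>

lemma Picard_iteration_bound:
  fixes F :: "real \<Rightarrow> 'a::banach \<Rightarrow> 'a"
  assumes L: "L > 0" and lip: "\<And>t x y. t \<in> {a..b} \<Longrightarrow> norm (F t x - F t y) \<le> L * norm (x - y)"
    and cont: "\<And>y. continuous_on {a..b} y \<Longrightarrow> continuous_on {a..b} (\<lambda>t. F t (y t))"
    and u: "continuous_on {a..b} u" and v: "continuous_on {a..b} v"
    and le: "\<And>s. s \<in> {a..b} \<Longrightarrow> norm (u s - v s) \<le> K * exp (2 * L * (s - a))" and K: "K \<ge> 0" and t: "t \<in> {a..b}"
  shows "norm (integral {a..t} (\<lambda>s. F s (u s)) - integral {a..t} (\<lambda>s. F s (v s))) \<le> K / 2 * exp (2 * L * (t - a))"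
proof -
  have sub: "{a..t} \<subseteq> {a..b}" using t by auto
  have c: "continuous_on {a..t} (\<lambda>s. F s (u s))" "continuous_on {a..t} (\<lambda>s. F s (v s))"
    using continuous_on_subset[OF cont[OF u] sub] continuous_on_subset[OF cont[OF v] sub] by auto
  have ex: "((\<lambda>s. L * K * exp (2 * L * (s - a))) has_integral (K / 2 * exp (2 * L * (t - a)) - K / 2 * exp (2 * L * (a - a)))) {a..t}"
    using t L by (intro fundamental_theorem_of_calculus)
      (auto intro!: derivative_eq_intros simp flip: has_real_derivative_iff_has_vector_derivative)
  have "norm (integral {a..t} (\<lambda>s. F s (u s)) - integral {a..t} (\<lambda>s. F s (v s))) = norm (integral {a..t} (\<lambda>s. F s (u s) - F s (v s)))"
    using c by (simp add: Henstock_Kurzweil_Integration.integral_diff integrable_continuous_interval)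
  also have "\<dots> \<le> integral {a..t} (\<lambda>s. L * K * exp (2 * L * (s - a)))"
  proof (rule Henstock_Kurzweil_Integration.integral_norm_bound_integral)
    show "(\<lambda>s. F s (u s) - F s (v s)) integrable_on {a..t}"
      by (intro integrable_continuous_interval continuous_intros c)
    show "(\<lambda>s. L * K * exp (2 * L * (s - a))) integrable_on {a..t}" using ex by (rule has_integral_integrable)
    fix s assume "s \<in> {a..t}"
    then have s: "s \<in> {a..b}" using t by auto
    have "norm (F s (u s) - F s (v s)) \<le> L * norm (u s - v s)" by (rule lip[OF s])
    also have "\<dots> \<le> L * (K * exp (2 * L * (s - a)))" using le[OF s] L by simp
    finally show "norm (F s (u s) - F s (v s)) \<le> L * K * exp (2 * L * (s - a))" by simp
  qed
  also have "\<dots> \<le> K / 2 * exp (2 * L * (t - a))"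
    using integral_unique[OF ex] K by simp
  finally show ?thesis .
qed

text \<open>The Lipschitz bound is global in space. Successive differences of the iterates halve in
  the weighted norm, so their telescoping series converges uniformly on all of \<open>[a, b]\<close>
  by the Weierstrass test.\<close>

theorem Picard_global:
  fixes F :: "real \<Rightarrow> 'a::banach \<Rightarrow> 'a"
  assumes ab: "a \<le> b" and L: "L > 0" and lip: "\<And>t x y. t \<in> {a..b} \<Longrightarrow> norm (F t x - F t y) \<le> L * norm (x - y)"
    and cont: "\<And>y. continuous_on {a..b} y \<Longrightarrow> continuous_on {a..b} (\<lambda>t. F t (y t))"
  obtains y where "y a = y0" "\<And>t. t \<in> {a..b} \<Longrightarrow> (y has_vector_derivative F t (y t)) (at t within {a..b})"
proof -
  define T where "T = (\<lambda>u t. y0 + integral {a..t} (\<lambda>s. F s (u s)))"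
  define Y where "Y = (\<lambda>n. (T ^^ n) (\<lambda>_. y0))"
  have Y0: "Y 0 = (\<lambda>_. y0)" and YS: "Y (Suc n) = T (Y n)" for n by (simp_all add: Y_def)
  have Tc: "continuous_on {a..b} (T u)" if "continuous_on {a..b} u" for u
    unfolding T_def by (intro continuous_intros indefinite_integral_continuous_1 integrable_continuous_interval cont that)
  have Yc: "continuous_on {a..b} (Y n)" for n
    by (induction n) (auto simp: Y0 YS intro: Tc)
  have "bounded ((\<lambda>t. Y 1 t - Y 0 t) ` {a..b})"
    by (intro compact_imp_bounded compact_continuous_image continuous_intros Yc) auto
  then obtain M where M: "\<And>t. t \<in> {a..b} \<Longrightarrow> norm (Y 1 t - Y 0 t) \<le> M"
    unfolding bounded_iff by fastforce
  have M0: "M \<ge> 0" using order_trans[OF norm_ge_zero M[of a]] ab by simp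
  have step: "norm (Y (Suc n) t - Y n t) \<le> M / 2 ^ n * exp (2 * L * (t - a))" if "t \<in> {a..b}" for n t
    using that
  proof (induction n arbitrary: t)
    case 0
    have "exp (2 * L * (t - a)) \<ge> 1" using 0 L by simp
    then have "M * 1 \<le> M * exp (2 * L * (t - a))" using M0 by (rule mult_left_mono)
    with M[OF 0] show ?case by simp
  next
    case (Suc n)
    have "norm (integral {a..t} (\<lambda>s. F s (Y (Suc n) s)) - integral {a..t} (\<lambda>s. F s (Y n s)))
      \<le> M / 2 ^ n / 2 * exp (2 * L * (t - a))"
      by (rule Picard_iteration_bound[OF L lip cont Yc Yc Suc.IH]) (use M0 Suc.prems in auto)
    then show ?case by (simp add: YS[of "Suc n"] YS[of n] T_def mult.commute)
  qed
  define G where "G = (\<lambda>n t. Y (Suc n) t - Y n t)"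
  have "uniform_limit {a..b} (\<lambda>n t. \<Sum>i<n. G i t) (\<lambda>t. suminf (\<lambda>i. G i t)) sequentially"
  proof (rule Weierstrass_m_test)
    show "norm (G n t) \<le> M * exp (2 * L * (b - a)) * (1 / 2) ^ n" if t: "t \<in> {a..b}" for n t
    proof -
      have "norm (G n t) \<le> M / 2 ^ n * exp (2 * L * (t - a))" unfolding G_def by (rule step[OF t])
      also have "\<dots> \<le> M / 2 ^ n * exp (2 * L * (b - a))" using t M0 L by (intro mult_left_mono) auto
      finally show ?thesis by (simp add: power_divide)
    qed
    show "summable (\<lambda>n. M * exp (2 * L * (b - a)) * (1 / 2) ^ n)" by (intro summable_mult summable_geometric) simp
  qed
  then have "uniform_limit {a..b} (\<lambda>n t. y0 + (\<Sum>i<n. G i t)) (\<lambda>t. y0 + suminf (\<lambda>i. G i t)) sequentially"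
    by (intro uniform_limit_intros)
  moreover have "y0 + (\<Sum>i<n. G i t) = Y n t" for n t
    using sum_lessThan_telescope[of "\<lambda>i. Y i t" n] by (simp add: G_def Y0)
  ultimately obtain y where y: "uniform_limit {a..b} Y y sequentially" by auto
  have yc: "continuous_on {a..b} y"
    using uniform_limit_theorem[OF _ y] Yc by auto
  have fix_eq: "y t = y0 + integral {a..t} (\<lambda>s. F s (y s))" if t: "t \<in> {a..b}" for t
  proof -
    have sub: "{a..t} \<subseteq> {a..b}" using t by auto
    have "(\<lambda>n. Y n t) \<longlonglongrightarrow> y t" using tendsto_uniform_limitI[OF y t] .
    then have 1: "(\<lambda>n. Y (Suc n) t) \<longlonglongrightarrow> y t" by (rule LIMSEQ_Suc)
    have "(\<lambda>n. integral {a..t} (\<lambda>s. F s (Y n s)) - integral {a..t} (\<lambda>s. F s (y s))) \<longlonglongrightarrow> 0"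
    proof (rule LIMSEQ_I)
      fix e :: real assume e: "e > 0"
      \<comment> \<open>Uniform closeness \<open>\<delta>\<close> of the iterates becomes closeness
        \<open>e / 2\<close> of the integrals through the iteration bound.\<close>
      define \<delta> where "\<delta> = e / exp (2 * L * (t - a))"
      have \<delta>: "\<delta> > 0" using e by (simp add: \<delta>_def)
      obtain N where N: "\<And>n s. n \<ge> N \<Longrightarrow> s \<in> {a..b} \<Longrightarrow> dist (Y n s) (y s) < \<delta>"
        using uniform_limitD[OF y \<delta>] unfolding eventually_sequentially by blast
      have "norm (integral {a..t} (\<lambda>s. F s (Y n s)) - integral {a..t} (\<lambda>s. F s (y s))) \<le> \<delta> / 2 * exp (2 * L * (t - a))" if n: "n \<ge> N" for n
      proof (rule Picard_iteration_bound[OF L lip cont Yc yc _ _ t])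
        show "norm (Y n s - y s) \<le> \<delta> * exp (2 * L * (s - a))" if s: "s \<in> {a..b}" for s
        proof -
          have "norm (Y n s - y s) \<le> \<delta> * 1" using N[OF n s] by (simp add: dist_norm)
          also have "\<dots> \<le> \<delta> * exp (2 * L * (s - a))" using s L \<delta> by (intro mult_left_mono) auto
          finally show ?thesis .
        qed
      qed (use \<delta> in auto)
      note bd = this
      have lt: "\<delta> / 2 * exp (2 * L * (t - a)) < e" using e by (simp add: \<delta>_def)
      show "\<exists>N. \<forall>n\<ge>N. norm (integral {a..t} (\<lambda>s. F s (Y n s)) - integral {a..t} (\<lambda>s. F s (y s)) - 0) < e"
        unfolding diff_zero by (rule exI[of _ N], intro allI impI, rule le_less_trans[OF bd lt])
    qed
    then have "(\<lambda>n. y0 + integral {a..t} (\<lambda>s. F s (Y n s))) \<longlonglongrightarrow> y0 + integral {a..t} (\<lambda>s. F s (y s))"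
      by (intro tendsto_intros) (rule LIM_zero_cancel)
    then have "(\<lambda>n. Y (Suc n) t) \<longlonglongrightarrow> y0 + integral {a..t} (\<lambda>s. F s (y s))" by (simp add: YS T_def)
    with 1 show ?thesis by (rule LIMSEQ_unique)
  qed
  show ?thesis
  proof
    show "y a = y0" using fix_eq[of a] ab by simp
    show "(y has_vector_derivative F t (y t)) (at t within {a..b})" if t: "t \<in> {a..b}" for t
    proof -
      have "((\<lambda>t. y0 + integral {a..t} (\<lambda>s. F s (y s))) has_vector_derivative 0 + F t (y t)) (at t within {a..b})"
        by (intro has_vector_derivative_add has_vector_derivative_const integral_has_vector_derivative cont yc t)
      then show ?thesis
        by (subst has_vector_derivative_cong_ev[where g="\<lambda>t. y0 + integral {a..t} (\<lambda>s. F s (y s))"])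
           (use fix_eq t in \<open>auto simp: eventually_nhds intro: exI[of _ UNIV]\<close>)
    qed
  qed
qed

text \<open>The flux \<open>p\<close> is an unknown of its own, so the coefficients are never
  differentiated and continuity suffices. The modes of the solution have \<open>f = 0\<close>; a
  source \<open>f\<close> occurs in the dual problem for uniqueness.\<close>

definition ode_sol :: "real \<Rightarrow> real \<Rightarrow> (real \<Rightarrow> complex) \<Rightarrow> (real \<Rightarrow> complex) \<Rightarrow> (real \<Rightarrow> complex) \<Rightarrow>
    (real \<Rightarrow> complex) \<Rightarrow> (real \<Rightarrow> complex) \<Rightarrow> bool" where
  "ode_sol a b A B f q p \<longleftrightarrow>
     (\<forall>t\<in>{a..b}. (q has_vector_derivative A t * p t) (at t within {a..b}) \<and>
       (p has_vector_derivative B t * q t - f t) (at t within {a..b}))"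

lemma ode_sol_exists:
  assumes ab: "a \<le> b" and A: "continuous_on {a..b} A" and B: "continuous_on {a..b} B" and f: "continuous_on {a..b} f"
  obtains q p where "ode_sol a b A B f q p" "q a = q0" "p a = p0"
proof -
  define F where "F = (\<lambda>t (y :: complex \<times> complex). (A t * snd y, B t * fst y - f t))"
  have "bounded (A ` {a..b})" "bounded (B ` {a..b})"
    by (intro compact_imp_bounded compact_continuous_image A B compact_Icc)+
  then obtain K1 K2 where K: "\<And>t. t \<in> {a..b} \<Longrightarrow> cmod (A t) \<le> K1" "\<And>t. t \<in> {a..b} \<Longrightarrow> cmod (B t) \<le> K2"
    unfolding bounded_iff by fastforce
  have K0: "K1 \<ge> 0" "K2 \<ge> 0" using order_trans[OF norm_ge_zero K(1)[of a]] order_trans[OF norm_ge_zero K(2)[of a]] ab by auto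
  have lip: "norm (F t x - F t y) \<le> (K1 + K2 + 1) * norm (x - y)" if t: "t \<in> {a..b}" for t x y
  proof -
    have "F t x - F t y = (A t * snd (x - y), B t * fst (x - y))" by (simp add: F_def algebra_simps)
    also have "norm \<dots> \<le> norm (A t * snd (x - y)) + norm (B t * fst (x - y))" by (rule norm_Pair_le)
    also have "\<dots> \<le> K1 * norm (x - y) + K2 * norm (x - y)"
    proof -
      have "cmod (fst z) \<le> norm z" "cmod (snd z) \<le> norm z" for z :: "complex \<times> complex"
        using norm_fst_le[of "fst z" "snd z"] norm_snd_le[of "snd z" "fst z"] by simp_all
      from this[of "x - y"] show ?thesis
        unfolding norm_mult using K[OF t] K0 by (intro add_mono mult_mono) auto
    qed
    also have "\<dots> \<le> (K1 + K2 + 1) * norm (x - y)" by (simp add: algebra_simps)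
    finally show ?thesis .
  qed
  have cont: "continuous_on {a..b} (\<lambda>t. F t (y t))" if "continuous_on {a..b} y" for y
    unfolding F_def by (intro continuous_intros A B f that)
  have L: "K1 + K2 + 1 > 0" using K0 by simp
  obtain y where y: "y a = (q0, p0)" "\<And>t. t \<in> {a..b} \<Longrightarrow> (y has_vector_derivative F t (y t)) (at t within {a..b})"
    using Picard_global[OF ab L lip cont, of "(q0, p0)"] by blast
  show ?thesis
  proof
    show "ode_sol a b A B f (\<lambda>t. fst (y t)) (\<lambda>t. snd (y t))"
      unfolding ode_sol_def
    proof (intro ballI conjI)
      fix t assume t: "t \<in> {a..b}"
      show "((\<lambda>t. fst (y t)) has_vector_derivative A t * snd (y t)) (at t within {a..b})"
        using bounded_linear.has_vector_derivative[OF bounded_linear_fst y(2)[OF t]] by (simp add: F_def)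
      show "((\<lambda>t. snd (y t)) has_vector_derivative B t * fst (y t) - f t) (at t within {a..b})"
        using bounded_linear.has_vector_derivative[OF bounded_linear_snd y(2)[OF t]] by (simp add: F_def)
    qed
  qed (use y in auto)
qed

lemma ode_sol_combine:
  assumes "ode_sol a b A B f q p" "ode_sol a b A B (\<lambda>_. 0) q' p'"
  shows "ode_sol a b A B f (\<lambda>t. q t - c * q' t) (\<lambda>t. p t - c * p' t)"
  unfolding ode_sol_def
proof (intro ballI conjI)
  fix t assume t: "t \<in> {a..b}"
  note * = assms[unfolded ode_sol_def, rule_format, OF t]
  have "((\<lambda>t. q t - c * q' t) has_vector_derivative A t * p t - c * (A t * p' t)) (at t within {a..b})"
    using * by (intro derivative_intros) auto
  then show "((\<lambda>t. q t - c * q' t) has_vector_derivative A t * (p t - c * p' t)) (at t within {a..b})"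
    by (simp add: algebra_simps)
  have "((\<lambda>t. p t - c * p' t) has_vector_derivative (B t * q t - f t) - c * (B t * q' t - 0)) (at t within {a..b})"
    using * by (intro derivative_intros) auto
  then show "((\<lambda>t. p t - c * p' t) has_vector_derivative B t * (q t - c * q' t) - f t) (at t within {a..b})"
    by (simp add: algebra_simps)
qed

text \<open>Shooting: by uniqueness the homogeneous solution with \<open>q a = 0\<close> and
  \<open>p a = 1\<close> is nonzero at \<open>b\<close>, and a multiple of it corrects the end value
  of any solution of an initial value problem.\<close>

lemma bvp_exists:
  assumes ab: "a \<le> b" and A: "continuous_on {a..b} A" and B: "continuous_on {a..b} B" and f: "continuous_on {a..b} f"
    and uniq: "\<And>q p. ode_sol a b A B (\<lambda>_. 0) q p \<Longrightarrow> q a = 0 \<Longrightarrow> q b = 0 \<Longrightarrow> p a = 0"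
  obtains q p where "ode_sol a b A B f q p" "q a = q0" "q b = 0"
proof -
  obtain q1 p1 where 1: "ode_sol a b A B (\<lambda>_. 0) q1 p1" "q1 a = 0" "p1 a = 1"
    using ode_sol_exists[OF ab A B continuous_on_const] by blast
  have nz: "q1 b \<noteq> 0" using uniq[OF 1(1,2)] 1(3) by auto
  obtain q2 p2 where 2: "ode_sol a b A B f q2 p2" "q2 a = q0" "p2 a = 0"
    using ode_sol_exists[OF ab A B f] by blast
  show ?thesis
    by (rule that[OF ode_sol_combine[OF 2(1) 1(1), of "q2 b / q1 b"]]) (use 1 2 nz in auto)
qed

lemma ode_sol_continuous:
  assumes "ode_sol a b A B f q p"
  shows "continuous_on {a..b} q" "continuous_on {a..b} p"
proof -
  have d: "(q has_vector_derivative A t * p t) (at t within {a..b})"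
    "(p has_vector_derivative B t * q t - f t) (at t within {a..b})" if "t \<in> {a..b}" for t
    using assms that unfolding ode_sol_def by blast+
  show "continuous_on {a..b} q" by (rule continuous_on_vector_derivative[OF d(1)])
  show "continuous_on {a..b} p" by (rule continuous_on_vector_derivative[OF d(2)])
qed

text \<open>The integrand is the derivative of \<open>p * g\<close>. Choosing
  \<open>g = cnj q\<close> gives the energy identity, choosing a lift of the boundary value gives
  the competitor in \<open>S_le\<close>.\<close>

lemma ode_sol_energy:
  assumes ab: "a \<le> b" and s: "ode_sol a b A B (\<lambda>_. 0) q p" and B: "continuous_on {a..b} B"
    and g: "\<And>t. t \<in> {a..b} \<Longrightarrow> (g has_vector_derivative g' t) (at t within {a..b})" and g': "continuous_on {a..b} g'"
  shows "(LINT t:{a<..<b}|lborel. p t * g' t + B t * q t * g t) = p b * g b - p a * g a"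
proof (rule set_integral_FTC[OF ab])
  show "((\<lambda>t. p t * g t) has_vector_derivative p t * g' t + B t * q t * g t) (at t within {a..b})" if "a \<le> t" "t \<le> b" for t
    using has_vector_derivative_mult[of p "B t * q t" t "{a..b}" g "g' t"] s g[of t] that by (simp add: ode_sol_def)
  have "continuous_on {a..b} g" by (rule continuous_on_vector_derivative[OF g])
  then show "continuous_on {a..b} (\<lambda>t. p t * g' t + B t * q t * g t)"
    by (intro continuous_intros ode_sol_continuous[OF s] B g')
qed

lemma ode_sol_energy_self:
  assumes ab: "a \<le> b" and s: "ode_sol a b A B (\<lambda>_. 0) q p" and A: "continuous_on {a..b} A" and B: "continuous_on {a..b} B"
  shows "(LINT t:{a<..<b}|lborel. cnj (A t) * of_real ((cmod (p t))\<^sup>2) + B t * of_real ((cmod (q t))\<^sup>2)) = p b * cnj (q b) - p a * cnj (q a)"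
proof -
  have "(LINT t:{a<..<b}|lborel. p t * cnj (A t * p t) + B t * q t * cnj (q t)) = p b * cnj (q b) - p a * cnj (q a)"
  proof (rule ode_sol_energy[OF ab s B])
    show "((\<lambda>t. cnj (q t)) has_vector_derivative cnj (A t * p t)) (at t within {a..b})" if "t \<in> {a..b}" for t
      using s that unfolding ode_sol_def by (intro bounded_linear.has_vector_derivative[OF bounded_linear_cnj]) blast
    show "continuous_on {a..b} (\<lambda>t. cnj (A t * p t))"
      by (intro continuous_intros ode_sol_continuous[OF s] A)
  qed
  then show ?thesis by (simp only: complex_norm_square complex_cnj_mult mult_ac)
qed

section \<open>The mode equation\<close>

lemma set_integral_Icc_mono:
  fixes f g :: "real \<Rightarrow> real"
  assumes "continuous_on {a..b} f" "continuous_on {a..b} g" "\<And>x. x \<in> {a<..<b} \<Longrightarrow> f x \<le> g x"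
  shows "(LINT x:{a<..<b}|lborel. f x) \<le> (LINT x:{a<..<b}|lborel. g x)"
  using assms by (intro set_integral_mono set_integrable_continuous[of "{a..b}"]) auto

lemma set_integral_Icc_add:
  fixes f g :: "real \<Rightarrow> real"
  assumes "continuous_on {a..b} f" "continuous_on {a..b} g"
  shows "(LINT x:{a<..<b}|lborel. f x + g x) = (LINT x:{a<..<b}|lborel. f x) + (LINT x:{a<..<b}|lborel. g x)"
  using assms by (intro set_integral_add(2) set_integrable_continuous[of "{a..b}"]) auto

lemma set_integral_Re:
  fixes f :: "real \<Rightarrow> complex"
  assumes "continuous_on {a..b} f"
  shows "Re (LINT x:{a<..<b}|lborel. f x) = (LINT x:{a<..<b}|lborel. Re (f x))"
    and "Im (LINT x:{a<..<b}|lborel. f x) = (LINT x:{a<..<b}|lborel. Im (f x))"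
proof -
  have "set_integrable lborel {a<..<b} f"
    using assms by (intro set_integrable_continuous[of "{a..b}"]) auto
  then have i: "integrable lborel (\<lambda>x. indicator {a<..<b} x *\<^sub>R f x)" by (simp add: set_integrable_def)
  show "Re (LINT x:{a<..<b}|lborel. f x) = (LINT x:{a<..<b}|lborel. Re (f x))"
    using integral_Re[OF i] by (simp add: set_lebesgue_integral_def)
  show "Im (LINT x:{a<..<b}|lborel. f x) = (LINT x:{a<..<b}|lborel. Im (f x))"
    using integral_Im[OF i] by (simp add: set_lebesgue_integral_def)
qed

lemma set_integral_norm_Icc:
  fixes f :: "real \<Rightarrow> complex"
  assumes "continuous_on {a..b} f"
  shows "cmod (LINT x:{a<..<b}|lborel. f x) \<le> (LINT x:{a<..<b}|lborel. cmod (f x))"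
  using assms by (intro set_integral_norm_le set_integrable_continuous[of "{a..b}"] continuous_intros) auto

lemma set_integral_Icc_nonneg_eq_0:
  fixes f :: "real \<Rightarrow> real"
  assumes ab: "a < b" and f: "continuous_on {a..b} f" "\<And>x. x \<in> {a..b} \<Longrightarrow> f x \<ge> 0"
    and 0: "(LINT x:{a<..<b}|lborel. f x) = 0" and x: "x \<in> {a..b}"
  shows "f x = 0"
proof -
  have "set_integrable lborel {a..b} f" by (rule set_integrable_continuous[OF compact_Icc f(1)]) auto
  then have "(LINT x:{a..b}|lborel. f x) = integral {a..b} f" by (rule set_borel_integral_eq_integral(2))
  with 0 have "integral {a..b} f = 0" by (simp add: set_integral_Ioo_Icc)
  with integral_eq_0_iff[OF f(1) ab f(2)] x show ?thesis by auto
qed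

text \<open>At \<open>t = \<theta> / H\<close> the \<open>N\<close> term on the right is half the
  one on the left. In use, \<open>\<theta>\<close> is a coercivity constant, \<open>S\<close> the
  modulus of the flux at \<open>R\<close>, \<open>N\<close> the energy of the mode and
  \<open>G\<close> that of the lift.\<close>

lemma absorb_quadratic:
  fixes N G S \<theta> H :: real
  assumes "\<theta> > 0" "H > 0" "\<theta> * N \<le> S" "\<And>t. t > 0 \<Longrightarrow> S \<le> H * (t * N + G / t) / 2"
  shows "N \<le> H\<^sup>2 * G / \<theta>\<^sup>2"
proof -
  have "\<theta> * N \<le> H * ((\<theta> / H) * N + G / (\<theta> / H)) / 2"
    using assms(3) assms(4)[of "\<theta> / H"] assms(1,2) by simp
  also have "\<dots> = \<theta> * N / 2 + H\<^sup>2 * G / (2 * \<theta>)"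
    using assms(1,2) by (simp add: field_simps power2_eq_square)
  also have "H\<^sup>2 * G / (2 * \<theta>) = (H\<^sup>2 * G / \<theta>) / 2" by simp
  finally have le: "\<theta> * N \<le> \<theta> * N / 2 + H\<^sup>2 * G / \<theta> / 2" .
  have "u \<le> v" if "u \<le> u / 2 + v / 2" for u v :: real using that by simp
  from this[OF le] have "\<theta> * N \<le> H\<^sup>2 * G / \<theta>" .
  then show ?thesis using assms(1) by (simp add: field_simps power2_eq_square)
qed

section \<open>The coefficients of the layer and the modal boundary value problem\<close>

definition al :: "real \<Rightarrow> real \<Rightarrow> real \<Rightarrow> complex" where
  "al \<chi>0 R r = Complex (1 + 2 * \<chi>0 * (r - R)) (2 * \<chi>0 * (r - R))"

definition be :: "real \<Rightarrow> real \<Rightarrow> real \<Rightarrow> complex" where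
  "be \<chi>0 R r = Complex (1 + \<chi>0 * (r - R)\<^sup>2 / r) (\<chi>0 * (r - R)\<^sup>2 / r)"

text \<open>\<open>al\<close> is a closed formula, evidently continuous up to \<open>R\<close>, and
  replaces the derivative in \<open>alpha\<close> from here on. Agreement for \<open>r > R\<close>
  covers the open layer and the end point \<open>\<rho>\<close>.\<close>

lemma alpha_eq_al: assumes "r > R" shows "alpha \<chi>0 R r = al \<chi>0 R r"
proof -
  have "((\<lambda>r. \<chi>0 * (r - R)\<^sup>2) has_real_derivative 2 * \<chi>0 * (r - R)) (at r)"
    by (auto intro!: derivative_eq_intros)
  then have "(chi \<chi>0 R has_real_derivative 2 * \<chi>0 * (r - R)) (at r)"
    by (rule has_field_derivative_transform_within_open[of _ _ _ "{R<..}"]) (use assms in \<open>auto simp: chi_def\<close>)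
  then have "deriv (chi \<chi>0 R) r = 2 * \<chi>0 * (r - R)" by (rule DERIV_imp_deriv)
  then show ?thesis by (simp add: alpha_def al_def complex_eq_iff)
qed

lemma beta_eq_be: assumes "r > R" shows "beta \<chi>0 R r = be \<chi>0 R r"
  using assms by (simp add: beta_def be_def chi_def complex_eq_iff)

text \<open>With \<open>q = w\<close> and \<open>p = w' / (r \<alpha> \<beta>)\<close>, the \<open>m\<close>-th sine mode of the PML equation is the first order system with
  the coefficients \<open>cA\<close> and \<open>cB\<close> for \<open>l = k\<^sub>m\<^sup>2\<close>.\<close>

definition cA :: "real \<Rightarrow> real \<Rightarrow> real \<Rightarrow> complex" where
  "cA \<chi>0 R r = of_real r * al \<chi>0 R r * be \<chi>0 R r"

definition cB :: "real \<Rightarrow> real \<Rightarrow> real \<Rightarrow> real \<Rightarrow> complex" where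
  "cB l \<chi>0 R r = - of_real l * al \<chi>0 R r / (of_real r * be \<chi>0 R r)"

text \<open>Both coefficients have the shape \<open>1 + (1 + \<i>) * x\<close> with real
  \<open>x\<close>. The signs of all energy weights are read off from these products.\<close>

lemma Complex_shift_mult:
  "Re (Complex (1 + x) x * Complex (1 + y) y) = 1 + x + y"
  "Im (Complex (1 + x) x * Complex (1 + y) y) = x + y + 2 * x * y"
  by (simp_all add: algebra_simps)

lemma Complex_shift_mult_cnj:
  "Complex (1 + x) x * cnj (Complex (1 + y) y) = Complex (1 + x + y + 2 * x * y) (x - y)"
  by (simp add: complex_eq_iff algebra_simps)

locale pml_interval =
  fixes R \<rho> \<chi>0 :: real
  assumes R: "R > 0" and \<rho>: "\<rho> \<ge> 2 * R" and \<chi>0: "\<chi>0 > 0"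
begin

text \<open>For \<open>r \<ge> R\<close>, \<open>a\<close> and \<open>b\<close> are the profiles
  \<open>\<chi>'(r)\<close> and \<open>\<chi>(r) / r\<close>, so that
  \<open>\<alpha> = 1 + (1 + \<i>) * a\<close> and
  \<open>\<beta> = 1 + (1 + \<i>) * b\<close>.\<close>

abbreviation "s r \<equiv> r - R"
abbreviation "a r \<equiv> 2 * \<chi>0 * (r - R)"
abbreviation "b r \<equiv> \<chi>0 * (r - R)\<^sup>2 / r"

lemma Rlt: "R < \<rho>" using R \<rho> by simp

lemma a_nonneg: "r \<ge> R \<Longrightarrow> 0 \<le> a r" using \<chi>0 by simp
lemma b_nonneg: "r \<ge> R \<Longrightarrow> 0 \<le> b r" using \<chi>0 R by simp

text \<open>Because \<open>r - R \<le> r\<close>. Half of \<open>a\<close> is left over in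
  \<open>Im (\<alpha> * cnj \<beta>) = a - b\<close>, and \<open>2 * b \<le> a\<close> also yields
  \<open>Re (\<alpha> / \<beta>) \<ge> 1\<close>.\<close>

lemma b_le: assumes "r \<ge> R" shows "b r \<le> a r / 2"
proof -
  have "(r - R)\<^sup>2 \<le> (r - R) * r" using assms R unfolding power2_eq_square by (intro mult_left_mono) auto
  then have "\<chi>0 * (r - R)\<^sup>2 \<le> \<chi>0 * ((r - R) * r)" using \<chi>0 by (intro mult_left_mono) auto
  then show ?thesis using assms R by (simp add: field_simps)
qed

lemma b_le': assumes "r \<ge> R" shows "b r \<le> a r"
  using b_le[OF assms] a_nonneg[OF assms] by linarith

lemma be_norm_sq: "(cmod (be \<chi>0 R r))\<^sup>2 = 1 + 2 * b r + 2 * (b r)\<^sup>2"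
  unfolding be_def cmod_power2 complex.sel power2_sum by simp

lemma al_norm_sq: "(cmod (al \<chi>0 R r))\<^sup>2 = 1 + 2 * a r + 2 * (a r)\<^sup>2"
  unfolding al_def cmod_power2 complex.sel power2_sum by simp

lemma norm_le_of_sq: "x\<^sup>2 = 1 + 2 * y + 2 * y\<^sup>2 \<Longrightarrow> 0 \<le> y \<Longrightarrow> x \<le> 1 + 2 * y" for x y :: real
  by (rule power2_le_imp_le) (auto simp: power2_sum power_mult_distrib)

lemma norm_ge_of_sq: "x\<^sup>2 = 1 + 2 * y + 2 * y\<^sup>2 \<Longrightarrow> 0 \<le> y \<Longrightarrow> 0 \<le> x \<Longrightarrow> 1 \<le> x" for x y :: real
  by (rule power2_le_imp_le) auto

lemma be_le: "r \<ge> R \<Longrightarrow> cmod (be \<chi>0 R r) \<le> 1 + 2 * b r"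
  by (rule norm_le_of_sq[OF be_norm_sq b_nonneg])
lemma al_le: "r \<ge> R \<Longrightarrow> cmod (al \<chi>0 R r) \<le> 1 + 2 * a r"
  by (rule norm_le_of_sq[OF al_norm_sq a_nonneg])
lemma be_ge: "r \<ge> R \<Longrightarrow> 1 \<le> cmod (be \<chi>0 R r)"
  by (rule norm_ge_of_sq[OF be_norm_sq b_nonneg]) auto
lemma al_ge: "r \<ge> R \<Longrightarrow> 1 \<le> cmod (al \<chi>0 R r)"
  by (rule norm_ge_of_sq[OF al_norm_sq a_nonneg]) auto

lemma al_nz: "r \<ge> R \<Longrightarrow> al \<chi>0 R r \<noteq> 0" using al_ge[of r] by auto
lemma be_nz: "r \<ge> R \<Longrightarrow> be \<chi>0 R r \<noteq> 0" using be_ge[of r] by auto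

lemma al_cont: "continuous_on {R..\<rho>} (al \<chi>0 R)"
  unfolding al_def[abs_def] Complex_eq by (intro continuous_intros)

lemma be_cont: "continuous_on {R..\<rho>} (be \<chi>0 R)"
  unfolding be_def[abs_def] Complex_eq using R by (intro continuous_intros) auto

lemma cA_cont: "continuous_on {R..\<rho>} (cA \<chi>0 R)"
  unfolding cA_def[abs_def] by (intro continuous_intros al_cont be_cont)

lemma cB_cont: "continuous_on {R..\<rho>} (cB l \<chi>0 R)"
  unfolding cB_def[abs_def] using R be_nz by (intro continuous_intros al_cont be_cont) auto

lemma al_be_Re: "Re (al \<chi>0 R r * be \<chi>0 R r) = 1 + a r + b r"
  and al_be_Im: "Im (al \<chi>0 R r * be \<chi>0 R r) = a r + b r + 2 * a r * b r"
  unfolding al_def be_def by (simp_all only: Complex_shift_mult)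

lemma al_div_be: "al \<chi>0 R r / be \<chi>0 R r = Complex (1 + a r + b r + 2 * a r * b r) (a r - b r) / of_real ((cmod (be \<chi>0 R r))\<^sup>2)"
proof -
  have "al \<chi>0 R r / be \<chi>0 R r = (al \<chi>0 R r * cnj (be \<chi>0 R r)) / of_real ((cmod (be \<chi>0 R r))\<^sup>2)"
    by (metis complex_div_cnj of_real_power)
  also have "al \<chi>0 R r * cnj (be \<chi>0 R r) = Complex (1 + a r + b r + 2 * a r * b r) (a r - b r)"
    unfolding al_def be_def by (rule Complex_shift_mult_cnj)
  finally show ?thesis .
qed

lemma cA_Re: "Re (cnj (cA \<chi>0 R r)) = r * (1 + a r + b r)"
  and cA_Im: "Im (cnj (cA \<chi>0 R r)) = - (r * (a r + b r + 2 * a r * b r))"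
proof -
  have "cA \<chi>0 R r = of_real r * (al \<chi>0 R r * be \<chi>0 R r)" by (simp add: cA_def mult.assoc)
  then have "cA \<chi>0 R r = Complex (r * (1 + a r + b r)) (r * (a r + b r + 2 * a r * b r))"
    using al_be_Re[of r] al_be_Im[of r] by (simp add: complex_eq_iff)
  then show "Re (cnj (cA \<chi>0 R r)) = r * (1 + a r + b r)" "Im (cnj (cA \<chi>0 R r)) = - (r * (a r + b r + 2 * a r * b r))"
    by simp_all
qed

lemma cB_Re: "Re (cB l \<chi>0 R r) = - l * ((1 + a r + b r + 2 * a r * b r) / (r * (cmod (be \<chi>0 R r))\<^sup>2))"
  and cB_Im: "Im (cB l \<chi>0 R r) = - l * ((a r - b r) / (r * (cmod (be \<chi>0 R r))\<^sup>2))"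
proof -
  have "cB l \<chi>0 R r = of_real (- l / r) * (al \<chi>0 R r / be \<chi>0 R r)" by (simp add: cB_def)
  also have "\<dots> = of_real (- l / r / (cmod (be \<chi>0 R r))\<^sup>2) * Complex (1 + a r + b r + 2 * a r * b r) (a r - b r)"
    unfolding al_div_be by simp
  finally have *: "cB l \<chi>0 R r = of_real (- l / r / (cmod (be \<chi>0 R r))\<^sup>2) * Complex (1 + a r + b r + 2 * a r * b r) (a r - b r)" .
  show "Re (cB l \<chi>0 R r) = - l * ((1 + a r + b r + 2 * a r * b r) / (r * (cmod (be \<chi>0 R r))\<^sup>2))"
    "Im (cB l \<chi>0 R r) = - l * ((a r - b r) / (r * (cmod (be \<chi>0 R r))\<^sup>2))"
    unfolding * by (simp_all add: mult.commute)
qed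

lemma ab_nonneg: assumes "r \<ge> R" shows "0 \<le> a r + b r + 2 * a r * b r"
proof -
  have "0 \<le> x + y + 2 * x * y" if "x \<ge> 0" "y \<ge> 0" for x y :: real
    using that by (intro add_nonneg_nonneg mult_nonneg_nonneg) auto
  then show ?thesis using a_nonneg[OF assms] b_nonneg[OF assms] by blast
qed

lemma cB_weights:
  assumes "r \<ge> R"
  shows "0 \<le> (1 + a r + b r + 2 * a r * b r) / (r * (cmod (be \<chi>0 R r))\<^sup>2)"
    and "0 \<le> (a r - b r) / (r * (cmod (be \<chi>0 R r))\<^sup>2)"
  using ab_nonneg[OF assms] b_le'[OF assms] R assms by (intro divide_nonneg_nonneg; simp)+

text \<open>For \<open>l \<ge> 0\<close> the two weights in the imaginary part have the same sign,
  for \<open>l \<le> 0\<close> those in the real part do; this decides which identity gives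
  uniqueness of a mode.\<close>

lemma energy_Re:
  assumes "ode_sol R \<rho> (cA \<chi>0 R) (cB l \<chi>0 R) (\<lambda>_. 0) q p" "q \<rho> = 0"
  shows "(LINT r:{R<..<\<rho>}|lborel. Re (cnj (cA \<chi>0 R r)) * (cmod (p r))\<^sup>2 + Re (cB l \<chi>0 R r) * (cmod (q r))\<^sup>2) = Re (- p R * cnj (q R))"
    and "(LINT r:{R<..<\<rho>}|lborel. Im (cnj (cA \<chi>0 R r)) * (cmod (p r))\<^sup>2 + Im (cB l \<chi>0 R r) * (cmod (q r))\<^sup>2) = Im (- p R * cnj (q R))"
proof -
  have le: "R \<le> \<rho>" using Rlt by simp
  note c = ode_sol_continuous[OF assms(1)]
  have "(LINT t:{R<..<\<rho>}|lborel. cnj (cA \<chi>0 R t) * of_real ((cmod (p t))\<^sup>2) + cB l \<chi>0 R t * of_real ((cmod (q t))\<^sup>2)) = - p R * cnj (q R)"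
    using ode_sol_energy_self[OF le assms(1) cA_cont cB_cont] assms(2) by simp
  moreover have "continuous_on {R..\<rho>} (\<lambda>t. cnj (cA \<chi>0 R t) * of_real ((cmod (p t))\<^sup>2) + cB l \<chi>0 R t * of_real ((cmod (q t))\<^sup>2))"
    by (intro continuous_intros c cA_cont cB_cont)
  note set_integral_Re[OF this]
  ultimately show "(LINT r:{R<..<\<rho>}|lborel. Re (cnj (cA \<chi>0 R r)) * (cmod (p r))\<^sup>2 + Re (cB l \<chi>0 R r) * (cmod (q r))\<^sup>2) = Re (- p R * cnj (q R))"
    "(LINT r:{R<..<\<rho>}|lborel. Im (cnj (cA \<chi>0 R r)) * (cmod (p r))\<^sup>2 + Im (cB l \<chi>0 R r) * (cmod (q r))\<^sup>2) = Im (- p R * cnj (q R))"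
    by simp_all
qed

text \<open>A continuous integrand of one sign with zero integral vanishes, so \<open>p = 0\<close>
  wherever its weight is nonzero. For \<open>l \<ge> 0\<close> that weight vanishes at
  \<open>R\<close>, and \<open>p R\<close> is recovered by continuity.\<close>

lemma mode_unique:
  assumes sol: "ode_sol R \<rho> (cA \<chi>0 R) (cB l \<chi>0 R) (\<lambda>_. 0) q p" and q0: "q R = 0" "q \<rho> = 0"
  shows "p R = 0"
proof -
  note c = ode_sol_continuous[OF sol]
  have p0: "p r = 0" if r: "r \<in> {R<..\<rho>}" for r
  proof (cases "l \<ge> 0")
    case True
    define f where "f r = r * (a r + b r + 2 * a r * b r) * (cmod (p r))\<^sup>2 + l * ((a r - b r) / (r * (cmod (be \<chi>0 R r))\<^sup>2)) * (cmod (q r))\<^sup>2" for r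
    have fc: "continuous_on {R..\<rho>} f"
      unfolding f_def using R be_nz by (intro continuous_intros c be_cont) auto
    have nn: "0 \<le> r * (a r + b r + 2 * a r * b r) * (cmod (p r))\<^sup>2" "0 \<le> l * ((a r - b r) / (r * (cmod (be \<chi>0 R r))\<^sup>2)) * (cmod (q r))\<^sup>2" if "r \<in> {R..\<rho>}" for r
    proof -
      have r: "r \<ge> R" using that by simp
      show "0 \<le> r * (a r + b r + 2 * a r * b r) * (cmod (p r))\<^sup>2"
        using ab_nonneg[OF r] R r by (intro mult_nonneg_nonneg zero_le_power2) linarith+
      show "0 \<le> l * ((a r - b r) / (r * (cmod (be \<chi>0 R r))\<^sup>2)) * (cmod (q r))\<^sup>2"
        using cB_weights(2)[OF r] True by (intro mult_nonneg_nonneg) auto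
    qed
    have "(LINT r:{R<..<\<rho>}|lborel. - f r) = 0"
      using energy_Re(2)[OF sol q0(2)] q0(1) unfolding cA_Im cB_Im f_def
      by (simp only: minus_add_distrib minus_mult_left complex_cnj_zero mult_zero_right zero_complex.sel)
    then have "(LINT r:{R<..<\<rho>}|lborel. f r) = 0"
      by (simp add: set_lebesgue_integral_def)
    note z = this
    have f0: "0 \<le> f r" if "r \<in> {R..\<rho>}" for r
      unfolding f_def using nn[OF that] by (rule add_nonneg_nonneg)
    have rI: "r \<in> {R..\<rho>}" using r by simp
    have "f r = 0" by (rule set_integral_Icc_nonneg_eq_0[OF Rlt fc f0 z rI])
    then have "r * (a r + b r + 2 * a r * b r) * (cmod (p r))\<^sup>2 = 0"
      unfolding f_def using add_nonneg_eq_0_iff[OF nn[OF rI]] by blast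
    moreover have "r * (a r + b r + 2 * a r * b r) > 0"
    proof -
      have *: "0 < x + y + 2 * x * y" if "x > 0" "y \<ge> 0" for x y :: real
        using that by (intro add_pos_nonneg mult_nonneg_nonneg) auto
      have "a r + b r + 2 * a r * b r > 0" by (rule *) (use r \<chi>0 b_nonneg[of r] in auto)
      then show ?thesis using r R by simp
    qed
    ultimately have "(cmod (p r))\<^sup>2 = 0" by (metis less_irrefl mult_eq_0_iff)
    then show ?thesis by simp
  next
    case False
    define f where "f r = r * (1 + a r + b r) * (cmod (p r))\<^sup>2 + (- l) * ((1 + a r + b r + 2 * a r * b r) / (r * (cmod (be \<chi>0 R r))\<^sup>2)) * (cmod (q r))\<^sup>2" for r
    have fc: "continuous_on {R..\<rho>} f"
      unfolding f_def using R be_nz by (intro continuous_intros c be_cont) auto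
    have nn: "0 \<le> r * (1 + a r + b r) * (cmod (p r))\<^sup>2" "0 \<le> (- l) * ((1 + a r + b r + 2 * a r * b r) / (r * (cmod (be \<chi>0 R r))\<^sup>2)) * (cmod (q r))\<^sup>2" if "r \<in> {R..\<rho>}" for r
    proof -
      have r: "r \<ge> R" using that by simp
      show "0 \<le> r * (1 + a r + b r) * (cmod (p r))\<^sup>2"
        using R r \<chi>0 a_nonneg[OF r] b_nonneg[OF r] by (intro mult_nonneg_nonneg add_nonneg_nonneg zero_le_power2) linarith+
      show "0 \<le> (- l) * ((1 + a r + b r + 2 * a r * b r) / (r * (cmod (be \<chi>0 R r))\<^sup>2)) * (cmod (q r))\<^sup>2"
        using cB_weights(1)[OF r] False by (intro mult_nonneg_nonneg) auto
    qed
    have "(LINT r:{R<..<\<rho>}|lborel. f r) = 0"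
      using energy_Re(1)[OF sol q0(2)] q0(1) unfolding cA_Re cB_Re f_def
      by (simp only: complex_cnj_zero mult_zero_right zero_complex.sel)
    note z = this
    have f0: "0 \<le> f r" if "r \<in> {R..\<rho>}" for r
      unfolding f_def using nn[OF that] by (rule add_nonneg_nonneg)
    have rI: "r \<in> {R..\<rho>}" using r by simp
    have "f r = 0" by (rule set_integral_Icc_nonneg_eq_0[OF Rlt fc f0 z rI])
    then have "r * (1 + a r + b r) * (cmod (p r))\<^sup>2 = 0"
      unfolding f_def using add_nonneg_eq_0_iff[OF nn[OF rI]] by blast
    moreover have "r * (1 + a r + b r) > 0"
      using r R a_nonneg[of r] b_nonneg[of r] by (intro mult_pos_pos add_pos_nonneg) auto
    ultimately have "(cmod (p r))\<^sup>2 = 0" by (metis less_irrefl mult_eq_0_iff)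
    then show ?thesis by simp
  qed
  have "\<forall>\<^sub>F r in at R within {R..\<rho>}. p r = 0"
    unfolding eventually_at_filter by (intro always_eventually) (use p0 in auto)
  then have "(p \<longlongrightarrow> 0) (at R within {R..\<rho>})" by (rule tendsto_eventually)
  moreover have "(p \<longlongrightarrow> p R) (at R within {R..\<rho>})" using c(2) Rlt by (simp add: continuous_on_def)
  moreover have "at R within {R..\<rho>} \<noteq> bot" using Rlt by (simp add: trivial_limit_within islimpt_Icc)
  ultimately show ?thesis using tendsto_unique by blast
qed

lemma mode_exists:
  assumes "continuous_on {R..\<rho>} f"
  obtains q p where "ode_sol R \<rho> (cA \<chi>0 R) (cB l \<chi>0 R) f q p" "q R = q0" "q \<rho> = 0"
proof (rule bvp_exists[of R \<rho> "cA \<chi>0 R" "cB l \<chi>0 R" f q0])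
  show "p R = 0" if "ode_sol R \<rho> (cA \<chi>0 R) (cB l \<chi>0 R) (\<lambda>_. 0) q p" "q R = 0" "q \<rho> = 0" for q p
    using that by (rule mode_unique)
qed (use Rlt assms cA_cont cB_cont that in auto)

end

section \<open>Pointwise bounds for the energy weights in powers of \<open>X\<close>\<close>

lemma AMGM_weighted:
  fixes x y t :: real
  assumes "t > 0" shows "x * y \<le> (t * x\<^sup>2 + y\<^sup>2 / t) / 2"
proof -
  have "0 \<le> (sqrt t * x - y / sqrt t)\<^sup>2" by simp
  also have "\<dots> = t * x\<^sup>2 + y\<^sup>2 / t - 2 * (x * y)"
    using assms by (simp add: power2_diff power_mult_distrib power_divide)
  finally show ?thesis by simp
qed

text \<open>Compares the real energy weight of \<open>|p|\<^sup>2\<close> with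
  \<open>|cA|\<^sup>2\<close>, because \<open>w' = cA * p\<close>. Of the four factors in
  \<open>|\<alpha>|\<^sup>2 * |\<beta>|\<^sup>2\<close> one \<open>|\<alpha>|\<close> is kept as
  \<open>2 * (1 + x + y)\<close> and the other three cost \<open>X\<close> each.\<close>

lemma weight_A_Re:
  fixes x y AL BE X r d :: real
  assumes "0 \<le> x" "0 \<le> y" "0 \<le> AL" "AL \<le> 1 + 2 * x" "AL \<le> X" "0 \<le> BE" "BE \<le> X" "0 < r" "r \<le> 2 * d" "X > 0"
  shows "1 / (4 * d * X ^ 3) * (r * AL * BE)\<^sup>2 \<le> r * (1 + x + y)"
proof -
  have d: "d > 0" using assms by linarith
  have "(r * AL * BE)\<^sup>2 = r * (r * (AL * AL) * (BE * BE))" by (simp add: power2_eq_square)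
  also have "\<dots> \<le> r * ((2 * d) * ((2 * (1 + x + y)) * X) * (X * X))"
    using assms d by (intro mult_left_mono mult_mono) auto
  also have "\<dots> = (4 * d * X ^ 3) * (r * (1 + x + y))" by (simp add: power3_eq_cube)
  finally show ?thesis using d assms(10) by (simp add: pos_divide_le_eq mult.commute)
qed

text \<open>In terms of the coefficients this is
  \<open>|\<beta>|\<^sup>2 \<le> Re (\<alpha> * cnj \<beta>)\<close>, that is,
  \<open>Re (\<alpha> / \<beta>) \<ge> 1\<close>.\<close>

lemma weight_B_Re:
  fixes x y :: real
  assumes "0 \<le> y" "2 * y \<le> x" shows "1 + 2 * y + 2 * y\<^sup>2 \<le> 1 + x + y + 2 * x * y"
proof -
  have "y * y \<le> x * y" using assms by (intro mult_right_mono) auto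
  then show ?thesis using assms by (simp add: power2_eq_square)
qed

text \<open>The imaginary counterpart of \<open>weight_A_Re\<close>, with \<open>2 * c\<close> for
  \<open>a\<close>. Now one \<open>|\<beta>| \<le> 1 + 2 * y\<close> is kept, as the weight is at
  least \<open>r * 2 * c * (1 + 2 * y)\<close>; the factor \<open>c\<close> carries the linear
  vanishing at \<open>R\<close>.\<close>

lemma weight_A_Im:
  fixes c y AL BE X r d :: real
  assumes "0 \<le> c" "0 \<le> y" "0 \<le> AL" "AL \<le> X" "0 \<le> BE" "BE \<le> X" "BE \<le> 1 + 2 * y" "0 < r" "r \<le> 2 * d" "X > 0"
  shows "c / (d * X ^ 3) * (r * AL * BE)\<^sup>2 \<le> r * (2 * c + y + 2 * (2 * c) * y)"
proof -
  have d: "d > 0" using assms by linarith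
  have "c * (r * AL * BE)\<^sup>2 = c * r * (r * (AL * AL) * (BE * BE))" by (simp add: power2_eq_square)
  also have "\<dots> \<le> c * r * ((2 * d) * (X * X) * (X * (1 + 2 * y)))"
    using assms d by (intro mult_left_mono mult_mono) auto
  also have "\<dots> = (d * X ^ 3) * (r * (2 * c * (1 + 2 * y)))" by (simp add: power3_eq_cube)
  also have "\<dots> \<le> (d * X ^ 3) * (r * (2 * c + y + 2 * (2 * c) * y))"
    using assms d by (intro mult_left_mono) (auto simp: algebra_simps)
  finally show ?thesis using d assms(10) by (simp add: pos_divide_le_eq mult.commute)
qed

text \<open>Since \<open>a\<^sup>2 = 4 * \<chi>0 * r * b\<close>, a large \<alpha> forces a large
  \<beta>, and the quotient is only of order \<open>sqrt X\<close>. With the trivial bound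
  \<open>X\<close> for it, this argument would produce a power of \<open>\<chi>0 * d\<close> above
  6.\<close>

lemma ratio_bound:
  fixes x y AL BE X Y :: real
  assumes "AL\<^sup>2 = 1 + 2 * x + 2 * x\<^sup>2" "BE\<^sup>2 = 1 + 2 * y + 2 * y\<^sup>2" "x\<^sup>2 \<le> 2 * X * y" "X \<ge> 1" "Y\<^sup>2 = X" "0 \<le> y" "0 \<le> Y" "0 \<le> BE"
  shows "AL \<le> 3 * Y * BE"
proof (rule power2_le_imp_le)
  have "2 * x \<le> 1 + x\<^sup>2" using zero_le_power2[of "x - 1"] by (simp add: power2_diff)
  then have "AL\<^sup>2 \<le> 2 + 3 * x\<^sup>2" using assms(1) by simp
  also have "\<dots> \<le> 2 * X + 6 * (X * y)" using assms(3,4) by simp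
  also have "\<dots> \<le> 9 * (X * (1 + 2 * y + 2 * y\<^sup>2))"
  proof -
    have "0 \<le> X * y" "0 \<le> X * y\<^sup>2" using assms by auto
    then show ?thesis using assms(4) by (simp add: algebra_simps)
  qed
  also have "\<dots> = (3 * Y * BE)\<^sup>2" using assms(2,5) by (simp add: power_mult_distrib)
  finally show "AL\<^sup>2 \<le> (3 * Y * BE)\<^sup>2" .
qed (use assms in simp)

locale pml_est = pml_interval +
  fixes \<kappa> k :: real
  assumes \<kappa>: "\<kappa> > 0" and \<kappa>\<chi>: "\<kappa> * \<chi>0 * R \<ge> 1"
begin

definition "d = \<rho> - R"
text \<open>The part \<open>\<kappa> * \<chi>0 * d\<close> is at least 1, and
  \<open>4 * \<chi>0 * d\<close> is twice the maximum of \<open>a\<close>; so \<open>X\<close>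
  dominates \<open>1 + 2 * a\<close> and thus both coefficients. Being a plain multiple of
  \<open>\<chi>0 * d\<close>, it is in turn controlled by the coefficients at
  \<open>\<rho>\<close>.\<close>

definition "X = (\<kappa> + 4) * \<chi>0 * d"
definition "Y = sqrt X"

lemma dR: "d \<ge> R" "d > 0" using \<rho> R by (auto simp: d_def)

lemma X_ge: "X \<ge> 1 + 4 * \<chi>0 * d"
proof -
  have "\<kappa> * \<chi>0 * R \<le> \<kappa> * \<chi>0 * d" using dR \<kappa> \<chi>0 by (intro mult_left_mono) auto
  then show ?thesis using \<kappa>\<chi> by (simp add: X_def algebra_simps)
qed

lemma cd: "\<chi>0 * d > 0" using dR \<chi>0 by simp
lemma X_ge2: "X \<ge> 1 + 4 * (\<chi>0 * d)" using X_ge by (simp add: mult.assoc)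
lemma X1: "X \<ge> 1" "X > 0" using X_ge2 cd by linarith+
lemma Y1: "Y \<ge> 1" "Y\<^sup>2 = X" "Y > 0" using X1 by (auto simp: Y_def)

lemma al_X: assumes "r \<in> {R..\<rho>}" shows "cmod (al \<chi>0 R r) \<le> X"
proof -
  have "cmod (al \<chi>0 R r) \<le> 1 + 2 * a r" using al_le assms by simp
  also have "a r \<le> 2 * \<chi>0 * d" using assms \<chi>0 by (intro mult_left_mono) (auto simp: d_def)
  finally show ?thesis using X_ge by simp
qed

lemma be_X: assumes "r \<in> {R..\<rho>}" shows "cmod (be \<chi>0 R r) \<le> X"
proof -
  have "cmod (be \<chi>0 R r) \<le> 1 + 2 * b r" using be_le assms by simp
  also have "\<dots> \<le> 1 + a r" using b_le[of r] assms by simp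
  also have "a r \<le> 2 * \<chi>0 * d" using assms \<chi>0 by (intro mult_left_mono) (auto simp: d_def)
  finally show ?thesis using X_ge2 cd by (simp add: mult.assoc)
qed

lemma r_le: "r \<in> {R..\<rho>} \<Longrightarrow> r \<le> 2 * d" using \<rho> by (auto simp: d_def)

lemma cA_norm: "r \<ge> R \<Longrightarrow> cmod (cA \<chi>0 R r) = r * cmod (al \<chi>0 R r) * cmod (be \<chi>0 R r)"
  using R by (simp add: cA_def norm_mult)

lemma cA_ge: assumes "r \<ge> R" shows "R \<le> cmod (cA \<chi>0 R r)"
proof -
  have "R * 1 * 1 \<le> r * cmod (al \<chi>0 R r) * cmod (be \<chi>0 R r)"
    using assms R al_ge[OF assms] be_ge[OF assms] by (intro mult_mono) auto
  then show ?thesis using cA_norm[OF assms] by simp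
qed

lemma al_ratio: assumes r: "r \<in> {R..\<rho>}" shows "cmod (al \<chi>0 R r) \<le> 3 * Y * cmod (be \<chi>0 R r)"
proof (rule ratio_bound[OF al_norm_sq be_norm_sq])
  have r0: "r > 0" using r R by auto
  have "(a r)\<^sup>2 = 4 * \<chi>0 * r * b r" using r0 by (simp add: power2_eq_square)
  also have "\<dots> \<le> 4 * \<chi>0 * (2 * d) * b r"
    using r_le[OF r] \<chi>0 b_nonneg[of r] r by (intro mult_right_mono mult_left_mono) auto
  also have "\<dots> \<le> 2 * X * b r" using X_ge b_nonneg[of r] r by (intro mult_right_mono) auto
  finally show "(a r)\<^sup>2 \<le> 2 * X * b r" .
qed (use X1 Y1 b_nonneg[of r] r in auto)

lemma cB_norm: assumes r: "r \<ge> R" shows "cmod (cB l \<chi>0 R r) = \<bar>l\<bar> * (cmod (al \<chi>0 R r) / cmod (be \<chi>0 R r)) / r"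
  using R r by (simp add: cB_def norm_mult norm_divide)

text \<open>Evanescent modes can afford the first bound; propagating modes need the second, which
  rests on \<open>al_ratio\<close>.\<close>

lemma cB_le:
  assumes r: "r \<in> {R..\<rho>}" shows "cmod (cB l \<chi>0 R r) \<le> \<bar>l\<bar> * X / R" "cmod (cB l \<chi>0 R r) \<le> \<bar>l\<bar> * (3 * Y) / R"
proof -
  have rR: "r \<ge> R" using r by simp
  have b1: "cmod (be \<chi>0 R r) \<ge> 1" by (rule be_ge[OF rR])
  then have b0: "cmod (be \<chi>0 R r) > 0" by linarith
  have 1: "cmod (al \<chi>0 R r) / cmod (be \<chi>0 R r) \<le> X"
  proof -
    have "X * 1 \<le> X * cmod (be \<chi>0 R r)" using b1 X1 by (intro mult_left_mono) auto
    then show ?thesis using b0 al_X[OF r] by (simp add: pos_divide_le_eq)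
  qed
  have 2: "cmod (al \<chi>0 R r) / cmod (be \<chi>0 R r) \<le> 3 * Y"
    using b0 al_ratio[OF r] by (simp add: pos_divide_le_eq)
  have 0: "0 \<le> cmod (al \<chi>0 R r) / cmod (be \<chi>0 R r)" by simp
  show "cmod (cB l \<chi>0 R r) \<le> \<bar>l\<bar> * X / R"
    unfolding cB_norm[OF rR] using 0 1 R rR X1 by (intro frac_le mult_left_mono mult_nonneg_nonneg) auto
  show "cmod (cB l \<chi>0 R r) \<le> \<bar>l\<bar> * (3 * Y) / R"
    unfolding cB_norm[OF rR] using 0 2 R rR Y1 by (intro frac_le mult_left_mono mult_nonneg_nonneg) auto
qed

end

section \<open>Energy estimates for a single mode\<close>

locale pml_mode = pml_est +
  fixes l :: real and q p :: "real \<Rightarrow> complex" and g g' :: "real \<Rightarrow> real"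
  assumes sol: "ode_sol R \<rho> (cA \<chi>0 R) (cB l \<chi>0 R) (\<lambda>_. 0) q p" and q1: "q R = 1" and q0: "q \<rho> = 0"
    and g: "\<And>r. r \<in> {R..\<rho>} \<Longrightarrow> (g has_vector_derivative g' r) (at r within {R..\<rho>})"
    and g': "continuous_on {R..\<rho>} g'" and g1: "g R = 1" and g0: "g \<rho> = 0"
begin

abbreviation J :: "(real \<Rightarrow> real) \<Rightarrow> real" where "J f \<equiv> (LINT r:{R<..<\<rho>}|lborel. f r)"
abbreviation "w' r \<equiv> cA \<chi>0 R r * p r"

lemma gc: "continuous_on {R..\<rho>} g" by (rule continuous_on_vector_derivative[OF g])
lemmas qc = ode_sol_continuous(1)[OF sol] and pc = ode_sol_continuous(2)[OF sol]
lemmas cont = gc g' qc pc cA_cont cB_cont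
lemma be_nz': "\<forall>r\<in>{R..\<rho>}. be \<chi>0 R r \<noteq> 0" using be_nz by auto
lemma r_nz: "\<forall>r\<in>{R..\<rho>}. r \<noteq> 0" using R by auto

lemma wd: "r \<in> {R..\<rho>} \<Longrightarrow> (q has_vector_derivative w' r) (at r within {R..\<rho>})"
  using sol unfolding ode_sol_def by blast

text \<open>The lift \<open>g\<close> has the boundary values of \<open>q\<close>, so testing with
  it in place of \<open>cnj q\<close> produces the same flux \<open>p R\<close>. The flux bounds the
  energy of \<open>q\<close> from above, and here it is bounded by a pairing of \<open>q\<close>
  with \<open>g\<close>: the two inputs of \<open>absorb_quadratic\<close>.\<close>

lemma S_le: "cmod (p R) \<le> J (\<lambda>r. cmod (p r) * \<bar>g' r\<bar> + cmod (cB l \<chi>0 R r) * cmod (q r) * \<bar>g r\<bar>)"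
proof -
  have "(LINT t:{R<..<\<rho>}|lborel. p t * of_real (g' t) + cB l \<chi>0 R t * q t * of_real (g t)) = p \<rho> * of_real (g \<rho>) - p R * of_real (g R)"
  proof (rule ode_sol_energy[OF _ sol cB_cont])
    show "((\<lambda>t. complex_of_real (g t)) has_vector_derivative complex_of_real (g' t)) (at t within {R..\<rho>})" if "t \<in> {R..\<rho>}" for t
      by (rule has_vector_derivative_of_real[OF g[OF that, folded has_real_derivative_iff_has_vector_derivative]])
  qed (use Rlt in \<open>auto intro!: continuous_intros g'\<close>)
  then have "cmod (p R) = cmod (LINT t:{R<..<\<rho>}|lborel. p t * of_real (g' t) + cB l \<chi>0 R t * q t * of_real (g t))"
    by (simp add: g1 g0)
  also have "\<dots> \<le> J (\<lambda>t. cmod (p t * of_real (g' t) + cB l \<chi>0 R t * q t * of_real (g t)))"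
    by (intro set_integral_norm_Icc continuous_intros cont)
  also have "\<dots> \<le> J (\<lambda>r. cmod (p r) * \<bar>g' r\<bar> + cmod (cB l \<chi>0 R r) * cmod (q r) * \<bar>g r\<bar>)"
    by (intro set_integral_Icc_mono continuous_intros cont) (auto intro!: norm_triangle_le simp: norm_mult)
  finally show ?thesis .
qed

lemma p_le: assumes "r \<ge> R" shows "cmod (p r) \<le> cmod (w' r) / R"
proof -
  have "R * cmod (p r) \<le> cmod (cA \<chi>0 R r) * cmod (p r)" by (intro mult_right_mono cA_ge[OF assms]) auto
  then show ?thesis using R by (simp add: norm_mult pos_le_divide_eq mult.commute)
qed

lemma energy1:
  "J (\<lambda>r. r * (1 + a r + b r) * (cmod (p r))\<^sup>2 + - l * ((1 + a r + b r + 2 * a r * b r) / (r * (cmod (be \<chi>0 R r))\<^sup>2)) * (cmod (q r))\<^sup>2) = Re (- p R)"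
  "J (\<lambda>r. - (r * (a r + b r + 2 * a r * b r)) * (cmod (p r))\<^sup>2 + - l * ((a r - b r) / (r * (cmod (be \<chi>0 R r))\<^sup>2)) * (cmod (q r))\<^sup>2) = Im (- p R)"
  using energy_Re[OF sol q0] unfolding q1 complex_cnj_one mult_1_right cA_Re cA_Im cB_Re cB_Im by blast+

lemma Re_weight_p: assumes r: "r \<in> {R..\<rho>}"
  shows "1 / (4 * d * X ^ 3) * (cmod (w' r))\<^sup>2 \<le> r * (1 + a r + b r) * (cmod (p r))\<^sup>2"
proof -
  have rR: "r \<ge> R" using r by simp
  have "1 / (4 * d * X ^ 3) * (r * cmod (al \<chi>0 R r) * cmod (be \<chi>0 R r))\<^sup>2 \<le> r * (1 + a r + b r)"
    by (rule weight_A_Re[OF a_nonneg[OF rR] b_nonneg[OF rR] _ al_le[OF rR] al_X[OF r] _ be_X[OF r] _ r_le[OF r] X1(2)])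
       (use R rR in auto)
  from mult_right_mono[OF this, of "(cmod (p r))\<^sup>2"]
  show ?thesis unfolding norm_mult[of _ "p r"] cA_norm[OF rR] power_mult_distrib[of _ "cmod (p r)"] by (simp add: mult.assoc)
qed

text \<open>For an evanescent mode both real weights are positive, with the common lower bound
  \<open>1 / (4 * d * X ^ 3)\<close> for \<open>w'\<close> and \<open>\<mu> * q\<close>. The flux
  estimate holds with \<open>H = X / R\<close>, where \<open>|l| = \<mu>\<^sup>2\<close> is split
  evenly between \<open>q\<close> and \<open>g\<close>.\<close>

lemma bound_neg:
  assumes l: "l = - \<mu>\<^sup>2" and \<mu>: "\<mu> > 0"
  shows "J (\<lambda>r. (cmod (w' r))\<^sup>2 + \<mu>\<^sup>2 * (cmod (q r))\<^sup>2) \<le> (X / R)\<^sup>2 * J (\<lambda>r. (g' r)\<^sup>2 + \<mu>\<^sup>2 * (g r)\<^sup>2) / (1 / (4 * d * X ^ 3))\<^sup>2"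
proof (rule absorb_quadratic[where S = "cmod (p R)"])
  let ?\<theta> = "1 / (4 * d * X ^ 3)"
  show "0 < ?\<theta>" "0 < X / R" using dR X1 R by auto
  have "?\<theta> * J (\<lambda>r. (cmod (w' r))\<^sup>2 + \<mu>\<^sup>2 * (cmod (q r))\<^sup>2) = J (\<lambda>r. ?\<theta> * ((cmod (w' r))\<^sup>2 + \<mu>\<^sup>2 * (cmod (q r))\<^sup>2))"
    by (rule set_integral_mult_right[symmetric])
  also have "\<dots> \<le> J (\<lambda>r. r * (1 + a r + b r) * (cmod (p r))\<^sup>2 + - l * ((1 + a r + b r + 2 * a r * b r) / (r * (cmod (be \<chi>0 R r))\<^sup>2)) * (cmod (q r))\<^sup>2)"
  proof (rule set_integral_Icc_mono)
    show "continuous_on {R..\<rho>} (\<lambda>r. ?\<theta> * ((cmod (w' r))\<^sup>2 + \<mu>\<^sup>2 * (cmod (q r))\<^sup>2))"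
      by (intro continuous_intros cont)
    show "continuous_on {R..\<rho>} (\<lambda>r. r * (1 + a r + b r) * (cmod (p r))\<^sup>2 + - l * ((1 + a r + b r + 2 * a r * b r) / (r * (cmod (be \<chi>0 R r))\<^sup>2)) * (cmod (q r))\<^sup>2)"
      using be_nz' r_nz by (intro continuous_intros cont be_cont) auto
    fix r assume "r \<in> {R<..<\<rho>}"
    then have r: "r \<in> {R..\<rho>}" and rR: "r \<ge> R" and r0: "r > 0" using R by auto
    have W: "1 + 2 * b r + 2 * (b r)\<^sup>2 \<le> 1 + a r + b r + 2 * a r * b r"
      by (rule weight_B_Re[OF b_nonneg[OF rR]]) (use b_le[OF rR] in linarith)
    have B: "0 < (cmod (be \<chi>0 R r))\<^sup>2" using be_nz[OF rR] by simp
    \<comment> \<open>The weight of \<open>q\<close> is at least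
      \<open>1 / r \<ge> 1 / (2 * d)\<close>, more than required; it is lowered to
      \<open>?\<theta>\<close> to share one constant with \<open>w'\<close>.\<close>
    have "X ^ 3 \<ge> 1" using X1 by simp
    then have "d * 1 \<le> d * X ^ 3" using dR by (intro mult_left_mono) auto
    then have "r \<le> 4 * d * X ^ 3" using r_le[OF r] dR by linarith
    then have "?\<theta> \<le> 1 / r" using r0 by (intro divide_left_mono) (auto intro: mult_pos_pos)
    also have "1 / r = (1 + 2 * b r + 2 * (b r)\<^sup>2) / (r * (cmod (be \<chi>0 R r))\<^sup>2)"
      using B unfolding be_norm_sq[symmetric] by simp
    also have "\<dots> \<le> (1 + a r + b r + 2 * a r * b r) / (r * (cmod (be \<chi>0 R r))\<^sup>2)"
      using W r0 B by (intro divide_right_mono) auto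
    finally have th: "?\<theta> \<le> (1 + a r + b r + 2 * a r * b r) / (r * (cmod (be \<chi>0 R r))\<^sup>2)" .
    have "?\<theta> * (\<mu>\<^sup>2 * (cmod (q r))\<^sup>2) = \<mu>\<^sup>2 * ?\<theta> * (cmod (q r))\<^sup>2" by simp
    also have "\<dots> \<le> \<mu>\<^sup>2 * ((1 + a r + b r + 2 * a r * b r) / (r * (cmod (be \<chi>0 R r))\<^sup>2)) * (cmod (q r))\<^sup>2"
      by (intro mult_right_mono mult_left_mono th) auto
    finally show "?\<theta> * ((cmod (w' r))\<^sup>2 + \<mu>\<^sup>2 * (cmod (q r))\<^sup>2) \<le> r * (1 + a r + b r) * (cmod (p r))\<^sup>2 + - l * ((1 + a r + b r + 2 * a r * b r) / (r * (cmod (be \<chi>0 R r))\<^sup>2)) * (cmod (q r))\<^sup>2"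
      unfolding l distrib_left[of ?\<theta>] minus_minus using Re_weight_p[OF r] by (intro add_mono)
  qed
  also have "\<dots> \<le> cmod (p R)" unfolding energy1 using complex_Re_le_cmod[of "- p R"] by simp
  finally show "?\<theta> * J (\<lambda>r. (cmod (w' r))\<^sup>2 + \<mu>\<^sup>2 * (cmod (q r))\<^sup>2) \<le> cmod (p R)" .
  fix t :: real assume t: "t > 0"
  have "cmod (p R) \<le> J (\<lambda>r. cmod (p r) * \<bar>g' r\<bar> + cmod (cB l \<chi>0 R r) * cmod (q r) * \<bar>g r\<bar>)" by (rule S_le)
  also have "\<dots> \<le> J (\<lambda>r. X / R / 2 * (t * ((cmod (w' r))\<^sup>2 + \<mu>\<^sup>2 * (cmod (q r))\<^sup>2) + 1 / t * ((g' r)\<^sup>2 + \<mu>\<^sup>2 * (g r)\<^sup>2)))"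
  proof (rule set_integral_Icc_mono)
    fix r assume "r \<in> {R<..<\<rho>}"
    then have r: "r \<in> {R..\<rho>}" and rR: "r \<ge> R" by auto
    have "cmod (p r) * \<bar>g' r\<bar> \<le> (cmod (w' r) / R) * \<bar>g' r\<bar>" by (intro mult_right_mono p_le[OF rR]) auto
    also have "\<dots> = 1 / R * (cmod (w' r) * \<bar>g' r\<bar>)" by simp
    also have "\<dots> \<le> X / R * ((t * (cmod (w' r))\<^sup>2 + \<bar>g' r\<bar>\<^sup>2 / t) / 2)"
      using R X1 t by (intro mult_mono AMGM_weighted divide_right_mono) auto
    finally have 1: "cmod (p r) * \<bar>g' r\<bar> \<le> X / R * ((t * (cmod (w' r))\<^sup>2 + (g' r)\<^sup>2 / t) / 2)" by simp
    have "cmod (cB l \<chi>0 R r) * cmod (q r) * \<bar>g r\<bar> \<le> (\<mu>\<^sup>2 * X / R) * cmod (q r) * \<bar>g r\<bar>"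
      using cB_le(1)[OF r, of l] by (intro mult_right_mono) (auto simp: l)
    also have "\<dots> = X / R * ((\<mu> * cmod (q r)) * (\<mu> * \<bar>g r\<bar>))" by (simp add: power2_eq_square)
    also have "\<dots> \<le> X / R * ((t * (\<mu> * cmod (q r))\<^sup>2 + (\<mu> * \<bar>g r\<bar>)\<^sup>2 / t) / 2)"
      using R X1 t by (intro mult_left_mono AMGM_weighted) auto
    finally have 2: "cmod (cB l \<chi>0 R r) * cmod (q r) * \<bar>g r\<bar> \<le> X / R * ((t * (\<mu>\<^sup>2 * (cmod (q r))\<^sup>2) + (\<mu>\<^sup>2 * (g r)\<^sup>2) / t) / 2)"
      by (simp add: power_mult_distrib)
    have comb: "U * ((t * w1 + g1 / t) / 2) + U * ((t * w2 + g2 / t) / 2) = U / 2 * (t * (w1 + w2) + 1 / t * (g1 + g2))" for U w1 w2 g1 g2 :: real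
      by (simp add: algebra_simps add_divide_distrib)
    show "cmod (p r) * \<bar>g' r\<bar> + cmod (cB l \<chi>0 R r) * cmod (q r) * \<bar>g r\<bar>
      \<le> X / R / 2 * (t * ((cmod (w' r))\<^sup>2 + \<mu>\<^sup>2 * (cmod (q r))\<^sup>2) + 1 / t * ((g' r)\<^sup>2 + \<mu>\<^sup>2 * (g r)\<^sup>2))"
      using add_mono[OF 1 2] unfolding comb .
  qed (intro continuous_intros cont)+
  also have "\<dots> = X / R / 2 * (t * J (\<lambda>r. (cmod (w' r))\<^sup>2 + \<mu>\<^sup>2 * (cmod (q r))\<^sup>2) + 1 / t * J (\<lambda>r. (g' r)\<^sup>2 + \<mu>\<^sup>2 * (g r)\<^sup>2))"
    unfolding set_integral_mult_right
    by (subst set_integral_Icc_add) (intro continuous_intros cont set_integral_mult_right | simp)+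
  finally show "cmod (p R) \<le> X / R * (t * J (\<lambda>r. (cmod (w' r))\<^sup>2 + \<mu>\<^sup>2 * (cmod (q r))\<^sup>2) + J (\<lambda>r. (g' r)\<^sup>2 + \<mu>\<^sup>2 * (g r)\<^sup>2) / t) / 2"
    by simp
qed

text \<open>The imaginary part of the energy controls \<open>w\<close> and \<open>w'\<close> with a weight vanishing linearly at \<open>R\<close>. The unweighted
  norm of \<open>w\<close> follows from \<open>\<integral> |w|\<^sup>2 = - 2 Re \<integral> (r - R) w' w\<^sup>*\<close>, and that of \<open>w'\<close> from the real part.\<close>

lemma bound_pos_L2:
  assumes l: "l = \<mu>\<^sup>2" and \<mu>: "\<mu> \<ge> \<kappa>"
  shows "J (\<lambda>r. (cmod (q r))\<^sup>2) \<le> d * Y ^ 5 / \<chi>0 * (1 + 2 / \<kappa>\<^sup>2) * cmod (p R)"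
proof -
  have \<mu>0: "\<mu> > 0" using \<mu> \<kappa> by simp
  \<comment> \<open>Weights in the imaginary part per unit of \<open>r - R\<close>:
    \<open>e1\<close> comes from \<open>weight_A_Im\<close>, \<open>e2\<close> from
    \<open>a - b \<ge> a / 2\<close> together with
    \<open>r * |\<beta>|\<^sup>2 \<le> 2 * d * X\<^sup>2\<close>.\<close>
  define e1 where "e1 = \<chi>0 / (d * X ^ 3)"
  define e2 where "e2 = \<mu>\<^sup>2 * \<chi>0 / (2 * d * X\<^sup>2)"
  have e: "e1 > 0" "e2 > 0" using \<chi>0 dR X1 \<mu>0 by (auto simp: e1_def e2_def)
  have w: "e1 * (s r * (cmod (w' r))\<^sup>2) \<le> r * (a r + b r + 2 * a r * b r) * (cmod (p r))\<^sup>2"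
    "e2 * (s r * (cmod (q r))\<^sup>2) \<le> l * ((a r - b r) / (r * (cmod (be \<chi>0 R r))\<^sup>2)) * (cmod (q r))\<^sup>2"
    if r: "r \<in> {R..\<rho>}" for r
  proof -
    have rR: "r \<ge> R" and r0: "r > 0" using r R by auto
    have c: "0 \<le> \<chi>0 * s r" using \<chi>0 rR by simp
    have "\<chi>0 * s r / (d * X ^ 3) * (r * cmod (al \<chi>0 R r) * cmod (be \<chi>0 R r))\<^sup>2 \<le> r * (2 * (\<chi>0 * s r) + b r + 2 * (2 * (\<chi>0 * s r)) * b r)"
      by (rule weight_A_Im[OF c b_nonneg[OF rR] _ al_X[OF r] _ be_X[OF r] be_le[OF rR] r0 r_le[OF r] X1(2)]) auto
    then have "\<chi>0 * s r / (d * X ^ 3) * (cmod (cA \<chi>0 R r))\<^sup>2 \<le> r * (a r + b r + 2 * a r * b r)"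
      unfolding cA_norm[OF rR] by (simp only: mult.assoc)
    from mult_right_mono[OF this, of "(cmod (p r))\<^sup>2"]
    show "e1 * (s r * (cmod (w' r))\<^sup>2) \<le> r * (a r + b r + 2 * a r * b r) * (cmod (p r))\<^sup>2"
      unfolding norm_mult[of _ "p r"] power_mult_distrib[of _ "cmod (p r)"] e1_def by (simp add: mult_ac)
    have "\<chi>0 * s r / (2 * d * X\<^sup>2) \<le> (a r - b r) / (r * (cmod (be \<chi>0 R r))\<^sup>2)"
      using b_le[OF rR] c r0 be_nz[OF rR] r_le[OF r] be_X[OF r]
      by (intro frac_le mult_mono power_mono) auto
    from mult_right_mono[OF mult_left_mono[OF this, of "\<mu>\<^sup>2"], of "(cmod (q r))\<^sup>2"]
    show "e2 * (s r * (cmod (q r))\<^sup>2) \<le> l * ((a r - b r) / (r * (cmod (be \<chi>0 R r))\<^sup>2)) * (cmod (q r))\<^sup>2"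
      unfolding l e2_def by (simp add: mult_ac)
  qed
  have "J (\<lambda>r. e1 * (s r * (cmod (w' r))\<^sup>2) + e2 * (s r * (cmod (q r))\<^sup>2))
     \<le> J (\<lambda>r. - (- (r * (a r + b r + 2 * a r * b r)) * (cmod (p r))\<^sup>2 + - l * ((a r - b r) / (r * (cmod (be \<chi>0 R r))\<^sup>2)) * (cmod (q r))\<^sup>2))"
  proof (rule set_integral_Icc_mono)
    show "e1 * (s r * (cmod (w' r))\<^sup>2) + e2 * (s r * (cmod (q r))\<^sup>2)
     \<le> - (- (r * (a r + b r + 2 * a r * b r)) * (cmod (p r))\<^sup>2 + - l * ((a r - b r) / (r * (cmod (be \<chi>0 R r))\<^sup>2)) * (cmod (q r))\<^sup>2)"
      if "r \<in> {R<..<\<rho>}" for r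
      unfolding minus_add_distrib minus_mult_left minus_minus using that by (intro add_mono w) auto
  qed (use be_nz' r_nz in \<open>(intro continuous_intros cont be_cont; auto)+\<close>)
  also have "\<dots> = - Im (- p R)"
    unfolding energy1(2)[symmetric] by (simp only: set_lebesgue_integral_def scaleR_minus_right integral_minus)
  also have "\<dots> \<le> cmod (p R)" using abs_Im_le_cmod[of "p R"] by simp
  finally have E: "e1 * J (\<lambda>r. s r * (cmod (w' r))\<^sup>2) + e2 * J (\<lambda>r. s r * (cmod (q r))\<^sup>2) \<le> cmod (p R)"
    unfolding set_integral_mult_right[symmetric]
    by (subst set_integral_Icc_add[symmetric]) (intro continuous_intros cont | simp)+
  have nn: "0 \<le> J (\<lambda>r. s r * (cmod (w' r))\<^sup>2)" "0 \<le> J (\<lambda>r. s r * (cmod (q r))\<^sup>2)"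
    unfolding set_lebesgue_integral_def by (intro integral_nonneg_AE AE_I2; simp add: indicator_def)+
  have I1: "J (\<lambda>r. s r * (cmod (w' r))\<^sup>2) \<le> cmod (p R) / e1"
  proof -
    have "e1 * J (\<lambda>r. s r * (cmod (w' r))\<^sup>2) \<le> cmod (p R)"
      using E mult_nonneg_nonneg[OF less_imp_le[OF e(2)] nn(2)] by linarith
    then show ?thesis using e(1) by (simp add: pos_le_divide_eq mult.commute)
  qed
  have I2: "J (\<lambda>r. s r * (cmod (q r))\<^sup>2) \<le> cmod (p R) / e2"
  proof -
    have "e2 * J (\<lambda>r. s r * (cmod (q r))\<^sup>2) \<le> cmod (p R)"
      using E mult_nonneg_nonneg[OF less_imp_le[OF e(1)] nn(1)] by linarith
    then show ?thesis using e(2) by (simp add: pos_le_divide_eq mult.commute)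
  qed
  \<comment> \<open>The integrand is the derivative of \<open>(r - R) * |q|\<^sup>2\<close>, which
    vanishes at \<open>R\<close> through the weight and at \<open>\<rho>\<close> through
    \<open>q\<close>.\<close>
  have hardy: "J (\<lambda>r. (cmod (q r))\<^sup>2 + 2 * s r * Re (w' r * cnj (q r))) = 0"
  proof -
    have "J (\<lambda>r. (cmod (q r))\<^sup>2 + 2 * s r * Re (w' r * cnj (q r))) = s \<rho> * (q \<rho> \<bullet> q \<rho>) - s R * (q R \<bullet> q R)"
    proof (rule set_integral_FTC)
      fix r assume "R \<le> r" "r \<le> \<rho>"
      then have r: "r \<in> {R..\<rho>}" by simp
      have "((\<lambda>r. q r \<bullet> q r) has_vector_derivative (q r \<bullet> w' r + w' r \<bullet> q r)) (at r within {R..\<rho>})"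
        by (rule bounded_bilinear.has_vector_derivative[OF bounded_bilinear_inner wd[OF r] wd[OF r]])
      moreover have "((\<lambda>r. s r) has_vector_derivative 1) (at r within {R..\<rho>})"
        by (auto intro!: derivative_eq_intros)
      ultimately have "((\<lambda>r. s r * (q r \<bullet> q r)) has_vector_derivative s r * (q r \<bullet> w' r + w' r \<bullet> q r) + 1 * (q r \<bullet> q r)) (at r within {R..\<rho>})"
        by (intro has_vector_derivative_mult)
      moreover have "s r * (q r \<bullet> w' r + w' r \<bullet> q r) + 1 * (q r \<bullet> q r) = (cmod (q r))\<^sup>2 + 2 * s r * Re (w' r * cnj (q r))"
      proof -
        have i1: "q r \<bullet> q r = (cmod (q r))\<^sup>2" by (rule power2_norm_eq_inner[symmetric])
        have i2: "q r \<bullet> w' r + w' r \<bullet> q r = 2 * Re (w' r * cnj (q r))"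
          by (simp add: inner_complex_def algebra_simps)
        show ?thesis unfolding i1 i2 by (simp only: mult_1_left add.commute mult.left_commute mult.assoc)
      qed
      ultimately show "((\<lambda>r. s r * (q r \<bullet> q r)) has_vector_derivative (cmod (q r))\<^sup>2 + 2 * s r * Re (w' r * cnj (q r))) (at r within {R..\<rho>})" by simp
    qed (use Rlt in \<open>auto intro!: continuous_intros cont\<close>)
    then show ?thesis by (simp add: q0)
  qed
  \<comment> \<open>The AM-GM parameter \<open>1 / Y\<close> balances the weighted integrals of
    \<open>w'\<close> and \<open>q\<close>, whose bounds carry \<open>X ^ 3\<close> and
    \<open>X\<^sup>2\<close>: both end up with \<open>Y ^ 5\<close>.\<close>
  have "J (\<lambda>r. (cmod (q r))\<^sup>2) \<le> J (\<lambda>r. ((cmod (q r))\<^sup>2 + 2 * s r * Re (w' r * cnj (q r))) + (1 / Y * (s r * (cmod (w' r))\<^sup>2) + Y * (s r * (cmod (q r))\<^sup>2)))"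
  proof (rule set_integral_Icc_mono)
    fix r assume "r \<in> {R<..<\<rho>}"
    then have s0: "s r \<ge> 0" by simp
    have "- Re (w' r * cnj (q r)) \<le> cmod (w' r) * cmod (q r)"
      using abs_Re_le_cmod[of "w' r * cnj (q r)"] by (simp add: norm_mult)
    also have "\<dots> \<le> (1 / Y * (cmod (w' r))\<^sup>2 + (cmod (q r))\<^sup>2 / (1 / Y)) / 2"
      by (rule AMGM_weighted) (use Y1 in simp)
    finally have "s r * (- (2 * Re (w' r * cnj (q r)))) \<le> s r * (1 / Y * (cmod (w' r))\<^sup>2 + Y * (cmod (q r))\<^sup>2)"
      using Y1 by (intro mult_left_mono s0) (simp add: mult.commute)
    moreover have "Q \<le> (Q + 2 * S * z) + (c * (S * W) + Y * (S * Q))" if "S * (- (2 * z)) \<le> S * (c * W + Y * Q)" for Q S z c W :: real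
      using that by (simp add: algebra_simps)
    ultimately show "(cmod (q r))\<^sup>2 \<le> ((cmod (q r))\<^sup>2 + 2 * s r * Re (w' r * cnj (q r))) + (1 / Y * (s r * (cmod (w' r))\<^sup>2) + Y * (s r * (cmod (q r))\<^sup>2))"
      by blast
  qed (intro continuous_intros cont)+
  also have "\<dots> = 0 + (1 / Y * J (\<lambda>r. s r * (cmod (w' r))\<^sup>2) + Y * J (\<lambda>r. s r * (cmod (q r))\<^sup>2))"
  proof -
    have c: "continuous_on {R..\<rho>} (\<lambda>r. (cmod (q r))\<^sup>2 + 2 * s r * Re (w' r * cnj (q r)))"
      "continuous_on {R..\<rho>} (\<lambda>r. 1 / Y * (s r * (cmod (w' r))\<^sup>2))" "continuous_on {R..\<rho>} (\<lambda>r. Y * (s r * (cmod (q r))\<^sup>2))"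
      by (intro continuous_intros cont)+
    show ?thesis
      by (simp only: set_integral_Icc_add[OF c(1) continuous_on_add[OF c(2,3)]] set_integral_Icc_add[OF c(2,3)] hardy set_integral_mult_right)
  qed
  also have "\<dots> \<le> 0 + (1 / Y * (cmod (p R) / e1) + Y * (cmod (p R) / e2))"
    using Y1 by (intro add_mono mult_left_mono I1 I2) auto
  also have "1 / Y * (cmod (p R) / e1) = d * Y ^ 5 / \<chi>0 * cmod (p R)"
  proof -
    have "X ^ 3 = Y * Y ^ 5" unfolding Y1(2)[symmetric] by (simp flip: power_mult power_Suc)
    then show ?thesis using Y1 by (simp add: e1_def)
  qed
  also have "Y * (cmod (p R) / e2) \<le> d * Y ^ 5 / \<chi>0 * (2 / \<kappa>\<^sup>2) * cmod (p R)"
  proof -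
    have "Y * X\<^sup>2 = Y ^ 5" unfolding Y1(2)[symmetric] by (simp flip: power_mult power_Suc)
    then have "Y * (cmod (p R) / e2) = (d * Y ^ 5 / \<chi>0 * 2 * cmod (p R)) / \<mu>\<^sup>2" by (simp add: e2_def mult_ac)
    also have "\<dots> \<le> (d * Y ^ 5 / \<chi>0 * 2 * cmod (p R)) / \<kappa>\<^sup>2"
      using \<mu> \<kappa> \<mu>0 dR Y1 \<chi>0 by (intro divide_left_mono power_mono mult_nonneg_nonneg) auto
    finally show ?thesis by (simp add: mult_ac)
  qed
  finally show ?thesis by (simp only: distrib_left distrib_right mult_1_right add_0_left)
qed

definition "K3 = 1 + 2 / \<kappa>\<^sup>2"
text \<open>\<open>K\<close> times the flux bounds the energy of a propagating mode. The last
  summand is the bound for \<open>q\<close> from \<open>bound_pos_L2\<close>; the first is the bound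
  for \<open>w'\<close> from the real part, with its negative \<open>q\<close> term moved to the
  other side.\<close>

definition "K = 4 * d * X ^ 3 * (1 + (3 * k\<^sup>2 / R) * K3 * (d * Y ^ 6 / \<chi>0)) + d * Y ^ 5 / \<chi>0 * K3"

text \<open>The mode enters only through \<open>\<kappa> \<le> \<mu> \<le> k\<close>: the lower
  bound is spent in \<open>K3\<close>, the upper one in the size of \<open>cB\<close>. Hence one
  constant serves all propagating modes.\<close>

lemma bound_pos:
  assumes l: "l = \<mu>\<^sup>2" and \<mu>: "\<kappa> \<le> \<mu>" "\<mu> \<le> k"
  shows "J (\<lambda>r. (cmod (w' r))\<^sup>2 + (cmod (q r))\<^sup>2) \<le> ((1 + 3 * k\<^sup>2 * Y) / R)\<^sup>2 * J (\<lambda>r. (g' r)\<^sup>2 + (g r)\<^sup>2) / (1 / K)\<^sup>2"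
proof (rule absorb_quadratic[where S = "cmod (p R)"])
  have K3: "K3 > 0" unfolding K3_def by (intro add_pos_nonneg) auto
  have Kpos: "K > 0" unfolding K_def using K3 dR X1 Y1 \<chi>0 R
    by (intro add_pos_nonneg mult_pos_pos mult_nonneg_nonneg) auto
  then show "0 < 1 / K" by simp
  have Hp: "0 < 1 + 3 * k\<^sup>2 * Y" using Y1 by (intro add_pos_nonneg) auto
  then show "0 < (1 + 3 * k\<^sup>2 * Y) / R" using R by simp
  have \<mu>k: "\<mu>\<^sup>2 \<le> k\<^sup>2" using \<mu> \<kappa> by (intro power_mono) auto
  have Q: "J (\<lambda>r. (cmod (q r))\<^sup>2) \<le> d * Y ^ 5 / \<chi>0 * K3 * cmod (p R)"
    unfolding K3_def by (rule bound_pos_L2[OF l \<mu>(1)])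
  have Bq: "cmod (cB l \<chi>0 R r) \<le> 3 * k\<^sup>2 * Y / R" if "r \<in> {R..\<rho>}" for r
  proof -
    have "cmod (cB l \<chi>0 R r) \<le> \<mu>\<^sup>2 * (3 * Y) / R" using cB_le(2)[OF that, of l] by (simp add: l)
    also have "\<dots> \<le> k\<^sup>2 * (3 * Y) / R" using \<mu>k Y1 R by (intro divide_right_mono mult_right_mono) auto
    finally show ?thesis by (simp add: mult_ac)
  qed
  \<comment> \<open>The real part controls \<open>w'\<close> only up to the term
    \<open>- Re cB * |q|\<^sup>2\<close>, which is at most \<open>3 * k\<^sup>2 * Y / R\<close>
    times the already bounded norm of \<open>q\<close>.\<close>
  have W: "J (\<lambda>r. (cmod (w' r))\<^sup>2) \<le> 4 * d * X ^ 3 * (1 + (3 * k\<^sup>2 / R) * K3 * (d * Y ^ 6 / \<chi>0)) * cmod (p R)"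
  proof -
    let ?\<theta> = "1 / (4 * d * X ^ 3)"
    have "J (\<lambda>r. ?\<theta> * (cmod (w' r))\<^sup>2) \<le> J (\<lambda>r. (r * (1 + a r + b r) * (cmod (p r))\<^sup>2 + Re (cB l \<chi>0 R r) * (cmod (q r))\<^sup>2)
         + 3 * k\<^sup>2 * Y / R * (cmod (q r))\<^sup>2)"
    proof (rule set_integral_Icc_mono)
      fix r assume "r \<in> {R<..<\<rho>}"
      then have r: "r \<in> {R..\<rho>}" by simp
      have "- Re (cB l \<chi>0 R r) \<le> 3 * k\<^sup>2 * Y / R" using Bq[OF r] abs_Re_le_cmod[of "cB l \<chi>0 R r"] by linarith
      from mult_right_mono[OF this, of "(cmod (q r))\<^sup>2"]
      show "?\<theta> * (cmod (w' r))\<^sup>2 \<le> (r * (1 + a r + b r) * (cmod (p r))\<^sup>2 + Re (cB l \<chi>0 R r) * (cmod (q r))\<^sup>2)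
         + 3 * k\<^sup>2 * Y / R * (cmod (q r))\<^sup>2" using Re_weight_p[OF r] by simp
    qed (use r_nz in \<open>(intro continuous_intros cont; auto)+\<close>)
    also have "\<dots> = J (\<lambda>r. r * (1 + a r + b r) * (cmod (p r))\<^sup>2 + Re (cB l \<chi>0 R r) * (cmod (q r))\<^sup>2)
         + 3 * k\<^sup>2 * Y / R * J (\<lambda>r. (cmod (q r))\<^sup>2)"
      unfolding set_integral_mult_right[symmetric]
      by (rule set_integral_Icc_add) (use r_nz in \<open>(intro continuous_intros cont; auto)+\<close>)
    also have "\<dots> \<le> cmod (p R) + 3 * k\<^sup>2 * Y / R * (d * Y ^ 5 / \<chi>0 * K3 * cmod (p R))"
    proof (intro add_mono mult_left_mono Q)
      show "J (\<lambda>r. r * (1 + a r + b r) * (cmod (p r))\<^sup>2 + Re (cB l \<chi>0 R r) * (cmod (q r))\<^sup>2) \<le> cmod (p R)"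
        unfolding cB_Re energy1(1) using complex_Re_le_cmod[of "- p R"] by simp
      show "0 \<le> 3 * k\<^sup>2 * Y / R" using Y1 R by simp
    qed
    also have "\<dots> = (1 + (3 * k\<^sup>2 / R) * K3 * (d * Y ^ 6 / \<chi>0)) * cmod (p R)"
    proof -
      have "Y ^ 6 = Y * Y ^ 5" by (simp flip: power_Suc)
      then show ?thesis by (simp only: distrib_right mult_1_left) (simp add: mult_ac)
    qed
    finally have "?\<theta> * J (\<lambda>r. (cmod (w' r))\<^sup>2) \<le> (1 + (3 * k\<^sup>2 / R) * K3 * (d * Y ^ 6 / \<chi>0)) * cmod (p R)"
      unfolding set_integral_mult_right .
    then have "4 * d * X ^ 3 * (?\<theta> * J (\<lambda>r. (cmod (w' r))\<^sup>2)) \<le> 4 * d * X ^ 3 * ((1 + (3 * k\<^sup>2 / R) * K3 * (d * Y ^ 6 / \<chi>0)) * cmod (p R))"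
      using dR X1 by (intro mult_left_mono) auto
    then show ?thesis using dR X1 by (simp add: mult.assoc)
  qed
  have "J (\<lambda>r. (cmod (w' r))\<^sup>2 + (cmod (q r))\<^sup>2) = J (\<lambda>r. (cmod (w' r))\<^sup>2) + J (\<lambda>r. (cmod (q r))\<^sup>2)"
    by (rule set_integral_Icc_add) (intro continuous_intros cont)+
  also have "\<dots> \<le> K * cmod (p R)" using W Q unfolding K_def distrib_right by linarith
  finally show "1 / K * J (\<lambda>r. (cmod (w' r))\<^sup>2 + (cmod (q r))\<^sup>2) \<le> cmod (p R)"
    using Kpos by (simp add: pos_divide_le_eq mult.commute)
  fix t :: real assume t: "t > 0"
  let ?H = "(1 + 3 * k\<^sup>2 * Y) / R"
  have "cmod (p R) \<le> J (\<lambda>r. cmod (p r) * \<bar>g' r\<bar> + cmod (cB l \<chi>0 R r) * cmod (q r) * \<bar>g r\<bar>)" by (rule S_le)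
  also have "\<dots> \<le> J (\<lambda>r. ?H / 2 * (t * ((cmod (w' r))\<^sup>2 + (cmod (q r))\<^sup>2) + 1 / t * ((g' r)\<^sup>2 + (g r)\<^sup>2)))"
  proof (rule set_integral_Icc_mono)
    fix r assume "r \<in> {R<..<\<rho>}"
    then have r: "r \<in> {R..\<rho>}" and rR: "r \<ge> R" by auto
    have H1: "1 / R \<le> ?H" "3 * k\<^sup>2 * Y / R \<le> ?H" using R Y1 by (auto intro!: divide_right_mono)
    have "cmod (p r) * \<bar>g' r\<bar> \<le> (cmod (w' r) / R) * \<bar>g' r\<bar>" by (intro mult_right_mono p_le[OF rR]) auto
    also have "\<dots> = 1 / R * (cmod (w' r) * \<bar>g' r\<bar>)" by simp
    also have "\<dots> \<le> ?H * ((t * (cmod (w' r))\<^sup>2 + \<bar>g' r\<bar>\<^sup>2 / t) / 2)"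
      using H1 R Hp t by (intro mult_mono AMGM_weighted) auto
    finally have 1: "cmod (p r) * \<bar>g' r\<bar> \<le> ?H * ((t * (cmod (w' r))\<^sup>2 + (g' r)\<^sup>2 / t) / 2)" by simp
    have "cmod (cB l \<chi>0 R r) * cmod (q r) * \<bar>g r\<bar> \<le> ?H * cmod (q r) * \<bar>g r\<bar>"
      by (intro mult_right_mono order_trans[OF Bq[OF r] H1(2)]) auto
    also have "\<dots> = ?H * (cmod (q r) * \<bar>g r\<bar>)" by (rule mult.assoc)
    also have "\<dots> \<le> ?H * ((t * (cmod (q r))\<^sup>2 + \<bar>g r\<bar>\<^sup>2 / t) / 2)"
      using R Hp t by (intro mult_left_mono AMGM_weighted) auto
    finally have 2: "cmod (cB l \<chi>0 R r) * cmod (q r) * \<bar>g r\<bar> \<le> ?H * ((t * (cmod (q r))\<^sup>2 + (g r)\<^sup>2 / t) / 2)"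
      by simp
    have comb: "U * ((t * w1 + g1 / t) / 2) + U * ((t * w2 + g2 / t) / 2) = U / 2 * (t * (w1 + w2) + 1 / t * (g1 + g2))" for U w1 w2 g1 g2 :: real
      by (simp add: algebra_simps add_divide_distrib)
    show "cmod (p r) * \<bar>g' r\<bar> + cmod (cB l \<chi>0 R r) * cmod (q r) * \<bar>g r\<bar>
      \<le> ?H / 2 * (t * ((cmod (w' r))\<^sup>2 + (cmod (q r))\<^sup>2) + 1 / t * ((g' r)\<^sup>2 + (g r)\<^sup>2))"
      using add_mono[OF 1 2] unfolding comb .
  qed (intro continuous_intros cont)+
  also have "\<dots> = ?H / 2 * (t * J (\<lambda>r. (cmod (w' r))\<^sup>2 + (cmod (q r))\<^sup>2) + 1 / t * J (\<lambda>r. (g' r)\<^sup>2 + (g r)\<^sup>2))"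
    unfolding set_integral_mult_right
    by (subst set_integral_Icc_add) (intro continuous_intros cont set_integral_mult_right | simp)+
  finally show "cmod (p R) \<le> ?H * (t * J (\<lambda>r. (cmod (w' r))\<^sup>2 + (cmod (q r))\<^sup>2) + J (\<lambda>r. (g' r)\<^sup>2 + (g r)\<^sup>2) / t) / 2"
    by simp
qed

end

section \<open>Constants independent of \<chi>0 and \<rho>\<close>

text \<open>Each missing power of \<open>d\<close> is inserted as a factor
  \<open>d * e \<ge> 1\<close>, at the price of one constant factor \<open>e\<close>.\<close>

lemma power_fill:
  fixes d e :: real
  assumes "e > 0" "d * e \<ge> 1" "i \<le> n" shows "d ^ i \<le> e ^ (n - i) * d ^ n"
proof -
  have d: "d > 0" using assms by (metis less_le_trans mult.commute zero_less_mult_pos zero_less_one)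
  have "d ^ i * 1 \<le> d ^ i * (d * e) ^ (n - i)"
    using d assms by (intro mult_left_mono one_le_power) auto
  also have "\<dots> = e ^ (n - i) * (d ^ i * d ^ (n - i))" by (simp add: power_mult_distrib mult_ac)
  also have "d ^ i * d ^ (n - i) = d ^ n" using assms(3) by (simp flip: power_add)
  finally show ?thesis by simp
qed

lemma power_fill2:
  fixes d x e h :: real
  assumes "e > 0" "d * e \<ge> 1" "i \<le> n" "h > 0" "x * h \<ge> 1" "j \<le> n"
  shows "d ^ i * x ^ j \<le> (e ^ (n - i) * h ^ (n - j)) * (d ^ n * x ^ n)"
proof -
  have "d > 0" "x > 0" using assms by (metis less_le_trans mult.commute zero_less_mult_pos zero_less_one)+
  then have "d ^ i * x ^ j \<le> (e ^ (n - i) * d ^ n) * (h ^ (n - j) * x ^ n)"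
    using assms by (intro mult_mono power_fill) auto
  then show ?thesis by (simp add: mult_ac)
qed

context pml_est
begin

text \<open>The decay length \<open>1 / m\<close> makes derivative and function cost equally much.
  The linear factor only enforces the zero at \<open>\<rho>\<close>, and its slope satisfies
  \<open>1 / d \<le> 1 / R\<close>.\<close>

definition "gm (m::nat) r = exp (- (real m * (r - R))) * (1 - (r - R) / d)"
definition "gm' (m::nat) r = - exp (- (real m * (r - R))) * (real m * (1 - (r - R) / d) + 1 / d)"

lemma gm_deriv: "(gm m has_vector_derivative gm' m r) (at r within A)"
proof -
  have "d \<noteq> 0" using dR by simp
  then show ?thesis
    unfolding has_real_derivative_iff_has_vector_derivative[symmetric] gm_def[abs_def] gm'_def
    by (auto intro!: derivative_eq_intros simp: field_simps)
qed

lemma gm'_cont: "continuous_on A (gm' m)"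
  unfolding gm'_def[abs_def] by (intro continuous_intros) (use dR in auto)

lemma gm_cont: "continuous_on A (gm m)"
  unfolding gm_def[abs_def] by (intro continuous_intros) (use dR in auto)

lemma gm_ends: "gm m R = 1" "gm m \<rho> = 0"
  using dR by (simp_all add: gm_def d_def)

text \<open>The integrand is of order \<open>m\<^sup>2\<close> and the exponential contributes
  \<open>1 / m\<close>. \<open>M\<close> is \<mu> for evanescent modes and 1 for propagating ones;
  both obey the hypothesis with the same \<open>\<Lambda>\<close>.\<close>

lemma gm_integral:
  assumes m: "m \<ge> 1" and M: "M\<^sup>2 \<le> (real m)\<^sup>2 * \<Lambda>"
  shows "(LINT r:{R<..<\<rho>}|lborel. (gm' m r)\<^sup>2 + M\<^sup>2 * (gm m r)\<^sup>2) \<le> real m * ((1 + 1 / R)\<^sup>2 + \<Lambda>)"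
proof -
  define E where "E r = exp (- (2 * real m * (r - R)))" for r
  define c where "c = (real m)\<^sup>2 * ((1 + 1 / R)\<^sup>2 + \<Lambda>)"
  have m0: "real m \<ge> 1" "real m > 0" using m by auto
  have c0: "c \<ge> 0" using order_trans[OF zero_le_power2 M] m0 unfolding c_def
    by (intro mult_nonneg_nonneg add_nonneg_nonneg) (auto simp: zero_le_mult_iff)
  have "(LINT r:{R<..<\<rho>}|lborel. (gm' m r)\<^sup>2 + M\<^sup>2 * (gm m r)\<^sup>2) \<le> (LINT r:{R<..<\<rho>}|lborel. c * E r)"
  proof (rule set_integral_Icc_mono)
    fix r assume r: "r \<in> {R<..<\<rho>}"
    have E: "(exp (- (real m * (r - R))))\<^sup>2 = E r" by (simp add: E_def flip: exp_double)
    have t: "0 \<le> 1 - (r - R) / d" "1 - (r - R) / d \<le> 1" using r dR by (auto simp: d_def)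
    have "(gm m r)\<^sup>2 = E r * (1 - (r - R) / d)\<^sup>2" by (simp add: gm_def power_mult_distrib E)
    also have "\<dots> \<le> E r * 1" using t by (intro mult_left_mono power_le_one) (auto simp: E_def)
    finally have 1: "(gm m r)\<^sup>2 \<le> E r" by simp
    have "1 / d \<le> 1 / R" using dR R by (intro divide_left_mono) auto
    also have "\<dots> \<le> real m * (1 / R)" using m0 R by (simp add: divide_right_mono)
    finally have "1 / d \<le> real m * (1 / R)" .
    moreover have "real m * (1 - (r - R) / d) \<le> real m * 1" using t m0 by (intro mult_left_mono) auto
    ultimately have 2: "real m * (1 - (r - R) / d) + 1 / d \<le> real m * (1 + 1 / R)" by (simp add: distrib_left)
    have "(gm' m r)\<^sup>2 = E r * (real m * (1 - (r - R) / d) + 1 / d)\<^sup>2" by (simp add: gm'_def power_mult_distrib E)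
    also have "\<dots> \<le> E r * (real m * (1 + 1 / R))\<^sup>2"
      using t m0 dR 2 by (intro mult_left_mono power_mono add_nonneg_nonneg mult_nonneg_nonneg) (auto simp: E_def)
    finally have 3: "(gm' m r)\<^sup>2 \<le> E r * (real m * (1 + 1 / R))\<^sup>2" .
    have "M\<^sup>2 * (gm m r)\<^sup>2 \<le> ((real m)\<^sup>2 * \<Lambda>) * E r"
      using M 1 order_trans[OF zero_le_power2 M] by (intro mult_mono) auto
    with 3 show "(gm' m r)\<^sup>2 + M\<^sup>2 * (gm m r)\<^sup>2 \<le> c * E r"
      unfolding c_def power_mult_distrib by (simp add: algebra_simps)
  next
    show "continuous_on {R..\<rho>} (\<lambda>r. (gm' m r)\<^sup>2 + M\<^sup>2 * (gm m r)\<^sup>2)" by (intro continuous_intros gm_cont gm'_cont)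
    show "continuous_on {R..\<rho>} (\<lambda>r. c * E r)" unfolding E_def by (intro continuous_intros)
  qed
  also have "\<dots> = c * (LINT r:{R<..<\<rho>}|lborel. E r)" by simp
  finally have le: "(LINT r:{R<..<\<rho>}|lborel. (gm' m r)\<^sup>2 + M\<^sup>2 * (gm m r)\<^sup>2) \<le> c * (LINT r:{R<..<\<rho>}|lborel. E r)" .
  have "(LINT r:{R<..<\<rho>}|lborel. E r) = (- E \<rho> / (2 * real m)) - (- E R / (2 * real m))"
  proof (rule set_integral_FTC)
    show "((\<lambda>r. - E r / (2 * real m)) has_vector_derivative E r) (at r within {R..\<rho>})" for r
      unfolding has_real_derivative_iff_has_vector_derivative[symmetric] E_def
      using m0 by (auto intro!: derivative_eq_intros)
    show "continuous_on {R..\<rho>} E" unfolding E_def by (intro continuous_intros)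
  qed (use Rlt in simp)
  also have "\<dots> \<le> 1 / real m"
  proof -
    have "0 \<le> E \<rho> / (2 * real m)" by (simp add: E_def)
    moreover have "E R / (2 * real m) \<le> 1 / real m" using m0 by (simp add: E_def field_simps)
    ultimately show ?thesis by simp
  qed
  finally have "c * (LINT r:{R<..<\<rho>}|lborel. E r) \<le> c * (1 / real m)" using c0 by (rule mult_left_mono)
  also have "\<dots> = real m * ((1 + 1 / R)\<^sup>2 + \<Lambda>)" using m0 by (simp add: c_def power2_eq_square)
  finally show ?thesis using le by linarith
qed

definition "x = \<chi>0 * d"

lemma x_pos: "x > 0" "x * \<kappa> \<ge> 1" "d * (1 / R) \<ge> 1" "X = (\<kappa> + 4) * x"
proof -
  show "x > 0" using cd by (simp add: x_def)
  have "\<kappa> * \<chi>0 * R \<le> \<kappa> * \<chi>0 * d" using dR \<kappa> \<chi>0 by (intro mult_left_mono) auto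
  then show "x * \<kappa> \<ge> 1" using \<kappa>\<chi> by (simp add: x_def mult_ac)
  show "d * (1 / R) \<ge> 1" using dR R by simp
  show "X = (\<kappa> + 4) * x" by (simp add: X_def x_def mult_ac)
qed

text \<open>The real parts at \<open>\<rho>\<close> give \<open>|\<alpha>| \<ge> 2 * x\<close> and,
  by \<open>\<rho> \<le> 2 * d\<close>, \<open>|\<beta>| \<ge> x / 2\<close>. As
  \<open>2 ^ 4 / 2 ^ 2 \<ge> 1\<close>, no constant is lost.\<close>

lemma target_ge: "d ^ 6 * x ^ 6 \<le> d ^ 6 * cmod (al \<chi>0 R \<rho>) ^ 4 * cmod (be \<chi>0 R \<rho>) ^ 2"
proof -
  have "2 * x \<le> Re (al \<chi>0 R \<rho>)" by (simp add: al_def x_def d_def)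
  then have A: "2 * x \<le> cmod (al \<chi>0 R \<rho>)" using complex_Re_le_cmod order_trans by blast
  have "x / 2 = \<chi>0 * d\<^sup>2 / (2 * d)" using dR by (simp add: x_def power2_eq_square)
  also have "\<dots> \<le> \<chi>0 * d\<^sup>2 / \<rho>" using r_le[of \<rho>] Rlt R dR \<chi>0 by (intro divide_left_mono) auto
  also have "\<dots> \<le> Re (be \<chi>0 R \<rho>)" by (simp add: be_def d_def)
  finally have B: "x / 2 \<le> cmod (be \<chi>0 R \<rho>)" using complex_Re_le_cmod order_trans by blast
  have "d ^ 6 * x ^ 6 \<le> d ^ 6 * ((2 * x) ^ 4 * (x / 2) ^ 2)"
    using dR x_pos by (intro mult_left_mono) (auto simp: power_mult_distrib power_divide power_add[symmetric] power_eq_if)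
  also have "\<dots> \<le> d ^ 6 * (cmod (al \<chi>0 R \<rho>) ^ 4 * cmod (be \<chi>0 R \<rho>) ^ 2)"
    using dR A B x_pos by (intro mult_left_mono mult_mono power_mono) auto
  finally show ?thesis by (simp add: mult.assoc)
qed

end

context pml_mode
begin

text \<open>The three terms of \<open>Y * K\<close> are of size \<open>d * x ^ 4\<close>,
  \<open>d ^ 3 * x ^ 6\<close> and \<open>d\<^sup>2 * x\<^sup>2\<close>; the middle one exhausts the
  exponent 6 of \<open>x\<close>, and the other powers are padded. Divisions by \<chi>0 are traded
  for \<open>d\<close> through \<open>X / \<chi>0 = (\<kappa> + 4) * d\<close>.\<close>

lemma HK_bound:
  "(1 + 3 * k\<^sup>2 * Y) / R * K \<le> (1 + 3 * k\<^sup>2) / R * (4 * (\<kappa> + 4) ^ 4 * ((1 / R) ^ 5 * \<kappa> ^ 2)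
     + 4 * (3 * k\<^sup>2 / R) * K3 * (\<kappa> + 4) ^ 7 * ((1 / R) ^ 3 * \<kappa> ^ 0) + K3 * (\<kappa> + 4) ^ 3 * ((1 / R) ^ 4 * \<kappa> ^ 4)) * (d ^ 6 * x ^ 6)"
proof -
  have K3: "K3 > 0" unfolding K3_def by (intro add_pos_nonneg) auto
  have e: "0 < 1 / R" using R by simp
  have YX: "Y \<le> X" using Y1 by (metis mult_right_mono mult_1 power2_eq_square less_imp_le)
  have Kp: "K \<ge> 0" unfolding K_def using K3 dR X1 Y1 \<chi>0 R
    by (intro add_nonneg_nonneg mult_nonneg_nonneg) auto
  have le: "1 + 3 * k\<^sup>2 * Y \<le> (1 + 3 * k\<^sup>2) * Y" using Y1 by (simp add: algebra_simps)
  have "Y * K = 4 * d * X ^ 3 * Y + 4 * (3 * k\<^sup>2 / R) * K3 * (d\<^sup>2 * X ^ 3 * X ^ 3 * (Y / \<chi>0)) + K3 * (d * X ^ 3 / \<chi>0)"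
  proof -
    have "Y ^ 6 = X ^ 3" "Y * Y ^ 5 = X ^ 3" unfolding Y1(2)[symmetric] by (simp_all flip: power_mult power_Suc)
    moreover have "Y * K = 4 * d * X ^ 3 * Y + 4 * (3 * k\<^sup>2 / R) * K3 * (d\<^sup>2 * X ^ 3 * (Y ^ 6) * (Y / \<chi>0)) + K3 * (d * (Y * Y ^ 5) / \<chi>0)"
      unfolding K_def by (simp add: algebra_simps power2_eq_square)
    ultimately show ?thesis by simp
  qed
  also have "\<dots> \<le> 4 * d * X ^ 3 * X + 4 * (3 * k\<^sup>2 / R) * K3 * (d\<^sup>2 * X ^ 3 * X ^ 3 * ((\<kappa> + 4) * d)) + K3 * (d * X ^ 2 * ((\<kappa> + 4) * d))"
  proof -
    have Xc: "X / \<chi>0 = (\<kappa> + 4) * d" using \<chi>0 by (simp add: X_def)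
    have "Y / \<chi>0 \<le> X / \<chi>0" using YX \<chi>0 by (intro divide_right_mono) auto
    then have Yc: "Y / \<chi>0 \<le> (\<kappa> + 4) * d" using Xc by simp
    have "d * X ^ 3 / \<chi>0 = d * X ^ 2 * (X / \<chi>0)" by (simp add: power3_eq_cube power2_eq_square)
    then have "d * X ^ 3 / \<chi>0 = d * X ^ 2 * ((\<kappa> + 4) * d)" unfolding Xc .
    then show ?thesis
      using YX Yc dR X1 K3 R by (intro add_mono mult_left_mono) (auto intro!: mult_nonneg_nonneg)
  qed
  also have "\<dots> = 4 * (\<kappa> + 4) ^ 4 * (d ^ 1 * x ^ 4) + 4 * (3 * k\<^sup>2 / R) * K3 * (\<kappa> + 4) ^ 7 * (d ^ 3 * x ^ 6) + K3 * (\<kappa> + 4) ^ 3 * (d ^ 2 * x ^ 2)"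
    unfolding x_pos(4) by (simp add: power_mult_distrib eval_nat_numeral mult_ac)
  also have "\<dots> \<le> 4 * (\<kappa> + 4) ^ 4 * (((1 / R) ^ (6 - 1) * \<kappa> ^ (6 - 4)) * (d ^ 6 * x ^ 6))
     + 4 * (3 * k\<^sup>2 / R) * K3 * (\<kappa> + 4) ^ 7 * (((1 / R) ^ (6 - 3) * \<kappa> ^ (6 - 6)) * (d ^ 6 * x ^ 6))
     + K3 * (\<kappa> + 4) ^ 3 * (((1 / R) ^ (6 - 2) * \<kappa> ^ (6 - 2)) * (d ^ 6 * x ^ 6))"
    using K3 \<kappa> R by (intro add_mono mult_left_mono power_fill2 e x_pos) auto
  finally have YK: "Y * K \<le> (4 * (\<kappa> + 4) ^ 4 * ((1 / R) ^ 5 * \<kappa> ^ 2)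
     + 4 * (3 * k\<^sup>2 / R) * K3 * (\<kappa> + 4) ^ 7 * ((1 / R) ^ 3 * \<kappa> ^ 0) + K3 * (\<kappa> + 4) ^ 3 * ((1 / R) ^ 4 * \<kappa> ^ 4)) * (d ^ 6 * x ^ 6)"
    by (simp add: distrib_right mult.assoc)
  from le have "(1 + 3 * k\<^sup>2 * Y) / R * K \<le> ((1 + 3 * k\<^sup>2) * Y) / R * K"
    using R Kp by (intro mult_right_mono divide_right_mono) auto
  also have "\<dots> = (1 + 3 * k\<^sup>2) / R * (Y * K)" by simp
  also have "\<dots> \<le> (1 + 3 * k\<^sup>2) / R * ((4 * (\<kappa> + 4) ^ 4 * ((1 / R) ^ 5 * \<kappa> ^ 2)
     + 4 * (3 * k\<^sup>2 / R) * K3 * (\<kappa> + 4) ^ 7 * ((1 / R) ^ 3 * \<kappa> ^ 0) + K3 * (\<kappa> + 4) ^ 3 * ((1 / R) ^ 4 * \<kappa> ^ 4)) * (d ^ 6 * x ^ 6))"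
    using R YK by (intro mult_left_mono divide_nonneg_pos add_nonneg_nonneg) auto
  finally show ?thesis by (simp only: mult.assoc)
qed

end

text \<open>\<open>C\<close> is fixed before \<open>\<rho>\<close>, \<open>\<chi>0\<close> and
  \<open>m\<close>. Up to a factor \<open>Z / 2\<close> the left-hand side is the squared
  \<open>H1\<close> norm of \<open>q(r) sin(m\<pi>z/Z)\<close>; the factor \<open>m\<close> on the
  right is the energy of the lift.\<close>

lemma mode_bound_uniform:
  fixes Z R k \<kappa> :: real
  assumes Z: "Z > 0" and R: "R > 0" and k: "k > 0" and \<kappa>: "\<kappa> > 0"
  obtains C where "C > 0"
    "\<And>\<rho> \<chi>0 m q p. \<rho> \<ge> 2 * R \<Longrightarrow> \<chi>0 > 0 \<Longrightarrow> \<kappa> * \<chi>0 * R \<ge> 1 \<Longrightarrow> m \<ge> (1::nat) \<Longrightarrow>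
       \<kappa>\<^sup>2 \<le> \<bar>k\<^sup>2 - (real m * pi / Z)\<^sup>2\<bar> \<Longrightarrow>
       ode_sol R \<rho> (cA \<chi>0 R) (cB (k\<^sup>2 - (real m * pi / Z)\<^sup>2) \<chi>0 R) (\<lambda>_. 0) q p \<Longrightarrow> q R = 1 \<Longrightarrow> q \<rho> = 0 \<Longrightarrow>
       (LINT r:{R<..<\<rho>}|lborel. (cmod (cA \<chi>0 R r * p r))\<^sup>2 + (1 + (real m * pi / Z)\<^sup>2) * (cmod (q r))\<^sup>2)
         \<le> C * real m * ((\<rho> - R) ^ 6 * cmod (al \<chi>0 R \<rho>) ^ 4 * cmod (be \<chi>0 R \<rho>) ^ 2)\<^sup>2"
proof -
  define \<Lambda> where "\<Lambda> = (pi / Z)\<^sup>2 + 1"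
  define \<Gamma> where "\<Gamma> = (1 + 1 / R)\<^sup>2 + \<Lambda>"
  have \<Gamma>: "\<Gamma> > 0" unfolding \<Gamma>_def \<Lambda>_def by (intro add_nonneg_pos) auto
  \<comment> \<open>For an evanescent mode \<open>(m\<pi>/Z)^2 = \<mu>^2 + k^2\<close> with
    \<open>\<mu> \<ge> \<kappa>\<close>, so \<open>c4 * \<mu>\<^sup>2\<close> dominates the weight
    \<open>1 + (m\<pi>/Z)^2\<close>.\<close>
  define c4 where "c4 = 1 + (1 + k\<^sup>2) / \<kappa>\<^sup>2"
  have c4: "c4 \<ge> 1" using \<kappa> by (simp add: c4_def)
  define K3' where "K3' = 1 + 2 / \<kappa>\<^sup>2"
  \<comment> \<open>The constant of \<open>HK_bound\<close>, written out because it must be fixed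
    before the layer and the mode are given.\<close>
  define c5 where "c5 = (1 + 3 * k\<^sup>2) / R * (4 * (\<kappa> + 4) ^ 4 * ((1 / R) ^ 5 * \<kappa> ^ 2)
     + 4 * (3 * k\<^sup>2 / R) * K3' * (\<kappa> + 4) ^ 7 * ((1 / R) ^ 3 * \<kappa> ^ 0) + K3' * (\<kappa> + 4) ^ 3 * ((1 / R) ^ 4 * \<kappa> ^ 4))"
  define C1 where "C1 = c4 * (16 * \<Gamma> / R\<^sup>2 * (\<kappa> + 4) ^ 8 * ((1 / R) ^ 10 * \<kappa> ^ 4))"
  define C2 where "C2 = (1 + k\<^sup>2) * (c5\<^sup>2 * \<Gamma>)"
  have C1: "C1 > 0" unfolding C1_def using c4 \<Gamma> R \<kappa> by (intro mult_pos_pos divide_pos_pos zero_less_power) auto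
  have C2: "C2 \<ge> 0" unfolding C2_def using \<Gamma> by (intro mult_nonneg_nonneg) auto
  show ?thesis
  proof (rule that[of "C1 + C2"])
    show "C1 + C2 > 0" using C1 C2 by simp
    fix \<rho> \<chi>0 m q p assume *: "\<rho> \<ge> 2 * R" "\<chi>0 > 0" "\<kappa> * \<chi>0 * R \<ge> 1" and m: "m \<ge> (1::nat)"
       and \<kappa>l: "\<kappa>\<^sup>2 \<le> \<bar>k\<^sup>2 - (real m * pi / Z)\<^sup>2\<bar>"
       and sol: "ode_sol R \<rho> (cA \<chi>0 R) (cB (k\<^sup>2 - (real m * pi / Z)\<^sup>2) \<chi>0 R) (\<lambda>_. 0) q p" "q R = 1" "q \<rho> = 0"
    define l where "l = k\<^sup>2 - (real m * pi / Z)\<^sup>2"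
    interpret E: pml_est R \<rho> \<chi>0 \<kappa> k by unfold_locales (use * R \<kappa> in auto)
    interpret M: pml_mode R \<rho> \<chi>0 \<kappa> k l q p "E.gm m" "E.gm' m"
      by unfold_locales (use sol E.gm_deriv E.gm'_cont E.gm_ends in \<open>auto simp: l_def\<close>)
    define \<mu> where "\<mu> = sqrt \<bar>l\<bar>"
    have \<mu>2: "\<mu>\<^sup>2 = \<bar>l\<bar>" by (simp add: \<mu>_def)
    have \<mu>\<kappa>: "\<mu> \<ge> \<kappa>" using \<kappa>l \<kappa> unfolding \<mu>_def l_def by (simp add: real_le_rsqrt)
    define T where "T = (\<rho> - R) ^ 6 * cmod (al \<chi>0 R \<rho>) ^ 4 * cmod (be \<chi>0 R \<rho>) ^ 2"
    define P where "P = E.d ^ 6 * E.x ^ 6"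
    have P0: "P \<ge> 0" using E.dR E.x_pos by (simp add: P_def)
    have PT: "P \<le> T" using E.target_ge unfolding P_def T_def E.d_def .
    have PT2: "P\<^sup>2 \<le> T\<^sup>2" using PT P0 by (rule power_mono)
    have m1: "real m \<ge> 1" using m by simp
    have mZ: "(real m * pi / Z)\<^sup>2 = (real m)\<^sup>2 * (pi / Z)\<^sup>2" by (simp add: power_mult_distrib power_divide)
    have e: "0 < 1 / R" using R by simp
    have C12: "C1 * real m * P\<^sup>2 \<le> (C1 + C2) * real m * T\<^sup>2" "C2 * real m * P\<^sup>2 \<le> (C1 + C2) * real m * T\<^sup>2"
      using C1 C2 m1 PT2 by (intro mult_mono; simp)+
    have "M.J (\<lambda>r. (cmod (M.w' r))\<^sup>2 + (1 + (real m * pi / Z)\<^sup>2) * (cmod (q r))\<^sup>2) \<le> (C1 + C2) * real m * T\<^sup>2"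
    proof (cases "l < 0")
      case True
      have l: "l = - \<mu>\<^sup>2" using True \<mu>2 by simp
      have \<mu>0: "\<mu> > 0" using \<mu>\<kappa> \<kappa> by simp
      have G: "M.J (\<lambda>r. (E.gm' m r)\<^sup>2 + \<mu>\<^sup>2 * (E.gm m r)\<^sup>2) \<le> real m * \<Gamma>"
        unfolding \<Gamma>_def
      proof (rule E.gm_integral[OF m])
        have "\<mu>\<^sup>2 \<le> (real m)\<^sup>2 * (pi / Z)\<^sup>2" using True unfolding \<mu>2 l_def mZ by simp
        then show "\<mu>\<^sup>2 \<le> (real m)\<^sup>2 * \<Lambda>" by (simp add: \<Lambda>_def distrib_left add_increasing2)
      qed
      have w: "1 + (real m * pi / Z)\<^sup>2 \<le> c4 * \<mu>\<^sup>2"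
      proof -
        have "\<kappa>\<^sup>2 \<le> \<mu>\<^sup>2" using \<mu>\<kappa> \<kappa> by (intro power_mono) auto
        then have "(1 + k\<^sup>2) / \<kappa>\<^sup>2 * \<kappa>\<^sup>2 \<le> (1 + k\<^sup>2) / \<kappa>\<^sup>2 * \<mu>\<^sup>2" by (intro mult_left_mono) auto
        then have "1 + k\<^sup>2 \<le> (1 + k\<^sup>2) / \<kappa>\<^sup>2 * \<mu>\<^sup>2" using \<kappa> by simp
        moreover have "(real m * pi / Z)\<^sup>2 = \<mu>\<^sup>2 + k\<^sup>2" using l by (simp add: l_def)
        ultimately show ?thesis by (simp add: c4_def distrib_right)
      qed
      have "M.J (\<lambda>r. (cmod (M.w' r))\<^sup>2 + (1 + (real m * pi / Z)\<^sup>2) * (cmod (q r))\<^sup>2) \<le> M.J (\<lambda>r. c4 * ((cmod (M.w' r))\<^sup>2 + \<mu>\<^sup>2 * (cmod (q r))\<^sup>2))"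
      proof (rule set_integral_Icc_mono)
        fix r
        have "1 * (cmod (M.w' r))\<^sup>2 \<le> c4 * (cmod (M.w' r))\<^sup>2" by (intro mult_right_mono c4) auto
        moreover have "(1 + (real m * pi / Z)\<^sup>2) * (cmod (q r))\<^sup>2 \<le> c4 * \<mu>\<^sup>2 * (cmod (q r))\<^sup>2" by (intro mult_right_mono w) auto
        ultimately show "(cmod (M.w' r))\<^sup>2 + (1 + (real m * pi / Z)\<^sup>2) * (cmod (q r))\<^sup>2 \<le> c4 * ((cmod (M.w' r))\<^sup>2 + \<mu>\<^sup>2 * (cmod (q r))\<^sup>2)"
          by (simp add: distrib_left mult.assoc)
      qed (intro continuous_intros M.cont)+
      also have "\<dots> = c4 * M.J (\<lambda>r. (cmod (M.w' r))\<^sup>2 + \<mu>\<^sup>2 * (cmod (q r))\<^sup>2)" by (rule set_integral_mult_right)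
      also have "\<dots> \<le> c4 * ((E.X / R)\<^sup>2 * M.J (\<lambda>r. (E.gm' m r)\<^sup>2 + \<mu>\<^sup>2 * (E.gm m r)\<^sup>2) / (1 / (4 * E.d * E.X ^ 3))\<^sup>2)"
        using c4 M.bound_neg[OF l \<mu>0] by (intro mult_left_mono) auto
      also have "\<dots> \<le> c4 * ((E.X / R)\<^sup>2 * (real m * \<Gamma>) / (1 / (4 * E.d * E.X ^ 3))\<^sup>2)"
        using c4 G by (intro mult_left_mono divide_right_mono) auto
      also have "\<dots> = c4 * (16 * \<Gamma> / R\<^sup>2 * (\<kappa> + 4) ^ 8 * (E.d ^ 2 * E.x ^ 8)) * real m"
      proof -
        have "(c * x / R)\<^sup>2 * (mm * \<Gamma>) / (1 / (4 * d * (c * x) ^ 3))\<^sup>2 = 16 * \<Gamma> / R\<^sup>2 * c ^ 8 * (d ^ 2 * x ^ 8) * mm" for c x mm d :: real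
          by (simp add: power_mult_distrib power_divide eval_nat_numeral mult_ac)
        then show ?thesis unfolding E.x_pos(4) by (simp only: mult.assoc)
      qed
      \<comment> \<open>The comparison is between squares, so the powers 2 and 8 are padded up to
        12.\<close>
      also have "\<dots> \<le> c4 * (16 * \<Gamma> / R\<^sup>2 * (\<kappa> + 4) ^ 8 * (((1 / R) ^ (12 - 2) * \<kappa> ^ (12 - 8)) * (E.d ^ 12 * E.x ^ 12))) * real m"
        using c4 \<Gamma> R \<kappa> by (intro mult_right_mono mult_left_mono power_fill2 e E.x_pos) auto
      also have "\<dots> = C1 * real m * P\<^sup>2"
      proof -
        have "P\<^sup>2 = E.d ^ 12 * E.x ^ 12" unfolding P_def power_mult_distrib by (simp flip: power_mult)
        then show ?thesis by (simp add: C1_def)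
      qed
      finally show ?thesis using C12(1) by linarith
    next
      case False
      have l: "l = \<mu>\<^sup>2" using False \<mu>2 by simp
      have lk: "(real m * pi / Z)\<^sup>2 \<le> k\<^sup>2" using False by (simp add: l_def)
      have \<mu>k: "\<mu> \<le> k"
      proof (rule power2_le_imp_le)
        show "\<mu>\<^sup>2 \<le> k\<^sup>2" unfolding l[symmetric] l_def by simp
      qed (use k in simp)
      have G: "M.J (\<lambda>r. (E.gm' m r)\<^sup>2 + (E.gm m r)\<^sup>2) \<le> real m * \<Gamma>"
      proof -
        have "1 \<le> (real m)\<^sup>2 * 1" using m1 by simp
        also have "\<dots> \<le> (real m)\<^sup>2 * \<Lambda>" by (intro mult_left_mono) (auto simp: \<Lambda>_def)
        finally show ?thesis using E.gm_integral[OF m, of 1 \<Lambda>] by (simp add: \<Gamma>_def)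
      qed
      have K: "M.K > 0"
      proof -
        have K3: "M.K3 > 0" unfolding M.K3_def by (intro add_pos_nonneg) auto
        show ?thesis unfolding M.K_def using K3 E.dR E.X1 E.Y1 *(2) R
          by (intro add_pos_nonneg mult_pos_pos mult_nonneg_nonneg) auto
      qed
      have HK: "(1 + 3 * k\<^sup>2 * E.Y) / R * M.K \<le> c5 * P"
        using M.HK_bound unfolding c5_def K3'_def M.K3_def P_def .
      have H0: "0 \<le> (1 + 3 * k\<^sup>2 * E.Y) / R * M.K" using K E.Y1 R by simp
      have "M.J (\<lambda>r. (cmod (M.w' r))\<^sup>2 + (1 + (real m * pi / Z)\<^sup>2) * (cmod (q r))\<^sup>2) \<le> M.J (\<lambda>r. (1 + k\<^sup>2) * ((cmod (M.w' r))\<^sup>2 + (cmod (q r))\<^sup>2))"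
      proof (rule set_integral_Icc_mono)
        fix r
        have "1 * (cmod (M.w' r))\<^sup>2 \<le> (1 + k\<^sup>2) * (cmod (M.w' r))\<^sup>2" by (intro mult_right_mono) auto
        moreover have "(1 + (real m * pi / Z)\<^sup>2) * (cmod (q r))\<^sup>2 \<le> (1 + k\<^sup>2) * (cmod (q r))\<^sup>2" using lk by (intro mult_right_mono) auto
        ultimately show "(cmod (M.w' r))\<^sup>2 + (1 + (real m * pi / Z)\<^sup>2) * (cmod (q r))\<^sup>2 \<le> (1 + k\<^sup>2) * ((cmod (M.w' r))\<^sup>2 + (cmod (q r))\<^sup>2)"
          by (simp only: distrib_left[of "1 + k\<^sup>2"] mult_1_left)
      qed (intro continuous_intros M.cont)+
      also have "\<dots> = (1 + k\<^sup>2) * M.J (\<lambda>r. (cmod (M.w' r))\<^sup>2 + (cmod (q r))\<^sup>2)" by (rule set_integral_mult_right)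
      also have "\<dots> \<le> (1 + k\<^sup>2) * (((1 + 3 * k\<^sup>2 * E.Y) / R)\<^sup>2 * M.J (\<lambda>r. (E.gm' m r)\<^sup>2 + (E.gm m r)\<^sup>2) / (1 / M.K)\<^sup>2)"
        using M.bound_pos[OF l \<mu>\<kappa> \<mu>k] by (intro mult_left_mono) auto
      also have "\<dots> \<le> (1 + k\<^sup>2) * (((1 + 3 * k\<^sup>2 * E.Y) / R)\<^sup>2 * (real m * \<Gamma>) / (1 / M.K)\<^sup>2)"
        using G by (intro mult_left_mono divide_right_mono) auto
      also have "\<dots> = (1 + k\<^sup>2) * (((1 + 3 * k\<^sup>2 * E.Y) / R * M.K)\<^sup>2 * (real m * \<Gamma>))"
        by (simp add: power_mult_distrib power_divide)
      also have "\<dots> \<le> (1 + k\<^sup>2) * ((c5 * P)\<^sup>2 * (real m * \<Gamma>))"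
        using HK H0 \<Gamma> by (intro mult_left_mono mult_right_mono power_mono) auto
      also have "\<dots> = C2 * real m * P\<^sup>2" by (simp add: C2_def power_mult_distrib)
      finally show ?thesis using C12(2) by linarith
    qed
    then show "(LINT r:{R<..<\<rho>}|lborel. (cmod (cA \<chi>0 R r * p r))\<^sup>2 + (1 + (real m * pi / Z)\<^sup>2) * (cmod (q r))\<^sup>2)
         \<le> (C1 + C2) * real m * ((\<rho> - R) ^ 6 * cmod (al \<chi>0 R \<rho>) ^ 4 * cmod (be \<chi>0 R \<rho>) ^ 2)\<^sup>2"
      unfolding T_def .
  qed
qed

section \<open>Uniqueness\<close>

lemma L2_mult_continuous:
  fixes a b c d :: real
  assumes h: "continuous_on ({a..b} \<times> {c..d}) h" and f: "L2 ({a<..<b} \<times> {c<..<d}) f"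
  shows "L2 ({a<..<b} \<times> {c<..<d}) (\<lambda>x. h x * f x)"
proof -
  have "bounded (h ` ({a..b} \<times> {c..d}))"
    by (intro compact_imp_bounded compact_continuous_image h compact_rect)
  then obtain M where "\<And>x. x \<in> {a..b} \<times> {c..d} \<Longrightarrow> cmod (h x) \<le> M"
    unfolding bounded_iff by blast
  then have M: "\<And>x. x \<in> {a<..<b} \<times> {c<..<d} \<Longrightarrow> cmod (h x) \<le> M" using rect_subset by blast
  have "set_borel_measurable lborel ({a<..<b} \<times> {c<..<d}) h" using L2_rect[OF h] by (simp add: L2_def)
  from L2_mult_bounded[OF f this M] show ?thesis .
qed

text \<open>Passes from the chosen \<open>wpd\<close> to any concrete weak derivatives and from
  \<open>alpha\<close>, \<open>beta\<close> to \<open>al\<close>, \<open>be\<close>. The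
  coefficients become \<open>1 / cA\<close> and \<open>E\<close>, grouped with the conjugated
  argument so that each integral is a pairing of two L2 functions.\<close>

lemma a_pml_eq:
  fixes R \<rho> \<chi>0 k Z :: real
  defines "\<Omega> \<equiv> {R<..<\<rho>} \<times> {0<..<Z}"
  defines "E \<equiv> \<lambda>r. al \<chi>0 R r / (of_real r * be \<chi>0 R r)"
  assumes par: "R > 0" "\<rho> \<ge> 2 * R" "\<chi>0 > 0"
    and w: "L2 \<Omega> w" "L2 \<Omega> w1" "weak_deriv \<Omega> (1,0) w w1" "L2 \<Omega> w2" "weak_deriv \<Omega> (0,1) w w2"
    and v: "L2 \<Omega> v" "L2 \<Omega> v1" "weak_deriv \<Omega> (1,0) v v1" "L2 \<Omega> v2" "weak_deriv \<Omega> (0,1) v v2"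
  shows "a_pml k Z R \<rho> \<chi>0 w v = (LINT x:\<Omega>|lborel. w1 x * (1 / cA \<chi>0 R (fst x) * cnj (v1 x)))
      + (LINT x:\<Omega>|lborel. w2 x * (E (fst x) * cnj (v2 x))) - of_real (k\<^sup>2) * (LINT x:\<Omega>|lborel. w x * (E (fst x) * cnj (v x)))"
    and "L2 \<Omega> f \<Longrightarrow> L2 \<Omega> (\<lambda>x. 1 / cA \<chi>0 R (fst x) * f x)" and "L2 \<Omega> f \<Longrightarrow> L2 \<Omega> (\<lambda>x. E (fst x) * f x)"
proof -
  interpret pml_interval R \<rho> \<chi>0 by unfold_locales (use par in auto)
  have nz: "cA \<chi>0 R r \<noteq> 0" if "r \<ge> R" for r using al_nz[OF that] be_nz[OF that] R that by (simp add: cA_def)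
  have Pc: "continuous_on {R..\<rho>} (\<lambda>r. 1 / cA \<chi>0 R r)" using nz by (intro continuous_intros cA_cont) auto
  have Ec: "continuous_on {R..\<rho>} E" unfolding E_def using R be_nz by (intro continuous_intros al_cont be_cont) auto
  note PE = continuous_on_fst_comp[OF Pc] continuous_on_fst_comp[OF Ec]
  show P2: "L2 \<Omega> (\<lambda>x. 1 / cA \<chi>0 R (fst x) * f x)" if "L2 \<Omega> f" for f
    using that unfolding \<Omega>_def by (intro L2_mult_continuous PE)
  show E2: "L2 \<Omega> (\<lambda>x. E (fst x) * f x)" if "L2 \<Omega> f" for f
    using that unfolding \<Omega>_def by (intro L2_mult_continuous PE)
  define I where "I = (\<lambda>u u1 u2 y y1 y2 (x::pt). u1 x * (1 / cA \<chi>0 R (fst x) * cnj (y1 x))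
      + u2 x * (E (fst x) * cnj (y2 x)) - of_real (k\<^sup>2) * (u x * (E (fst x) * cnj (y x))))"
  have ii: "set_integrable lborel \<Omega> (\<lambda>x. u1 x * (1 / cA \<chi>0 R (fst x) * cnj (y1 x)))"
    "set_integrable lborel \<Omega> (\<lambda>x. u1 x * (E (fst x) * cnj (y1 x)))" if "L2 \<Omega> u1" "L2 \<Omega> y1" for u1 y1
    by (intro L2_mult_integrable P2 E2 L2_cnj that)+
  have iI: "set_integrable lborel \<Omega> (I u u1 u2 y y1 y2)" if "L2 \<Omega> u" "L2 \<Omega> u1" "L2 \<Omega> u2" "L2 \<Omega> y" "L2 \<Omega> y1" "L2 \<Omega> y2" for u u1 u2 y y1 y2
    unfolding I_def by (intro set_integral_diff(1) set_integral_add(1) set_integrable_mult_right impI ii that)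
  have mI: "set_borel_measurable lborel \<Omega> (I u u1 u2 y y1 y2)" if "L2 \<Omega> u" "L2 \<Omega> u1" "L2 \<Omega> u2" "L2 \<Omega> y" "L2 \<Omega> y1" "L2 \<Omega> y2" for u u1 u2 y y1 y2
    using iI[OF that] unfolding set_integrable_def set_borel_measurable_def by (rule borel_measurable_integrable)
  note W = wpd_works[OF w(2,3)] wpd_works[OF w(4,5)] wpd_works[OF v(2,3)] wpd_works[OF v(4,5)]
  have "a_pml k Z R \<rho> \<chi>0 w v = (LINT x:\<Omega>|lborel. I w (wpd \<Omega> (1,0) w) (wpd \<Omega> (0,1) w) v (wpd \<Omega> (1,0) v) (wpd \<Omega> (0,1) v) x)"
    unfolding a_pml_def Let_def Omega_pml_def \<Omega>_def[symmetric]
  proof (rule set_lebesgue_integral_cong)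
    show "\<Omega> \<in> sets lborel" by (simp add: \<Omega>_def)
    have "1 / (of_real (fst x) * beta \<chi>0 R (fst x)) * (1 / alpha \<chi>0 R (fst x) * U * U' + alpha \<chi>0 R (fst x) * V * V' - alpha \<chi>0 R (fst x) * of_real (k\<^sup>2) * u * u')
        = U * (1 / cA \<chi>0 R (fst x) * U') + V * (E (fst x) * V') - of_real (k\<^sup>2) * (u * (E (fst x) * u'))" if "x \<in> \<Omega>" for x :: pt and U U' V V' u u'
    proof -
      have r: "fst x > R" using that by (auto simp: \<Omega>_def)
      show ?thesis
        unfolding alpha_eq_al[OF r] beta_eq_be[OF r] cA_def E_def
        by (simp add: algebra_simps)
    qed
    then show "\<forall>x. x \<in> \<Omega> \<longrightarrow> 1 / (of_real (fst x) * beta \<chi>0 R (fst x)) * (1 / alpha \<chi>0 R (fst x) * wpd \<Omega> (1, 0) w x * cnj (wpd \<Omega> (1, 0) v x) +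
       alpha \<chi>0 R (fst x) * wpd \<Omega> (0, 1) w x * cnj (wpd \<Omega> (0, 1) v x) - alpha \<chi>0 R (fst x) * of_real (k\<^sup>2) * w x * cnj (v x)) =
       I w (wpd \<Omega> (1,0) w) (wpd \<Omega> (0,1) w) v (wpd \<Omega> (1,0) v) (wpd \<Omega> (0,1) v) x"
      unfolding I_def by blast
  qed
  also have "\<dots> = (LINT x:\<Omega>|lborel. I w w1 w2 v v1 v2 x)"
  proof (rule set_integral_AE_cong)
    show "AE x in lborel. x \<in> \<Omega> \<longrightarrow> I w (wpd \<Omega> (1,0) w) (wpd \<Omega> (0,1) w) v (wpd \<Omega> (1,0) v) (wpd \<Omega> (0,1) v) x = I w w1 w2 v v1 v2 x"
      using wpd_AE_eq[OF w(2,3)[unfolded \<Omega>_def]] wpd_AE_eq[OF w(4,5)[unfolded \<Omega>_def]] wpd_AE_eq[OF v(2,3)[unfolded \<Omega>_def]] wpd_AE_eq[OF v(4,5)[unfolded \<Omega>_def]]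
      unfolding \<Omega>_def[symmetric] by eventually_elim (simp add: I_def)
  qed (intro mI w v W)+
  also have "\<dots> = (LINT x:\<Omega>|lborel. w1 x * (1 / cA \<chi>0 R (fst x) * cnj (v1 x)))
      + (LINT x:\<Omega>|lborel. w2 x * (E (fst x) * cnj (v2 x))) - (LINT x:\<Omega>|lborel. of_real (k\<^sup>2) * (w x * (E (fst x) * cnj (v x))))"
  proof -
    have i3: "set_integrable lborel \<Omega> (\<lambda>x. of_real (k\<^sup>2) * (w x * (E (fst x) * cnj (v x))))"
      by (intro set_integrable_mult_right ii w v)
    show ?thesis
      unfolding I_def using ii(1)[OF w(2) v(2)] ii(2)[OF w(4) v(4)] i3
      by (simp only: set_integral_diff(2) set_integral_add)
  qed
  finally show "a_pml k Z R \<rho> \<chi>0 w v = (LINT x:\<Omega>|lborel. w1 x * (1 / cA \<chi>0 R (fst x) * cnj (v1 x)))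
      + (LINT x:\<Omega>|lborel. w2 x * (E (fst x) * cnj (v2 x))) - of_real (k\<^sup>2) * (LINT x:\<Omega>|lborel. w x * (E (fst x) * cnj (v x)))"
    by (simp only: set_integral_mult_right)
qed

lemma H1_norm_nonneg: "0 \<le> H1_norm \<Omega> u"
  unfolding H1_norm_def set_lebesgue_integral_def
  by (intro real_sqrt_ge_zero integral_nonneg_AE) (auto intro!: AE_I2)

lemma smooth_weak_deriv:
  fixes a b c d :: real
  assumes "smooth u" "a \<le> b" "c \<le> d"
  shows "weak_deriv ({a<..<b} \<times> {c<..<d}) (1,0) u (pd (1,0) u)" "weak_deriv ({a<..<b} \<times> {c<..<d}) (0,1) u (pd (0,1) u)"
    "L2 ({a<..<b} \<times> {c<..<d}) u" "L2 ({a<..<b} \<times> {c<..<d}) (pd e u)"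
proof -
  show "weak_deriv ({a<..<b} \<times> {c<..<d}) (1,0) u (pd (1,0) u)"
    by (rule weak_deriv_fst_classical[OF smooth_continuous_on[OF assms(1)] smooth_continuous_on[OF smooth_pd[OF assms(1)]] assms(2) smooth_deriv_fst[OF assms(1)]])
  show "weak_deriv ({a<..<b} \<times> {c<..<d}) (0,1) u (pd (0,1) u)"
    by (rule weak_deriv_snd_classical[OF smooth_continuous_on[OF assms(1)] smooth_continuous_on[OF smooth_pd[OF assms(1)]] assms(3) smooth_deriv_snd[OF assms(1)]])
  show "L2 ({a<..<b} \<times> {c<..<d}) u" by (rule L2_rect[OF smooth_continuous_on[OF assms(1)]])
  show "L2 ({a<..<b} \<times> {c<..<d}) (pd e u)" by (rule L2_rect[OF smooth_continuous_on[OF smooth_pd[OF assms(1)]]])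
qed

lemma H1_norm_tendsto_smooth:
  fixes a b c d :: real
  defines "\<Omega> \<equiv> {a<..<b} \<times> {c<..<d}"
  assumes ab: "a \<le> b" "c \<le> d" and w: "L2 \<Omega> w" "L2 \<Omega> w1" "weak_deriv \<Omega> (1,0) w w1" "L2 \<Omega> w2" "weak_deriv \<Omega> (0,1) w w2"
    and u: "\<And>n. smooth (u n)" and lim: "(\<lambda>n. H1_norm \<Omega> (\<lambda>x. w x - u n x)) \<longlonglongrightarrow> 0"
  shows "(\<lambda>n. sqn \<Omega> (\<lambda>x. w x - u n x)) \<longlonglongrightarrow> 0" "(\<lambda>n. sqn \<Omega> (\<lambda>x. w1 x - pd (1,0) (u n) x)) \<longlonglongrightarrow> 0"
    "(\<lambda>n. sqn \<Omega> (\<lambda>x. w2 x - pd (0,1) (u n) x)) \<longlonglongrightarrow> 0"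
proof -
  note U = smooth_weak_deriv[OF u ab, folded \<Omega>_def]
  have eq: "(H1_norm \<Omega> (\<lambda>x. w x - u n x))\<^sup>2 = sqn \<Omega> (\<lambda>x. w x - u n x) + sqn \<Omega> (\<lambda>x. w1 x - pd (1,0) (u n) x) + sqn \<Omega> (\<lambda>x. w2 x - pd (0,1) (u n) x)" for n
    unfolding \<Omega>_def
    by (rule H1_norm_sq_eq; unfold \<Omega>_def[symmetric]; intro L2_diff weak_deriv_diff[of a b c d, folded \<Omega>_def] w U)
  have 0: "(\<lambda>n. (H1_norm \<Omega> (\<lambda>x. w x - u n x))\<^sup>2) \<longlonglongrightarrow> 0"
    using tendsto_power[OF lim, of 2] by simp
  have sq: "(\<lambda>n. s n) \<longlonglongrightarrow> 0" if "\<And>n. s n \<le> (H1_norm \<Omega> (\<lambda>x. w x - u n x))\<^sup>2" "\<And>n. 0 \<le> s n" for s :: "nat \<Rightarrow> real"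
    by (rule tendsto_sandwich[OF _ _ tendsto_const 0]) (use that in auto)
  show "(\<lambda>n. sqn \<Omega> (\<lambda>x. w x - u n x)) \<longlonglongrightarrow> 0" "(\<lambda>n. sqn \<Omega> (\<lambda>x. w1 x - pd (1,0) (u n) x)) \<longlonglongrightarrow> 0"
    "(\<lambda>n. sqn \<Omega> (\<lambda>x. w2 x - pd (0,1) (u n) x)) \<longlonglongrightarrow> 0"
    by (rule sq; simp add: eq sqn_nonneg)+
qed

lemma sqn_diff_commute: "sqn S (\<lambda>x. f x - g x) = sqn S (\<lambda>x. g x - f x)"
  by (simp add: sqn_def norm_minus_commute)

lemma L2_tendsto_integral_eqI:
  assumes "L2 S f" "\<And>n. L2 S (F n)" "L2 S g" "(\<lambda>n. sqn S (\<lambda>x. f x - F n x)) \<longlonglongrightarrow> 0"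
    "L2 S f'" "\<And>n. L2 S (F' n)" "L2 S g'" "(\<lambda>n. sqn S (\<lambda>x. f' x - F' n x)) \<longlonglongrightarrow> 0"
    and lim: "(\<lambda>n. (LINT x:S|lborel. F n x * g x) + (LINT x:S|lborel. F' n x * g' x)) \<longlonglongrightarrow> l"
  shows "(LINT x:S|lborel. f x * g x) + (LINT x:S|lborel. f' x * g' x) = l"
  using LIMSEQ_unique[OF tendsto_add[OF L2_tendsto_integral[OF assms(1-4)] L2_tendsto_integral[OF assms(5-8)]] lim] .

text \<open>The identity holds for the smooth approximants of \<open>trace_bc\<close>;
  \<open>H1\<close> convergence handles the interior integrals and L2 convergence on the sides
  \<open>r = R\<close> and \<open>r = \<rho>\<close> the boundary ones. Through this limit the datum
  \<eta> enters the uniqueness proof.\<close>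

lemma trace_ibp_fst:
  fixes R \<rho> Z :: real
  defines "\<Omega> \<equiv> {R<..<\<rho>} \<times> {0<..<Z}"
  assumes R: "R \<le> \<rho>" "0 \<le> Z" and w: "H1 \<Omega> w" and \<eta>: "L2 {0<..<Z} \<eta>" and tr: "trace_bc R \<rho> Z w \<eta>"
    and F: "continuous_on ({R..\<rho>} \<times> {0..Z}) F" and G: "continuous_on ({R..\<rho>} \<times> {0..Z}) G"
    and D: "\<And>r z. r \<in> {R..\<rho>} \<Longrightarrow> z \<in> {0..Z} \<Longrightarrow> ((\<lambda>r. F (r, z)) has_vector_derivative G (r, z)) (at r within {R..\<rho>})"
  shows "(LINT x:\<Omega>|lborel. wpd \<Omega> (1,0) w x * F x) + (LINT x:\<Omega>|lborel. w x * G x) = - (LINT z:{0<..<Z}|lborel. \<eta> z * F (R, z))"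
proof -
  obtain u where u: "\<And>n. smooth (u n)" "(\<lambda>n. H1_norm \<Omega> (\<lambda>x. w x - u n x)) \<longlonglongrightarrow> 0"
    "(\<lambda>n. LINT z:{0<..<Z}|lborel. (cmod (u n (R, z) - \<eta> z))\<^sup>2) \<longlonglongrightarrow> 0"
    "(\<lambda>n. LINT z:{0<..<Z}|lborel. (cmod (u n (\<rho>, z)))\<^sup>2) \<longlonglongrightarrow> 0"
    using tr unfolding trace_bc_def Omega_pml_def \<Omega>_def by blast
  note L = H1D[OF w]
  note U = smooth_weak_deriv[OF u(1) R, folded \<Omega>_def]
  note lim = H1_norm_tendsto_smooth[OF R L[unfolded \<Omega>_def] u(1) u(2)[unfolded \<Omega>_def], folded \<Omega>_def]
  have Uc: "continuous_on A (u n)" "continuous_on A (pd e (u n))" for A n e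
    by (rule smooth_continuous_on[OF u(1)], rule smooth_continuous_on[OF smooth_pd[OF u(1)]])
  have F2: "L2 \<Omega> F" "L2 \<Omega> G" unfolding \<Omega>_def by (rule L2_rect[OF F], rule L2_rect[OF G])
  have Fz: "L2 {0<..<Z} (\<lambda>z. F (r, z))" "L2 {0<..<Z} (\<lambda>z. u n (r, z))" if "r \<in> {R..\<rho>}" for r n
    by (rule L2_Ioo, rule continuous_on_slice2[OF F that], rule L2_Ioo, rule continuous_on_slice2[OF Uc(1)[of "{R..\<rho>} \<times> {0..Z}"] that])
  have Rm: "R \<in> {R..\<rho>}" "\<rho> \<in> {R..\<rho>}" using R by auto
  have eq: "(LINT x:\<Omega>|lborel. pd (1,0) (u n) x * F x) + (LINT x:\<Omega>|lborel. u n x * G x)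
     = (LINT z:{0<..<Z}|lborel. u n (\<rho>, z) * F (\<rho>, z)) - (LINT z:{0<..<Z}|lborel. u n (R, z) * F (R, z))" for n
  proof -
    have "(LINT x:\<Omega>|lborel. u n x * G x + pd (1,0) (u n) x * F x) = (LINT z:{0<..<Z}|lborel. u n (\<rho>, z) * F (\<rho>, z) - u n (R, z) * F (R, z))"
      unfolding \<Omega>_def
    proof (rule integral_rect_deriv_fst[OF R(1)])
      show "((\<lambda>r. u n (r, z) * F (r, z)) has_vector_derivative u n (r, z) * G (r, z) + pd (1, 0) (u n) (r, z) * F (r, z)) (at r within {R..\<rho>})"
        if "r \<in> {R..\<rho>}" "z \<in> {0..Z}" for r z
        by (intro has_vector_derivative_mult D that smooth_deriv_fst u)
    qed (intro continuous_intros Uc F G)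
    also have "\<dots> = (LINT z:{0<..<Z}|lborel. u n (\<rho>, z) * F (\<rho>, z)) - (LINT z:{0<..<Z}|lborel. u n (R, z) * F (R, z))"
      by (intro set_integral_diff(2) L2_mult_integrable Fz Rm)
    finally have fin: "(LINT x:\<Omega>|lborel. u n x * G x + pd (1,0) (u n) x * F x) = \<dots>" .
    have i: "set_integrable lborel \<Omega> (\<lambda>x. u n x * G x)" "set_integrable lborel \<Omega> (\<lambda>x. pd (1,0) (u n) x * F x)"
      by (intro L2_mult_integrable U F2)+
    show ?thesis using fin unfolding set_integral_add(2)[OF i] by (simp add: add.commute)
  qed
  have "(\<lambda>n. (LINT x:\<Omega>|lborel. pd (1,0) (u n) x * F x) + (LINT x:\<Omega>|lborel. u n x * G x)) \<longlonglongrightarrow>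
     (LINT z:{0<..<Z}|lborel. 0 * F (\<rho>, z)) - (LINT z:{0<..<Z}|lborel. \<eta> z * F (R, z))"
    unfolding eq
  proof (intro tendsto_diff)
    show "(\<lambda>n. LINT z:{0<..<Z}|lborel. u n (\<rho>, z) * F (\<rho>, z)) \<longlonglongrightarrow> (LINT z:{0<..<Z}|lborel. 0 * F (\<rho>, z))"
      by (rule L2_tendsto_integral[OF L2_zero Fz(2)[OF Rm(2)] Fz(1)[OF Rm(2)]]) (use u(4) in \<open>simp add: sqn_def\<close>)
    show "(\<lambda>n. LINT z:{0<..<Z}|lborel. u n (R, z) * F (R, z)) \<longlonglongrightarrow> (LINT z:{0<..<Z}|lborel. \<eta> z * F (R, z))"
      by (rule L2_tendsto_integral[OF \<eta> Fz(2)[OF Rm(1)] Fz(1)[OF Rm(1)]]) (use u(3) in \<open>simp add: sqn_def norm_minus_commute\<close>)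
  qed
  from L2_tendsto_integral_eqI[OF L(2) U(4) F2(1) lim(2) L(1) U(3) F2(2) lim(1) this] show ?thesis by simp
qed

text \<open>Since the traces of \<open>w\<close> on \<open>z = 0\<close> and \<open>z = Z\<close>
  vanish, \<open>F\<close> is unrestricted there; in the application it contains a cosine.\<close>

lemma trace_ibp_snd:
  fixes R \<rho> Z :: real
  defines "\<Omega> \<equiv> {R<..<\<rho>} \<times> {0<..<Z}"
  assumes R: "R \<le> \<rho>" "0 \<le> Z" and w: "H1 \<Omega> w" and tr: "trace_bc R \<rho> Z w \<eta>"
    and F: "continuous_on ({R..\<rho>} \<times> {0..Z}) F" and G: "continuous_on ({R..\<rho>} \<times> {0..Z}) G"
    and D: "\<And>r z. r \<in> {R..\<rho>} \<Longrightarrow> z \<in> {0..Z} \<Longrightarrow> ((\<lambda>z. F (r, z)) has_vector_derivative G (r, z)) (at z within {0..Z})"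
  shows "(LINT x:\<Omega>|lborel. wpd \<Omega> (0,1) w x * F x) + (LINT x:\<Omega>|lborel. w x * G x) = 0"
proof -
  obtain u where u: "\<And>n. smooth (u n)" "(\<lambda>n. H1_norm \<Omega> (\<lambda>x. w x - u n x)) \<longlonglongrightarrow> 0"
    "(\<lambda>n. LINT r:{R<..<\<rho>}|lborel. (cmod (u n (r, 0)))\<^sup>2) \<longlonglongrightarrow> 0"
    "(\<lambda>n. LINT r:{R<..<\<rho>}|lborel. (cmod (u n (r, Z)))\<^sup>2) \<longlonglongrightarrow> 0"
    using tr unfolding trace_bc_def Omega_pml_def \<Omega>_def by blast
  note L = H1D[OF w]
  note U = smooth_weak_deriv[OF u(1) R, folded \<Omega>_def]
  note lim = H1_norm_tendsto_smooth[OF R L[unfolded \<Omega>_def] u(1) u(2)[unfolded \<Omega>_def], folded \<Omega>_def]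
  have Uc: "continuous_on A (u n)" "continuous_on A (pd e (u n))" for A n e
    by (rule smooth_continuous_on[OF u(1)], rule smooth_continuous_on[OF smooth_pd[OF u(1)]])
  have F2: "L2 \<Omega> F" "L2 \<Omega> G" unfolding \<Omega>_def by (rule L2_rect[OF F], rule L2_rect[OF G])
  have Fz: "L2 {R<..<\<rho>} (\<lambda>r. F (r, z))" "L2 {R<..<\<rho>} (\<lambda>r. u n (r, z))" if "z \<in> {0..Z}" for z n
    by (rule L2_Ioo, rule continuous_on_slice1[OF F that], rule L2_Ioo, rule continuous_on_slice1[OF Uc(1)[of "{R..\<rho>} \<times> {0..Z}"] that])
  have Zm: "0 \<in> {0..Z}" "Z \<in> {0..Z}" using R by auto
  have eq: "(LINT x:\<Omega>|lborel. pd (0,1) (u n) x * F x) + (LINT x:\<Omega>|lborel. u n x * G x)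
     = (LINT r:{R<..<\<rho>}|lborel. u n (r, Z) * F (r, Z)) - (LINT r:{R<..<\<rho>}|lborel. u n (r, 0) * F (r, 0))" for n
  proof -
    have "(LINT x:\<Omega>|lborel. u n x * G x + pd (0,1) (u n) x * F x) = (LINT r:{R<..<\<rho>}|lborel. u n (r, Z) * F (r, Z) - u n (r, 0) * F (r, 0))"
      unfolding \<Omega>_def
    proof (rule integral_rect_deriv_snd[OF R(2)])
      show "((\<lambda>z. u n (r, z) * F (r, z)) has_vector_derivative u n (r, z) * G (r, z) + pd (0,1) (u n) (r, z) * F (r, z)) (at z within {0..Z})"
        if "r \<in> {R..\<rho>}" "z \<in> {0..Z}" for r z
        by (intro has_vector_derivative_mult D that smooth_deriv_snd u)
    qed (intro continuous_intros Uc F G)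
    also have "\<dots> = (LINT r:{R<..<\<rho>}|lborel. u n (r, Z) * F (r, Z)) - (LINT r:{R<..<\<rho>}|lborel. u n (r, 0) * F (r, 0))"
      by (intro set_integral_diff(2) L2_mult_integrable Fz Zm)
    finally have fin: "(LINT x:\<Omega>|lborel. u n x * G x + pd (0,1) (u n) x * F x) = \<dots>" .
    have i: "set_integrable lborel \<Omega> (\<lambda>x. u n x * G x)" "set_integrable lborel \<Omega> (\<lambda>x. pd (0,1) (u n) x * F x)"
      by (intro L2_mult_integrable U F2)+
    show ?thesis using fin unfolding set_integral_add(2)[OF i] by (simp add: add.commute)
  qed
  have "(\<lambda>n. (LINT x:\<Omega>|lborel. pd (0,1) (u n) x * F x) + (LINT x:\<Omega>|lborel. u n x * G x)) \<longlonglongrightarrow>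
     (LINT r:{R<..<\<rho>}|lborel. 0 * F (r, Z)) - (LINT r:{R<..<\<rho>}|lborel. 0 * F (r, 0))"
    unfolding eq
  proof (intro tendsto_diff)
    show "(\<lambda>n. LINT r:{R<..<\<rho>}|lborel. u n (r, Z) * F (r, Z)) \<longlonglongrightarrow> (LINT r:{R<..<\<rho>}|lborel. 0 * F (r, Z))"
      by (rule L2_tendsto_integral[OF L2_zero Fz(2)[OF Zm(2)] Fz(1)[OF Zm(2)]]) (use u(4) in \<open>simp add: sqn_def\<close>)
    show "(\<lambda>n. LINT r:{R<..<\<rho>}|lborel. u n (r, 0) * F (r, 0)) \<longlonglongrightarrow> (LINT r:{R<..<\<rho>}|lborel. 0 * F (r, 0))"
      by (rule L2_tendsto_integral[OF L2_zero Fz(2)[OF Zm(1)] Fz(1)[OF Zm(1)]]) (use u(3) in \<open>simp add: sqn_def\<close>)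
  qed
  from L2_tendsto_integral_eqI[OF L(4) U(4) F2(1) lim(3) L(1) U(3) F2(2) lim(1) this] show ?thesis by simp
qed

lemma sin_deriv: "((\<lambda>z. complex_of_real (sin (c * z))) has_vector_derivative of_real (c * cos (c * z))) (at z within A)"
proof (rule has_vector_derivative_of_real)
  show "((\<lambda>z. sin (c * z)) has_real_derivative c * cos (c * z)) (at z within A)"
    by (auto intro!: derivative_eq_intros)
qed

lemma cos_deriv: "((\<lambda>z. complex_of_real (c * cos (c * z))) has_vector_derivative of_real (- (c\<^sup>2 * sin (c * z)))) (at z within A)"
proof (rule has_vector_derivative_of_real)
  show "((\<lambda>z. c * cos (c * z)) has_real_derivative - (c\<^sup>2 * sin (c * z))) (at z within A)"
    by (auto intro!: derivative_eq_intros simp: power2_eq_square)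
qed

text \<open>Testing with \<open>v = q\<^sup>* sin(m\<pi>z/Z)\<close>, where \<open>q\<close> solves the mode equation with right-hand side \<open>f\<close> and zero boundary
  values, moves all derivatives onto \<open>v\<close>, so that the moment of a solution against \<open>f(r) sin(m\<pi>z/Z)\<close> depends only on \<open>\<eta>\<close>.\<close>

lemma pml_solution_moment:
  fixes R \<rho> \<chi>0 k Z :: real
  defines "\<Omega> \<equiv> {R<..<\<rho>} \<times> {0<..<Z}"
  assumes par: "R > 0" "\<rho> \<ge> 2 * R" "\<chi>0 > 0" "Z > 0" and \<eta>: "L2 {0<..<Z} \<eta>" and f: "continuous_on {R..\<rho>} f"
  obtains I where "\<And>w. pml_solution k Z R \<rho> \<chi>0 \<eta> w \<Longrightarrow> (LINT x:\<Omega>|lborel. w x * (f (fst x) * complex_of_real (sin (real m * pi / Z * snd x)))) = I"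
proof -
  interpret pml_interval R \<rho> \<chi>0 by unfold_locales (use par in auto)
  define c where "c = real m * pi / Z"
  define l where "l = k\<^sup>2 - c\<^sup>2"
  define E where "E = (\<lambda>r. al \<chi>0 R r / (of_real r * be \<chi>0 R r))"
  have Ec: "continuous_on {R..\<rho>} E" unfolding E_def using R be_nz by (intro continuous_intros al_cont be_cont) auto
  have cB: "cB l \<chi>0 R r = - of_real l * E r" for r by (simp add: cB_def E_def)
  obtain q p where sol: "ode_sol R \<rho> (cA \<chi>0 R) (cB l \<chi>0 R) f q p" "q R = 0" "q \<rho> = 0"
    using mode_exists[OF f] by blast
  have le: "R \<le> \<rho>" "0 \<le> Z" using Rlt par by auto
  have qd: "(q has_vector_derivative cA \<chi>0 R t * p t) (at t within {R..\<rho>})" "(p has_vector_derivative cB l \<chi>0 R t * q t - f t) (at t within {R..\<rho>})" if "t \<in> {R..\<rho>}" for t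
    using sol(1) that unfolding ode_sol_def by blast+
  note qc = ode_sol_continuous[OF sol(1)]
  define s where "s = (\<lambda>z. complex_of_real (sin (c * z)))"
  define s' where "s' = (\<lambda>z. complex_of_real (c * cos (c * z)))"
  have sc: "continuous_on A s" "continuous_on A s'" for A unfolding s_def s'_def by (intro continuous_intros)+
  have s0: "s 0 = 0" "s Z = 0" using par(4) by (simp_all add: s_def c_def)
  have sd: "(s has_vector_derivative s' z) (at z within A)" for z A unfolding s_def s'_def by (rule sin_deriv)
  \<comment> \<open>The form conjugates its second argument, so \<open>cnj v\<close> is
    \<open>q * s\<close>.\<close>
  define v where "v = (\<lambda>x. cnj (q (fst x)) * s (snd x))"
  have vd: "((\<lambda>r. cnj (q r)) has_vector_derivative cnj (cA \<chi>0 R t * p t)) (at t within {R..\<rho>})" if "t \<in> {R..\<rho>}" for t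
    by (rule bounded_linear.has_vector_derivative[OF bounded_linear_cnj qd(1)[OF that]])
  have vdc: "continuous_on {R..\<rho>} (\<lambda>t. cnj (cA \<chi>0 R t * p t))" by (intro continuous_intros cA_cont qc)
  have vH: "H1_0 \<Omega> v"
    unfolding \<Omega>_def v_def
    by (rule H1_0_product[OF Rlt par(4) vd vdc sd sc(2)]) (use sol s0 in auto)
  note V = weak_deriv_product[OF le vd vdc sd sc(2), folded \<Omega>_def v_def]
  \<comment> \<open>The flux of the dual mode times the sine moment of \<eta>: no dependence on the
    solution \<open>w\<close>.\<close>
  define I where "I = p R * (LINT z:{0<..<Z}|lborel. \<eta> z * s z)"
  have "(LINT x:\<Omega>|lborel. w x * (f (fst x) * s (snd x))) = I" if w: "pml_solution k Z R \<rho> \<chi>0 \<eta> w" for w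
  proof -
    have wH: "H1 \<Omega> w" and tr: "trace_bc R \<rho> Z w \<eta>" and a0: "a_pml k Z R \<rho> \<chi>0 w v = 0"
      using w vH unfolding pml_solution_def Omega_pml_def \<Omega>_def by auto
    note L = H1D[OF wH]
    have cF: "continuous_on ({R..\<rho>} \<times> {0..Z}) (\<lambda>x. p (fst x) * s (snd x))"
      "continuous_on ({R..\<rho>} \<times> {0..Z}) (\<lambda>x. (cB l \<chi>0 R (fst x) * q (fst x) - f (fst x)) * s (snd x))"
      "continuous_on ({R..\<rho>} \<times> {0..Z}) (\<lambda>x. E (fst x) * q (fst x) * s' (snd x))"
      "continuous_on ({R..\<rho>} \<times> {0..Z}) (\<lambda>x. E (fst x) * q (fst x) * (- of_real (c\<^sup>2) * s (snd x)))"
      by (intro continuous_intros continuous_on_fst_comp continuous_on_snd_comp qc sc cB_cont f Ec)+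
    have 1: "(LINT x:\<Omega>|lborel. wpd \<Omega> (1,0) w x * (p (fst x) * s (snd x))) + (LINT x:\<Omega>|lborel. w x * ((cB l \<chi>0 R (fst x) * q (fst x) - f (fst x)) * s (snd x)))
        = - (LINT z:{0<..<Z}|lborel. \<eta> z * (p R * s z))"
      using trace_ibp_fst[OF le wH[unfolded \<Omega>_def] \<eta> tr cF(1,2)] qd(2)
      by (simp add: has_vector_derivative_mult_left \<Omega>_def)
    have 2: "(LINT x:\<Omega>|lborel. wpd \<Omega> (0,1) w x * (E (fst x) * q (fst x) * s' (snd x))) + (LINT x:\<Omega>|lborel. w x * (E (fst x) * q (fst x) * (- of_real (c\<^sup>2) * s (snd x)))) = 0"
      unfolding \<Omega>_def
    proof (rule trace_ibp_snd[OF le wH[unfolded \<Omega>_def] tr cF(3,4)])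
      fix r z
      have "(s' has_vector_derivative - of_real (c\<^sup>2) * s z) (at z within {0..Z})"
        using cos_deriv[of c z "{0..Z}"] by (simp add: s'_def s_def)
      from has_vector_derivative_mult_right[OF this, of "E r * q r"]
      show "((\<lambda>z. E (fst (r, z)) * q (fst (r, z)) * s' (snd (r, z))) has_vector_derivative E (fst (r, z)) * q (fst (r, z)) * (- of_real (c\<^sup>2) * s (snd (r, z)))) (at z within {0..Z})"
        by simp
    qed
    have nz: "cA \<chi>0 R r \<noteq> 0" if "r \<ge> R" for r using al_nz[OF that] be_nz[OF that] R that by (simp add: cA_def)
    \<comment> \<open>Division by \<open>cA\<close> turns the radial derivative of
      \<open>cnj v\<close> into \<open>p * s\<close>, whose derivative is known from the mode
      equation.\<close>
    have T1: "(LINT x:\<Omega>|lborel. wpd \<Omega> (1,0) w x * (1 / cA \<chi>0 R (fst x) * cnj (cnj (cA \<chi>0 R (fst x) * p (fst x)) * s (snd x))))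
        = (LINT x:\<Omega>|lborel. wpd \<Omega> (1,0) w x * (p (fst x) * s (snd x)))"
    proof (rule set_lebesgue_integral_cong)
      show "\<forall>x. x \<in> \<Omega> \<longrightarrow> wpd \<Omega> (1,0) w x * (1 / cA \<chi>0 R (fst x) * cnj (cnj (cA \<chi>0 R (fst x) * p (fst x)) * s (snd x)))
        = wpd \<Omega> (1,0) w x * (p (fst x) * s (snd x))"
        using nz by (auto simp: \<Omega>_def s_def)
    qed (simp add: \<Omega>_def)
    have T2: "E (fst x) * cnj (cnj (q (fst x)) * s' (snd x)) = E (fst x) * q (fst x) * s' (snd x)" for x :: pt
      by (simp add: s'_def)
    have T3: "E (fst x) * cnj (v x) = E (fst x) * q (fst x) * s (snd x)" for x :: pt
      by (simp add: v_def s_def)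
    define A where "A = (LINT x:\<Omega>|lborel. w x * (E (fst x) * q (fst x) * s (snd x)))"
    define M where "M = (LINT x:\<Omega>|lborel. w x * (f (fst x) * s (snd x)))"
    have A1: "(LINT x:\<Omega>|lborel. w x * (E (fst x) * q (fst x) * (- of_real (c\<^sup>2) * s (snd x)))) = - of_real (c\<^sup>2) * A"
      unfolding A_def set_integral_mult_right[symmetric] by (simp add: mult_ac)
    have cG: "continuous_on ({R..\<rho>} \<times> {0..Z}) (\<lambda>x. E (fst x) * q (fst x) * s (snd x))" "continuous_on ({R..\<rho>} \<times> {0..Z}) (\<lambda>x. f (fst x) * s (snd x))"
      by (intro continuous_intros continuous_on_fst_comp continuous_on_snd_comp qc sc f Ec)+
    have A2: "(LINT x:\<Omega>|lborel. w x * ((cB l \<chi>0 R (fst x) * q (fst x) - f (fst x)) * s (snd x))) = - of_real l * A - M"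
    proof -
      have "(LINT x:\<Omega>|lborel. w x * ((cB l \<chi>0 R (fst x) * q (fst x) - f (fst x)) * s (snd x)))
         = (LINT x:\<Omega>|lborel. - of_real l * (w x * (E (fst x) * q (fst x) * s (snd x))) - w x * (f (fst x) * s (snd x)))"
        unfolding cB by (simp add: algebra_simps)
      also have "\<dots> = (LINT x:\<Omega>|lborel. - of_real l * (w x * (E (fst x) * q (fst x) * s (snd x)))) - M"
        unfolding M_def \<Omega>_def
        by (intro set_integral_diff(2) set_integrable_mult_right impI L2_mult_integrable L(1)[unfolded \<Omega>_def] L2_rect cG)
      also have "(LINT x:\<Omega>|lborel. - of_real l * (w x * (E (fst x) * q (fst x) * s (snd x)))) = - of_real l * A"
        unfolding A_def by (rule set_integral_mult_right)
      finally show ?thesis .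
    qed
    have B: "(LINT z:{0<..<Z}|lborel. \<eta> z * (p R * s z)) = I"
      unfolding I_def set_integral_mult_right[symmetric] by (simp add: mult_ac)
    have a: "a_pml k Z R \<rho> \<chi>0 w v = (LINT x:\<Omega>|lborel. wpd \<Omega> (1,0) w x * (1 / cA \<chi>0 R (fst x) * cnj (cnj (cA \<chi>0 R (fst x) * p (fst x)) * s (snd x))))
      + (LINT x:\<Omega>|lborel. wpd \<Omega> (0,1) w x * (E (fst x) * cnj (cnj (q (fst x)) * s' (snd x)))) - of_real (k\<^sup>2) * (LINT x:\<Omega>|lborel. w x * (E (fst x) * cnj (v x)))"
      unfolding \<Omega>_def E_def by (rule a_pml_eq(1)[OF par(1-3) L[unfolded \<Omega>_def] V(3,4,1,5,2)[unfolded \<Omega>_def]])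
    have "0 = (LINT x:\<Omega>|lborel. wpd \<Omega> (1,0) w x * (p (fst x) * s (snd x)))
       + (LINT x:\<Omega>|lborel. wpd \<Omega> (0,1) w x * (E (fst x) * q (fst x) * s' (snd x))) - of_real (k\<^sup>2) * A"
      using a unfolding a0 T1 T2 T3 A_def .
    \<comment> \<open>The terms with \<open>A\<close> have total coefficient
      \<open>l + c\<^sup>2 - k\<^sup>2 = 0\<close>, which leaves the source moment \<open>M\<close>
      against the boundary term \<open>I\<close>.\<close>
    then have "0 = (- I - (- of_real l * A - M)) + of_real (c\<^sup>2) * A - of_real (k\<^sup>2) * A"
      using 1 2 unfolding A1 A2 B by (simp add: algebra_simps add_eq_0_iff2 eq_neg_iff_add_eq_0)
    moreover have "complex_of_real l = of_real (k\<^sup>2) - of_real (c\<^sup>2)" by (simp add: l_def)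
    ultimately have "M = I" by (simp add: algebra_simps)
    then show ?thesis by (simp add: M_def)
  qed
  then show ?thesis using that[of I] by (simp add: s_def c_def)
qed

text \<open>Two solutions have the same moments against all products
  \<open>f(r) sin(m\<pi>z/Z)\<close> by \<open>pml_solution_moment\<close>, and these products are
  complete.\<close>

theorem pml_solution_unique:
  assumes par: "R > 0" "\<rho> \<ge> 2 * R" "\<chi>0 > 0" "Z > 0" and \<eta>: "L2 {0<..<Z} \<eta>"
    and w: "pml_solution k Z R \<rho> \<chi>0 \<eta> w1" "pml_solution k Z R \<rho> \<chi>0 \<eta> w2"
  shows "AE x in lborel. x \<in> Omega_pml R \<rho> Z \<longrightarrow> w1 x = w2 x"
proof -
  have L: "L2 ({R<..<\<rho>} \<times> {0<..<Z}) w1" "L2 ({R<..<\<rho>} \<times> {0<..<Z}) w2"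
    using w H1D(1) unfolding pml_solution_def Omega_pml_def by blast+
  have "AE x in lborel. x \<in> {R<..<\<rho>} \<times> {0<..<Z} \<longrightarrow> w1 x - w2 x = 0"
  proof (rule sine_products_complete[OF par(4)])
    show "L2 ({R<..<\<rho>} \<times> {0<..<Z}) (\<lambda>x. w1 x - w2 x)" by (intro L2_diff L)
    fix f :: "real \<Rightarrow> complex" and m :: nat
    assume f: "continuous_on {R..\<rho>} f" and "1 \<le> m"
    obtain I where I: "\<And>w. pml_solution k Z R \<rho> \<chi>0 \<eta> w \<Longrightarrow> (LINT x:{R<..<\<rho>} \<times> {0<..<Z}|lborel. w x * (f (fst x) * complex_of_real (sin (real m * pi / Z * snd x)))) = I"
      using pml_solution_moment[OF par \<eta> f] by blast
    have c: "continuous_on ({R..\<rho>} \<times> {0..Z}) (\<lambda>x. f (fst x) * complex_of_real (sin (real m * pi / Z * snd x)))"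
      by (intro continuous_intros continuous_on_fst_comp f)
    have "(LINT x:{R<..<\<rho>} \<times> {0<..<Z}|lborel. (w1 x - w2 x) * (f (fst x) * complex_of_real (sin (real m * pi / Z * snd x)))) = I - I"
      unfolding left_diff_distrib
      using set_integral_diff(2)[OF L2_mult_integrable[OF L(1) L2_rect[OF c]] L2_mult_integrable[OF L(2) L2_rect[OF c]]]
      unfolding I[OF w(1)] I[OF w(2)] .
    then show "(LINT x:{R<..<\<rho>} \<times> {0<..<Z}|lborel. (w1 x - w2 x) * (f (fst x) * complex_of_real (sin (real m * pi * snd x / Z)))) = 0"
      by simp
  qed
  then show ?thesis unfolding Omega_pml_def by eventually_elim simp
qed

text \<open>Functions that agree almost everywhere have the same set of weak derivatives, hence
  literally the same choice in \<open>wpd\<close>. This transfers the bound from the constructed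
  solution to every other one.\<close>

lemma H1_norm_AE_cong:
  assumes "AE x in lborel. x \<in> \<Omega> \<longrightarrow> w1 x = w2 x" "H1 \<Omega> w1" "H1 \<Omega> w2"
  shows "H1_norm \<Omega> w1 = H1_norm \<Omega> w2"
proof -
  have L: "L2 \<Omega> w1" "L2 \<Omega> w2" using assms(2,3) H1D(1) by auto
  have wd: "weak_deriv \<Omega> d w1 g = weak_deriv \<Omega> d w2 g" for d g
  proof -
    have "(LINT x:\<Omega>|lborel. w1 x * pd d \<phi> x) = (LINT x:\<Omega>|lborel. w2 x * pd d \<phi> x)" if "test_fun \<Omega> \<phi>" for \<phi>
    proof (rule set_integral_AE_cong)
      have cm: "pd d \<phi> \<in> borel_measurable borel"
        by (rule borel_measurable_continuous_onI[OF smooth_continuous_on[OF smooth_pd[OF test_fun_smooth[OF that]]]])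
      have "set_borel_measurable lborel \<Omega> (\<lambda>x. w x * pd d \<phi> x)" if "L2 \<Omega> w" for w
      proof -
        have "(\<lambda>x. (indicator \<Omega> x *\<^sub>R w x) * pd d \<phi> x) \<in> borel_measurable lborel"
          using L2_measurable[OF that] cm by (intro borel_measurable_times) auto
        then show ?thesis by (simp add: set_borel_measurable_def)
      qed
      with L show "set_borel_measurable lborel \<Omega> (\<lambda>x. w1 x * pd d \<phi> x)" "set_borel_measurable lborel \<Omega> (\<lambda>x. w2 x * pd d \<phi> x)" by blast+
      show "AE x in lborel. x \<in> \<Omega> \<longrightarrow> w1 x * pd d \<phi> x = w2 x * pd d \<phi> x"
        using assms(1) by eventually_elim simp
    qed
    then show ?thesis by (simp add: weak_deriv_def)
  qed
  have wp: "wpd \<Omega> d w1 = wpd \<Omega> d w2" for d by (simp add: wpd_def wd)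
  have "(H1_norm \<Omega> w1)\<^sup>2 = (H1_norm \<Omega> w2)\<^sup>2"
    unfolding H1_norm_sq[OF assms(2)] H1_norm_sq[OF assms(3)] wp sqn_AE_cong[OF L assms(1)] ..
  then show ?thesis using H1_norm_nonneg by (simp add: power2_eq_iff_nonneg)
qed

section \<open>Existence\<close>

lemma sqn_add_orthogonal:
  assumes F: "L2 S F" and G: "L2 S G" and 0: "(LINT x:S|lborel. F x * cnj (G x)) = 0"
  shows "sqn S (\<lambda>x. F x + G x) = sqn S F + sqn S G"
proof -
  have i: "set_integrable lborel S (\<lambda>x. F x * cnj (G x))" by (intro L2_mult_integrable F L2_cnj G)
  have iR: "set_integrable lborel S (\<lambda>x. Re (F x * cnj (G x)))"
    using integrable_Re[OF i[unfolded set_integrable_def]] by (simp add: set_integrable_def)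
  have R0: "(LINT x:S|lborel. Re (F x * cnj (G x))) = 0"
    using integral_Re[OF i[unfolded set_integrable_def]] 0 by (simp add: set_lebesgue_integral_def)
  have eq: "(cmod (F x + G x))\<^sup>2 = (cmod (F x))\<^sup>2 + (cmod (G x))\<^sup>2 + 2 * Re (F x * cnj (G x))" for x
    unfolding cmod_power2 by (simp add: power2_eq_square algebra_simps)
  have "sqn S (\<lambda>x. F x + G x) = sqn S F + sqn S G + 2 * (LINT x:S|lborel. Re (F x * cnj (G x)))"
    unfolding sqn_def eq using L2_sq_integrable[OF F] L2_sq_integrable[OF G] iR
    by (simp add: set_integral_add del: complex_cnj_mult times_complex.sel)
  then show ?thesis by (simp only: R0)
qed

lemma set_integral_sum_0:
  fixes f :: "'i \<Rightarrow> 'a::euclidean_space \<Rightarrow> complex"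
  assumes "finite I" "\<And>i. i \<in> I \<Longrightarrow> set_integrable lborel S (f i)" "\<And>i. i \<in> I \<Longrightarrow> (LINT x:S|lborel. f i x) = 0"
  shows "set_integrable lborel S (\<lambda>x. \<Sum>i\<in>I. f i x) \<and> (LINT x:S|lborel. \<Sum>i\<in>I. f i x) = 0"
  using assms
proof (induction I rule: finite_induct)
  case empty
  then show ?case by (simp add: set_integrable_def)
next
  case (insert i I)
  then show ?case by (simp add: set_integral_add)
qed

lemma sqn_orthogonal_sum:
  assumes "finite I" "\<And>i. i \<in> I \<Longrightarrow> L2 S (F i)"
    "\<And>i j. i \<in> I \<Longrightarrow> j \<in> I \<Longrightarrow> i \<noteq> j \<Longrightarrow> (LINT x:S|lborel. F i x * cnj (F j x)) = 0"
  shows "sqn S (\<lambda>x. \<Sum>i\<in>I. F i x) = (\<Sum>i\<in>I. sqn S (F i))"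
  using assms
proof (induction I rule: finite_induct)
  case empty
  then show ?case by (simp add: sqn_def)
next
  case (insert i I)
  have "(LINT x:S|lborel. \<Sum>j\<in>I. F i x * cnj (F j x)) = 0"
    using insert by (intro set_integral_sum_0[THEN conjunct2] L2_mult_integrable L2_cnj) auto
  then have 0: "(LINT x:S|lborel. F i x * cnj (\<Sum>j\<in>I. F j x)) = 0" by (simp add: sum_distrib_left)
  have "sqn S (\<lambda>x. F i x + (\<Sum>j\<in>I. F j x)) = sqn S (F i) + sqn S (\<lambda>x. \<Sum>j\<in>I. F j x)"
    using insert by (intro sqn_add_orthogonal 0 L2_sum) auto
  then show ?case using insert by simp
qed

section \<open>Sine and cosine modes in \<open>z\<close>\<close>

definition es :: "real \<Rightarrow> nat \<Rightarrow> real \<Rightarrow> complex" where "es Z m z = of_real (sin (real m * pi / Z * z))"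
definition ec :: "real \<Rightarrow> nat \<Rightarrow> real \<Rightarrow> complex" where "ec Z m z = of_real (cos (real m * pi / Z * z))"

lemma es_cont: "continuous_on A (es Z m)" and ec_cont: "continuous_on A (ec Z m)"
  unfolding es_def[abs_def] ec_def[abs_def] by (intro continuous_intros)+

lemma es_ends: "Z > 0 \<Longrightarrow> es Z m 0 = 0" "Z > 0 \<Longrightarrow> es Z m Z = 0"
  by (simp_all add: es_def)

text \<open>The product formulas lead to one integral with a sign, \<open>k = -1\<close> for sines
  and \<open>k = 1\<close> for cosines; its antiderivative vanishes at both ends since the
  frequencies \<open>u\<close> and \<open>v\<close> are integer multiples of
  \<open>pi / Z\<close>.\<close>

lemma trig_orthogonal:
  assumes Z: "Z > 0" and m: "m \<ge> 1" and n: "n \<ge> 1" and mn: "m \<noteq> n"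
  shows "(LINT z:{0<..<Z}|lborel. es Z m z * cnj (es Z n z)) = 0"
    and "(LINT z:{0<..<Z}|lborel. ec Z m z * cnj (ec Z n z)) = 0"
proof -
  define u where "u = (real m - real n) * pi / Z"
  define v where "v = (real m + real n) * pi / Z"
  have uv: "u \<noteq> 0" "v \<noteq> 0" using Z m mn by (auto simp: u_def v_def)
  have ends: "sin (u * Z) = 0" "sin (v * Z) = 0"
  proof -
    have "u * Z = (real m - real n) * pi" "v * Z = (real m + real n) * pi"
      using Z by (simp_all add: u_def v_def)
    then have "u * Z = real m * pi - real n * pi" "v * Z = real m * pi + real n * pi"
      by (simp_all only: left_diff_distrib distrib_right)
    then show "sin (u * Z) = 0" "sin (v * Z) = 0" by (simp_all add: sin_diff sin_add)
  qed
  have prod: "sin (real m * pi / Z * z) * sin (real n * pi / Z * z) = (cos (u * z) - cos (v * z)) / 2"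
    "cos (real m * pi / Z * z) * cos (real n * pi / Z * z) = (cos (u * z) + cos (v * z)) / 2" for z
    unfolding sin_times_sin cos_times_cos u_def v_def by (simp_all add: algebra_simps diff_divide_distrib add_divide_distrib)
  have d: "((\<lambda>z. (sin (u * z) / u + k * (sin (v * z) / v)) / 2) has_vector_derivative (cos (u * z) + k * cos (v * z)) / 2) (at z within A)" for z k A
    unfolding has_real_derivative_iff_has_vector_derivative[symmetric] using uv
    by (auto intro!: derivative_eq_intros)
  have I: "(LINT z:{0<..<Z}|lborel. (cos (u * z) + k * cos (v * z)) / 2) = 0" for k :: real
    by (subst set_integral_FTC[OF less_imp_le[OF Z] d]) (auto intro!: continuous_intros simp: ends)
  have "es Z m z * cnj (es Z n z) = complex_of_real ((cos (u * z) + (-1) * cos (v * z)) / 2)" for z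
  proof -
    have "es Z m z * cnj (es Z n z) = complex_of_real (sin (real m * pi / Z * z) * sin (real n * pi / Z * z))" by (simp add: es_def)
    also have "sin (real m * pi / Z * z) * sin (real n * pi / Z * z) = (cos (u * z) + (-1) * cos (v * z)) / 2" unfolding prod by simp
    finally show ?thesis .
  qed
  then have "(LINT z:{0<..<Z}|lborel. es Z m z * cnj (es Z n z)) = (LINT z:{0<..<Z}|lborel. complex_of_real ((cos (u * z) + (-1) * cos (v * z)) / 2))"
    by (simp only:)
  then show "(LINT z:{0<..<Z}|lborel. es Z m z * cnj (es Z n z)) = 0" by (simp only: set_integral_complex_of_real I) simp
  have "ec Z m z * cnj (ec Z n z) = complex_of_real ((cos (u * z) + 1 * cos (v * z)) / 2)" for z
  proof -
    have "ec Z m z * cnj (ec Z n z) = complex_of_real (cos (real m * pi / Z * z) * cos (real n * pi / Z * z))" by (simp add: ec_def)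
    also have "cos (real m * pi / Z * z) * cos (real n * pi / Z * z) = (cos (u * z) + 1 * cos (v * z)) / 2" unfolding prod by simp
    finally show ?thesis .
  qed
  then have "(LINT z:{0<..<Z}|lborel. ec Z m z * cnj (ec Z n z)) = (LINT z:{0<..<Z}|lborel. complex_of_real ((cos (u * z) + 1 * cos (v * z)) / 2))"
    by (simp only:)
  then show "(LINT z:{0<..<Z}|lborel. ec Z m z * cnj (ec Z n z)) = 0" by (simp only: set_integral_complex_of_real I) simp
qed

lemma trig_sqn:
  assumes Z: "Z > 0" and m: "m \<ge> 1"
  shows "sqn {0<..<Z} (es Z m) = Z / 2" and "sqn {0<..<Z} (ec Z m) = Z / 2"
proof -
  define v where "v = 2 * real m * pi / Z"
  have v: "v \<noteq> 0" using Z m by (simp add: v_def)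
  have ends: "sin (v * Z) = 0" using Z sin_npi[of "2 * m"] by (simp add: v_def)
  have sq: "(sin (real m * pi / Z * z))\<^sup>2 = (1 + (-1) * cos (v * z)) / 2" "(cos (real m * pi / Z * z))\<^sup>2 = (1 + 1 * cos (v * z)) / 2" for z
  proof -
    have vz: "v * z = 2 * (real m * pi / Z * z)" by (simp add: v_def)
    show "(sin (real m * pi / Z * z))\<^sup>2 = (1 + (-1) * cos (v * z)) / 2"
      unfolding vz using cos_double_sin[of "real m * pi / Z * z"] by simp
    show "(cos (real m * pi / Z * z))\<^sup>2 = (1 + 1 * cos (v * z)) / 2"
      unfolding vz using cos_double_cos[of "real m * pi / Z * z"] by simp
  qed
  have d: "((\<lambda>z. (z + k * (sin (v * z) / v)) / 2) has_vector_derivative (1 + k * cos (v * z)) / 2) (at z within A)" for z k A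
    unfolding has_real_derivative_iff_has_vector_derivative[symmetric] using v
    by (auto intro!: derivative_eq_intros)
  have I: "(LINT z:{0<..<Z}|lborel. (1 + k * cos (v * z)) / 2) = Z / 2" for k :: real
    by (subst set_integral_FTC[OF less_imp_le[OF Z] d]) (auto intro!: continuous_intros simp: ends)
  show "sqn {0<..<Z} (es Z m) = Z / 2" unfolding sqn_def es_def norm_of_real power2_abs sq I ..
  show "sqn {0<..<Z} (ec Z m) = Z / 2" unfolding sqn_def ec_def norm_of_real power2_abs sq I ..
qed

text \<open>Integrating in \<open>z\<close> first removes all cross terms. The two choices of
  \<open>e\<close> serve the function and its \<open>r\<close> derivative (sines) and its
  \<open>z\<close> derivative (cosines).\<close>

lemma modal_sum_sqn:
  fixes f :: "nat \<Rightarrow> real \<Rightarrow> complex"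
  assumes I: "finite I" "\<And>m. m \<in> I \<Longrightarrow> m \<ge> 1" and Z: "Z > 0" and f: "\<And>m. m \<in> I \<Longrightarrow> continuous_on {a..b} (f m)"
    and e: "e = es Z \<or> e = ec Z"
  shows "sqn ({a<..<b} \<times> {0<..<Z}) (\<lambda>x. \<Sum>m\<in>I. f m (fst x) * e m (snd x)) = Z / 2 * (\<Sum>m\<in>I. sqn {a<..<b} (f m))"
proof -
  have ec: "continuous_on A (e m)" for A m using e es_cont ec_cont by metis
  have sq: "sqn {0<..<Z} (e m) = Z / 2" if "m \<in> I" for m using e trig_sqn[OF Z I(2)[OF that]] by auto
  have orth: "(LINT z:{0<..<Z}|lborel. e m z * cnj (e n z)) = 0" if "m \<in> I" "n \<in> I" "m \<noteq> n" for m n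
    using e trig_orthogonal[OF Z I(2)[OF that(1)] I(2)[OF that(2)] that(3)] by auto
  have c: "continuous_on ({a..b} \<times> {0..Z}) (\<lambda>x. f m (fst x) * e m (snd x))" if "m \<in> I" for m
    by (intro continuous_intros continuous_on_fst_comp continuous_on_snd_comp f ec that)
  have "sqn ({a<..<b} \<times> {0<..<Z}) (\<lambda>x. \<Sum>m\<in>I. f m (fst x) * e m (snd x)) = (\<Sum>m\<in>I. sqn ({a<..<b} \<times> {0<..<Z}) (\<lambda>x. f m (fst x) * e m (snd x)))"
  proof (rule sqn_orthogonal_sum[OF I(1)])
    show "L2 ({a<..<b} \<times> {0<..<Z}) (\<lambda>x. f m (fst x) * e m (snd x))" if "m \<in> I" for m by (rule L2_rect[OF c[OF that]])
    fix m n assume mn: "m \<in> I" "n \<in> I" "m \<noteq> n"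
    have "(LINT x:{a<..<b} \<times> {0<..<Z}|lborel. f m (fst x) * e m (snd x) * cnj (f n (fst x) * e n (snd x)))
       = (LINT r:{a<..<b}|lborel. LINT z:{0<..<Z}|lborel. (f m r * cnj (f n r)) * (e m z * cnj (e n z)))"
      by (subst set_integral_Times(1)[OF set_integrable_rect]) (intro continuous_intros c mn, simp add: mult_ac)
    then show "(LINT x:{a<..<b} \<times> {0<..<Z}|lborel. f m (fst x) * e m (snd x) * cnj (f n (fst x) * e n (snd x))) = 0"
      by (simp only: set_integral_mult_right orth[OF mn]) simp
  qed
  also have "\<dots> = (\<Sum>m\<in>I. sqn {a<..<b} (f m) * (Z / 2))"
    by (intro sum.cong refl) (simp add: L2_product(2) L2_Ioo f ec sq)
  also have "\<dots> = (\<Sum>m\<in>I. sqn {a<..<b} (f m)) * (Z / 2)" by (rule sum_distrib_right[symmetric])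
  also have "\<dots> = Z / 2 * (\<Sum>m\<in>I. sqn {a<..<b} (f m))" by (rule mult.commute)
  finally show ?thesis .
qed

lemma sqn_Cauchy_of_tails:
  fixes f :: "nat \<Rightarrow> 'a::euclidean_space \<Rightarrow> complex"
  assumes a: "summable a" and le: "\<And>i j. j \<le> i \<Longrightarrow> sqn S (\<lambda>x. f i x - f j x) \<le> sum a {j<..i}" and e: "e > 0"
  shows "\<exists>N. \<forall>i\<ge>N. \<forall>j\<ge>N. sqn S (\<lambda>x. f i x - f j x) < e"
proof -
  obtain N where N: "\<And>m n. m \<ge> N \<Longrightarrow> norm (sum a {m..<n}) < e"
    using a[unfolded summable_Cauchy] e by blast
  have lt: "sqn S (\<lambda>x. f i x - f j x) < e" if "j \<le> i" "j \<ge> N" for i j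
  proof -
    have "{j<..i} = {Suc j..<Suc i}" by auto
    then have "sum a {j<..i} < e" using N[of "Suc j" "Suc i"] that by simp
    then show ?thesis using le[OF that(1)] by linarith
  qed
  have "sqn S (\<lambda>x. f i x - f j x) < e" if "i \<ge> N" "j \<ge> N" for i j
    using lt[of j i] lt[of i j] that sqn_diff_commute[of S "f i" "f j"] by (cases "j \<le> i") auto
  then show ?thesis by blast
qed

lemma sum_Icc_diff:
  fixes g :: "nat \<Rightarrow> complex"
  assumes "j \<le> i" shows "sum g {1..i} - sum g {1..j} = sum g {j<..i}"
proof -
  have "{1..i} - {1..j} = {j<..i}" using assms by auto
  then show ?thesis using sum_diff[of "{1..i}" "{1..j}" g] assms by auto
qed

text \<open>The partial sums converge to some \<open>g\<close> in L2; \<open>g\<close> has the sine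
  coefficients of \<eta>, and \<open>sine_complete\<close> identifies the two. This yields the
  boundary value on the side \<open>r = R\<close>.\<close>

lemma sine_series_converges:
  assumes Z: "Z > 0" and \<eta>: "L2 {0<..<Z} \<eta>" and sm: "summable (\<lambda>m. (cmod (sine_coeff Z \<eta> m))\<^sup>2)"
  shows "(\<lambda>N. sqn {0<..<Z} (\<lambda>z. (\<Sum>m\<in>{1..N}. sine_coeff Z \<eta> m * es Z m z) - \<eta> z)) \<longlonglongrightarrow> 0"
proof -
  define c where "c = sine_coeff Z \<eta>"
  define S where "S = (\<lambda>N z. \<Sum>m\<in>{1..N}. c m * es Z m z)"
  define I where "I = {0<..<Z}"
  have IS: "I \<in> sets borel" "emeasure lborel I < \<infinity>" by (simp_all add: I_def)
  have eL: "L2 I (es Z m)" for m unfolding I_def by (intro L2_Ioo es_cont)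
  have SL: "L2 I (S N)" for N unfolding S_def by (intro L2_sum L2_cmult eL)
  have orth: "(LINT z:I|lborel. es Z m z * cnj (es Z n z)) = (if m = n then of_real (Z / 2) else 0)" if "m \<ge> 1" "n \<ge> 1" for m n
  proof (cases "m = n")
    case True
    have "(LINT z:I|lborel. es Z m z * cnj (es Z m z)) = (LINT z:I|lborel. complex_of_real ((cmod (es Z m z))\<^sup>2))"
      by (simp only: complex_norm_square)
    also have "\<dots> = of_real (sqn I (es Z m))" unfolding sqn_def by (rule set_integral_complex_of_real)
    finally show ?thesis using True unfolding I_def trig_sqn(1)[OF Z that(1)] by simp
  next
    case False
    then show ?thesis using trig_orthogonal(1)[OF Z that] by (simp add: I_def)
  qed
  have "\<exists>g. L2 I g \<and> (\<lambda>n. sqn I (\<lambda>x. g x - S n x)) \<longlonglongrightarrow> 0"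
  proof (rule Riesz_Fischer_L2[OF SL IS])
    have a: "summable (\<lambda>m. Z / 2 * (cmod (c m))\<^sup>2)" using sm unfolding c_def by (rule summable_mult)
    show "\<exists>N. \<forall>i\<ge>N. \<forall>j\<ge>N. sqn I (\<lambda>x. S i x - S j x) < e" if "e > 0" for e
    proof (rule sqn_Cauchy_of_tails[OF a _ that])
      fix i j :: nat assume ij: "j \<le> i"
      have "sqn I (\<lambda>x. S i x - S j x) = sqn I (\<lambda>x. \<Sum>m\<in>{j<..i}. c m * es Z m x)"
        unfolding S_def sum_Icc_diff[OF ij] ..
      also have "\<dots> = (\<Sum>m\<in>{j<..i}. sqn I (\<lambda>x. c m * es Z m x))"
      proof (rule sqn_orthogonal_sum)
        fix m n assume *: "m \<in> {j<..i}" "n \<in> {j<..i}" "m \<noteq> n"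
        have "(LINT x:I|lborel. c m * es Z m x * cnj (c n * es Z n x)) = (LINT x:I|lborel. c m * cnj (c n) * (es Z m x * cnj (es Z n x)))"
          by (simp add: mult_ac)
        also have "\<dots> = 0" unfolding set_integral_mult_right using orth[of m n] * by simp
        finally show "(LINT x:I|lborel. c m * es Z m x * cnj (c n * es Z n x)) = 0" .
      qed (auto intro: L2_cmult eL)
      also have "\<dots> = (\<Sum>m\<in>{j<..i}. Z / 2 * (cmod (c m))\<^sup>2)"
        by (intro sum.cong refl) (simp add: sqn_cmult trig_sqn(1)[OF Z] I_def)
      finally show "sqn I (\<lambda>x. S i x - S j x) \<le> (\<Sum>m\<in>{j<..i}. Z / 2 * (cmod (c m))\<^sup>2)" by simp
    qed
  qed blast
  then obtain g where g: "L2 I g" "(\<lambda>n. sqn I (\<lambda>x. g x - S n x)) \<longlonglongrightarrow> 0" by blast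
  have \<eta>I: "L2 I \<eta>" using \<eta> by (simp add: I_def)
  have "sqn {0<..<Z} (\<lambda>z. \<eta> z - g z) = 0"
  proof (rule sine_complete[OF Z])
    show "L2 {0<..<Z} (\<lambda>z. \<eta> z - g z)" using L2_diff[OF \<eta>I g(1)] by (simp add: I_def)
    fix m :: nat assume m: "1 \<le> m"
    have "(\<lambda>n. LINT z:I|lborel. S n z * es Z m z) \<longlonglongrightarrow> (LINT z:I|lborel. g z * es Z m z)"
      by (rule L2_tendsto_integral[OF g(1) SL eL g(2)])
    moreover have "(LINT z:I|lborel. S n z * es Z m z) = c m * of_real (Z / 2)" if "n \<ge> m" for n
    proof -
      have "S n z * es Z m z - (c m * (es Z m z * cnj (es Z m z))) = (\<Sum>j\<in>{1..n} - {m}. c j * (es Z j z * cnj (es Z m z)))" for z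
      proof -
        have "m \<in> {1..n}" using m that by simp
        then have "S n z = c m * es Z m z + (\<Sum>j\<in>{1..n} - {m}. c j * es Z j z)"
          unfolding S_def by (simp add: sum.remove)
        moreover have "cnj (es Z m z) = es Z m z" by (simp add: es_def)
        ultimately show ?thesis by (simp add: algebra_simps sum_distrib_left)
      qed
      then have eq: "S n z * es Z m z = (\<Sum>j\<in>{1..n} - {m}. c j * (es Z j z * cnj (es Z m z))) + c m * (es Z m z * cnj (es Z m z))" for z
        by (metis diff_add_cancel)
      have 0: "set_integrable lborel I (\<lambda>z. \<Sum>j\<in>{1..n} - {m}. c j * (es Z j z * cnj (es Z m z))) \<and> (LINT z:I|lborel. \<Sum>j\<in>{1..n} - {m}. c j * (es Z j z * cnj (es Z m z))) = 0"
      proof (rule set_integral_sum_0)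
        fix j assume j: "j \<in> {1..n} - {m}"
        show "set_integrable lborel I (\<lambda>z. c j * (es Z j z * cnj (es Z m z)))"
          by (intro set_integrable_mult_right L2_mult_integrable eL L2_cnj)
        show "(LINT z:I|lborel. c j * (es Z j z * cnj (es Z m z))) = 0"
          unfolding set_integral_mult_right using orth[of j m] j m by simp
      qed simp
      have i2: "set_integrable lborel I (\<lambda>z. c m * (es Z m z * cnj (es Z m z)))"
        by (intro set_integrable_mult_right L2_mult_integrable eL L2_cnj)
      show ?thesis
        unfolding eq set_integral_add(2)[OF conjunct1[OF 0] i2] conjunct2[OF 0] set_integral_mult_right
        using orth[OF m m] by simp
    qed
    then have "(\<lambda>n. LINT z:I|lborel. S n z * es Z m z) \<longlonglongrightarrow> c m * of_real (Z / 2)"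
      by (intro tendsto_eventually) (auto simp: eventually_sequentially)
    ultimately have gm: "(LINT z:I|lborel. g z * es Z m z) = c m * of_real (Z / 2)" by (rule LIMSEQ_unique)
    have "c m = of_real (2 / Z) * (LINT z:I|lborel. \<eta> z * es Z m z)"
      unfolding c_def sine_coeff_def I_def es_def by (simp only: times_divide_eq_left)
    then have \<eta>m: "(LINT z:I|lborel. \<eta> z * es Z m z) = c m * of_real (Z / 2)" using Z by simp
    have "(LINT z:I|lborel. (\<eta> z - g z) * es Z m z) = 0"
      unfolding left_diff_distrib set_integral_diff(2)[OF L2_mult_integrable[OF \<eta>I eL] L2_mult_integrable[OF g(1) eL]] gm \<eta>m by simp
    then show "(LINT z:{0<..<Z}|lborel. (\<eta> z - g z) * complex_of_real (sin (real m * pi * z / Z))) = 0"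
      unfolding I_def es_def by (simp only: times_divide_eq_left)
  qed
  then have z: "sqn I (\<lambda>z. g z - \<eta> z) = 0" by (simp add: I_def sqn_diff_commute[of _ g])
  have bd: "norm (sqn I (\<lambda>z. S n z - \<eta> z)) \<le> 2 * sqn I (\<lambda>z. g z - S n z)" for n
    using sqn_add_le[OF L2_diff[OF SL g(1)] L2_diff[OF g(1) \<eta>I], of n] z
    by (simp add: sqn_nonneg sqn_diff_commute[of I "S n" g])
  have "(\<lambda>n. 2 * sqn I (\<lambda>z. g z - S n z)) \<longlonglongrightarrow> 0" using tendsto_mult_left[OF g(2), of 2] by simp
  from Lim_null_comparison[OF always_eventually[OF allI[OF bd]] this]
  have "(\<lambda>n. sqn I (\<lambda>z. S n z - \<eta> z)) \<longlonglongrightarrow> 0" .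
  then show ?thesis by (simp add: S_def I_def c_def)
qed

lemma sqn_tendsto:
  assumes "L2 S f" "\<And>n. L2 S (F n)" "(\<lambda>n. sqn S (\<lambda>x. f x - F n x)) \<longlonglongrightarrow> 0"
  shows "(\<lambda>n. sqn S (F n)) \<longlonglongrightarrow> sqn S f"
proof -
  have l0: "(\<lambda>n. l2n S (\<lambda>x. f x - F n x)) \<longlonglongrightarrow> 0" using assms(3) by (simp add: sqn_tendsto_iff)
  have "\<bar>l2n S (F n) - l2n S f\<bar> \<le> l2n S (\<lambda>x. f x - F n x)" for n
  proof -
    have "l2n S f \<le> l2n S (F n) + l2n S (\<lambda>x. f x - F n x)"
      using l2n_triangle[OF assms(2) L2_diff[OF assms(1,2)], of n n] by simp
    moreover have "l2n S (F n) \<le> l2n S f + l2n S (\<lambda>x. f x - F n x)"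
      using l2n_triangle[OF assms(1) L2_diff[OF assms(2,1)], of n]
      unfolding l2n_def sqn_diff_commute[of S f "F n"] by simp
    ultimately show ?thesis by linarith
  qed
  then have "(\<lambda>n. l2n S (F n) - l2n S f) \<longlonglongrightarrow> 0"
    unfolding real_norm_def[symmetric] by (intro Lim_null_comparison[OF always_eventually l0] allI)
  then have "(\<lambda>n. l2n S (F n)) \<longlonglongrightarrow> l2n S f" by (rule LIM_zero_cancel)
  from tendsto_power[OF this, of 2] show ?thesis by (simp add: l2n_sq)
qed

lemma weak_deriv_sum:
  fixes a b c d :: real
  defines "\<Omega> \<equiv> {a<..<b} \<times> {c<..<d}"
  assumes "finite I" "\<And>i. i \<in> I \<Longrightarrow> L2 \<Omega> (w i)" "\<And>i. i \<in> I \<Longrightarrow> L2 \<Omega> (g i)" "\<And>i. i \<in> I \<Longrightarrow> weak_deriv \<Omega> e (w i) (g i)"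
  shows "weak_deriv \<Omega> e (\<lambda>x. \<Sum>i\<in>I. w i x) (\<lambda>x. \<Sum>i\<in>I. g i x)"
  using assms(2-)
proof (induction I rule: finite_induct)
  case empty
  then show ?case by (simp add: weak_deriv_def)
next
  case (insert i I)
  have "weak_deriv \<Omega> e (\<lambda>x. w i x + (\<Sum>i\<in>I. w i x)) (\<lambda>x. g i x + (\<Sum>i\<in>I. g i x))"
    unfolding \<Omega>_def by (rule weak_deriv_add; unfold \<Omega>_def[symmetric]; (intro L2_sum)?; use insert in blast)
  then show ?case using insert by simp
qed

lemma pd_cnj: assumes "f differentiable (at x)" shows "pd e (\<lambda>x. cnj (f x)) x = cnj (pd e f x)"
proof -
  have "(f has_derivative frechet_derivative f (at x)) (at x)" using assms by (simp add: frechet_derivative_works)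
  then have "((\<lambda>x. cnj (f x)) has_derivative (\<lambda>h. cnj (frechet_derivative f (at x) h))) (at x)"
    by (rule bounded_linear.has_derivative[OF bounded_linear_cnj])
  from fun_cong[OF frechet_derivative_at[OF this], of e] show ?thesis by (simp add: pd_def)
qed

lemma smooth_cnj: assumes "smooth f" shows "smooth (\<lambda>x. cnj (f x))"
proof (rule smoothI[where S="{\<lambda>x. cnj (f x) | f. smooth f}"])
  show "(\<lambda>x. cnj (f x)) \<in> {\<lambda>x. cnj (f x) | f. smooth f}" using assms by blast
  fix g assume "g \<in> {\<lambda>x. cnj (f x) | f. smooth f}"
  then obtain f where g: "g = (\<lambda>x. cnj (f x))" and f: "smooth f" by blast
  show "g differentiable_on UNIV"
    unfolding g differentiable_on_def differentiable_def
    using bounded_linear.has_derivative[OF bounded_linear_cnj smooth_has_derivative[OF f]] by blast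
  have "pd e g = (\<lambda>x. cnj (pd e f x))" for e
    unfolding g by (intro ext pd_cnj smooth_differentiable f)
  then show "pd e g \<in> {\<lambda>x. cnj (f x) | f. smooth f}" for e using smooth_pd[OF f] by blast
qed

text \<open>\<open>weak_deriv\<close> pairs without conjugation whereas \<open>a_pml\<close>
  conjugates its second argument; conjugates of test functions are again test functions.\<close>

lemma weak_deriv_test_cnj:
  assumes "weak_deriv \<Omega> e w g" "test_fun \<Omega> \<phi>"
  shows "(LINT x:\<Omega>|lborel. w x * cnj (pd e \<phi> x)) = - (LINT x:\<Omega>|lborel. g x * cnj (\<phi> x))"
proof -
  have s: "smooth \<phi>" by (rule test_fun_smooth[OF assms(2)])
  have "test_fun \<Omega> (\<lambda>x. cnj (\<phi> x))"
    using assms(2) smooth_cnj[OF s] by (simp add: test_fun_def tsupport_def)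
  moreover have "pd e (\<lambda>x. cnj (\<phi> x)) = (\<lambda>x. cnj (pd e \<phi> x))"
    by (intro ext pd_cnj smooth_differentiable s)
  ultimately show ?thesis using assms(1) unfolding weak_deriv_def by metis
qed

lemma es_deriv: "(es Z m has_vector_derivative of_real (real m * pi / Z) * ec Z m z) (at z within A)"
  using sin_deriv[of "real m * pi / Z" z A] by (simp add: es_def[abs_def] ec_def)

lemma ec_deriv: "(ec Z m has_vector_derivative - of_real (real m * pi / Z) * es Z m z) (at z within A)"
proof -
  have "((\<lambda>z. cos (c * z)) has_real_derivative - c * sin (c * z)) (at z within A)" for c
    by (auto intro!: derivative_eq_intros)
  from has_vector_derivative_of_real[OF this[of "real m * pi / Z"], where 'a=complex]
  show ?thesis by (simp add: ec_def[abs_def] es_def)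
qed

lemma sqn_le_of_bound:
  fixes f :: "real \<Rightarrow> complex"
  assumes "a \<le> b" "continuous_on {a..b} f" "\<And>x. x \<in> {a..b} \<Longrightarrow> cmod (f x) \<le> e"
  shows "sqn {a<..<b} f \<le> e\<^sup>2 * (b - a)"
proof -
  have "sqn {a<..<b} f \<le> (LINT x:{a<..<b}|lborel. e\<^sup>2)"
    unfolding sqn_def by (rule set_integral_Icc_mono) (use assms in \<open>auto intro!: continuous_intros power_mono\<close>)
  also have "\<dots> = e\<^sup>2 * (b - a)" using assms(1) by (simp add: set_lebesgue_integral_def)
  finally show ?thesis .
qed

lemma L2_tendsto_integral_cnj:
  assumes "L2 S f" "\<And>n. L2 S (F n)" "L2 S g" "(\<lambda>n. sqn S (\<lambda>x. f x - F n x)) \<longlonglongrightarrow> 0"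
  shows "(\<lambda>n. LINT x:S|lborel. g x * cnj (F n x)) \<longlonglongrightarrow> (LINT x:S|lborel. g x * cnj (f x))"
proof -
  have "cnj (f x) - cnj (F n x) = cnj (f x - F n x)" for n x by simp
  then have "(\<lambda>n. sqn S (\<lambda>x. cnj (f x) - cnj (F n x))) \<longlonglongrightarrow> 0"
    using assms(4) unfolding sqn_def by (simp only: complex_mod_cnj)
  from L2_tendsto_integral[OF L2_cnj[OF assms(1)] L2_cnj[OF assms(2)] assms(3) this]
  show ?thesis by (simp only: mult.commute)
qed

text \<open>Separation of variables: the solution is the \<open>H\<^sup>1\<close>-limit of the partial sums of the modal series.\<close>

lemma pml_exists:
  fixes R \<rho> \<chi>0 k Z K :: real
  assumes par: "R > 0" "\<rho> \<ge> 2 * R" "\<chi>0 > 0" "Z > 0" and \<eta>: "H12_0 Z \<eta>" and K: "K \<ge> 0"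
    and bound: "\<And>m q p. m \<ge> (1::nat) \<Longrightarrow> ode_sol R \<rho> (cA \<chi>0 R) (cB (k\<^sup>2 - (real m * pi / Z)\<^sup>2) \<chi>0 R) (\<lambda>_. 0) q p \<Longrightarrow> q R = 1 \<Longrightarrow> q \<rho> = 0 \<Longrightarrow>
       (LINT r:{R<..<\<rho>}|lborel. (cmod (cA \<chi>0 R r * p r))\<^sup>2 + (1 + (real m * pi / Z)\<^sup>2) * (cmod (q r))\<^sup>2) \<le> K * real m"
  shows "\<exists>w. pml_solution k Z R \<rho> \<chi>0 \<eta> w \<and> H1_norm (Omega_pml R \<rho> Z) w \<le> sqrt (Z / 2 * K) * H12_norm Z \<eta>"
proof -
  interpret pml_interval R \<rho> \<chi>0 by unfold_locales (use par in auto)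
  define \<Omega> where "\<Omega> = {R<..<\<rho>} \<times> {0<..<Z}"
  define \<gamma> where "\<gamma> m = real m * pi / Z" for m
  define l where "l m = k\<^sup>2 - (\<gamma> m)\<^sup>2" for m
  define c where "c = sine_coeff Z \<eta>"
  have le: "R \<le> \<rho>" "0 \<le> Z" using Rlt par by auto
  have \<eta>L: "L2 {0<..<Z} \<eta>" and sm: "summable (\<lambda>m. real m * (cmod (c m))\<^sup>2)" using \<eta> by (auto simp: H12_0_def c_def)
  have "\<forall>m. \<exists>q p. ode_sol R \<rho> (cA \<chi>0 R) (cB (l m) \<chi>0 R) (\<lambda>_. 0) q p \<and> q R = 1 \<and> q \<rho> = 0"
  proof
    fix m
    have "continuous_on {R..\<rho>} (\<lambda>_. 0 :: complex)" by simp
    from mode_exists[OF this, of "l m" 1]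
    show "\<exists>q p. ode_sol R \<rho> (cA \<chi>0 R) (cB (l m) \<chi>0 R) (\<lambda>_. 0) q p \<and> q R = 1 \<and> q \<rho> = 0" by blast
  qed
  then obtain q p where sol: "\<And>m. ode_sol R \<rho> (cA \<chi>0 R) (cB (l m) \<chi>0 R) (\<lambda>_. 0) (q m) (p m)" and q1: "\<And>m. q m R = 1" and q0: "\<And>m. q m \<rho> = 0"
    by metis
  define q' where "q' = (\<lambda>m r. cA \<chi>0 R r * p m r)"
  have qc: "continuous_on {R..\<rho>} (q m)" and pc: "continuous_on {R..\<rho>} (p m)" for m using ode_sol_continuous[OF sol] by auto
  have q'c: "continuous_on {R..\<rho>} (q' m)" for m unfolding q'_def by (intro continuous_intros cA_cont pc)
  have qd: "(q m has_vector_derivative q' m r) (at r within {R..\<rho>})" if "r \<in> {R..\<rho>}" for m r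
    using sol[of m] that unfolding ode_sol_def q'_def by blast
  have pd: "(p m has_vector_derivative cB (l m) \<chi>0 R r * q m r) (at r within {R..\<rho>})" if "r \<in> {R..\<rho>}" for m r
    using sol[of m] that unfolding ode_sol_def by force
  have B: "sqn {R<..<\<rho>} (q' m) + (1 + (\<gamma> m)\<^sup>2) * sqn {R<..<\<rho>} (q m) \<le> K * real m" if "m \<ge> 1" for m
  proof -
    have "(LINT r:{R<..<\<rho>}|lborel. (cmod (q' m r))\<^sup>2 + (1 + (\<gamma> m)\<^sup>2) * (cmod (q m r))\<^sup>2) \<le> K * real m"
      using bound[OF that sol[of m, unfolded l_def \<gamma>_def] q1 q0] unfolding q'_def \<gamma>_def .
    moreover have "(LINT r:{R<..<\<rho>}|lborel. (cmod (q' m r))\<^sup>2 + (1 + (\<gamma> m)\<^sup>2) * (cmod (q m r))\<^sup>2)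
        = sqn {R<..<\<rho>} (q' m) + (1 + (\<gamma> m)\<^sup>2) * sqn {R<..<\<rho>} (q m)"
      unfolding sqn_def set_integral_mult_right[symmetric]
      by (rule set_integral_Icc_add; intro continuous_intros qc q'c)
    ultimately show ?thesis by simp
  qed
  have B': "sqn {R<..<\<rho>} (q m) \<le> K * real m" "sqn {R<..<\<rho>} (q' m) \<le> K * real m" "(\<gamma> m)\<^sup>2 * sqn {R<..<\<rho>} (q m) \<le> K * real m" if "m \<ge> 1" for m
  proof -
    have "0 \<le> sqn {R<..<\<rho>} (q m)" "0 \<le> sqn {R<..<\<rho>} (q' m)" "0 \<le> (\<gamma> m)\<^sup>2 * sqn {R<..<\<rho>} (q m)" by (simp_all add: sqn_nonneg)
    then show "sqn {R<..<\<rho>} (q m) \<le> K * real m" "sqn {R<..<\<rho>} (q' m) \<le> K * real m" "(\<gamma> m)\<^sup>2 * sqn {R<..<\<rho>} (q m) \<le> K * real m"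
      using B[OF that, unfolded distrib_right mult_1] by linarith+
  qed
  \<comment> \<open>Partial sums with their termwise derivatives in \<open>r\<close> and
    \<open>z\<close>. Index 0 is absent, its sine being zero.\<close>
  define W where "W = (\<lambda>N x. \<Sum>m\<in>{1..N}. (c m * q m (fst x)) * es Z m (snd x))"
  define W1 where "W1 = (\<lambda>N x. \<Sum>m\<in>{1..N}. (c m * q' m (fst x)) * es Z m (snd x))"
  define W2 where "W2 = (\<lambda>N x. \<Sum>m\<in>{1..N}. (c m * of_real (\<gamma> m) * q m (fst x)) * ec Z m (snd x))"
  have trm: "weak_deriv \<Omega> (1,0) (\<lambda>x. (c m * u (fst x)) * es Z m (snd x)) (\<lambda>x. (c m * u' (fst x)) * es Z m (snd x))"
    "weak_deriv \<Omega> (0,1) (\<lambda>x. (c m * u (fst x)) * es Z m (snd x)) (\<lambda>x. (c m * of_real (\<gamma> m) * u (fst x)) * ec Z m (snd x))"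
    "L2 \<Omega> (\<lambda>x. (c m * u (fst x)) * es Z m (snd x))" "L2 \<Omega> (\<lambda>x. (c m * u' (fst x)) * es Z m (snd x))"
    "L2 \<Omega> (\<lambda>x. (c m * of_real (\<gamma> m) * u (fst x)) * ec Z m (snd x))"
    if ud: "\<And>r. r \<in> {R..\<rho>} \<Longrightarrow> (u has_vector_derivative u' r) (at r within {R..\<rho>})" and u'c: "continuous_on {R..\<rho>} u'" for m u u'
  proof -
    have 1: "((\<lambda>r. c m * u r) has_vector_derivative c m * u' r) (at r within {R..\<rho>})" if "r \<in> {R..\<rho>}" for r
      by (rule has_vector_derivative_mult_right[OF ud[OF that]])
    have 2: "continuous_on {R..\<rho>} (\<lambda>r. c m * u' r)" by (intro continuous_intros u'c)
    have 3: "continuous_on {0..Z} (\<lambda>z. of_real (real m * pi / Z) * ec Z m z)" by (intro continuous_intros ec_cont)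
    note X = weak_deriv_product[OF le 1 2 es_deriv 3, folded \<Omega>_def]
    have eq: "c m * u r * (of_real (real m * pi / Z) * ec Z m z) = c m * of_real (\<gamma> m) * u r * ec Z m z" for r z
      by (simp add: \<gamma>_def)
    show "weak_deriv \<Omega> (1,0) (\<lambda>x. (c m * u (fst x)) * es Z m (snd x)) (\<lambda>x. (c m * u' (fst x)) * es Z m (snd x))"
      by (rule X(1))
    show "L2 \<Omega> (\<lambda>x. (c m * u (fst x)) * es Z m (snd x))" by (rule X(3))
    show "L2 \<Omega> (\<lambda>x. (c m * u' (fst x)) * es Z m (snd x))" by (rule X(4))
    show "weak_deriv \<Omega> (0,1) (\<lambda>x. (c m * u (fst x)) * es Z m (snd x)) (\<lambda>x. (c m * of_real (\<gamma> m) * u (fst x)) * ec Z m (snd x))"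
      "L2 \<Omega> (\<lambda>x. (c m * of_real (\<gamma> m) * u (fst x)) * ec Z m (snd x))" by (rule X(2)[unfolded eq], assumption, rule X(5)[unfolded eq])
  qed
  note wds = weak_deriv_sum[where a=R and b=\<rho> and c=0 and d=Z, folded \<Omega>_def]
  have WL: "L2 \<Omega> (W N)" "L2 \<Omega> (W1 N)" "L2 \<Omega> (W2 N)" for N
    unfolding W_def W1_def W2_def by (intro L2_sum trm(3,4,5)[OF qd q'c]; assumption)+
  have Wd: "weak_deriv \<Omega> (1,0) (W N) (W1 N)" "weak_deriv \<Omega> (0,1) (W N) (W2 N)" for N
  proof -
    show "weak_deriv \<Omega> (1,0) (W N) (W1 N)" unfolding W_def W1_def
      by (rule wds; (rule finite_atLeastAtMost | rule trm[OF qd q'c]; assumption))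
    show "weak_deriv \<Omega> (0,1) (W N) (W2 N)" unfolding W_def W2_def
      by (rule wds; (rule finite_atLeastAtMost | rule trm[OF qd q'c]; assumption))
  qed
  have modal: "sqn \<Omega> (\<lambda>x. \<Sum>m\<in>I. (d m * f m (fst x)) * e m (snd x)) = Z / 2 * (\<Sum>m\<in>I. (cmod (d m))\<^sup>2 * sqn {R<..<\<rho>} (f m))"
    if "finite I" "\<And>m. m \<in> I \<Longrightarrow> m \<ge> 1" "\<And>m. continuous_on {R..\<rho>} (f m)" "e = es Z \<or> e = ec Z" for I d f e
  proof -
    have "continuous_on {R..\<rho>} (\<lambda>r. d m * f m r)" for m by (intro continuous_intros that)
    from modal_sum_sqn[OF that(1,2) par(4) this that(4)] show ?thesis by (simp only: \<Omega>_def sqn_cmult)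
  qed
  \<comment> \<open>A summable majorant for the squared norm of each mode: the factor
    \<open>m\<close> from the mode bound is the weight of the \<open>H12\<close> norm.\<close>
  define A where "A m = Z / 2 * (K * (real m * (cmod (c m))\<^sup>2))" for m
  have Asm: "summable A" unfolding A_def by (intro summable_mult sm)
  have Ab: "Z / 2 * (\<Sum>m\<in>I. (cmod (c m))\<^sup>2 * s m) \<le> sum A I" if "finite I" "\<And>m. m \<in> I \<Longrightarrow> m \<ge> 1" "\<And>m. m \<ge> 1 \<Longrightarrow> s m \<le> K * real m" for I s
  proof -
    have "(cmod (c m))\<^sup>2 * s m \<le> K * (real m * (cmod (c m))\<^sup>2)" if "m \<in> I" for m
      using mult_left_mono[OF \<open>\<And>m. m \<ge> 1 \<Longrightarrow> s m \<le> K * real m\<close>[OF \<open>\<And>m. m \<in> I \<Longrightarrow> m \<ge> 1\<close>[OF that]], of "(cmod (c m))\<^sup>2"] by (simp add: mult_ac)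
    then have "(\<Sum>m\<in>I. (cmod (c m))\<^sup>2 * s m) \<le> (\<Sum>m\<in>I. K * (real m * (cmod (c m))\<^sup>2))" by (rule sum_mono)
    then have "Z / 2 * (\<Sum>m\<in>I. (cmod (c m))\<^sup>2 * s m) \<le> Z / 2 * (\<Sum>m\<in>I. K * (real m * (cmod (c m))\<^sup>2))"
      using par(4) by (intro mult_left_mono) auto
    then show ?thesis by (simp only: A_def[abs_def] sum_distrib_left)
  qed
  have sq2: "(cmod (c m * of_real (\<gamma> m)))\<^sup>2 * s = (cmod (c m))\<^sup>2 * ((\<gamma> m)\<^sup>2 * s)" for m s
    by (simp add: norm_mult power_mult_distrib)
  have \<Omega>S: "\<Omega> \<in> sets borel" "emeasure lborel \<Omega> < \<infinity>" unfolding \<Omega>_def by (rule sets_rect, rule emeasure_rect_finite)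
  have "\<exists>w. L2 \<Omega> w \<and> (\<lambda>n. sqn \<Omega> (\<lambda>x. w x - W n x)) \<longlonglongrightarrow> 0"
  proof (rule Riesz_Fischer_L2[OF WL(1) \<Omega>S])
    show "\<exists>N. \<forall>i\<ge>N. \<forall>j\<ge>N. sqn \<Omega> (\<lambda>x. W i x - W j x) < e" if "e > 0" for e
    proof (rule sqn_Cauchy_of_tails[OF Asm _ that])
      fix i j :: nat assume ij: "j \<le> i"
      have "sqn \<Omega> (\<lambda>x. W i x - W j x) = sqn \<Omega> (\<lambda>x. \<Sum>m\<in>{j<..i}. (c m * q m (fst x)) * es Z m (snd x))"
        unfolding W_def sum_Icc_diff[OF ij] ..
      also have "\<dots> = Z / 2 * (\<Sum>m\<in>{j<..i}. (cmod (c m))\<^sup>2 * sqn {R<..<\<rho>} (q m))" by (rule modal) (use qc in auto)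
      also have "\<dots> \<le> sum A {j<..i}" by (rule Ab) (use B'(1) in auto)
      finally show "sqn \<Omega> (\<lambda>x. W i x - W j x) \<le> sum A {j<..i}" .
    qed
  qed blast
  then obtain w where w: "L2 \<Omega> w" "(\<lambda>n. sqn \<Omega> (\<lambda>x. w x - W n x)) \<longlonglongrightarrow> 0" by blast
  have "\<exists>w. L2 \<Omega> w \<and> (\<lambda>n. sqn \<Omega> (\<lambda>x. w x - W1 n x)) \<longlonglongrightarrow> 0"
  proof (rule Riesz_Fischer_L2[OF WL(2) \<Omega>S])
    show "\<exists>N. \<forall>i\<ge>N. \<forall>j\<ge>N. sqn \<Omega> (\<lambda>x. W1 i x - W1 j x) < e" if "e > 0" for e
    proof (rule sqn_Cauchy_of_tails[OF Asm _ that])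
      fix i j :: nat assume ij: "j \<le> i"
      have "sqn \<Omega> (\<lambda>x. W1 i x - W1 j x) = sqn \<Omega> (\<lambda>x. \<Sum>m\<in>{j<..i}. (c m * q' m (fst x)) * es Z m (snd x))"
        unfolding W1_def sum_Icc_diff[OF ij] ..
      also have "\<dots> = Z / 2 * (\<Sum>m\<in>{j<..i}. (cmod (c m))\<^sup>2 * sqn {R<..<\<rho>} (q' m))" by (rule modal) (use q'c in auto)
      also have "\<dots> \<le> sum A {j<..i}" by (rule Ab) (use B'(2) in auto)
      finally show "sqn \<Omega> (\<lambda>x. W1 i x - W1 j x) \<le> sum A {j<..i}" .
    qed
  qed blast
  then obtain w1 where w1: "L2 \<Omega> w1" "(\<lambda>n. sqn \<Omega> (\<lambda>x. w1 x - W1 n x)) \<longlonglongrightarrow> 0" by blast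
  have "\<exists>w. L2 \<Omega> w \<and> (\<lambda>n. sqn \<Omega> (\<lambda>x. w x - W2 n x)) \<longlonglongrightarrow> 0"
  proof (rule Riesz_Fischer_L2[OF WL(3) \<Omega>S])
    show "\<exists>N. \<forall>i\<ge>N. \<forall>j\<ge>N. sqn \<Omega> (\<lambda>x. W2 i x - W2 j x) < e" if "e > 0" for e
    proof (rule sqn_Cauchy_of_tails[OF Asm _ that])
      fix i j :: nat assume ij: "j \<le> i"
      have "sqn \<Omega> (\<lambda>x. W2 i x - W2 j x) = sqn \<Omega> (\<lambda>x. \<Sum>m\<in>{j<..i}. (c m * of_real (\<gamma> m) * q m (fst x)) * ec Z m (snd x))"
        unfolding W2_def sum_Icc_diff[OF ij] ..
      also have "\<dots> = Z / 2 * (\<Sum>m\<in>{j<..i}. (cmod (c m * of_real (\<gamma> m)))\<^sup>2 * sqn {R<..<\<rho>} (q m))" by (rule modal) (use qc in auto)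
      also have "\<dots> \<le> sum A {j<..i}" unfolding sq2 by (rule Ab) (use B'(3) in auto)
      finally show "sqn \<Omega> (\<lambda>x. W2 i x - W2 j x) \<le> sum A {j<..i}" .
    qed
  qed blast
  then obtain w2 where w2: "L2 \<Omega> w2" "(\<lambda>n. sqn \<Omega> (\<lambda>x. w2 x - W2 n x)) \<longlonglongrightarrow> 0" by blast
  have wd1: "weak_deriv \<Omega> (1,0) w w1" unfolding \<Omega>_def
    by (rule weak_deriv_limit[where W=W and G=W1]; unfold \<Omega>_def[symmetric]; fact WL Wd w w1)
  have wd2: "weak_deriv \<Omega> (0,1) w w2" unfolding \<Omega>_def
    by (rule weak_deriv_limit[where W=W and G=W2]; unfold \<Omega>_def[symmetric]; fact WL Wd w w2)
  have wH: "H1 \<Omega> w" by (rule H1I[OF w(1) w1(1) wd1 w2(1) wd2])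

  have norm: "H1_norm \<Omega> w \<le> sqrt (Z / 2 * K) * H12_norm Z \<eta>"
  proof -
    have "(H1_norm \<Omega> w)\<^sup>2 = sqn \<Omega> w + sqn \<Omega> w1 + sqn \<Omega> w2"
      unfolding \<Omega>_def by (rule H1_norm_sq_eq; unfold \<Omega>_def[symmetric]; fact w w1 w2 wd1 wd2)
    also have "\<dots> \<le> suminf A"
    proof (rule LIMSEQ_le_const2)
      show "(\<lambda>N. sqn \<Omega> (W N) + sqn \<Omega> (W1 N) + sqn \<Omega> (W2 N)) \<longlonglongrightarrow> sqn \<Omega> w + sqn \<Omega> w1 + sqn \<Omega> w2"
        by (intro tendsto_add sqn_tendsto w w1 w2 WL)
      have "sqn \<Omega> (W N) + sqn \<Omega> (W1 N) + sqn \<Omega> (W2 N) \<le> suminf A" for N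
      proof -
        have "sqn \<Omega> (W N) = Z / 2 * (\<Sum>m\<in>{1..N}. (cmod (c m))\<^sup>2 * sqn {R<..<\<rho>} (q m))"
          unfolding W_def by (rule modal) (use qc in auto)
        moreover have "sqn \<Omega> (W1 N) = Z / 2 * (\<Sum>m\<in>{1..N}. (cmod (c m))\<^sup>2 * sqn {R<..<\<rho>} (q' m))"
          unfolding W1_def by (rule modal) (use q'c in auto)
        moreover have "sqn \<Omega> (W2 N) = Z / 2 * (\<Sum>m\<in>{1..N}. (cmod (c m))\<^sup>2 * ((\<gamma> m)\<^sup>2 * sqn {R<..<\<rho>} (q m)))"
          unfolding W2_def sq2[symmetric] by (rule modal) (use qc in auto)
        ultimately have "sqn \<Omega> (W N) + sqn \<Omega> (W1 N) + sqn \<Omega> (W2 N)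
          = Z / 2 * (\<Sum>m\<in>{1..N}. (cmod (c m))\<^sup>2 * (sqn {R<..<\<rho>} (q' m) + (1 + (\<gamma> m)\<^sup>2) * sqn {R<..<\<rho>} (q m)))"
          by (simp add: algebra_simps sum.distrib)
        also have "\<dots> \<le> sum A {1..N}" by (rule Ab) (use B in auto)
        also have "\<dots> \<le> suminf A"
          by (rule sum_le_suminf[OF Asm]) (use K par in \<open>auto simp: A_def\<close>)
        finally show ?thesis .
      qed
      then show "\<exists>N. \<forall>n\<ge>N. sqn \<Omega> (W n) + sqn \<Omega> (W1 n) + sqn \<Omega> (W2 n) \<le> suminf A" by blast
    qed
    also have "suminf A = Z / 2 * K * (\<Sum>m. real m * (cmod (c m))\<^sup>2)"
      unfolding A_def using suminf_mult[OF sm, of "Z / 2 * K"] by (simp add: mult.assoc)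
    finally have "sqrt ((H1_norm \<Omega> w)\<^sup>2) \<le> sqrt (Z / 2 * K * (\<Sum>m. real m * (cmod (c m))\<^sup>2))" by (rule real_sqrt_le_mono)
    then show ?thesis
      unfolding H12_norm_def c_def[symmetric] real_sqrt_mult[symmetric] by (simp add: H1_norm_nonneg)
  qed

  define E where "E = (\<lambda>r. al \<chi>0 R r / (of_real r * be \<chi>0 R r))"
  define P where "P = (\<lambda>r. 1 / cA \<chi>0 R r)"
  have Ec: "continuous_on {R..\<rho>} E" unfolding E_def using R be_nz by (intro continuous_intros al_cont be_cont) auto
  have nz: "cA \<chi>0 R r \<noteq> 0" if "r \<ge> R" for r using al_nz[OF that] be_nz[OF that] R that by (simp add: cA_def)
  have Pc: "continuous_on {R..\<rho>} P" unfolding P_def using nz by (intro continuous_intros cA_cont) auto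
  have PL: "L2 \<Omega> (\<lambda>x. P (fst x) * f x)" and EL: "L2 \<Omega> (\<lambda>x. E (fst x) * f x)" if "L2 \<Omega> f" for f
    using that unfolding \<Omega>_def by (intro L2_mult_continuous continuous_on_fst_comp Pc Ec; assumption)+
  \<comment> \<open>The form with the derivatives as separate arguments, so that limits can be taken
    in each of them.\<close>
  define bil where "bil = (\<lambda>u u1 u2 y y1 y2. (LINT x:\<Omega>|lborel. (P (fst x) * u1 x) * cnj (y1 x))
      + (LINT x:\<Omega>|lborel. (E (fst x) * u2 x) * cnj (y2 x)) - of_real (k\<^sup>2) * (LINT x:\<Omega>|lborel. (E (fst x) * u x) * cnj (y x)))"

  have bil0: "bil (W N) (W1 N) (W2 N) \<phi> (pd (1,0) \<phi>) (pd (0,1) \<phi>) = 0" if \<phi>: "test_fun \<Omega> \<phi>" for N \<phi>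
  proof -
    \<comment> \<open>\<open>F\<close> is the radial flux of the partial sum and \<open>G\<close>
      its weighted \<open>z\<close> derivative. The mode equation provides the derivative of
      \<open>p\<close>, hence \<open>F'\<close>, without differentiating \<open>cA\<close>.\<close>
    define F where "F = (\<lambda>x. \<Sum>m\<in>{1..N}. (c m * p m (fst x)) * es Z m (snd x))"
    define F' where "F' = (\<lambda>x. \<Sum>m\<in>{1..N}. (c m * (cB (l m) \<chi>0 R (fst x) * q m (fst x))) * es Z m (snd x))"
    define G where "G = (\<lambda>x. \<Sum>m\<in>{1..N}. (c m * of_real (\<gamma> m) * (E (fst x) * q m (fst x))) * ec Z m (snd x))"
    define G' where "G' = (\<lambda>x. \<Sum>m\<in>{1..N}. (c m * of_real (\<gamma> m) * (E (fst x) * q m (fst x))) * (- of_real (\<gamma> m) * es Z m (snd x)))"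
    have cBc: "continuous_on {R..\<rho>} (\<lambda>r. cB (l m) \<chi>0 R r * q m r)" for m by (intro continuous_intros cB_cont qc)
    have Fd: "weak_deriv \<Omega> (1,0) F F'"
      unfolding F_def F'_def
      by (rule wds; (rule finite_atLeastAtMost | rule trm[OF pd cBc]; assumption))
    have Gc: "continuous_on ({R..\<rho>} \<times> {0..Z}) G" "continuous_on ({R..\<rho>} \<times> {0..Z}) G'"
      unfolding G_def G'_def by (intro continuous_intros continuous_on_fst_comp continuous_on_snd_comp Ec qc es_cont ec_cont)+
    have F'c: "continuous_on ({R..\<rho>} \<times> {0..Z}) F'"
      unfolding F'_def by (intro continuous_intros continuous_on_fst_comp continuous_on_snd_comp cB_cont qc es_cont)
    have Gd: "weak_deriv \<Omega> (0,1) G G'"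
      unfolding \<Omega>_def
    proof (rule weak_deriv_snd_classical[OF Gc le(2)])
      fix r z
      show "((\<lambda>z. G (r, z)) has_vector_derivative G' (r, z)) (at z within {0..Z})"
        unfolding G_def G'_def fst_conv snd_conv
      proof (rule has_vector_derivative_sum)
        fix m
        show "((\<lambda>z. c m * of_real (\<gamma> m) * (E r * q m r) * ec Z m z) has_vector_derivative
            c m * of_real (\<gamma> m) * (E r * q m r) * (- of_real (\<gamma> m) * es Z m z)) (at z within {0..Z})"
          using ec_deriv[of Z m z "{0..Z}"] unfolding \<gamma>_def[symmetric] by (rule has_vector_derivative_mult_right)
      qed
    qed
    have T1: "(LINT x:\<Omega>|lborel. (P (fst x) * W1 N x) * cnj (pd (1,0) \<phi> x)) = - (LINT x:\<Omega>|lborel. F' x * cnj (\<phi> x))"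
    proof -
      have "(LINT x:\<Omega>|lborel. (P (fst x) * W1 N x) * cnj (pd (1,0) \<phi> x)) = (LINT x:\<Omega>|lborel. F x * cnj (pd (1,0) \<phi> x))"
      proof (rule set_lebesgue_integral_cong)
        have "P (fst x) * W1 N x = F x" if "x \<in> \<Omega>" for x
        proof -
          have "cA \<chi>0 R (fst x) \<noteq> 0" using that by (intro nz) (auto simp: \<Omega>_def)
          then have "P (fst x) * ((c m * q' m (fst x)) * es Z m (snd x)) = (c m * p m (fst x)) * es Z m (snd x)" for m
            by (simp add: P_def q'_def)
          then show ?thesis by (simp only: W1_def F_def sum_distrib_left)
        qed
        then show "\<forall>x. x \<in> \<Omega> \<longrightarrow> (P (fst x) * W1 N x) * cnj (pd (1,0) \<phi> x) = F x * cnj (pd (1,0) \<phi> x)" by simp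
      qed (use \<Omega>S in simp)
      then show ?thesis using weak_deriv_test_cnj[OF Fd \<phi>] by simp
    qed
    have T2: "(LINT x:\<Omega>|lborel. (E (fst x) * W2 N x) * cnj (pd (0,1) \<phi> x)) = - (LINT x:\<Omega>|lborel. G' x * cnj (\<phi> x))"
    proof -
      have "E (fst x) * W2 N x = G x" for x
        unfolding W2_def G_def sum_distrib_left by (intro sum.cong refl) (simp add: mult_ac)
      then show ?thesis using weak_deriv_test_cnj[OF Gd \<phi>] by simp
    qed
    \<comment> \<open>The sum of the mode equations: \<open>cB (l m)\<close> contributes
      \<open>- k\<^sup>2 + \<gamma>\<^sup>2\<close> times \<open>E\<close>, the second
      \<open>z\<close> derivative \<open>- \<gamma>\<^sup>2\<close> times \<open>E\<close>.\<close>
    have pt: "F' x + G' x + of_real (k\<^sup>2) * (E (fst x) * W N x) = 0" for x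
    proof -
      have cB: "cB (l m) \<chi>0 R (fst x) = - of_real (k\<^sup>2) * E (fst x) + of_real ((\<gamma> m)\<^sup>2) * E (fst x)" for m
        by (simp add: cB_def E_def l_def left_diff_distrib diff_divide_distrib)
      have "F' x + G' x + of_real (k\<^sup>2) * (E (fst x) * W N x) = (\<Sum>m\<in>{1..N}. (c m * (cB (l m) \<chi>0 R (fst x) * q m (fst x))) * es Z m (snd x)
         + (c m * of_real (\<gamma> m) * (E (fst x) * q m (fst x))) * (- of_real (\<gamma> m) * es Z m (snd x))
         + of_real (k\<^sup>2) * (E (fst x) * ((c m * q m (fst x)) * es Z m (snd x))))"
        unfolding F'_def G'_def W_def sum_distrib_left by (simp only: sum.distrib)
      also have "\<dots> = 0"
      proof (intro sum.neutral ballI)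
        fix m
        have "(C * ((- k2 * e + g\<^sup>2 * e) * Q)) * S + (C * g * (e * Q)) * (- g * S) + k2 * (e * ((C * Q) * S)) = 0" for C k2 e g Q S :: complex
          by (simp add: algebra_simps power2_eq_square)
        then show "(c m * (cB (l m) \<chi>0 R (fst x) * q m (fst x))) * es Z m (snd x)
         + (c m * of_real (\<gamma> m) * (E (fst x) * q m (fst x))) * (- of_real (\<gamma> m) * es Z m (snd x))
         + of_real (k\<^sup>2) * (E (fst x) * ((c m * q m (fst x)) * es Z m (snd x))) = 0"
          unfolding cB of_real_power[of "\<gamma> m"] by blast
      qed
      finally show ?thesis .
    qed
    have \<phi>L: "L2 \<Omega> \<phi>" unfolding \<Omega>_def by (rule test_fun_L2[OF \<phi>])
    have FL: "L2 \<Omega> F'" "L2 \<Omega> G'" unfolding \<Omega>_def by (rule L2_rect[OF F'c], rule L2_rect[OF Gc(2)])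
    have i: "set_integrable lborel \<Omega> (\<lambda>x. F' x * cnj (\<phi> x))" "set_integrable lborel \<Omega> (\<lambda>x. G' x * cnj (\<phi> x))"
      "set_integrable lborel \<Omega> (\<lambda>x. of_real (k\<^sup>2) * ((E (fst x) * W N x) * cnj (\<phi> x)))"
      by (intro set_integrable_mult_right L2_mult_integrable FL L2_cnj \<phi>L EL WL)+
    have "(LINT x:\<Omega>|lborel. F' x * cnj (\<phi> x)) + (LINT x:\<Omega>|lborel. G' x * cnj (\<phi> x)) + of_real (k\<^sup>2) * (LINT x:\<Omega>|lborel. (E (fst x) * W N x) * cnj (\<phi> x))
      = (LINT x:\<Omega>|lborel. F' x * cnj (\<phi> x) + G' x * cnj (\<phi> x) + of_real (k\<^sup>2) * ((E (fst x) * W N x) * cnj (\<phi> x)))"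
      unfolding set_integral_mult_right[symmetric] using i by (simp only: set_integral_add)
    also have "\<dots> = (LINT x:\<Omega>|lborel. 0)"
    proof -
      have "F' x * cnj (\<phi> x) + G' x * cnj (\<phi> x) + of_real (k\<^sup>2) * ((E (fst x) * W N x) * cnj (\<phi> x)) = (F' x + G' x + of_real (k\<^sup>2) * (E (fst x) * W N x)) * cnj (\<phi> x)" for x
        by (simp only: distrib_right mult.assoc)
      then show ?thesis by (simp only: pt mult_zero_left)
    qed
    finally have z: "(LINT x:\<Omega>|lborel. F' x * cnj (\<phi> x)) + (LINT x:\<Omega>|lborel. G' x * cnj (\<phi> x)) + of_real (k\<^sup>2) * (LINT x:\<Omega>|lborel. (E (fst x) * W N x) * cnj (\<phi> x)) = 0"
      by simp
    have "bil (W N) (W1 N) (W2 N) \<phi> (pd (1,0) \<phi>) (pd (0,1) \<phi>) = - ((LINT x:\<Omega>|lborel. F' x * cnj (\<phi> x)) + (LINT x:\<Omega>|lborel. G' x * cnj (\<phi> x)) + of_real (k\<^sup>2) * (LINT x:\<Omega>|lborel. (E (fst x) * W N x) * cnj (\<phi> x)))"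
      unfolding bil_def T1 T2 by simp
    then show ?thesis unfolding z by simp
  qed
  have bil1: "bil w w1 w2 \<phi> (pd (1,0) \<phi>) (pd (0,1) \<phi>) = 0" if \<phi>: "test_fun \<Omega> \<phi>" for \<phi>
  proof -
    have \<phi>L: "L2 \<Omega> \<phi>" "L2 \<Omega> (pd e \<phi>)" for e unfolding \<Omega>_def by (rule test_fun_L2[OF \<phi>], rule test_fun_pd_L2[OF \<phi>])
    have ac: "(LINT x:\<Omega>|lborel. (h (fst x) * u x) * cnj (y x)) = (LINT x:\<Omega>|lborel. u x * (h (fst x) * cnj (y x)))" for h u y
      by (simp only: mult_ac)
    have "(\<lambda>N. bil (W N) (W1 N) (W2 N) \<phi> (pd (1,0) \<phi>) (pd (0,1) \<phi>)) \<longlonglongrightarrow> bil w w1 w2 \<phi> (pd (1,0) \<phi>) (pd (0,1) \<phi>)"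
      unfolding bil_def ac
      by (intro tendsto_diff tendsto_add tendsto_mult[OF tendsto_const] L2_tendsto_integral w w1 w2 WL PL EL L2_cnj \<phi>L)
    then show ?thesis unfolding bil0[OF \<phi>] by (simp add: LIMSEQ_const_iff)
  qed
  \<comment> \<open>Test functions approximate \<open>v\<close> in \<open>H1\<close>, and the form
    is continuous in its second argument.\<close>
  have weak: "a_pml k Z R \<rho> \<chi>0 w v = 0" if v: "H1_0 (Omega_pml R \<rho> Z) v" for v
  proof -
    have vH: "H1 \<Omega> v" using v by (simp add: H1_0_def Omega_pml_def \<Omega>_def)
    obtain \<phi> where \<phi>: "\<And>n. test_fun \<Omega> (\<phi> n)" "(\<lambda>n. H1_norm \<Omega> (\<lambda>x. v x - \<phi> n x)) \<longlonglongrightarrow> 0"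
      using v unfolding H1_0_def Omega_pml_def \<Omega>_def by blast
    note L = H1D[OF vH]
    note lim = H1_norm_tendsto_smooth[OF le L[unfolded \<Omega>_def] test_fun_smooth[OF \<phi>(1)] \<phi>(2)[unfolded \<Omega>_def], folded \<Omega>_def]
    have \<phi>L: "L2 \<Omega> (\<phi> n)" "L2 \<Omega> (pd e (\<phi> n))" for e n unfolding \<Omega>_def by (rule test_fun_L2[OF \<phi>(1)], rule test_fun_pd_L2[OF \<phi>(1)])
    have "(\<lambda>n. bil w w1 w2 (\<phi> n) (pd (1,0) (\<phi> n)) (pd (0,1) (\<phi> n))) \<longlonglongrightarrow> bil w w1 w2 v (wpd \<Omega> (1,0) v) (wpd \<Omega> (0,1) v)"
      unfolding bil_def
      by (intro tendsto_diff tendsto_add tendsto_mult[OF tendsto_const] L2_tendsto_integral_cnj L \<phi>L PL EL w w1 w2 lim)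
    then have z: "bil w w1 w2 v (wpd \<Omega> (1,0) v) (wpd \<Omega> (0,1) v) = 0" unfolding bil1[OF \<phi>(1)] by (simp add: LIMSEQ_const_iff)
    have "a_pml k Z R \<rho> \<chi>0 w v = (LINT x:\<Omega>|lborel. w1 x * (P (fst x) * cnj (wpd \<Omega> (1,0) v x)))
      + (LINT x:\<Omega>|lborel. w2 x * (E (fst x) * cnj (wpd \<Omega> (0,1) v x))) - of_real (k\<^sup>2) * (LINT x:\<Omega>|lborel. w x * (E (fst x) * cnj (v x)))"
      unfolding \<Omega>_def E_def P_def
      by (rule a_pml_eq(1)[OF par(1-3)]; unfold \<Omega>_def[symmetric]; fact w w1 w2 wd1 wd2 L)
    also have "\<dots> = bil w w1 w2 v (wpd \<Omega> (1,0) v) (wpd \<Omega> (0,1) v)" unfolding bil_def by (simp only: mult_ac)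
    finally show ?thesis unfolding z .
  qed

  have tr: "trace_bc R \<rho> Z w \<eta>"
  proof -
    \<comment> \<open>The mode functions are controlled only on \<open>[R, \<rho>]\<close> and only
      as C^1 functions, while \<open>trace_bc\<close> asks for functions smooth on the plane. Each
      is replaced by a smooth one with the same end values; \<open>M N\<close> bounds how the errors
      of \<open>N\<close> modes add up in \<open>H1\<close>.\<close>
    define M where "M N = Z / 2 * (\<Sum>m\<in>{1..N}. (cmod (c m))\<^sup>2 * (1 + (\<gamma> m)\<^sup>2)) * (\<rho> - R)" for N
    have M0: "M N \<ge> 0" for N using par le unfolding M_def by (intro mult_nonneg_nonneg sum_nonneg) auto
    \<comment> \<open>Chosen so that each squared error of stage \<open>N\<close> is at most
      \<open>1 / (N + 1)\<close>; the 1 in the denominator covers \<open>M N = 0\<close>.\<close>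
    define \<epsilon> where "\<epsilon> N = sqrt (inverse (real (Suc N)) / (M N + 1))" for N
    have \<epsilon>: "\<epsilon> N > 0" "(\<epsilon> N)\<^sup>2 = inverse (real (Suc N)) / (M N + 1)" for N
      using M0[of N] by (simp_all add: \<epsilon>_def)
    have \<epsilon>M: "M N * (\<epsilon> N)\<^sup>2 \<le> inverse (real (Suc N))" for N
    proof -
      have "M N * (\<epsilon> N)\<^sup>2 = inverse (real (Suc N)) * (M N / (M N + 1))" by (simp add: \<epsilon>(2))
      also have "\<dots> \<le> inverse (real (Suc N)) * 1" using M0[of N] by (intro mult_left_mono) auto
      finally show ?thesis by simp
    qed
    define Q where "Q N m f f' \<longleftrightarrow> sm f \<and> sm f' \<and> (\<forall>x. (f has_vector_derivative f' x) (at x)) \<and> f R = 1 \<and> f \<rho> = 0 \<and>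
      (\<forall>x\<in>{R..\<rho>}. cmod (q m x - f x) \<le> \<epsilon> N) \<and> (\<forall>x\<in>{R..\<rho>}. cmod (q' m x - f' x) \<le> \<epsilon> N)" for N m f f'
    have "\<exists>f f'. Q N m f f'" for N m
    proof (rule sm_C1_approx[of R \<rho> "q m" "q' m" "\<epsilon> N"])
      fix f f'
      assume "sm f" "sm f'" "\<And>x. (f has_vector_derivative f' x) (at x)" "f R = q m R" "f \<rho> = q m \<rho>"
        "\<And>x. x \<in> {R..\<rho>} \<Longrightarrow> cmod (q m x - f x) \<le> \<epsilon> N" "\<And>x. x \<in> {R..\<rho>} \<Longrightarrow> cmod (q' m x - f' x) \<le> \<epsilon> N"
      then have "Q N m f f'" unfolding Q_def q1 q0 by blast
      then show ?thesis by blast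
    qed (use Rlt qd q'c \<epsilon>(1) in auto)
    then obtain f f' where Q: "\<And>N m. Q N m (f N m) (f' N m)" by metis
    have f: "sm (f N m)" "sm (f' N m)" "(f N m has_vector_derivative f' N m x) (at x)" "f N m R = 1" "f N m \<rho> = 0" for N m x
      using Q[of N m] unfolding Q_def by blast+
    have fe: "cmod (q m x - f N m x) \<le> \<epsilon> N" "cmod (q' m x - f' N m x) \<le> \<epsilon> N" if "x \<in> {R..\<rho>}" for N m x
      using Q[of N m] that unfolding Q_def by blast+
    have smc: "continuous_on X g" if "sm g" for X g
      by (rule smE[OF that]) (auto intro!: continuous_at_imp_continuous_on has_vector_derivative_continuous)
    have fd: "(f N m has_vector_derivative f' N m r) (at r within {R..\<rho>})" for N m r by (rule has_vector_derivative_at_within[OF f(3)])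
    note f'c = smc[OF f(2)] and fc = smc[OF f(1)]
    define u where "u = (\<lambda>N x. \<Sum>m\<in>{1..N}. (c m * f N m (fst x)) * es Z m (snd x))"
    define u1 where "u1 = (\<lambda>N x. \<Sum>m\<in>{1..N}. (c m * f' N m (fst x)) * es Z m (snd x))"
    define u2 where "u2 = (\<lambda>N x. \<Sum>m\<in>{1..N}. (c m * of_real (\<gamma> m) * f N m (fst x)) * ec Z m (snd x))"
    have smu: "smooth (u N)" for N
    proof -
      have "sm (es Z m)" for m unfolding es_def[abs_def] by (rule sm_sin)
      then show ?thesis unfolding u_def by (intro smooth_sum smooth_mult smooth_const smooth_fst smooth_snd f) auto
    qed
    have uL: "L2 \<Omega> (u N)" "L2 \<Omega> (u1 N)" "L2 \<Omega> (u2 N)" for N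
      unfolding u_def u1_def u2_def by (intro L2_sum trm(3,4,5)[OF fd f'c])+
    have ud: "weak_deriv \<Omega> (1,0) (u N) (u1 N)" "weak_deriv \<Omega> (0,1) (u N) (u2 N)" for N
    proof -
      show "weak_deriv \<Omega> (1,0) (u N) (u1 N)" unfolding u_def u1_def
        by (rule wds; (rule finite_atLeastAtMost | rule trm[OF fd f'c]))
      show "weak_deriv \<Omega> (0,1) (u N) (u2 N)" unfolding u_def u2_def
        by (rule wds; (rule finite_atLeastAtMost | rule trm[OF fd f'c]))
    qed
    have d1: "sqn {R<..<\<rho>} (\<lambda>r. q m r - f N m r) \<le> (\<epsilon> N)\<^sup>2 * (\<rho> - R)" for m N
      by (rule sqn_le_of_bound[OF le(1)]) (auto intro!: continuous_intros qc fc fe)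
    have d2: "sqn {R<..<\<rho>} (\<lambda>r. q' m r - f' N m r) \<le> (\<epsilon> N)\<^sup>2 * (\<rho> - R)" for m N
      by (rule sqn_le_of_bound[OF le(1)]) (auto intro!: continuous_intros q'c f'c fe)
    have small: "Z / 2 * (\<Sum>m\<in>{1..N}. (cmod (c m))\<^sup>2 * s m) \<le> inverse (real (Suc N))"
      if s: "\<And>m. s m \<le> (1 + (\<gamma> m)\<^sup>2) * ((\<epsilon> N)\<^sup>2 * (\<rho> - R))" for s N
    proof -
      have "(\<Sum>m\<in>{1..N}. (cmod (c m))\<^sup>2 * s m) \<le> (\<Sum>m\<in>{1..N}. (cmod (c m))\<^sup>2 * ((1 + (\<gamma> m)\<^sup>2) * ((\<epsilon> N)\<^sup>2 * (\<rho> - R))))"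
        by (intro sum_mono mult_left_mono s) auto
      then have "Z / 2 * (\<Sum>m\<in>{1..N}. (cmod (c m))\<^sup>2 * s m) \<le> Z / 2 * (\<Sum>m\<in>{1..N}. (cmod (c m))\<^sup>2 * ((1 + (\<gamma> m)\<^sup>2) * ((\<epsilon> N)\<^sup>2 * (\<rho> - R))))"
        using par(4) by (intro mult_left_mono) auto
      also have "\<dots> = M N * (\<epsilon> N)\<^sup>2"
        unfolding M_def by (simp add: sum_distrib_left sum_distrib_right mult_ac)
      finally show ?thesis using \<epsilon>M[of N] by linarith
    qed
    have e0: "0 \<le> (\<epsilon> N)\<^sup>2 * (\<rho> - R)" for N using le by simp
    have D: "sqn \<Omega> (\<lambda>x. W N x - u N x) \<le> inverse (real (Suc N))" "sqn \<Omega> (\<lambda>x. W1 N x - u1 N x) \<le> inverse (real (Suc N))"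
      "sqn \<Omega> (\<lambda>x. W2 N x - u2 N x) \<le> inverse (real (Suc N))" for N
    proof -
      have "(\<lambda>x. W N x - u N x) = (\<lambda>x. \<Sum>m\<in>{1..N}. (c m * (q m (fst x) - f N m (fst x))) * es Z m (snd x))"
        unfolding W_def u_def by (simp add: algebra_simps sum_subtractf)
      then have "sqn \<Omega> (\<lambda>x. W N x - u N x) = Z / 2 * (\<Sum>m\<in>{1..N}. (cmod (c m))\<^sup>2 * sqn {R<..<\<rho>} (\<lambda>r. q m r - f N m r))"
        using modal[of "{1..N}" "\<lambda>m r. q m r - f N m r" "es Z" c] by (simp add: continuous_on_diff qc fc)
      also have "\<dots> \<le> inverse (real (Suc N))"
      proof (rule small)
        show "sqn {R<..<\<rho>} (\<lambda>r. q m r - f N m r) \<le> (1 + (\<gamma> m)\<^sup>2) * ((\<epsilon> N)\<^sup>2 * (\<rho> - R))" for m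
          using d1[of m N] mult_right_mono[of 1 "1 + (\<gamma> m)\<^sup>2" "(\<epsilon> N)\<^sup>2 * (\<rho> - R)"] e0[of N] by simp
      qed
      finally show "sqn \<Omega> (\<lambda>x. W N x - u N x) \<le> inverse (real (Suc N))" .
      have "(\<lambda>x. W1 N x - u1 N x) = (\<lambda>x. \<Sum>m\<in>{1..N}. (c m * (q' m (fst x) - f' N m (fst x))) * es Z m (snd x))"
        unfolding W1_def u1_def by (simp add: algebra_simps sum_subtractf)
      then have "sqn \<Omega> (\<lambda>x. W1 N x - u1 N x) = Z / 2 * (\<Sum>m\<in>{1..N}. (cmod (c m))\<^sup>2 * sqn {R<..<\<rho>} (\<lambda>r. q' m r - f' N m r))"
        using modal[of "{1..N}" "\<lambda>m r. q' m r - f' N m r" "es Z" c] by (simp add: continuous_on_diff q'c f'c)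
      also have "\<dots> \<le> inverse (real (Suc N))"
      proof (rule small)
        show "sqn {R<..<\<rho>} (\<lambda>r. q' m r - f' N m r) \<le> (1 + (\<gamma> m)\<^sup>2) * ((\<epsilon> N)\<^sup>2 * (\<rho> - R))" for m
          using d2[of m N] mult_right_mono[of 1 "1 + (\<gamma> m)\<^sup>2" "(\<epsilon> N)\<^sup>2 * (\<rho> - R)"] e0[of N] by simp
      qed
      finally show "sqn \<Omega> (\<lambda>x. W1 N x - u1 N x) \<le> inverse (real (Suc N))" .
      have "(\<lambda>x. W2 N x - u2 N x) = (\<lambda>x. \<Sum>m\<in>{1..N}. (c m * of_real (\<gamma> m) * (q m (fst x) - f N m (fst x))) * ec Z m (snd x))"
        unfolding W2_def u2_def by (simp add: algebra_simps sum_subtractf)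
      then have "sqn \<Omega> (\<lambda>x. W2 N x - u2 N x) = Z / 2 * (\<Sum>m\<in>{1..N}. (cmod (c m))\<^sup>2 * ((\<gamma> m)\<^sup>2 * sqn {R<..<\<rho>} (\<lambda>r. q m r - f N m r)))"
        using modal[of "{1..N}" "\<lambda>m r. q m r - f N m r" "ec Z" "\<lambda>m. c m * of_real (\<gamma> m)"] unfolding sq2 by (simp add: continuous_on_diff qc fc)
      also have "\<dots> \<le> inverse (real (Suc N))"
      proof (rule small)
        show "(\<gamma> m)\<^sup>2 * sqn {R<..<\<rho>} (\<lambda>r. q m r - f N m r) \<le> (1 + (\<gamma> m)\<^sup>2) * ((\<epsilon> N)\<^sup>2 * (\<rho> - R))" for m
          using d1[of m N] by (intro mult_mono) (auto simp: sqn_nonneg)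
      qed
      finally show "sqn \<Omega> (\<lambda>x. W2 N x - u2 N x) \<le> inverse (real (Suc N))" .
    qed
    have tri: "(\<lambda>N. sqn \<Omega> (\<lambda>x. h x - v N x)) \<longlonglongrightarrow> 0"
      if "L2 \<Omega> h" "\<And>N. L2 \<Omega> (H N)" "\<And>N. L2 \<Omega> (v N)" "(\<lambda>N. sqn \<Omega> (\<lambda>x. h x - H N x)) \<longlonglongrightarrow> 0" "\<And>N. sqn \<Omega> (\<lambda>x. H N x - v N x) \<le> inverse (real (Suc N))" for h H v
    proof -
      have bd: "norm (sqn \<Omega> (\<lambda>x. h x - v N x)) \<le> 2 * sqn \<Omega> (\<lambda>x. h x - H N x) + 2 * inverse (real (Suc N))" for N
        using sqn_add_le[OF L2_diff[OF that(1) that(2)[of N]] L2_diff[OF that(2)[of N] that(3)[of N]]] that(5)[of N] by (simp add: sqn_nonneg)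
      have "(\<lambda>N. 2 * sqn \<Omega> (\<lambda>x. h x - H N x) + 2 * inverse (real (Suc N))) \<longlonglongrightarrow> 2 * 0 + 2 * 0"
        by (intro tendsto_add tendsto_mult[OF tendsto_const] that(4) LIMSEQ_inverse_real_of_nat)
      then have "(\<lambda>N. 2 * sqn \<Omega> (\<lambda>x. h x - H N x) + 2 * inverse (real (Suc N))) \<longlonglongrightarrow> 0" by simp
      from Lim_null_comparison[OF always_eventually[OF allI[OF bd]] this] show ?thesis .
    qed
    have hn: "(H1_norm \<Omega> (\<lambda>x. w x - u N x))\<^sup>2 = sqn \<Omega> (\<lambda>x. w x - u N x) + sqn \<Omega> (\<lambda>x. w1 x - u1 N x) + sqn \<Omega> (\<lambda>x. w2 x - u2 N x)" for N
      unfolding \<Omega>_def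
      by (rule H1_norm_sq_eq; unfold \<Omega>_def[symmetric]; intro L2_diff weak_deriv_diff[of R \<rho> 0 Z, folded \<Omega>_def] w w1 w2 wd1 wd2 uL ud)
    have "(\<lambda>N. sqn \<Omega> (\<lambda>x. w x - u N x) + sqn \<Omega> (\<lambda>x. w1 x - u1 N x) + sqn \<Omega> (\<lambda>x. w2 x - u2 N x)) \<longlonglongrightarrow> 0 + 0 + 0"
      by (intro tendsto_add tri[OF w(1) WL(1) uL(1) w(2) D(1)] tri[OF w1(1) WL(2) uL(2) w1(2) D(2)] tri[OF w2(1) WL(3) uL(3) w2(2) D(3)])
    then have "(\<lambda>N. (H1_norm \<Omega> (\<lambda>x. w x - u N x))\<^sup>2) \<longlonglongrightarrow> 0" unfolding hn by simp
    then have "(\<lambda>N. sqrt ((H1_norm \<Omega> (\<lambda>x. w x - u N x))\<^sup>2)) \<longlonglongrightarrow> sqrt 0" by (rule tendsto_real_sqrt)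
    then have lim: "(\<lambda>N. H1_norm \<Omega> (\<lambda>x. w x - u N x)) \<longlonglongrightarrow> 0" by (simp add: H1_norm_nonneg)
    \<comment> \<open>For \<open>m \<ge> 1\<close> the weight \<open>m\<close> dominates 1, so
      square summability follows from the \<open>H12\<close> condition.\<close>
    have sm1: "summable (\<lambda>m. (cmod (c m))\<^sup>2)"
    proof (rule summable_comparison_test_ev[OF _ sm])
      show "\<forall>\<^sub>F m in sequentially. norm ((cmod (c m))\<^sup>2) \<le> real m * (cmod (c m))\<^sup>2"
        using eventually_ge_at_top[of 1]
      proof eventually_elim
        case (elim m)
        then have "1 * (cmod (c m))\<^sup>2 \<le> real m * (cmod (c m))\<^sup>2" by (intro mult_right_mono) auto
        then show ?case by simp
      qed
    qed
    have tR: "(\<lambda>N. LINT z:{0<..<Z}|lborel. (cmod (u N (R, z) - \<eta> z))\<^sup>2) \<longlonglongrightarrow> 0"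
      using sine_series_converges[OF par(4) \<eta>L sm1[unfolded c_def]] by (simp add: u_def f(4) sqn_def c_def)
    \<comment> \<open>As end values are kept exactly, the traces on the other three sides vanish at
      every stage, and on \<open>r = R\<close> stage \<open>N\<close> is the partial sine sum of
      \<eta>.\<close>
    show ?thesis
      unfolding trace_bc_def Omega_pml_def \<Omega>_def[symmetric]
    proof (intro exI conjI allI)
      show "smooth (u N)" for N by (rule smu)
      show "(\<lambda>N. H1_norm \<Omega> (\<lambda>x. w x - u N x)) \<longlonglongrightarrow> 0" by (rule lim)
      show "(\<lambda>N. LINT z:{0<..<Z}|lborel. (cmod (u N (R, z) - \<eta> z))\<^sup>2) \<longlonglongrightarrow> 0" by (rule tR)
    qed (simp_all add: u_def f(5) es_ends par(4))
  qed
  show ?thesis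
    using wH tr weak norm unfolding pml_solution_def Omega_pml_def \<Omega>_def by blast
qed

section \<open>Collecting the modal bounds into the final statement\<close>

lemma kappa_sq_le:
  assumes Z: "Z > 0" and k: "k > 0" and \<kappa>: "kappa Z k > 0" and m: "m \<ge> (1::nat)"
  shows "(kappa Z k)\<^sup>2 \<le> \<bar>k\<^sup>2 - (real m * pi / Z)\<^sup>2\<bar>"
proof -
  have "kappa Z k \<le> cmod (km Z k m)"
    unfolding kappa_def by (rule cINF_lower) (use m in \<open>auto intro!: bdd_belowI[of _ 0]\<close>)
  then have "(kappa Z k)\<^sup>2 \<le> (cmod (km Z k m))\<^sup>2" using \<kappa> by (intro power_mono) auto
  also have "\<dots> = \<bar>k\<^sup>2 - (real m * pi / Z)\<^sup>2\<bar>"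
  proof (cases "k > real m * pi / Z")
    case True
    then have "(real m * pi / Z)\<^sup>2 \<le> k\<^sup>2" using Z by (intro power_mono) auto
    then show ?thesis using True by (simp add: km_def norm_mult power_mult_distrib power_divide)
  next
    case False
    then have "k\<^sup>2 \<le> (real m * pi / Z)\<^sup>2" using k by (intro power_mono) auto
    then show ?thesis using False by (simp add: km_def norm_mult power_mult_distrib power_divide)
  qed
  finally show ?thesis .
qed

theorem theorem4p2:
  fixes Z R k :: real
  assumes "Z > 0" and "R > 0" and "k > 0"
    and "\<forall>m::nat. m \<ge> 1 \<longrightarrow> k \<noteq> real m * pi / Z"
  shows "(\<forall>\<rho> \<chi>0 \<eta>. \<rho> \<ge> 2 * R \<and> \<chi>0 > 0 \<and> kappa Z k * \<chi>0 * R \<ge> 1 \<and> H12_0 Z \<eta> \<longrightarrow>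
            (\<exists>w. pml_solution k Z R \<rho> \<chi>0 \<eta> w) \<and>
            (\<forall>w1 w2. pml_solution k Z R \<rho> \<chi>0 \<eta> w1 \<and> pml_solution k Z R \<rho> \<chi>0 \<eta> w2 \<longrightarrow>
               (AE x in lborel. x \<in> Omega_pml R \<rho> Z \<longrightarrow> w1 x = w2 x)))
       \<and> (\<exists>C>0. \<forall>\<rho> \<chi>0 \<eta> w. \<rho> \<ge> 2 * R \<and> \<chi>0 > 0 \<and> kappa Z k * \<chi>0 * R \<ge> 1 \<and> H12_0 Z \<eta>
            \<and> pml_solution k Z R \<rho> \<chi>0 \<eta> w \<longrightarrow>
            H1_norm (Omega_pml R \<rho> Z) w
              \<le> C * (\<rho> - R) ^ 6 * (cmod (alpha \<chi>0 R \<rho>)) ^ 4 * (cmod (beta \<chi>0 R \<rho>)) ^ 2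
                  * H12_norm Z \<eta>)"
proof (cases "kappa Z k > 0")
  \<comment> \<open>With \<open>kappa Z k \<le> 0\<close> the condition
    \<open>kappa Z k * \<chi>0 * R \<ge> 1\<close> cannot hold, so both claims are vacuous.\<close>
  case False
  have "\<not> kappa Z k * \<chi>0 * R \<ge> 1" if "\<chi>0 > 0" for \<chi>0
  proof -
    have "kappa Z k * \<chi>0 * R \<le> 0" using False that assms(2) by (intro mult_nonpos_nonneg) auto
    then show ?thesis by simp
  qed
  then show ?thesis by (intro conjI exI[of _ 1]) auto
next
  case True
  obtain C where C: "C > 0"
    "\<And>\<rho> \<chi>0 m q p. \<rho> \<ge> 2 * R \<Longrightarrow> \<chi>0 > 0 \<Longrightarrow> kappa Z k * \<chi>0 * R \<ge> 1 \<Longrightarrow> m \<ge> (1::nat) \<Longrightarrow>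
       (kappa Z k)\<^sup>2 \<le> \<bar>k\<^sup>2 - (real m * pi / Z)\<^sup>2\<bar> \<Longrightarrow>
       ode_sol R \<rho> (cA \<chi>0 R) (cB (k\<^sup>2 - (real m * pi / Z)\<^sup>2) \<chi>0 R) (\<lambda>_. 0) q p \<Longrightarrow> q R = 1 \<Longrightarrow> q \<rho> = 0 \<Longrightarrow>
       (LINT r:{R<..<\<rho>}|lborel. (cmod (cA \<chi>0 R r * p r))\<^sup>2 + (1 + (real m * pi / Z)\<^sup>2) * (cmod (q r))\<^sup>2)
         \<le> C * real m * ((\<rho> - R) ^ 6 * cmod (al \<chi>0 R \<rho>) ^ 4 * cmod (be \<chi>0 R \<rho>) ^ 2)\<^sup>2"
  proof (rule mode_bound_uniform[OF assms(1-3) True], goal_cases)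
    case (1 C)
    show ?case by (rule 1(1)[OF 1(2)]) (rule 1(3))
  qed
  \<comment> \<open>The factor \<open>Z / 2\<close> is the squared norm of a sine or cosine mode;
    the target expression, squared in the mode bound, comes out of the root.\<close>
  have ex: "\<exists>w. pml_solution k Z R \<rho> \<chi>0 \<eta> w \<and> H1_norm (Omega_pml R \<rho> Z) w
      \<le> sqrt (Z / 2 * C) * (\<rho> - R) ^ 6 * (cmod (alpha \<chi>0 R \<rho>)) ^ 4 * (cmod (beta \<chi>0 R \<rho>)) ^ 2 * H12_norm Z \<eta>"
    if h: "\<rho> \<ge> 2 * R" "\<chi>0 > 0" "kappa Z k * \<chi>0 * R \<ge> 1" "H12_0 Z \<eta>" for \<rho> \<chi>0 \<eta>
  proof -
    define T where "T = (\<rho> - R) ^ 6 * cmod (al \<chi>0 R \<rho>) ^ 4 * cmod (be \<chi>0 R \<rho>) ^ 2"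
    have \<rho>: "\<rho> > R" using h assms(2) by simp
    have T0: "T \<ge> 0" using \<rho> by (simp add: T_def)
    have "\<exists>w. pml_solution k Z R \<rho> \<chi>0 \<eta> w \<and> H1_norm (Omega_pml R \<rho> Z) w \<le> sqrt (Z / 2 * (C * T\<^sup>2)) * H12_norm Z \<eta>"
    proof (rule pml_exists[OF assms(2) h(1,2) assms(1) h(4)])
      show "0 \<le> C * T\<^sup>2" using C(1) by simp
      fix m :: nat and q p
      assume m: "m \<ge> 1" and s: "ode_sol R \<rho> (cA \<chi>0 R) (cB (k\<^sup>2 - (real m * pi / Z)\<^sup>2) \<chi>0 R) (\<lambda>_. 0) q p" "q R = 1" "q \<rho> = 0"
      show "(LINT r:{R<..<\<rho>}|lborel. (cmod (cA \<chi>0 R r * p r))\<^sup>2 + (1 + (real m * pi / Z)\<^sup>2) * (cmod (q r))\<^sup>2) \<le> C * T\<^sup>2 * real m"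
        using C(2)[OF h(1-3) m kappa_sq_le[OF assms(1,3) True m] s] unfolding T_def[symmetric] by (simp only: mult_ac)
    qed
    moreover have "sqrt (Z / 2 * (C * T\<^sup>2)) = sqrt (Z / 2 * C) * (\<rho> - R) ^ 6 * (cmod (alpha \<chi>0 R \<rho>)) ^ 4 * (cmod (beta \<chi>0 R \<rho>)) ^ 2"
    proof -
      have "sqrt (Z / 2 * (C * T\<^sup>2)) = sqrt (Z / 2 * C) * T"
        using T0 by (simp only: mult.assoc[symmetric] real_sqrt_mult[of _ "T\<^sup>2"] real_sqrt_abs abs_of_nonneg)
      then show ?thesis unfolding T_def alpha_eq_al[OF \<rho>] beta_eq_be[OF \<rho>] by (simp only: mult.assoc)
    qed
    ultimately show ?thesis by simp
  qed
  have uniq: "AE x in lborel. x \<in> Omega_pml R \<rho> Z \<longrightarrow> w1 x = w2 x"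
    if "\<rho> \<ge> 2 * R" "\<chi>0 > 0" "H12_0 Z \<eta>" "pml_solution k Z R \<rho> \<chi>0 \<eta> w1" "pml_solution k Z R \<rho> \<chi>0 \<eta> w2" for \<rho> \<chi>0 \<eta> w1 w2
    using that pml_solution_unique[OF assms(2) that(1,2) assms(1)] by (auto simp: H12_0_def)
  show ?thesis
  proof (intro conjI exI[of _ "sqrt (Z / 2 * C)"] allI impI)
    show "sqrt (Z / 2 * C) > 0" using assms(1) C(1) by simp
    fix \<rho> \<chi>0 \<eta> w
    assume a: "\<rho> \<ge> 2 * R \<and> \<chi>0 > 0 \<and> kappa Z k * \<chi>0 * R \<ge> 1 \<and> H12_0 Z \<eta> \<and> pml_solution k Z R \<rho> \<chi>0 \<eta> w"
    then obtain w0 where w0: "pml_solution k Z R \<rho> \<chi>0 \<eta> w0" "H1_norm (Omega_pml R \<rho> Z) w0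
      \<le> sqrt (Z / 2 * C) * (\<rho> - R) ^ 6 * (cmod (alpha \<chi>0 R \<rho>)) ^ 4 * (cmod (beta \<chi>0 R \<rho>)) ^ 2 * H12_norm Z \<eta>"
      using ex by blast
    \<comment> \<open>The estimate is known for the constructed \<open>w0\<close>; uniqueness
      carries it over to the given \<open>w\<close>.\<close>
    have "AE x in lborel. x \<in> Omega_pml R \<rho> Z \<longrightarrow> w x = w0 x" using a w0(1) by (intro uniq) auto
    then have "H1_norm (Omega_pml R \<rho> Z) w = H1_norm (Omega_pml R \<rho> Z) w0"
      by (rule H1_norm_AE_cong) (use a w0(1) in \<open>auto simp: pml_solution_def\<close>)
    then show "H1_norm (Omega_pml R \<rho> Z) w
      \<le> sqrt (Z / 2 * C) * (\<rho> - R) ^ 6 * (cmod (alpha \<chi>0 R \<rho>)) ^ 4 * (cmod (beta \<chi>0 R \<rho>)) ^ 2 * H12_norm Z \<eta>"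
      using w0(2) by simp
  next
    fix \<rho> \<chi>0 \<eta>
    assume "\<rho> \<ge> 2 * R \<and> \<chi>0 > 0 \<and> kappa Z k * \<chi>0 * R \<ge> 1 \<and> H12_0 Z \<eta>"
    then show "\<exists>w. pml_solution k Z R \<rho> \<chi>0 \<eta> w" using ex by blast
  next
    fix \<rho> \<chi>0 \<eta> w1 w2
    assume "\<rho> \<ge> 2 * R \<and> \<chi>0 > 0 \<and> kappa Z k * \<chi>0 * R \<ge> 1 \<and> H12_0 Z \<eta>"
      and "pml_solution k Z R \<rho> \<chi>0 \<eta> w1 \<and> pml_solution k Z R \<rho> \<chi>0 \<eta> w2"
    then show "AE x in lborel. x \<in> Omega_pml R \<rho> Z \<longrightarrow> w1 x = w2 x" using uniq by blast
  qed
qed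

end
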